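(* Assume that for every $i\in\mathcal I$ there is at least one $j\in\mathcal O$ with $K_{ij}>0$. Then there exist parameters $\gamma_{ij}$ ($i\in\mathcal O$, $j\in\mathcal I$), uniquely determined by the numbers $\lambda_i$ and $K_{ij}$ ($i,j\in\mathcal M$), with $$\gamma_{ij}\ge 0\quad \forall i\in\mathcal O,\ \forall j\in\mathcal I,\qquad \sum_{i\in\mathcal O}\gamma_{ij}=1\quad \forall j\in\mathcal I,$$ such that the following holds. Let $u_0\in BV(\mathcal A)$ and $B_i\in\mathbb R$ for $i\in\mathcal I$, let $\{\epsilon_n\}_{n\in\mathbb N}$ be any decreasing sequence of positive numbers with $\epsilon_n\to0$, let $\{u_0^{\epsilon_n}\}_{n\in\mathbb N}$ be an admissible approximation of $u_0$, and let $u^{\epsilon_n}$ be the solution of the parabolic problem $(P_n)$. Then, for all $T>0$, the whole sequence $\{u^{\epsilon_n}\}_{n\in\mathbb N}$ converges in $L^1(\mathcal A\times(0,T))$ to the solution $u$ of the transport problem $(H_\gamma)$ with these parameters $\gamma_{ij}$. Moreover, if for each $i\in\mathcal O$ there exists at least one $j\in\mathcal I$ such that $K_{ij}>0$, then for every $i\in\mathcal O$ there exists at least one $j\in\mathcal I$ such that $\gamma_{ij}>0$.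
   Context: Network. $\mathcal M=\{1,\dots,m\}$ is the disjoint union of two nonempty sets $\mathcal I$ (arcs incoming in the inner node $N$) and $\mathcal O$ (arcs outgoing from $N$). For $i\in\mathcal M$, $L_i>0$, $I_i=(0,L_i)$, $\lambda_i>0$. For a function $f_i$ on $I_i$ (with traces), $f_i(N)$ means $f_i(L_i)$ if $i\in\mathcal I$ and $f_i(0)$ if $i\in\mathcal O$; $e_i$ is the other endpoint of $I_i$. Set $\beta_i=1$ if $i\in\mathcal I$, $\beta_i=-1$ if $i\in\mathcal O$. The coefficients $K_{ij}$ ($i,j\in\mathcal M$) satisfy $K_{ij}\ge0$ and $K_{ij}=K_{ji}$. Spaces. $L^p(\mathcal A)$, $W^{k,p}(\mathcal A)$, $BV(\mathcal A)$, $L^1(\mathcal A\times(0,T))$, $BV(\mathcal A\times(0,T))$ denote the $m$-tuples $f=(f_1,\dots,f_m)$ with $f_i$ in $L^p(I_i)$, $W^{k,p}(I_i)$, $BV(I_i)$, $L^1(I_i\times(0,T))$, $BV(I_i\times(0,T))$ respectively, with norm $\|f\|=\sum_{i\in\mathcal M}\|f_i\|$. Admissible approximation of $u_0$: a sequence $\{u_0^{\epsilon_n}\}$ with $u_0^{\epsilon_n}\in W^{2,1}(\mathcal A)$, $u^{\epsilon_n}_{0i}(0)=B_i$ for $i\in\mathcal I$, $\beta_i\big(-\lambda_i u_{0i}^{\epsilon_n}(N)+\epsilon_n (u_{0i}^{\epsilon_n})_x(N)\big)=\sum_{j\in\mathcal M}K_{ij}\big(u^{\epsilon_n}_{0j}(N)-u^{\epsilon_n}_{0i}(N)\big)$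 for $i\in\mathcal M$, such that $u_0^{\epsilon_n}\to u_0$ in $L^1(\mathcal A)$, $\|(u_0^{\epsilon_n})_x\|_{L^1(\mathcal A)}$ is bounded by a quantity depending on $\|u_0\|_{BV(\mathcal A)}$ and independent of $n$, and $\epsilon_n\|u_0^{\epsilon_n}\|_{W^{2,1}(\mathcal A)}$ is bounded independently of $n$. Problem $(P_n)$: find $u^{\epsilon_n}\in C([0,+\infty);W^{2,1}(\mathcal A))\cap C^1([0,+\infty);L^1(\mathcal A))$ with, for all $i\in\mathcal M$ and $t>0$, $$(u_i^{\epsilon_n})_t=-\lambda_i (u_i^{\epsilon_n})_x+\epsilon_n (u_i^{\epsilon_n})_{xx}\ \text{ in } I_i,\qquad u_i^{\epsilon_n}(x,0)=u_{0i}^{\epsilon_n}(x),$$ $$\beta_i\big(-\lambda_i u_i^{\epsilon_n}(N,t)+\epsilon_n (u_i^{\epsilon_n})_x(N,t)\big)=\sum_{j\in\mathcal M}K_{ij}\big(u_j^{\epsilon_n}(N,t)-u_i^{\epsilon_n}(N,t)\big),$$ $$u_i^{\epsilon_n}(0,t)=B_i\ (i\in\mathcal I),\qquad u_i^{\epsilon_n}(L_i,t)=u_{0i}^{\epsilon_n}(L_i)\ (i\in\mathcal O).$$ (This problem has a unique solution.) Problem $(H_\gamma)$: $u_{i,t}=-\lambda_i u_{i,x}$ in $I_i$ ($i\in\mathcal M$), $u_i(x,0)=u_{0i}(x)$, $u_i(0,t)=B_i$ for $i\in\mathcal I$, $\lambda_i u_i(0,t)=\sum_{j\in\mathcal I}\gamma_{ij}\lambda_j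 u_j(L_j,t)$ for $i\in\mathcal O$. A solution on $(0,T)$ is a function $u\in BV(\mathcal A\times(0,T))$ such that for all $\phi_i\in C^1_0([0,L_i)\times[0,T))$ (compactly supported), $$\int_0^T\!\!\int_{I_i}u_i(\phi_{i,t}+\lambda_i\phi_{i,x})\,dx\,dt+\int_{I_i}u_{0i}(x)\phi_i(x,0)\,dx=-\lambda_iB_i\int_0^T\phi_i(0,t)\,dt,\quad i\in\mathcal I,$$ $$\int_0^T\!\!\int_{I_i}u_i(\phi_{i,t}+\lambda_i\phi_{i,x})\,dx\,dt+\int_{I_i}u_{0i}(x)\phi_i(x,0)\,dx=-\int_0^T\phi_i(0,t)\sum_{j\in\mathcal I}\gamma_{ij}\lambda_ju_j(L_j,t)\,dt,\quad i\in\mathcal O,$$ where $u_j(L_j,\cdot)$ is the trace of the $BV$ function $u_j$. (Such a solution exists and is unique.) *)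

theory Defs
  imports "HOL-Analysis.Analysis"
begin

text \<open>
  Elements of Lebesgue, Sobolev and BV spaces are represented by functions, two functions being
  identified when they agree almost everywhere. All notions below respect this identification.
\<close>


text \<open>The set S need not be open: for S a product of half-open intervals this is the space of
  functions that are continuously differentiable up to the boundary lines belonging to S and whose
  support is a compact subset of S. Values outside S are irrelevant.\<close>

definition C1c :: "'a::euclidean_space set \<Rightarrow> ('a \<Rightarrow> 'b::euclidean_space) \<Rightarrow> bool" where
  "C1c S \<phi> \<longleftrightarrow>
     (\<exists>\<phi>'. (\<forall>x\<in>S. (\<phi> has_derivative \<phi>' x) (at x within S)) \<and>
           (\<forall>v. continuous_on S (\<lambda>x. \<phi>' x v))) \<and>
     (\<exists>C. compact C \<and> C \<subseteq> S \<and> (\<forall>x\<in>S - C. \<phi> x = 0))"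

definition L1_norm :: "'a::euclidean_space set \<Rightarrow> ('a \<Rightarrow> real) \<Rightarrow> real" where
  "L1_norm S f = (LINT x:S|lebesgue. \<bar>f x\<bar>)"

definition divergence :: "('a::euclidean_space \<Rightarrow> 'a) \<Rightarrow> 'a \<Rightarrow> real" where
  "divergence \<phi> x = (\<Sum>b\<in>Basis. frechet_derivative \<phi> (at x) b \<bullet> b)"

text \<open>The numbers whose supremum is the total variation of f in the open set S.\<close>

definition variation_sums :: "'a::euclidean_space set \<Rightarrow> ('a \<Rightarrow> real) \<Rightarrow> real set" where
  "variation_sums S f =
     {LINT x:S|lebesgue. f x * divergence \<phi> x | \<phi>. C1c S \<phi> \<and> (\<forall>x\<in>S. norm (\<phi> x) \<le> 1)}"

definition BV :: "'a::euclidean_space set \<Rightarrow> ('a \<Rightarrow> real) \<Rightarrow> bool" where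
  "BV S f \<longleftrightarrow> f absolutely_integrable_on S \<and> bdd_above (variation_sums S f)"

definition BV_norm :: "'a::euclidean_space set \<Rightarrow> ('a \<Rightarrow> real) \<Rightarrow> real" where
  "BV_norm S f = L1_norm S f + Sup (variation_sums S f)"

definition weak_deriv :: "real set \<Rightarrow> (real \<Rightarrow> real) \<Rightarrow> (real \<Rightarrow> real) \<Rightarrow> bool" where
  "weak_deriv S f g \<longleftrightarrow>
     f absolutely_integrable_on S \<and> g absolutely_integrable_on S \<and>
     (\<forall>\<phi>. C1c S \<phi> \<longrightarrow>
        (LINT x:S|lebesgue. f x * deriv \<phi> x) = - (LINT x:S|lebesgue. g x * \<phi> x))"

definition W21 :: "real set \<Rightarrow> (real \<Rightarrow> real) \<Rightarrow> bool" where
  "W21 S f \<longleftrightarrow> (\<exists>g h. weak_deriv S f g \<and> weak_deriv S g h)"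

text \<open>A weak derivative is unique up to a null set; Dx selects a representative.\<close>

definition Dx :: "real set \<Rightarrow> (real \<Rightarrow> real) \<Rightarrow> real \<Rightarrow> real" where
  "Dx S f = (SOME g. weak_deriv S f g)"

definition W21_norm :: "real set \<Rightarrow> (real \<Rightarrow> real) \<Rightarrow> real" where
  "W21_norm S f = L1_norm S f + L1_norm S (Dx S f) + L1_norm S (Dx S (Dx S f))"

text \<open>The usual pointwise description of the trace of a BV function at a boundary point p: the
  mean of the deviation from y over the part of a small ball that lies in S tends to zero. For BV
  functions on an interval or a rectangle such a y exists at (almost) every boundary point, and it
  is unique. For a one-dimensional Sobolev function it is the value at p of the continuous
  representative. The function f is meant to be integrable on S.\<close>

definition has_trace :: "'a::euclidean_space set \<Rightarrow> ('a \<Rightarrow> real) \<Rightarrow> 'a \<Rightarrow> real \<Rightarrow> bool" where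
  "has_trace S f p y \<longleftrightarrow>
     ((\<lambda>r. (LINT x:ball p r \<inter> S|lebesgue. \<bar>f x - y\<bar>) / measure lebesgue (ball p r \<inter> S))
        \<longlongrightarrow> 0) (at_right 0)"

definition boundary_trace :: "'a::euclidean_space set \<Rightarrow> ('a \<Rightarrow> real) \<Rightarrow> 'a \<Rightarrow> real" where
  "boundary_trace S f p = (THE y. has_trace S f p y)"

text \<open>Continuity on the closed half-line of times of a map with values in a normed function space
  with norm N.\<close>

definition time_continuous :: "((real \<Rightarrow> real) \<Rightarrow> real) \<Rightarrow> (real \<Rightarrow> real \<Rightarrow> real) \<Rightarrow> bool" where
  "time_continuous N w \<longleftrightarrow> (\<forall>t\<ge>0. ((\<lambda>s. N (\<lambda>x. w s x - w t x)) \<longlongrightarrow> 0) (at t within {0..}))"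

definition time_derivative ::
  "((real \<Rightarrow> real) \<Rightarrow> real) \<Rightarrow> (real \<Rightarrow> real \<Rightarrow> real) \<Rightarrow> (real \<Rightarrow> real \<Rightarrow> real) \<Rightarrow> bool" where
  "time_derivative N w w' \<longleftrightarrow>
     (\<forall>t\<ge>0. ((\<lambda>s. N (\<lambda>x. (w s x - w t x) / (s - t) - w' t x)) \<longlongrightarrow> 0) (at t within {0..}))"



text \<open>In and Out are the sets of incoming and outgoing arcs, L the lengths, lam the velocities.
  A function on the network is a family indexed by the arcs in the union of In and Out.\<close>

abbreviation edge :: "(nat \<Rightarrow> real) \<Rightarrow> nat \<Rightarrow> real set" where
  "edge L i \<equiv> {0<..<L i}"

definition node :: "nat set \<Rightarrow> (nat \<Rightarrow> real) \<Rightarrow> nat \<Rightarrow> real" where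
  "node In L i = (if i \<in> In then L i else 0)"

definition beta :: "nat set \<Rightarrow> nat \<Rightarrow> real" where
  "beta In i = (if i \<in> In then 1 else -1)"

definition at_node :: "nat set \<Rightarrow> (nat \<Rightarrow> real) \<Rightarrow> (nat \<Rightarrow> real \<Rightarrow> real) \<Rightarrow> nat \<Rightarrow> real" where
  "at_node In L f i = boundary_trace (edge L i) (f i) (node In L i)"

definition transmission_condition ::
  "nat set \<Rightarrow> nat set \<Rightarrow> (nat \<Rightarrow> real) \<Rightarrow> (nat \<Rightarrow> real) \<Rightarrow> (nat \<Rightarrow> nat \<Rightarrow> real) \<Rightarrow> real
    \<Rightarrow> (nat \<Rightarrow> real \<Rightarrow> real) \<Rightarrow> bool" where
  "transmission_condition In Out L lam K \<epsilon> f \<longleftrightarrow>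
     (\<forall>i\<in>In \<union> Out.
        beta In i * (- lam i * at_node In L f i + \<epsilon> * at_node In L (\<lambda>k. Dx (edge L k) (f k)) i)
        = (\<Sum>j\<in>In \<union> Out. K i j * (at_node In L f j - at_node In L f i)))"

text \<open>The bound on the derivatives is a function of the BV norm of the datum; since the sequence
  is fixed, this means that the sequence of norms is bounded.\<close>

definition admissible_approximation ::
  "nat set \<Rightarrow> nat set \<Rightarrow> (nat \<Rightarrow> real) \<Rightarrow> (nat \<Rightarrow> real) \<Rightarrow> (nat \<Rightarrow> nat \<Rightarrow> real) \<Rightarrow> (nat \<Rightarrow> real)
    \<Rightarrow> (nat \<Rightarrow> real) \<Rightarrow> (nat \<Rightarrow> real \<Rightarrow> real) \<Rightarrow> (nat \<Rightarrow> nat \<Rightarrow> real \<Rightarrow> real) \<Rightarrow> bool" where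
  "admissible_approximation In Out L lam K B \<epsilon> u0 u0\<epsilon> \<longleftrightarrow>
     (\<forall>n. (\<forall>i\<in>In \<union> Out. W21 (edge L i) (u0\<epsilon> n i)) \<and>
          (\<forall>i\<in>In. boundary_trace (edge L i) (u0\<epsilon> n i) 0 = B i) \<and>
          transmission_condition In Out L lam K (\<epsilon> n) (u0\<epsilon> n)) \<and>
     (\<lambda>n. \<Sum>i\<in>In \<union> Out. L1_norm (edge L i) (\<lambda>x. u0\<epsilon> n i x - u0 i x)) \<longlonglongrightarrow> 0 \<and>
     (\<exists>Q :: real \<Rightarrow> real. \<forall>n.
        (\<Sum>i\<in>In \<union> Out. L1_norm (edge L i) (Dx (edge L i) (u0\<epsilon> n i)))
          \<le> Q (\<Sum>i\<in>In \<union> Out. BV_norm (edge L i) (u0 i))) \<and>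
     (\<exists>C. \<forall>n. \<epsilon> n * (\<Sum>i\<in>In \<union> Out. W21_norm (edge L i) (u0\<epsilon> n i)) \<le> C)"

text \<open>Here v is the initial datum. Measurability in both variables singles out representatives
  for which the curve t |-> u(.,t) in L1 is also a function on the product of the arc with the time
  axis; such representatives always exist.\<close>

definition parabolic_solution ::
  "nat set \<Rightarrow> nat set \<Rightarrow> (nat \<Rightarrow> real) \<Rightarrow> (nat \<Rightarrow> real) \<Rightarrow> (nat \<Rightarrow> nat \<Rightarrow> real) \<Rightarrow> (nat \<Rightarrow> real)
    \<Rightarrow> real \<Rightarrow> (nat \<Rightarrow> real \<Rightarrow> real) \<Rightarrow> (nat \<Rightarrow> real \<times> real \<Rightarrow> real) \<Rightarrow> bool" where
  "parabolic_solution In Out L lam K B \<epsilon> v u \<longleftrightarrow>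
     (\<forall>i\<in>In \<union> Out. set_borel_measurable lebesgue (edge L i \<times> {0<..}) (u i)) \<and>
     (\<forall>i\<in>In \<union> Out. (\<forall>t\<ge>0. W21 (edge L i) (\<lambda>x. u i (x, t))) \<and>
        time_continuous (W21_norm (edge L i)) (\<lambda>t x. u i (x, t))) \<and>
     (\<exists>u\<^sub>t. \<forall>i\<in>In \<union> Out.
        (\<forall>t\<ge>0. u\<^sub>t i t absolutely_integrable_on edge L i) \<and>
        time_derivative (L1_norm (edge L i)) (\<lambda>t x. u i (x, t)) (u\<^sub>t i) \<and>
        time_continuous (L1_norm (edge L i)) (u\<^sub>t i) \<and>
        (\<forall>t>0. AE x in lebesgue. x \<in> edge L i \<longrightarrow>
           u\<^sub>t i t x = - lam i * Dx (edge L i) (\<lambda>x. u i (x, t)) x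
                      + \<epsilon> * Dx (edge L i) (Dx (edge L i) (\<lambda>x. u i (x, t))) x)) \<and>
     (\<forall>i\<in>In \<union> Out. AE x in lebesgue. x \<in> edge L i \<longrightarrow> u i (x, 0) = v i x) \<and>
     (\<forall>t>0. transmission_condition In Out L lam K \<epsilon> (\<lambda>i x. u i (x, t)) \<and>
        (\<forall>i\<in>In. boundary_trace (edge L i) (\<lambda>x. u i (x, t)) 0 = B i) \<and>
        (\<forall>i\<in>Out. boundary_trace (edge L i) (\<lambda>x. u i (x, t)) (L i) = boundary_trace (edge L i) (v i) (L i)))"

text \<open>In this definition g j is the trace of u j on the side x = L j of its rectangle; it is
  determined almost everywhere.\<close>

definition transport_solution ::
  "nat set \<Rightarrow> nat set \<Rightarrow> (nat \<Rightarrow> real) \<Rightarrow> (nat \<Rightarrow> real) \<Rightarrow> (nat \<Rightarrow> nat \<Rightarrow> real) \<Rightarrow> (nat \<Rightarrow> real)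
    \<Rightarrow> (nat \<Rightarrow> real \<Rightarrow> real) \<Rightarrow> real \<Rightarrow> (nat \<Rightarrow> real \<times> real \<Rightarrow> real) \<Rightarrow> bool" where
  "transport_solution In Out L lam \<gamma> B u0 T u \<longleftrightarrow>
     (\<forall>i\<in>In \<union> Out. BV (edge L i \<times> {0<..<T}) (u i)) \<and>
     (\<exists>g. (\<forall>j\<in>In. g j absolutely_integrable_on {0<..<T} \<and>
             (AE t in lebesgue. t \<in> {0<..<T} \<longrightarrow>
                has_trace (edge L j \<times> {0<..<T}) (u j) (L j, t) (g j t))) \<and>
          (\<forall>i\<in>In \<union> Out. \<forall>\<phi>. C1c ({0..<L i} \<times> {0..<T}) \<phi> \<longrightarrow>
             (LINT p:edge L i \<times> {0<..<T}|lebesgue.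
                u i p * (frechet_derivative \<phi> (at p) (0, 1)
                         + lam i * frechet_derivative \<phi> (at p) (1, 0)))
             + (LINT x:edge L i|lebesgue. u0 i x * \<phi> (x, 0))
             = (if i \<in> In
                then - lam i * B i * (LINT t:{0<..<T}|lebesgue. \<phi> (0, t))
                else - (LINT t:{0<..<T}|lebesgue. \<phi> (0, t) * (\<Sum>j\<in>In. \<gamma> i j * lam j * g j t)))))"

text \<open>The solutions of the parabolic problems converge to the solution of the transport problem
  with coefficients \<gamma>, whatever the lengths of the arcs and the data are.\<close>

definition vanishing_viscosity_limit ::
  "nat set \<Rightarrow> nat set \<Rightarrow> (nat \<Rightarrow> real) \<Rightarrow> (nat \<Rightarrow> nat \<Rightarrow> real) \<Rightarrow> (nat \<Rightarrow> nat \<Rightarrow> real) \<Rightarrow> bool" where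
  "vanishing_viscosity_limit In Out lam K \<gamma> \<longleftrightarrow>
     (\<forall>L u0 B \<epsilon> u0\<epsilon> u\<epsilon>.
        (\<forall>i\<in>In \<union> Out. L i > 0) \<longrightarrow>
        (\<forall>i\<in>In \<union> Out. BV (edge L i) (u0 i)) \<longrightarrow>
        (\<forall>n. \<epsilon> n > 0) \<longrightarrow> decseq \<epsilon> \<longrightarrow> \<epsilon> \<longlonglongrightarrow> 0 \<longrightarrow>
        admissible_approximation In Out L lam K B \<epsilon> u0 u0\<epsilon> \<longrightarrow>
        (\<forall>n. parabolic_solution In Out L lam K B (\<epsilon> n) (u0\<epsilon> n) (u\<epsilon> n)) \<longrightarrow>
        (\<forall>T>0.
           (\<forall>n. \<forall>i\<in>In \<union> Out. u\<epsilon> n i absolutely_integrable_on edge L i \<times> {0<..<T}) \<and>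
           (\<exists>u. transport_solution In Out L lam \<gamma> B u0 T u) \<and>
           (\<forall>u. transport_solution In Out L lam \<gamma> B u0 T u \<longrightarrow>
              (\<lambda>n. \<Sum>i\<in>In \<union> Out. L1_norm (edge L i \<times> {0<..<T}) (\<lambda>p. u\<epsilon> n i p - u i p))
                \<longlonglongrightarrow> 0)))"

end

theory Submission
  imports Defs
begin

text \<open>
  Away from its jumps the transport solution is u i (x, t) = P i (x - lam i * t) for profiles P i on the
  whole line. On an incoming arc P i is B i on the negative axis; there, on an outgoing arc, it is a
  superposition of the profiles of the incoming arcs with the weights G, the inverse of the linear
  system for the node values that is left of the transmission conditions as the viscosity vanishes:
  since the incoming arcs carry a boundary layer at the node, the flux arriving at the node is that of
  the transport solution, not that of the node value. Hence \<gamma> i j = lam i * G i j, and the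
  columns of \<gamma> sum to 1 because K is symmetric.

  Convergence needs no compactness. For smooth profiles, the transport solution plus explicit
  exponential boundary layers solves the parabolic problem up to an error that tends to 0 in L1, and
  the parabolic evolution is an L1 contraction. Data in BV are approximated in L1 by smooth compatible
  profiles, the transport evolution being L1 continuous as well.

  For the uniqueness of \<gamma>, take B = 1 on one incoming arc and B = 0 on the others: the parabolic
  problem then has explicit stationary solutions, whose limit is constant on every arc.
\<close>

section \<open>The linear system for the node values\<close>

text \<open>A layer of width of order \<epsilon> is invisible in L1, yet \<epsilon> times its slope
  at its end is lam times its height. On an incoming arc with node value v and transported value P,
  the viscous flux lam * (v - P) therefore turns - lam * v into - lam * P. An outgoing arc has its
  layer at the outer end, where the prescribed value differs from the transported one; at the node
  the layer is almost 0 and the flux stays lam * v. Hence D vanishes on the incoming arcs only, and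
  one layer shape, attached to x = L i, serves both kinds of arcs. The error of profile plus layer
  contains two derivatives of the profile, which blow up as smooth profiles approach BV data. So the
  viscosity tends to 0 at a fixed profile, and the profile is improved afterwards; contraction makes
  the loss in the data independent of the viscosity. A smooth profile must be C2 across 0 as well,
  where boundary part and datum meet, so this compatibility is built into the approximation of the
  datum. The parabolic solution is differentiable in time only as a curve in L1. The contraction is
  therefore derived from an inequality for the spatial operator at a single time.\<close>

text \<open>For the limit problem D is lam on the outgoing arcs and 0 on the incoming arcs.\<close>

definition node_op :: "nat set \<Rightarrow> (nat \<Rightarrow> real) \<Rightarrow> (nat \<Rightarrow> nat \<Rightarrow> real) \<Rightarrow> (nat \<Rightarrow> real) \<Rightarrow> nat \<Rightarrow> real" where
  "node_op M D K v i = D i * v i + (\<Sum>j\<in>M. K i j * (v i - v j))"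

lemma node_op_alt: "node_op M D K v i = (D i + (\<Sum>j\<in>M. K i j)) * v i - (\<Sum>j\<in>M. K i j * v j)"
  unfolding node_op_def by (simp add: algebra_simps sum_subtractf sum_distrib_left)

lemma node_op_add: "node_op M D K (\<lambda>i. v i + w i) i = node_op M D K v i + node_op M D K w i"
  unfolding node_op_def by (simp add: algebra_simps sum_subtractf sum.distrib)

lemma node_op_diff: "node_op M D K (\<lambda>i. v i - w i) i = node_op M D K v i - node_op M D K w i"
  unfolding node_op_def by (simp add: algebra_simps sum_subtractf sum.distrib)

lemma node_op_cmult: "node_op M D K (\<lambda>i. c * v i) i = c * node_op M D K v i"
  unfolding node_op_def by (simp add: algebra_simps sum_distrib_left)

lemma node_op_sum:
  assumes "finite A"
  shows "node_op M D K (\<lambda>i. \<Sum>k\<in>A. c k * G i k) i = (\<Sum>k\<in>A. c k * node_op M D K (\<lambda>i. G i k) i)"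
  using assms
proof (induction A rule: finite_induct)
  case empty
  then show ?case by (simp add: node_op_def)
next
  case (insert a A)
  then show ?case by (simp add: node_op_add node_op_cmult)
qed

text \<open>A minimum principle: \<open>x\<close> is compared with the multiple \<open>t * s\<close>
  that touches it from below, at the index minimising \<open>x j / s j\<close>. If
  \<open>t < 0\<close>, the operator at that index is at most \<open>t * node_op M D K s i\<close>,
  which is negative.\<close>

lemma node_op_nonneg_imp_nonneg:
  assumes "finite M" and K: "\<And>i j. i \<in> M \<Longrightarrow> j \<in> M \<Longrightarrow> K i j \<ge> 0"
    and s: "\<And>i. i \<in> M \<Longrightarrow> s i > 0" "\<And>i. i \<in> M \<Longrightarrow> node_op M D K s i > 0"
    and x: "\<And>i. i \<in> M \<Longrightarrow> node_op M D K x i \<ge> 0" and k: "k \<in> M"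
  shows "x k \<ge> 0"
proof (rule ccontr)
  assume neg: "\<not> x k \<ge> 0"
  obtain i where i: "i \<in> M" and min: "\<And>j. j \<in> M \<Longrightarrow> x i / s i \<le> x j / s j"
    using arg_min_if_finite(1)[of M "\<lambda>j. x j / s j"] arg_min_least[of M _ "\<lambda>j. x j / s j"] assms(1) k
    by (metis (no_types, lifting) empty_iff)
  define t where "t = x i / s i"
  have t: "t < 0"
    using min[OF k] s(1)[OF k] neg unfolding t_def by (smt (verit) divide_less_0_iff)
  have xi: "x i = t * s i" using s(1)[OF i] by (simp add: t_def)
  have xj: "t * s j \<le> x j" if "j \<in> M" for j
    using min[OF that] s(1)[OF that] by (simp add: t_def pos_le_divide_eq)
  have "node_op M D K x i \<le> t * node_op M D K s i"
    unfolding node_op_def xi distrib_left sum_distrib_left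
  proof (intro add_mono sum_mono)
    fix j assume j: "j \<in> M"
    have "K i j * (t * s i - x j) \<le> K i j * (t * s i - t * s j)"
      using xj[OF j] K[OF i j] by (intro mult_left_mono) auto
    then show "K i j * (t * s i - x j) \<le> t * (K i j * (s i - s j))" by (simp add: algebra_simps)
  qed simp
  then show False using x[OF i] s(2)[OF i] t by (smt (verit) mult_neg_pos)
qed

text \<open>Jacobi iteration started at 0: nonnegative coupling makes the iterates increase, the
  supersolution \<open>C * s\<close> caps them, and the monotone limit solves the system. The cap is
  kept in the conclusion because perturbed systems later need bounds uniform in the
  perturbation.\<close>

lemma node_op_solution:
  assumes "finite M" and K: "\<And>i j. i \<in> M \<Longrightarrow> j \<in> M \<Longrightarrow> K i j \<ge> 0"
    and s: "\<And>i. i \<in> M \<Longrightarrow> s i > 0" "\<And>i. i \<in> M \<Longrightarrow> node_op M D K s i > 0"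
    and r: "\<And>i. i \<in> M \<Longrightarrow> 0 \<le> r i" "\<And>i. i \<in> M \<Longrightarrow> r i \<le> C * node_op M D K s i" and C: "C \<ge> 0"
  shows "\<exists>v. \<forall>i\<in>M. 0 \<le> v i \<and> v i \<le> C * s i \<and> node_op M D K v i = r i"
proof -
  \<comment> \<open>The diagonal includes \<open>K i i\<close>; its contribution reappears in the
    sum and cancels.\<close>
  define d where "d = (\<lambda>i. D i + (\<Sum>j\<in>M. K i j))"
  have dpos: "d i > 0" if "i \<in> M" for i
  proof -
    have "0 \<le> (\<Sum>j\<in>M. K i j * s j)" using K[OF that] s(1) by (intro sum_nonneg) (simp add: less_imp_le)
    then have "d i * s i > 0" using s(2)[OF that] unfolding node_op_alt d_def by simp
    then show ?thesis using s(1)[OF that] by (simp add: zero_less_mult_iff)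
  qed
  define F where "F = (\<lambda>v i. (r i + (\<Sum>j\<in>M. K i j * v j)) / d i)"
  define V where "V = (\<lambda>n. (F ^^ n) (\<lambda>_. 0))"
  have Vs: "V (Suc n) i = (r i + (\<Sum>j\<in>M. K i j * V n j)) / d i" for n i
    by (simp add: V_def F_def)
  have mono: "\<forall>i\<in>M. 0 \<le> V n i \<and> V n i \<le> V (Suc n) i" for n
  proof (induction n)
    case 0
    then show ?case using r dpos by (auto simp: V_def F_def divide_nonneg_pos)
  next
    case (Suc n)
    show ?case
    proof (intro ballI conjI)
      fix i assume i: "i \<in> M"
      show "0 \<le> V (Suc n) i" using Suc i by fastforce
      show "V (Suc n) i \<le> V (Suc (Suc n)) i"
        unfolding Vs[of "Suc n"] Vs[of n] using Suc K[OF i] dpos[OF i]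
        by (intro divide_right_mono add_left_mono sum_mono mult_left_mono) (auto simp: less_imp_le Vs)
    qed
  qed
  have bd: "\<forall>i\<in>M. V n i \<le> C * s i" for n
  proof (induction n)
    case 0
    then show ?case using C s(1) by (auto simp: V_def less_imp_le)
  next
    case (Suc n)
    show ?case
    proof
      fix i assume i: "i \<in> M"
      have "(\<Sum>j\<in>M. K i j * V n j) \<le> (\<Sum>j\<in>M. K i j * (C * s j))"
        using Suc K[OF i] by (intro sum_mono mult_left_mono) auto
      moreover have "r i + (\<Sum>j\<in>M. K i j * (C * s j)) \<le> d i * (C * s i)"
        using r(2)[OF i] unfolding node_op_alt d_def by (simp add: algebra_simps sum_distrib_left)
      ultimately show "V (Suc n) i \<le> C * s i"
        using dpos[OF i] unfolding Vs by (simp add: pos_divide_le_eq algebra_simps)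
    qed
  qed
  have "\<exists>l. (\<lambda>n. V n i) \<longlonglongrightarrow> l" if "i \<in> M" for i
  proof -
    have "incseq (\<lambda>n. V n i)" using mono that by (intro incseq_SucI) auto
    moreover have "bdd_above (range (\<lambda>n. V n i))" using bd that by (intro bdd_aboveI[of _ "C * s i"]) auto
    ultimately show ?thesis using LIMSEQ_incseq_SUP[of "\<lambda>n. V n i"] by blast
  qed
  then obtain l where l: "\<And>i. i \<in> M \<Longrightarrow> (\<lambda>n. V n i) \<longlonglongrightarrow> l i" by metis
  show ?thesis
  proof (intro exI[of _ l] ballI conjI)
    fix i assume i: "i \<in> M"
    show "0 \<le> l i" using l[OF i] mono i by (intro LIMSEQ_le_const) auto
    show "l i \<le> C * s i" using l[OF i] bd i by (intro LIMSEQ_le_const2) auto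
    have "(\<lambda>n. V (Suc n) i) \<longlonglongrightarrow> (r i + (\<Sum>j\<in>M. K i j * l j)) / d i"
      unfolding Vs using l dpos[OF i] by (intro tendsto_intros) auto
    then have "l i = (r i + (\<Sum>j\<in>M. K i j * l j)) / d i"
      using LIMSEQ_Suc[OF l[OF i]] LIMSEQ_unique by blast
    then have "d i * l i = r i + (\<Sum>j\<in>M. K i j * l j)"
      using dpos[OF i] by (metis less_irrefl nonzero_mult_div_cancel_left times_divide_eq_right)
    then show "node_op M D K l i = r i"
      unfolding node_op_alt d_def by simp
  qed
qed

text \<open>Comparison of \<open>w n\<close> and its negative with \<open>C n * s\<close> bounds the
  inverse of the system in the sup norm weighted by \<open>s\<close>, so small residuals force small
  solutions.\<close>

lemma node_op_perturbation:
  assumes "finite M" and K: "\<And>i j. i \<in> M \<Longrightarrow> j \<in> M \<Longrightarrow> K i j \<ge> 0"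
    and s: "\<And>i. i \<in> M \<Longrightarrow> s i > 0" "\<And>i. i \<in> M \<Longrightarrow> node_op M D K s i > 0"
    and res: "\<And>i. i \<in> M \<Longrightarrow> (\<lambda>n. node_op M D K (w n) i) \<longlonglongrightarrow> 0" and k: "k \<in> M"
  shows "(\<lambda>n. w n k) \<longlonglongrightarrow> 0"
proof -
  \<comment> \<open>The sum of the ratios replaces their maximum, which makes its limit
    immediate.\<close>
  define C where "C = (\<lambda>n. \<Sum>i\<in>M. \<bar>node_op M D K (w n) i\<bar> / node_op M D K s i)"
  have "C \<longlonglongrightarrow> (\<Sum>i\<in>M. \<bar>0\<bar> / node_op M D K s i)"
    unfolding C_def using res s(2) by (intro tendsto_intros) (auto simp: less_imp_neq[THEN not_sym])
  then have C0: "(\<lambda>n. C n * s k) \<longlonglongrightarrow> 0" by (auto intro: tendsto_eq_intros)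
  have C: "\<bar>node_op M D K (w n) i\<bar> \<le> C n * node_op M D K s i" if "i \<in> M" for i n
  proof -
    have "\<bar>node_op M D K (w n) i\<bar> / node_op M D K s i \<le> C n"
      unfolding C_def using s(2) assms(1) that by (intro member_le_sum) (auto simp: less_imp_le)
    then show ?thesis using s(2)[OF that] by (simp add: pos_divide_le_eq)
  qed
  have "\<bar>w n k\<bar> \<le> C n * s k" for n
  proof -
    have "0 \<le> C n * s k - w n k"
      by (rule node_op_nonneg_imp_nonneg[OF assms(1) K s, where x = "\<lambda>i. C n * s i - w n i"])
        (use C[of _ n] k in \<open>auto simp: node_op_diff node_op_cmult abs_le_iff\<close>)
    moreover have "0 \<le> C n * s k + w n k"
      by (rule node_op_nonneg_imp_nonneg[OF assms(1) K s, where x = "\<lambda>i. C n * s i + w n i"])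
        (use C[of _ n] k in \<open>auto simp: node_op_add node_op_cmult abs_le_iff algebra_simps\<close>, smt (verit) C)
    ultimately show ?thesis by linarith
  qed
  then show ?thesis using C0 by (rule_tac Lim_null_comparison[of _ "\<lambda>n. C n * s k"]) auto
qed

text \<open>On an incoming arc the transport coefficient is 0, so positivity has to come from an
  outgoing neighbour with a smaller value: hence \<open>1 + \<eta>\<close> on incoming and 1 on
  outgoing arcs. On an outgoing arc this excess costs
  \<open>\<eta> * (\<Sum>j\<in>In. K i j)\<close>, which must stay below
  \<open>lam i\<close>.\<close>

lemma network_supersolution:
  fixes lam :: "nat \<Rightarrow> real"
  assumes fin: "finite (In \<union> Out)" and disj: "In \<inter> Out = {}"
    and lam: "\<And>i. i \<in> Out \<Longrightarrow> lam i > 0"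
    and K: "\<And>i j. i \<in> In \<union> Out \<Longrightarrow> j \<in> In \<union> Out \<Longrightarrow> K i j \<ge> 0"
    and KIO: "\<forall>i\<in>In. \<exists>j\<in>Out. K i j > 0"
  shows "\<exists>s. \<forall>i\<in>In \<union> Out. s i > 0 \<and>
           node_op (In \<union> Out) (\<lambda>i. if i \<in> In then 0 else lam i) K s i > 0"
proof -
  \<comment> \<open>\<open>S\<close> bounds the ratio of incoming coupling to velocity on each
    outgoing arc, so \<open>\<eta> = 1 / (S + 1)\<close> keeps the cost strictly below
    \<open>lam i\<close> on all of them at once.\<close>
  define S where "S = (\<Sum>i\<in>Out. (\<Sum>j\<in>In. K i j) / lam i)"
  define \<eta> where "\<eta> = 1 / (S + 1)"
  have KO: "(\<Sum>j\<in>In. K i j) / lam i \<ge> 0" if "i \<in> Out" for i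
    using that K lam[OF that] by (intro divide_nonneg_pos sum_nonneg) auto
  then have S0: "S \<ge> 0" unfolding S_def by (rule sum_nonneg)
  then have \<eta>: "\<eta> > 0" by (simp add: \<eta>_def)
  define s where "s = (\<lambda>i. if i \<in> In then 1 + \<eta> else (1::real))"
  have "node_op (In \<union> Out) (\<lambda>i. if i \<in> In then 0 else lam i) K s i > 0" if "i \<in> In \<union> Out" for i
  proof (cases "i \<in> In")
    case True
    have "(\<Sum>j\<in>In \<union> Out. K i j * (s i - s j)) = (\<Sum>j\<in>Out. K i j * \<eta>)"
      using True disj fin by (intro sum.mono_neutral_cong_right) (auto simp: s_def)
    also obtain j where j: "j \<in> Out" "K i j > 0" using KIO True by blast
    have "K i j * \<eta> \<le> (\<Sum>j\<in>Out. K i j * \<eta>)"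
      using fin j True K \<eta> by (intro member_le_sum[of j]) auto
    ultimately have "(\<Sum>j\<in>In \<union> Out. K i j * (s i - s j)) > 0"
      using j \<eta> by (smt (verit) mult_pos_pos)
    then show ?thesis using True by (simp add: node_op_def)
  next
    case False
    then have i: "i \<in> Out" using that by auto
    have "(\<Sum>j\<in>In \<union> Out. K i j * (s i - s j)) = (\<Sum>j\<in>In. - (K i j * \<eta>))"
      using False disj fin by (intro sum.mono_neutral_cong_right) (auto simp: s_def)
    also have "\<dots> = - \<eta> * (\<Sum>j\<in>In. K i j)" by (simp add: sum_negf sum_distrib_left mult.commute)
    finally have e: "(\<Sum>j\<in>In \<union> Out. K i j * (s i - s j)) = - \<eta> * (\<Sum>j\<in>In. K i j)" .
    have "(\<Sum>j\<in>In. K i j) / lam i \<le> S"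
      unfolding S_def using fin i KO by (intro member_le_sum) auto
    then have "(\<Sum>j\<in>In. K i j) < lam i * (S + 1)"
      using lam[OF i] by (simp add: pos_divide_le_eq algebra_simps)
    then have "\<eta> * (\<Sum>j\<in>In. K i j) < lam i"
      using S0 unfolding \<eta>_def by (simp add: pos_divide_less_eq)
    then show ?thesis using False unfolding node_op_def e by (simp add: s_def)
  qed
  then show ?thesis using \<eta> by (intro exI[of _ s]) (auto simp: s_def)
qed

text \<open>\<open>G i k\<close> is the node value on arc \<open>i\<close> caused by a unit flux
  arriving through arc \<open>k\<close>. Adding the equations over all arcs cancels the exchange
  terms by symmetry of \<open>K\<close> and leaves the column sum. Positivity starts at
  \<open>G k k\<close>, forced by the right-hand side 1, and passes to every outgoing arc coupled
  with \<open>k\<close>.\<close>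

lemma network_response:
  fixes lam :: "nat \<Rightarrow> real"
  assumes fin: "finite (In \<union> Out)" and disj: "In \<inter> Out = {}"
    and lam: "\<And>i. i \<in> Out \<Longrightarrow> lam i > 0"
    and K: "\<And>i j. i \<in> In \<union> Out \<Longrightarrow> j \<in> In \<union> Out \<Longrightarrow> K i j \<ge> 0"
    and Ks: "\<And>i j. i \<in> In \<union> Out \<Longrightarrow> j \<in> In \<union> Out \<Longrightarrow> K i j = K j i"
    and KIO: "\<forall>i\<in>In. \<exists>j\<in>Out. K i j > 0"
  obtains G :: "nat \<Rightarrow> nat \<Rightarrow> real"
  where "\<And>i k. i \<in> In \<union> Out \<Longrightarrow> k \<in> In \<Longrightarrow> G i k \<ge> 0"
    and "\<And>i k. i \<in> In \<union> Out \<Longrightarrow> k \<in> In \<Longrightarrow>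
      node_op (In \<union> Out) (\<lambda>i. if i \<in> In then 0 else lam i) K (\<lambda>i. G i k) i = (if i = k then 1 else 0)"
    and "\<And>k. k \<in> In \<Longrightarrow> (\<Sum>i\<in>Out. lam i * G i k) = 1"
    and "\<And>i k. i \<in> Out \<Longrightarrow> k \<in> In \<Longrightarrow> K i k > 0 \<Longrightarrow> G i k > 0"
proof -
  define M where "M = In \<union> Out"
  define D where "D = (\<lambda>i. if i \<in> In then 0 else lam i)"
  obtain s where s: "\<And>i. i \<in> M \<Longrightarrow> s i > 0" "\<And>i. i \<in> M \<Longrightarrow> node_op M D K s i > 0"
    using network_supersolution[where lam = lam, OF fin disj _ _ KIO] lam K unfolding M_def D_def by blast
  have finM: "finite M" using fin by (simp add: M_def)
  have "\<exists>v. \<forall>i\<in>M. 0 \<le> v i \<and> node_op M D K v i = (if i = k then 1 else 0)" if k: "k \<in> In" for k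
  proof -
    have kM: "k \<in> M" using k by (simp add: M_def)
    have "\<exists>v. \<forall>i\<in>M. 0 \<le> v i \<and> v i \<le> 1 / node_op M D K s k * s i
              \<and> node_op M D K v i = (if i = k then 1 else 0)"
      using s(2)[OF kM] s(2)
      by (intro node_op_solution[OF finM _ s]) (use K in \<open>auto simp: M_def less_imp_le\<close>)
    then show ?thesis by blast
  qed
  then obtain v where v: "\<And>k i. k \<in> In \<Longrightarrow> i \<in> M \<Longrightarrow> 0 \<le> v k i"
     "\<And>k i. k \<in> In \<Longrightarrow> i \<in> M \<Longrightarrow> node_op M D K (v k) i = (if i = k then 1 else 0)" by metis
  define G where "G = (\<lambda>i k. v k i)"
  have sum1: "(\<Sum>i\<in>Out. lam i * G i k) = 1" if k: "k \<in> In" for k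
  proof -
    have "(\<Sum>i\<in>M. \<Sum>j\<in>M. K i j * (G i k - G j k)) = (\<Sum>j\<in>M. \<Sum>i\<in>M. K i j * (G i k - G j k))"
      by (rule sum.swap)
    also have "\<dots> = (\<Sum>j\<in>M. \<Sum>i\<in>M. - (K j i * (G j k - G i k)))"
      using Ks by (intro sum.cong refl) (simp add: M_def algebra_simps)
    finally have z: "(\<Sum>i\<in>M. \<Sum>j\<in>M. K i j * (G i k - G j k)) = 0" by (simp add: sum_negf)
    have "(\<Sum>i\<in>M. node_op M D K (\<lambda>i. G i k) i) = (\<Sum>i\<in>M. if i = k then 1 else 0)"
      using v(2)[OF k] by (intro sum.cong) (auto simp: G_def)
    also have "\<dots> = 1" using finM k by (simp add: M_def)
    finally have "(\<Sum>i\<in>M. D i * G i k) = 1" using z by (simp add: node_op_def sum.distrib)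
    moreover have "(\<Sum>i\<in>M. D i * G i k) = (\<Sum>i\<in>Out. lam i * G i k)"
      unfolding M_def using disj fin by (intro sum.mono_neutral_cong_right) (auto simp: D_def)
    ultimately show ?thesis by simp
  qed
  have pos: "G i k > 0" if i: "i \<in> Out" and k: "k \<in> In" and Kik: "K i k > 0" for i k
  proof -
    have M: "i \<in> M" "k \<in> M" using i k by (auto simp: M_def)
    have ge: "(\<Sum>j\<in>M. K a j * G j k) \<ge> 0" if "a \<in> M" for a
      using v(1)[OF k] K that by (intro sum_nonneg mult_nonneg_nonneg) (auto simp: G_def M_def)
    \<comment> \<open>A zero here would make row \<open>k\<close> nonpositive, whereas its
      right-hand side is 1.\<close>
    have "G k k \<noteq> 0"
    proof
      assume "G k k = 0"
      then have "node_op M D K (\<lambda>i. G i k) k \<le> 0" using ge[OF M(2)] by (simp add: node_op_alt)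
      then show False using v(2)[OF k M(2)] by (simp add: G_def)
    qed
    then have Gk: "G k k > 0" using v(1)[OF k M(2)] by (simp add: G_def)
    have "K i k * G k k \<le> (\<Sum>j\<in>M. K i j * G j k)"
      using v(1)[OF k] K M finM by (intro member_le_sum) (auto simp: G_def M_def)
    moreover have "0 < K i k * G k k" using Gk Kik by simp
    ultimately have g: "(\<Sum>j\<in>M. K i j * G j k) > 0" by linarith
    have "i \<noteq> k" using i k disj by auto
    then have "(D i + (\<Sum>j\<in>M. K i j)) * G i k = (\<Sum>j\<in>M. K i j * G j k)"
      using v(2)[OF k M(1)] unfolding node_op_alt by (simp add: G_def)
    then have "G i k \<noteq> 0" using g by auto
    then show ?thesis using v(1)[OF k M(1)] by (simp add: G_def)
  qed
  show ?thesis
    using that[of G] v sum1 pos unfolding G_def M_def D_def by blast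
qed

section \<open>Smooth functions and density in L1\<close>

definition C2 :: "(real \<Rightarrow> real) \<Rightarrow> bool" where
  "C2 p \<longleftrightarrow> (\<exists>p' p''. (\<forall>x. (p has_real_derivative p' x) (at x)) \<and>
     (\<forall>x. (p' has_real_derivative p'' x) (at x)) \<and> continuous_on UNIV p'')"

lemma C2_const: "C2 (\<lambda>x. c)"
  unfolding C2_def by (intro exI[of _ "\<lambda>x. 0"]) auto

lemma C2_add:
  assumes "C2 p" "C2 q"
  shows "C2 (\<lambda>x. p x + q x)"
proof -
  obtain p' p'' q' q'' where *: "\<And>x. (p has_real_derivative p' x) (at x)" "\<And>x. (p' has_real_derivative p'' x) (at x)"
    "continuous_on UNIV p''" "\<And>x. (q has_real_derivative q' x) (at x)" "\<And>x. (q' has_real_derivative q'' x) (at x)"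
    "continuous_on UNIV q''"
    using assms unfolding C2_def by metis
  show ?thesis unfolding C2_def
    by (rule exI[of _ "\<lambda>x. p' x + q' x"], rule exI[of _ "\<lambda>x. p'' x + q'' x"])
      (auto intro!: derivative_intros continuous_intros *)
qed

lemma C2_mult:
  assumes "C2 p" "C2 q"
  shows "C2 (\<lambda>x. p x * q x)"
proof -
  obtain p' p'' q' q'' where *: "\<And>x. (p has_real_derivative p' x) (at x)" "\<And>x. (p' has_real_derivative p'' x) (at x)"
    "continuous_on UNIV p''" "\<And>x. (q has_real_derivative q' x) (at x)" "\<And>x. (q' has_real_derivative q'' x) (at x)"
    "continuous_on UNIV q''"
    using assms unfolding C2_def by metis
  have c: "continuous_on UNIV p" "continuous_on UNIV q" "continuous_on UNIV p'" "continuous_on UNIV q'"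
    using * by (auto intro!: DERIV_continuous_on)
  show ?thesis unfolding C2_def
    by (rule exI[of _ "\<lambda>x. p' x * q x + q' x * p x"],
        rule exI[of _ "\<lambda>x. (p'' x * q x + q' x * p' x) + (q'' x * p x + p' x * q' x)"])
      (intro conjI allI DERIV_add DERIV_mult continuous_intros * c)
qed

lemma C2_cmult: "C2 p \<Longrightarrow> C2 (\<lambda>x. c * p x)"
  by (intro C2_mult C2_const)

lemma C2_diff: "C2 p \<Longrightarrow> C2 q \<Longrightarrow> C2 (\<lambda>x. p x - q x)"
  using C2_add[of p "\<lambda>x. (-1) * q x"] C2_cmult[of q "-1"] by simp

lemma C2_affine:
  assumes "C2 p"
  shows "C2 (\<lambda>x. p (a * x + b))"
proof -
  obtain p' p'' where *: "\<And>x. (p has_real_derivative p' x) (at x)" "\<And>x. (p' has_real_derivative p'' x) (at x)"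
    "continuous_on UNIV p''"
    using assms unfolding C2_def by metis
  have l: "((\<lambda>x. a * x + b) has_real_derivative a) (at x)" for x
    by (auto intro!: derivative_eq_intros)
  show ?thesis unfolding C2_def
    by (rule exI[of _ "\<lambda>x. p' (a * x + b) * a"], rule exI[of _ "\<lambda>x. p'' (a * x + b) * a * a"])
      (auto intro!: DERIV_cmult_right DERIV_chain2[OF *(1) l] DERIV_chain2[OF *(2) l] continuous_intros
        continuous_on_compose2[OF *(3)])
qed

lemma C2_inverse:
  assumes "C2 p" and nz: "\<And>x. p x \<noteq> 0"
  shows "C2 (\<lambda>x. 1 / p x)"
proof -
  obtain p' p'' where *: "\<And>x. (p has_real_derivative p' x) (at x)" "\<And>x. (p' has_real_derivative p'' x) (at x)"
    "continuous_on UNIV p''"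
    using assms unfolding C2_def by metis
  have c: "continuous_on UNIV p" "continuous_on UNIV p'"
    using * by (auto intro!: DERIV_continuous_on)
  define q where "q = (\<lambda>x. 1 / p x)"
  define q' where "q' = (\<lambda>x. - (p' x * (q x * q x)))"
  have q: "(q has_real_derivative q' x) (at x)" for x
    unfolding q_def q'_def using nz[of x] by (auto intro!: derivative_eq_intros *(1))
  have q': "(q' has_real_derivative - (p'' x * (q x * q x) + (q' x * q x + q' x * q x) * p' x)) (at x)" for x
    unfolding q'_def[abs_def] by (intro DERIV_minus DERIV_mult * q[unfolded q'_def])
  have "continuous_on UNIV q" "continuous_on UNIV q'"
    using q q' by (auto intro!: DERIV_continuous_on)
  then have "continuous_on UNIV (\<lambda>x. - (p'' x * (q x * q x) + (q' x * q x + q' x * q x) * p' x))"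
    by (intro continuous_intros c *)
  with q q' show ?thesis unfolding C2_def q_def[symmetric]
    by (intro exI conjI allI)
qed

lemma C2_polynomial:
  assumes "real_polynomial_function p"
  shows "C2 p"
proof -
  obtain p' where p': "real_polynomial_function p'" "\<And>x. (p has_real_derivative p' x) (at x)"
    using has_real_derivative_polynomial_function[OF assms] by blast
  obtain p'' where p'': "real_polynomial_function p''" "\<And>x. (p' has_real_derivative p'' x) (at x)"
    using has_real_derivative_polynomial_function[OF p'(1)] by blast
  have "continuous_on UNIV p''"
    using continuous_on_polymonial_function p''(1) real_polynomial_function_eq by blast
  then show ?thesis unfolding C2_def
    using p'(2) p''(2) by (intro exI[of _ p'] exI[of _ p'']) blast
qed

text \<open>At 0 the Caratheodory form of the derivative applies: the difference quotient is exactly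
  \<open>max 0 z ^ Suc n\<close>, continuous with value 0.\<close>

lemma DERIV_pos_part_power:
  "((\<lambda>x. max 0 x ^ Suc (Suc n)) has_real_derivative real (Suc (Suc n)) * max 0 x ^ Suc n) (at (x::real))"
proof -
  consider "x > 0" | "x < 0" | "x = 0" by linarith
  then show ?thesis
  proof cases
    case 1
    have "((\<lambda>x. x ^ Suc (Suc n)) has_real_derivative real (Suc (Suc n)) * max 0 x ^ Suc n) (at x)"
      using 1 DERIV_pow[of "Suc (Suc n)" x] by (simp add: max_def)
    then show ?thesis
      by (rule has_field_derivative_transform_within_open[where S = "{0<..}"]) (use 1 in \<open>auto simp: max_def\<close>)
  next
    case 2
    have "((\<lambda>x. 0) has_real_derivative real (Suc (Suc n)) * max 0 x ^ Suc n) (at x)"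
      using 2 by (simp add: max_def)
    then show ?thesis
      by (rule has_field_derivative_transform_within_open[where S = "{..<0}"]) (use 2 in \<open>auto simp: max_def\<close>)
  next
    case 3
    have "isCont (\<lambda>z::real. max 0 z ^ Suc n) 0" by (intro continuous_intros)
    moreover have "max 0 z ^ Suc (Suc n) - max 0 0 ^ Suc (Suc n) = max 0 z ^ Suc n * (z - 0)" for z :: real
      by (simp add: max_def)
    ultimately have "((\<lambda>x::real. max 0 x ^ Suc (Suc n)) has_real_derivative 0) (at 0)"
      unfolding CARAT_DERIV by (intro exI[of _ "\<lambda>z. max 0 z ^ Suc n"]) simp
    then show ?thesis using 3 by simp
  qed
qed

lemma C2_pos_part_cube: "C2 (\<lambda>x. max 0 x ^ 3)"
proof -
  have "((\<lambda>x. max 0 x ^ 3) has_real_derivative 3 * max 0 x ^ 2) (at x)" for x :: real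
    using DERIV_pos_part_power[of 1 x] by (simp add: numeral_eq_Suc)
  moreover have "((\<lambda>x. 3 * max 0 x ^ 2) has_real_derivative 3 * (2 * max 0 x)) (at x)" for x :: real
    using DERIV_cmult[OF DERIV_pos_part_power[of 0 x], of 3] by (simp add: numeral_eq_Suc)
  moreover have "continuous_on UNIV (\<lambda>x::real. 3 * (2 * max 0 x))" by (intro continuous_intros)
  ultimately show ?thesis unfolding C2_def
    by (intro exI[of _ "\<lambda>x. 3 * max 0 x ^ 2"] exI[of _ "\<lambda>x. 3 * (2 * max 0 x)"]) blast
qed

text \<open>Cubes are the lowest integer powers of the positive part that are twice continuously
  differentiable.\<close>

definition bump :: "real \<Rightarrow> real \<Rightarrow> real \<Rightarrow> real" where
  "bump a b x = max 0 (x - a) ^ 3 * max 0 (b - x) ^ 3"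

lemma C2_bump: "C2 (bump a b)"
proof -
  have "C2 (\<lambda>x. max 0 (1 * x + (- a)) ^ 3 * max 0 ((-1) * x + b) ^ 3)"
    by (intro C2_mult C2_affine[where p = "\<lambda>x. max 0 x ^ 3"] C2_pos_part_cube)
  then show ?thesis by (simp add: bump_def[abs_def] algebra_simps)
qed

lemma bump_nonneg: "bump a b x \<ge> 0" by (simp add: bump_def)

text \<open>A rational function of a bump instead of an exponential mollifier. The bump belongs to
  the interval shrunk by \<open>1 / Suc n\<close> on both sides, so the support is compact in the
  open interval; inside, the growing factor drives the value to 1. On an interval no longer than
  \<open>2 / Suc n\<close> the function is identically 0.\<close>

definition cutoff :: "real \<Rightarrow> real \<Rightarrow> nat \<Rightarrow> real \<Rightarrow> real" where
  "cutoff a b n x = 1 - 1 / (1 + Suc n * bump (a + 1 / Suc n) (b - 1 / Suc n) x)"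

lemma C2_cutoff: "C2 (cutoff a b n)"
proof -
  have "1 + Suc n * bump (a + 1 / Suc n) (b - 1 / Suc n) x \<noteq> 0" for x
    using mult_nonneg_nonneg[OF of_nat_0_le_iff bump_nonneg, of "Suc n" "a + 1 / Suc n" "b - 1 / Suc n" x]
    by linarith
  then show ?thesis
    unfolding cutoff_def[abs_def] by (intro C2_diff C2_const C2_inverse C2_add C2_cmult C2_bump)
qed

lemma cutoff_bounds: "0 \<le> cutoff a b n x" "cutoff a b n x \<le> 1"
proof -
  have "Suc n * bump (a + 1 / Suc n) (b - 1 / Suc n) x \<ge> 0" by (intro mult_nonneg_nonneg bump_nonneg) simp
  then show "0 \<le> cutoff a b n x" "cutoff a b n x \<le> 1" by (auto simp: cutoff_def)
qed

lemma cutoff_eq_0: "x \<le> a + 1 / Suc n \<or> x \<ge> b - 1 / Suc n \<Longrightarrow> cutoff a b n x = 0"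
  by (auto simp: cutoff_def bump_def)

lemma cutoff_eq_0': "x \<notin> {a<..<b} \<Longrightarrow> cutoff a b n x = 0"
proof (rule cutoff_eq_0)
  assume *: "x \<notin> {a<..<b}"
  have "1 / real (Suc n) > 0" by simp
  with * show "x \<le> a + 1 / Suc n \<or> x \<ge> b - 1 / Suc n"
    unfolding greaterThanLessThan_iff by linarith
qed

lemma cutoff_tendsto: "(\<lambda>n. cutoff a b n x) \<longlonglongrightarrow> indicator {a<..<b} x"
proof (cases "x \<in> {a<..<b}")
  case False
  then show ?thesis by (simp add: cutoff_eq_0')
next
  case True
  have S: "(\<lambda>n. 1 / real (Suc n)) \<longlonglongrightarrow> 0" using LIMSEQ_Suc[OF lim_1_over_n] .
  have "(\<lambda>n. bump (a + 1 / Suc n) (b - 1 / Suc n) x) \<longlonglongrightarrow> max 0 (x - (a + 0)) ^ 3 * max 0 (b - 0 - x) ^ 3"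
    unfolding bump_def by (intro tendsto_intros S)
  moreover have "max 0 (x - (a + 0)) ^ 3 * max 0 (b - 0 - x) ^ 3 > 0" using True by simp
  moreover have "filterlim (\<lambda>n. real (Suc n)) at_top sequentially"
    using filterlim_compose[OF filterlim_real_sequentially filterlim_Suc] .
  ultimately have "filterlim (\<lambda>n. bump (a + 1 / Suc n) (b - 1 / Suc n) x * real (Suc n)) at_top sequentially"
    by (intro filterlim_tendsto_pos_mult_at_top)
  then have "filterlim (\<lambda>n. 1 + bump (a + 1 / Suc n) (b - 1 / Suc n) x * real (Suc n)) at_top sequentially"
    by (rule filterlim_tendsto_add_at_top[OF tendsto_const])
  then have "(\<lambda>n. 1 - 1 / (1 + bump (a + 1 / Suc n) (b - 1 / Suc n) x * real (Suc n))) \<longlonglongrightarrow> 1 - 0"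
    by (intro tendsto_diff tendsto_const tendsto_divide_0[where c = 1] filterlim_at_top_imp_at_infinity)
  then show ?thesis using True by (simp add: cutoff_def mult.commute)
qed

text \<open>For \<open>L > 0\<close> the two positive parts never vanish together, so the quotient
  is C2 on the whole line without a case distinction.\<close>

definition smooth_step :: "real \<Rightarrow> real \<Rightarrow> real" where
  "smooth_step L x = max 0 x ^ 3 / (max 0 x ^ 3 + max 0 (L - x) ^ 3)"

lemma smooth_step_denominator: "L > 0 \<Longrightarrow> max 0 x ^ 3 + max 0 (L - x) ^ 3 > (0::real)"
  by (cases "x > 0") (simp_all add: add_pos_nonneg add_nonneg_pos max_def)

lemma C2_smooth_step:
  assumes "L > 0"
  shows "C2 (smooth_step L)"
proof -
  have "C2 (\<lambda>x. max 0 x ^ 3 + max 0 ((-1) * x + L) ^ 3)"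
    by (intro C2_add C2_affine[where p = "\<lambda>x. max 0 x ^ 3"] C2_pos_part_cube)
  then have "C2 (\<lambda>x. max 0 x ^ 3 * (1 / (max 0 x ^ 3 + max 0 (L - x) ^ 3)))"
    using smooth_step_denominator[OF assms] by (intro C2_mult C2_pos_part_cube C2_inverse) (auto simp: less_imp_neq[THEN not_sym])
  then show ?thesis by (simp add: smooth_step_def[abs_def])
qed

lemma smooth_step_0: "x \<le> 0 \<Longrightarrow> smooth_step L x = 0"
  by (simp add: smooth_step_def max_def)

lemma smooth_step_1: "L > 0 \<Longrightarrow> x \<ge> L \<Longrightarrow> smooth_step L x = 1"
  by (simp add: smooth_step_def max_def)

section \<open>Density of continuous functions\<close>

lemma borel_measurable_continuous_lebesgue:
  fixes g :: "'a::euclidean_space \<Rightarrow> real"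
  shows "continuous_on UNIV g \<Longrightarrow> g \<in> borel_measurable lebesgue"
  by (intro measurable_completion) (simp add: borel_measurable_continuous_onI)

text \<open>Truncation makes the target bounded at a small L1 cost. Continuous functions converge to
  it almost everywhere, and dominated convergence on the bounded interval does the rest.\<close>

lemma L1_dense_continuous:
  fixes f :: "real \<Rightarrow> real"
  assumes f: "f absolutely_integrable_on {a..b}" and e: "e > 0"
  shows "\<exists>g. continuous_on UNIV g \<and> L1_norm {a..b} (\<lambda>x. f x - g x) < e"
proof -
  define fh where "fh = (\<lambda>x. indicat_real {a..b} x * f x)"
  have fh: "integrable lebesgue fh" using f by (simp add: set_integrable_def fh_def)
  then have fhm[measurable]: "fh \<in> borel_measurable lebesgue" by simp
  define cl where "cl = (\<lambda>k::nat. \<lambda>x::real. max (- real k) (min (real k) x))"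
  have clm: "(\<lambda>x. cl k (u x)) \<in> borel_measurable lebesgue" if "u \<in> borel_measurable lebesgue" for k u
    unfolding cl_def using that by measurable
  have cl1: "\<bar>y - cl k y\<bar> \<le> \<bar>y\<bar>" for y k by (simp add: cl_def max_def min_def)
  have "- real k \<le> cl k y" "cl k y \<le> real k" for k y by (simp_all add: cl_def)
  then have cl2: "\<bar>cl k y - cl k z\<bar> \<le> 2 * real k" for y z k by (smt (verit))
  have cl3: "cl k y = y" if "\<bar>y\<bar> \<le> real k" for y k using that unfolding cl_def by linarith
  have cm: "(\<lambda>x. \<bar>fh x - cl k (fh x)\<bar>) \<in> borel_measurable lebesgue" for k
    using clm[OF fhm, of k] fhm by (intro borel_measurable_abs borel_measurable_diff)
  have "(\<lambda>k. \<integral>x. \<bar>fh x - cl k (fh x)\<bar> \<partial>lebesgue) \<longlonglongrightarrow> (\<integral>x. 0 \<partial>(lebesgue :: real measure))"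
  proof (rule integral_dominated_convergence[where w = "\<lambda>x. \<bar>fh x\<bar>"])
    show "AE x in lebesgue. (\<lambda>k. \<bar>fh x - cl k (fh x)\<bar>) \<longlonglongrightarrow> 0"
    proof (intro AE_I2)
      fix x
      obtain k0 :: nat where "\<bar>fh x\<bar> \<le> real k0" using real_arch_simple by blast
      then have "eventually (\<lambda>k. \<bar>fh x - cl k (fh x)\<bar> = 0) sequentially"
        unfolding eventually_sequentially by (intro exI[of _ k0]) (auto simp: cl3)
      then show "(\<lambda>k. \<bar>fh x - cl k (fh x)\<bar>) \<longlonglongrightarrow> 0" by (rule tendsto_eventually)
    qed
    show "integrable lebesgue (\<lambda>x. \<bar>fh x\<bar>)" using fh by (rule integrable_abs)
  qed (simp_all add: cl1 cm)
  then have "eventually (\<lambda>k. (\<integral>x. \<bar>fh x - cl k (fh x)\<bar> \<partial>lebesgue) < e / 2) sequentially"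
    using e by (intro order_tendstoD(2)[where y = 0]) auto
  then obtain k where k: "(\<integral>x. \<bar>fh x - cl k (fh x)\<bar> \<partial>lebesgue) < e / 2"
    using eventually_happens'[OF sequentially_bot] by blast
  obtain N g where N: "negligible N" and g: "\<And>n::nat. continuous_on UNIV (g n)"
    and conv: "\<And>x. x \<notin> N \<Longrightarrow> (\<lambda>n. g n x) \<longlonglongrightarrow> fh x"
    using lebesgue_measurable_imp_measurable_on_real[OF fhm, of UNIV] unfolding measurable_on_def by auto
  \<comment> \<open>The continuous approximations carry no bound of their own. Truncated at the same
    level \<open>k\<close>, they stay within \<open>2 * real k\<close> of the truncated target,
    which supplies the dominating constant.\<close>
  define h where "h = (\<lambda>n x. cl k (g n x))"
  have hc: "continuous_on UNIV (h n)" for n unfolding h_def cl_def by (intro continuous_intros g)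
  have hm[measurable]: "h n \<in> borel_measurable lebesgue" for n
    by (rule borel_measurable_continuous_lebesgue[OF hc])
  have w: "integrable lebesgue (\<lambda>x. indicat_real {a..b} x * (2 * real k))"
    using absolutely_integrable_on_const[of "{a..b}" "2 * real k"] by (simp add: set_integrable_def)
  have clm': "(\<lambda>x. cl k (fh x)) \<in> borel_measurable lebesgue" by (rule clm[OF fhm])
  have dm: "(\<lambda>x. indicat_real {a..b} x * \<bar>cl k (fh x) - h n x\<bar>) \<in> borel_measurable lebesgue" for n
    using clm' hm fhm
    by (auto intro!: borel_measurable_times borel_measurable_abs borel_measurable_diff borel_measurable_indicator)
  have "(\<lambda>n. \<integral>x. indicat_real {a..b} x * \<bar>cl k (fh x) - h n x\<bar> \<partial>lebesgue) \<longlonglongrightarrow> (\<integral>x. 0 \<partial>(lebesgue :: real measure))"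
  proof (rule integral_dominated_convergence[OF _ _ w])
    have "AE x in lebesgue. x \<notin> N" using N by (simp add: AE_not_in negligible_iff_null_sets)
    then show "AE x in lebesgue. (\<lambda>n. indicat_real {a..b} x * \<bar>cl k (fh x) - h n x\<bar>) \<longlonglongrightarrow> 0"
    proof eventually_elim
      case (elim x)
      have "(\<lambda>n. indicat_real {a..b} x * \<bar>cl k (fh x) - h n x\<bar>) \<longlonglongrightarrow> indicat_real {a..b} x * \<bar>cl k (fh x) - cl k (fh x)\<bar>"
        unfolding h_def cl_def by (intro tendsto_intros conv elim)
      then show ?case by simp
    qed
    show "AE x in lebesgue. norm (indicat_real {a..b} x * \<bar>cl k (fh x) - h n x\<bar>) \<le> indicat_real {a..b} x * (2 * real k)" for n
      by (intro AE_I2) (simp add: h_def cl2 mult_left_mono)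
  qed (use dm in auto)
  then have "eventually (\<lambda>n. (\<integral>x. indicat_real {a..b} x * \<bar>cl k (fh x) - h n x\<bar> \<partial>lebesgue) < e / 2) sequentially"
    using e by (intro order_tendstoD(2)[where y = 0]) auto
  then obtain n where n: "(\<integral>x. indicat_real {a..b} x * \<bar>cl k (fh x) - h n x\<bar> \<partial>lebesgue) < e / 2"
    using eventually_happens'[OF sequentially_bot] by blast
  have i1: "integrable lebesgue (\<lambda>x. \<bar>fh x - cl k (fh x)\<bar>)"
    by (rule Bochner_Integration.integrable_bound[OF fh cm]) (simp add: cl1)
  have i2: "integrable lebesgue (\<lambda>x. indicat_real {a..b} x * \<bar>cl k (fh x) - h n x\<bar>)"
  proof (rule Bochner_Integration.integrable_bound[OF w dm], intro AE_I2)
    show "norm (indicat_real {a..b} x * \<bar>cl k (fh x) - h n x\<bar>) \<le> norm (indicat_real {a..b} x * (2 * real k))" for x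
      by (simp add: h_def cl2 mult_left_mono)
  qed
  have "L1_norm {a..b} (\<lambda>x. f x - h n x) \<le> (\<integral>x. \<bar>fh x - cl k (fh x)\<bar> + indicat_real {a..b} x * \<bar>cl k (fh x) - h n x\<bar> \<partial>lebesgue)"
    unfolding L1_norm_def set_lebesgue_integral_def
  proof (rule integral_mono')
    show "integrable lebesgue (\<lambda>x. \<bar>fh x - cl k (fh x)\<bar> + indicat_real {a..b} x * \<bar>cl k (fh x) - h n x\<bar>)"
      by (rule Bochner_Integration.integrable_add[OF i1 i2])
    show "indicat_real {a..b} x *\<^sub>R \<bar>f x - h n x\<bar> \<le> \<bar>fh x - cl k (fh x)\<bar> + indicat_real {a..b} x * \<bar>cl k (fh x) - h n x\<bar>" for x
      using abs_triangle_ineq[of "f x - cl k (f x)" "cl k (f x) - h n x"]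
      by (cases "x \<in> {a..b}") (simp_all add: fh_def del: abs_le_iff)
    show "0 \<le> \<bar>fh x - cl k (fh x)\<bar> + indicat_real {a..b} x * \<bar>cl k (fh x) - h n x\<bar>" for x
      by simp
  qed
  also have "\<dots> = (\<integral>x. \<bar>fh x - cl k (fh x)\<bar> \<partial>lebesgue) + (\<integral>x. indicat_real {a..b} x * \<bar>cl k (fh x) - h n x\<bar> \<partial>lebesgue)"
    by (rule Bochner_Integration.integral_add[OF i1 i2])
  also have "\<dots> < e" using k n by simp
  finally show ?thesis using hc by blast
qed

section \<open>The L1 norm\<close>

lemma AE_lebesgue_not_mem: "negligible N \<Longrightarrow> AE x in lebesgue. x \<notin> N"
  by (simp add: AE_not_in negligible_iff_null_sets)

lemma AE_lebesgueE:
  assumes "AE x in lebesgue. P x"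
  obtains N where "negligible N" "\<And>x. x \<notin> N \<Longrightarrow> P x"
  using assms unfolding completion.AE_iff_null_sets negligible_iff_null_sets by auto

text \<open>The measure is complete, so functions equal almost everywhere are measurable together;
  if neither is, both integrals have the default value 0. Measurability thus never has to be checked
  when representatives are exchanged.\<close>

lemma integral_lebesgue_cong_AE:
  fixes f g :: "'a::euclidean_space \<Rightarrow> real"
  assumes "AE x in lebesgue. f x = g x"
  shows "integral\<^sup>L lebesgue f = integral\<^sup>L lebesgue g"
proof (cases "f \<in> borel_measurable lebesgue")
  case True
  then have "g \<in> borel_measurable lebesgue" using assms by (rule borel_measurable_AE)
  with True assms show ?thesis by (intro integral_cong_AE)
next
  case False
  then have "g \<notin> borel_measurable lebesgue"
    using borel_measurable_AE[of g f] assms by (auto simp: eq_commute)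
  with False have "\<not> integrable lebesgue f" "\<not> integrable lebesgue g" by auto
  then show ?thesis by (simp add: not_integrable_integral_eq)
qed

lemma set_integral_lebesgue_cong_AE:
  fixes f g :: "'a::euclidean_space \<Rightarrow> real"
  assumes "AE x in lebesgue. x \<in> S \<longrightarrow> f x = g x"
  shows "(LINT x:S|lebesgue. f x) = (LINT x:S|lebesgue. g x)"
  unfolding set_lebesgue_integral_def
  by (rule integral_lebesgue_cong_AE) (use assms in \<open>auto simp: indicator_def\<close>)

lemma L1_norm_cong_AE:
  assumes "AE x in lebesgue. x \<in> S \<longrightarrow> f x = g x"
  shows "L1_norm S f = L1_norm S g"
  unfolding L1_norm_def by (rule set_integral_lebesgue_cong_AE) (use assms in auto)

lemma absolutely_integrable_cong_AE:
  fixes f g :: "'a::euclidean_space \<Rightarrow> real"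
  assumes "AE x in lebesgue. x \<in> S \<longrightarrow> f x = g x" and "f absolutely_integrable_on S"
  shows "g absolutely_integrable_on S"
proof -
  obtain N where N: "negligible N" "\<And>x. x \<notin> N \<Longrightarrow> x \<in> S \<longrightarrow> f x = g x"
    using assms(1) by (rule AE_lebesgueE) blast
  show ?thesis
    by (rule absolutely_integrable_spike[OF assms(2) N(1)]) (use N(2) in auto)
qed

lemma L1_norm_nonneg: "L1_norm S f \<ge> 0"
  unfolding L1_norm_def set_lebesgue_integral_def by (rule Bochner_Integration.integral_nonneg) auto

lemma L1_norm_triangle:
  assumes "f absolutely_integrable_on S" "g absolutely_integrable_on S"
  shows "L1_norm S (\<lambda>x. f x + g x) \<le> L1_norm S f + L1_norm S g"
proof -
  have "L1_norm S (\<lambda>x. f x + g x) \<le> (LINT x:S|lebesgue. \<bar>f x\<bar> + \<bar>g x\<bar>)"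
    unfolding L1_norm_def using assms
    by (intro set_integral_mono set_integrable_abs set_integral_add(1)) auto
  also have "\<dots> = L1_norm S f + L1_norm S g"
    unfolding L1_norm_def using assms by (intro set_integral_add(2) set_integrable_abs)
  finally show ?thesis .
qed

lemma L1_norm_triangle_diff:
  assumes "f absolutely_integrable_on S" "g absolutely_integrable_on S" "h absolutely_integrable_on S"
  shows "L1_norm S (\<lambda>x. f x - h x) \<le> L1_norm S (\<lambda>x. f x - g x) + L1_norm S (\<lambda>x. g x - h x)"
  using L1_norm_triangle[OF set_integral_diff(1)[OF assms(1,2)] set_integral_diff(1)[OF assms(2,3)]] by simp

lemma L1_norm_minus: "L1_norm S (\<lambda>x. - f x) = L1_norm S f"
  by (simp add: L1_norm_def)

lemma L1_norm_diff_commute: "L1_norm S (\<lambda>x. f x - g x) = L1_norm S (\<lambda>x. g x - f x)"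
  by (simp add: L1_norm_def abs_minus_commute)

lemma L1_norm_cmult: "L1_norm S (\<lambda>x. c * f x) = \<bar>c\<bar> * L1_norm S f"
  by (simp add: L1_norm_def abs_mult)

text \<open>If the absolute value of \<open>f\<close> is not integrable on \<open>S\<close>, its
  norm is 0 by default, and \<open>g\<close> is nonnegative almost everywhere on
  \<open>S\<close>.\<close>

lemma L1_norm_mono_AE:
  assumes "AE x in lebesgue. x \<in> S \<longrightarrow> \<bar>f x\<bar> \<le> g x" and "g absolutely_integrable_on S"
  shows "L1_norm S f \<le> (LINT x:S|lebesgue. g x)"
proof (cases "set_integrable lebesgue S (\<lambda>x. \<bar>f x\<bar>)")
  case True
  then show ?thesis unfolding L1_norm_def using assms
    by (intro set_integral_mono_AE) auto
next
  case False
  then have "L1_norm S f = 0"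
    by (simp add: L1_norm_def set_lebesgue_integral_def set_integrable_def not_integrable_integral_eq)
  also have "0 \<le> (LINT x:S|lebesgue. g x)"
    unfolding set_lebesgue_integral_def
    by (rule integral_nonneg_AE) (use assms(1) in \<open>auto simp: indicator_def elim!: eventually_mono\<close>)
  finally show ?thesis .
qed

lemma L1_norm_le_const:
  assumes "S \<in> lmeasurable" and "AE x in lebesgue. x \<in> S \<longrightarrow> \<bar>f x\<bar> \<le> c"
  shows "L1_norm S f \<le> c * measure lebesgue S"
proof -
  have "(\<lambda>x. c) absolutely_integrable_on S"
    by (intro absolutely_integrable_on_const assms)
  moreover have "(LINT x:S|lebesgue. c) = c * measure lebesgue S"
    using assms(1) by (subst set_integral_const) (auto simp: fmeasurable_def)
  ultimately show ?thesis using L1_norm_mono_AE[OF assms(2)] by simp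
qed

lemma L1_norm_eq_integral:
  "f absolutely_integrable_on S \<Longrightarrow> L1_norm S f = integral S (\<lambda>x. \<bar>f x\<bar>)"
  unfolding L1_norm_def by (intro set_lebesgue_integral_eq_integral set_integrable_abs)

lemma set_integral_Ioo_Icc:
  fixes f :: "real \<Rightarrow> real"
  shows "(LINT x:{a<..<b}|lebesgue. f x) = (LINT x:{a..b}|lebesgue. f x)"
  by (rule set_integral_discrete_difference[where X = "{a, b}"]) auto

lemma L1_norm_Ioo_Icc: "L1_norm {a<..<b::real} f = L1_norm {a..b} f"
  unfolding L1_norm_def by (rule set_integral_Ioo_Icc)

lemma absolutely_integrable_continuous_Ioo:
  fixes f :: "real \<Rightarrow> real"
  shows "continuous_on {a..b} f \<Longrightarrow> f absolutely_integrable_on {a<..<b}"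
  using absolutely_integrable_continuous_real absolutely_integrable_on_Icc_iff_Ioo by blast

lemma C2_continuous: "C2 p \<Longrightarrow> continuous_on S p"
  unfolding C2_def using DERIV_continuous_on has_field_derivative_at_within by blast

text \<open>Three errors below \<open>e / 3\<close>: a continuous function, a polynomial near it,
  which is smooth for free, and the polynomial times a cutoff, which vanishes off the open
  interval.\<close>

lemma L1_dense_C2:
  fixes f :: "real \<Rightarrow> real"
  assumes f: "f absolutely_integrable_on {0<..<L}" and e: "e > 0" and L: "L > 0"
  shows "\<exists>p. C2 p \<and> (\<forall>x. x \<notin> {0<..<L} \<longrightarrow> p x = 0) \<and> L1_norm {0<..<L} (\<lambda>x. f x - p x) < e"
proof -
  have f': "f absolutely_integrable_on {0..L}" using f absolutely_integrable_on_Icc_iff_Ioo by blast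
  obtain g where g: "continuous_on UNIV g" "L1_norm {0..L} (\<lambda>x. f x - g x) < e / 3"
    using L1_dense_continuous[OF f', of "e / 3"] e by auto
  have gc: "continuous_on {0..L} g" using g(1) continuous_on_subset by blast
  \<comment> \<open>Over the length \<open>L\<close> this uniform error costs less than
    \<open>e / 3\<close>; \<open>L + 1\<close> in place of \<open>L\<close> makes the inequality
    strict.\<close>
  obtain q where q: "real_polynomial_function q" "\<And>x. x \<in> {0..L} \<Longrightarrow> \<bar>g x - q x\<bar> < e / (3 * (L + 1))"
    using Stone_Weierstrass_real_polynomial_function[OF compact_Icc gc, of "e / (3 * (L + 1))"] e L by auto
  have qc: "continuous_on {0..L} q" by (rule C2_continuous[OF C2_polynomial[OF q(1)]])
  have "L1_norm {0..L} (\<lambda>x. g x - q x) \<le> e / (3 * (L + 1)) * measure lebesgue {0..L}"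
    by (rule L1_norm_le_const) (use q(2) in \<open>auto intro!: AE_I2 less_imp_le\<close>)
  also have "\<dots> < e / 3" using e L by (simp add: field_simps)
  finally have gq: "L1_norm {0..L} (\<lambda>x. g x - q x) < e / 3" .
  have qi: "q absolutely_integrable_on {0<..<L}" by (rule absolutely_integrable_continuous_Ioo[OF qc])
  define p where "p = (\<lambda>n x. cutoff 0 L n x * q x)"
  have pc: "C2 (p n)" for n unfolding p_def by (intro C2_mult C2_cutoff C2_polynomial q)
  have "(\<lambda>n. \<integral>x. indicat_real {0<..<L} x * \<bar>q x - p n x\<bar> \<partial>lebesgue) \<longlonglongrightarrow> (\<integral>x. 0 \<partial>(lebesgue :: real measure))"
  proof (rule integral_dominated_convergence[where w = "\<lambda>x. indicat_real {0<..<L} x * \<bar>q x\<bar>"])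
    show "integrable lebesgue (\<lambda>x. indicat_real {0<..<L} x * \<bar>q x\<bar>)"
      using set_integrable_abs[OF qi] by (simp add: set_integrable_def)
    show "(\<lambda>x. indicat_real {0<..<L} x * \<bar>q x - p n x\<bar>) \<in> borel_measurable lebesgue" for n
      using C2_continuous[OF pc, of UNIV] C2_continuous[OF C2_polynomial[OF q(1)], of UNIV]
      by (intro borel_measurable_times borel_measurable_indicator borel_measurable_abs borel_measurable_diff
          borel_measurable_continuous_lebesgue) auto
    show "AE x in lebesgue. (\<lambda>n. indicat_real {0<..<L} x * \<bar>q x - p n x\<bar>) \<longlonglongrightarrow> 0"
    proof (intro AE_I2)
      fix x
      have "(\<lambda>n. indicat_real {0<..<L} x * \<bar>q x - p n x\<bar>) \<longlonglongrightarrow> indicat_real {0<..<L} x * \<bar>q x - indicat_real {0<..<L} x * q x\<bar>"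
        unfolding p_def by (intro tendsto_intros cutoff_tendsto)
      then show "(\<lambda>n. indicat_real {0<..<L} x * \<bar>q x - p n x\<bar>) \<longlonglongrightarrow> 0"
        by (cases "x \<in> {0<..<L}") auto
    qed
    show "AE x in lebesgue. norm (indicat_real {0<..<L} x * \<bar>q x - p n x\<bar>) \<le> indicat_real {0<..<L} x * \<bar>q x\<bar>" for n
    proof (intro AE_I2)
      fix x
      have "\<bar>q x - p n x\<bar> = \<bar>1 - cutoff 0 L n x\<bar> * \<bar>q x\<bar>"
        unfolding p_def abs_mult[symmetric] by (simp add: algebra_simps)
      also have "\<dots> \<le> 1 * \<bar>q x\<bar>"
        using cutoff_bounds[of 0 L n x] by (intro mult_right_mono) auto
      finally show "norm (indicat_real {0<..<L} x * \<bar>q x - p n x\<bar>) \<le> indicat_real {0<..<L} x * \<bar>q x\<bar>"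
        by (simp add: mult_left_mono)
    qed
  qed simp
  then have "eventually (\<lambda>n. (\<integral>x. indicat_real {0<..<L} x * \<bar>q x - p n x\<bar> \<partial>lebesgue) < e / 3) sequentially"
    using e by (intro order_tendstoD(2)[where y = 0]) auto
  then obtain n where "(\<integral>x. indicat_real {0<..<L} x * \<bar>q x - p n x\<bar> \<partial>lebesgue) < e / 3"
    using eventually_happens'[OF sequentially_bot] by blast
  then have qp: "L1_norm {0<..<L} (\<lambda>x. q x - p n x) < e / 3"
    by (simp add: L1_norm_def set_lebesgue_integral_def)
  have gi: "g absolutely_integrable_on {0<..<L}" by (rule absolutely_integrable_continuous_Ioo[OF gc])
  have pi: "p n absolutely_integrable_on {0<..<L}"
    by (rule absolutely_integrable_continuous_Ioo[OF C2_continuous[OF pc]])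
  have "L1_norm {0<..<L} (\<lambda>x. f x - p n x) < e"
    using L1_norm_triangle_diff[OF f gi pi] L1_norm_triangle_diff[OF gi qi pi] g(2) gq qp
    by (simp add: L1_norm_Ioo_Icc)
  then show ?thesis
    using pc[of n] cutoff_eq_0'[of _ 0 L n] by (intro exI[of _ "p n"]) (auto simp: p_def)
qed

section \<open>Differentiation of integrals and integration by parts\<close>

lemma lebesgue_point:
  fixes f :: "real \<Rightarrow> real"
  assumes "\<And>a b. f integrable_on {a..b}"
  obtains N where "negligible N"
    "\<And>x. x \<notin> N \<Longrightarrow> ((\<lambda>h. integral {x..x + h} f / h) \<longlongrightarrow> f x) (at_right 0)"
proof -
  obtain N where N: "negligible N" and *: "\<And>x e. \<lbrakk>x \<notin> N; 0 < e\<rbrakk> \<Longrightarrow>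
     \<exists>d>0. \<forall>h. 0 < h \<and> h < d \<longrightarrow> norm(integral (cbox x (x + h *\<^sub>R One)) f /\<^sub>R h ^ DIM(real) - f x) < e"
    using integrable_ccontinuous_explicit[of f] assms by (auto simp: cbox_interval)
  have "((\<lambda>h. integral {x..x + h} f / h) \<longlongrightarrow> f x) (at_right 0)" if x: "x \<notin> N" for x
    unfolding tendsto_iff
  proof (intro allI impI)
    fix e :: real assume "e > 0"
    then obtain d where d: "d > 0" "\<And>h. 0 < h \<Longrightarrow> h < d \<Longrightarrow> \<bar>integral {x..x + h} f / h - f x\<bar> < e"
      using *[OF x \<open>e > 0\<close>] by (auto simp: cbox_interval divide_inverse mult.commute)
    then show "eventually (\<lambda>h. dist (integral {x..x + h} f / h) (f x) < e) (at_right 0)"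
      unfolding eventually_at_right_field by (intro exI[of _ d]) (auto simp: dist_real_def)
  qed
  with N that show ?thesis by blast
qed

text \<open>At almost every point the averages over shrinking cubes converge to \<open>f x\<close>,
  and here all these averages are 0.\<close>

lemma AE_zero_of_box_integrals:
  fixes f :: "'a::euclidean_space \<Rightarrow> real"
  assumes int: "\<And>a b. f integrable_on cbox a b" and zero: "\<And>a b. integral (cbox a b) f = 0"
  shows "AE x in lebesgue. f x = 0"
proof -
  obtain N where N: "negligible N" and *: "\<And>x e. \<lbrakk>x \<notin> N; 0 < e\<rbrakk> \<Longrightarrow>
     \<exists>d>0. \<forall>h. 0 < h \<and> h < d \<longrightarrow> norm(integral (cbox x (x + h *\<^sub>R One)) f /\<^sub>R h ^ DIM('a) - f x) < e"
    by (rule integrable_ccontinuous_explicit[OF int]) (rule that)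
  have "f x = 0" if xN: "x \<notin> N" for x
  proof (rule ccontr)
    assume "f x \<noteq> 0"
    then obtain d :: real where "d > 0" and d: "\<And>h. 0 < h \<Longrightarrow> h < d \<Longrightarrow> norm (0 /\<^sub>R h ^ DIM('a) - f x) < \<bar>f x\<bar>"
      using *[OF xN, of "\<bar>f x\<bar>"] unfolding zero by (metis zero_less_abs_iff)
    then show False using d[of "d / 2"] by simp
  qed
  then show ?thesis using AE_lebesgue_not_mem[OF N] by (auto elim!: eventually_mono)
qed

lemma absolutely_integrable_imp_integrable_abs:
  fixes f :: "'a::euclidean_space \<Rightarrow> real"
  shows "f absolutely_integrable_on S \<Longrightarrow> (\<lambda>x. \<bar>f x\<bar>) integrable_on S"
  by (simp add: absolutely_integrable_on_def)

lemma continuous_on_Icc_bounded: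
  fixes \<phi> :: "real \<Rightarrow> real"
  assumes "continuous_on {a..b} \<phi>"
  obtains M where "M \<ge> 0" "\<And>x. x \<in> {a..b} \<Longrightarrow> \<bar>\<phi> x\<bar> \<le> M"
proof -
  obtain M where "\<forall>y\<in>\<phi> ` {a..b}. norm y \<le> M"
    using compact_imp_bounded[OF compact_continuous_image[OF assms compact_Icc]] unfolding bounded_iff by blast
  then show ?thesis by (intro that[of "max 0 M"]) (auto simp: max.coboundedI2)
qed

lemma absolutely_integrable_times_continuous:
  fixes g \<phi> :: "real \<Rightarrow> real"
  assumes "g absolutely_integrable_on {a..b}" "continuous_on {a..b} \<phi>"
  shows "(\<lambda>x. g x * \<phi> x) absolutely_integrable_on {a..b}"
proof -
  have "(\<lambda>x. \<phi> x * g x) absolutely_integrable_on {a..b}"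
    using assms compact_imp_bounded[OF compact_continuous_image[OF assms(2) compact_Icc]]
    by (intro absolutely_integrable_bounded_measurable_product_real continuous_imp_measurable_on_sets_lebesgue) auto
  then show ?thesis by (simp add: mult.commute)
qed

lemma integral_diff_le_L1_norm:
  fixes f g :: "real \<Rightarrow> real"
  assumes "f absolutely_integrable_on {a..b}" "g absolutely_integrable_on {a..b}" "x \<in> {a..b}"
  shows "\<bar>integral {a..x} f - integral {a..x} g\<bar> \<le> L1_norm {a..b} (\<lambda>x. f x - g x)"
proof -
  have sub: "{a..x} \<subseteq> {a..b}" using assms(3) by auto
  have i: "(\<lambda>x. f x - g x) absolutely_integrable_on {a..b}" using assms by (intro set_integral_diff)
  have fx: "f absolutely_integrable_on {a..x}" "g absolutely_integrable_on {a..x}" "(\<lambda>x. f x - g x) absolutely_integrable_on {a..x}"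
    using assms i sub by (auto intro: set_integrable_subset)
  have "integral {a..x} f - integral {a..x} g = integral {a..x} (\<lambda>x. f x - g x)"
    using fx by (intro integral_diff[symmetric] set_lebesgue_integral_eq_integral)
  also have "\<bar>\<dots>\<bar> \<le> integral {a..x} (\<lambda>x. \<bar>f x - g x\<bar>)"
    using integral_norm_bound_integral[of "\<lambda>x. f x - g x" "{a..x}" "\<lambda>x. \<bar>f x - g x\<bar>"]
      set_lebesgue_integral_eq_integral(1)[OF fx(3)] absolutely_integrable_imp_integrable_abs[OF fx(3)] by simp
  also have "\<dots> \<le> integral {a..b} (\<lambda>x. \<bar>f x - g x\<bar>)"
    by (intro integral_subset_le sub absolutely_integrable_imp_integrable_abs fx i) auto
  finally show ?thesis using L1_norm_eq_integral[OF i] by simp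
qed

text \<open>\<open>G\<close> is merely the primitive of an L1 function, so the product rule is not
  at hand. It holds for a continuous \<open>h\<close> near \<open>g\<close> in L1, whose primitive
  is uniformly near \<open>G\<close>; the error is a constant times the L1 distance.\<close>

lemma integration_by_parts_L1:
  fixes g G \<phi> \<phi>' :: "real \<Rightarrow> real"
  assumes ab: "a \<le> b" and g: "g absolutely_integrable_on {a..b}"
    and \<phi>: "\<And>x. x \<in> {a..b} \<Longrightarrow> (\<phi> has_real_derivative \<phi>' x) (at x within {a..b})"
    and \<phi>': "continuous_on {a..b} \<phi>'"
    and G: "\<And>x. x \<in> {a..b} \<Longrightarrow> G x = G a + integral {a..x} g"
  shows "integral {a..b} (\<lambda>x. g x * \<phi> x) = G b * \<phi> b - G a * \<phi> a - integral {a..b} (\<lambda>x. G x * \<phi>' x)"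
proof -
  have gi: "g integrable_on {a..b}" using g by (rule set_lebesgue_integral_eq_integral)
  have \<phi>c: "continuous_on {a..b} \<phi>" using \<phi> by (rule DERIV_continuous_on)
  obtain M where M0: "M \<ge> 0" and M: "\<And>x. x \<in> {a..b} \<Longrightarrow> \<bar>\<phi> x\<bar> \<le> M"
    by (rule continuous_on_Icc_bounded[OF \<phi>c]) (rule that)
  obtain M' where M0': "M' \<ge> 0" and M': "\<And>x. x \<in> {a..b} \<Longrightarrow> \<bar>\<phi>' x\<bar> \<le> M'"
    by (rule continuous_on_Icc_bounded[OF \<phi>']) (rule that)
  have Gc: "continuous_on {a..b} G"
  proof -
    have "continuous_on {a..b} (\<lambda>x. G a + integral {a..x} g)"
      by (intro continuous_intros indefinite_integral_continuous_1 gi)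
    then show ?thesis by (rule continuous_on_eq) (rule G[symmetric])
  qed
  \<comment> \<open>The summands bound, in units of \<open>e\<close>, the errors in the integral of
    \<open>g x * \<phi> x\<close>, in that of \<open>G x * \<phi>' x\<close> and in the boundary
    term at \<open>b\<close>; at \<open>a\<close> both primitives agree.\<close>
  define C where "C = M + M' * (b - a) + M"
  have key: "\<bar>integral {a..b} (\<lambda>x. g x * \<phi> x) - (G b * \<phi> b - G a * \<phi> a - integral {a..b} (\<lambda>x. G x * \<phi>' x))\<bar> \<le> C * e"
    if e: "e > 0" for e
  proof -
    obtain h where h: "continuous_on UNIV h" "L1_norm {a..b} (\<lambda>x. g x - h x) < e"
      using L1_dense_continuous[OF g e] by blast
    have hc: "continuous_on {a..b} h" using h(1) continuous_on_subset by blast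
    have ha: "h absolutely_integrable_on {a..b}" by (rule absolutely_integrable_continuous_real[OF hc])
    define H where "H = (\<lambda>x. G a + integral {a..x} h)"
    have H': "(H has_real_derivative h x) (at x within {a..b})" if "x \<in> {a..b}" for x
      unfolding H_def using integral_has_real_derivative[OF hc that] by (auto intro!: derivative_eq_intros)
    have Hc: "continuous_on {a..b} H" using H' by (rule DERIV_continuous_on)
    have "((\<lambda>x. h x * \<phi> x + H x * \<phi>' x) has_integral (H b * \<phi> b - H a * \<phi> a)) {a..b}"
    proof (rule fundamental_theorem_of_calculus[OF ab])
      fix x assume x: "x \<in> {a..b}"
      have "((\<lambda>x. H x * \<phi> x) has_real_derivative h x * \<phi> x + \<phi>' x * H x) (at x within {a..b})"
        by (intro DERIV_mult H' \<phi> x)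
      then show "((\<lambda>x. H x * \<phi> x) has_vector_derivative h x * \<phi> x + H x * \<phi>' x) (at x within {a..b})"
        by (simp add: has_real_derivative_iff_has_vector_derivative mult.commute)
    qed
    then have "integral {a..b} (\<lambda>x. h x * \<phi> x + H x * \<phi>' x) = H b * \<phi> b - H a * \<phi> a"
      by (rule integral_unique)
    moreover have "integral {a..b} (\<lambda>x. h x * \<phi> x + H x * \<phi>' x) = integral {a..b} (\<lambda>x. h x * \<phi> x) + integral {a..b} (\<lambda>x. H x * \<phi>' x)"
      by (intro integral_add integrable_continuous_real continuous_intros hc \<phi>c Hc \<phi>')
    ultimately have eq: "integral {a..b} (\<lambda>x. h x * \<phi> x) = H b * \<phi> b - H a * \<phi> a - integral {a..b} (\<lambda>x. H x * \<phi>' x)"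
      by linarith
    have GH: "\<bar>G x - H x\<bar> \<le> e" if "x \<in> {a..b}" for x
      using integral_diff_le_L1_norm[OF g ha that] h(2) G[OF that] by (simp add: H_def)
    have gh: "(\<lambda>x. g x - h x) absolutely_integrable_on {a..b}" by (intro set_integral_diff g ha)
    have i1: "(\<lambda>x. g x * \<phi> x) absolutely_integrable_on {a..b}" "(\<lambda>x. h x * \<phi> x) absolutely_integrable_on {a..b}"
      by (intro absolutely_integrable_times_continuous g ha \<phi>c)+
    have "integral {a..b} (\<lambda>x. g x * \<phi> x) - integral {a..b} (\<lambda>x. h x * \<phi> x) = integral {a..b} (\<lambda>x. g x * \<phi> x - h x * \<phi> x)"
      by (intro integral_diff[symmetric] set_lebesgue_integral_eq_integral i1)
    also have "\<bar>\<dots>\<bar> \<le> integral {a..b} (\<lambda>x. M * \<bar>g x - h x\<bar>)"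
    proof -
      have "norm (integral {a..b} (\<lambda>x. g x * \<phi> x - h x * \<phi> x)) \<le> integral {a..b} (\<lambda>x. M * \<bar>g x - h x\<bar>)"
      proof (rule integral_norm_bound_integral)
        show "(\<lambda>x. g x * \<phi> x - h x * \<phi> x) integrable_on {a..b}"
          using i1 by (intro integrable_diff set_lebesgue_integral_eq_integral)
        show "(\<lambda>x. M * \<bar>g x - h x\<bar>) integrable_on {a..b}"
          using integrable_on_cmult_left[OF absolutely_integrable_imp_integrable_abs[OF gh], of M] by simp
        show "norm (g x * \<phi> x - h x * \<phi> x) \<le> M * \<bar>g x - h x\<bar>" if "x \<in> {a..b}" for x
        proof -
          have "norm (g x * \<phi> x - h x * \<phi> x) = \<bar>\<phi> x\<bar> * \<bar>g x - h x\<bar>"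
            unfolding real_norm_def abs_mult[symmetric] by (simp add: algebra_simps)
          then show ?thesis using M[OF that] by (simp add: mult_right_mono)
        qed
      qed
      then show ?thesis by simp
    qed
    also have "\<dots> = M * L1_norm {a..b} (\<lambda>x. g x - h x)"
      using L1_norm_eq_integral[OF gh] by simp
    also have "\<dots> \<le> M * e" using h(2) M0 by (intro mult_left_mono) auto
    finally have b1: "\<bar>integral {a..b} (\<lambda>x. g x * \<phi> x) - integral {a..b} (\<lambda>x. h x * \<phi> x)\<bar> \<le> M * e" .
    have "integral {a..b} (\<lambda>x. G x * \<phi>' x) - integral {a..b} (\<lambda>x. H x * \<phi>' x) = integral {a..b} (\<lambda>x. (G x - H x) * \<phi>' x)"
      unfolding left_diff_distrib
      by (intro integral_diff[symmetric] integrable_continuous_real continuous_intros Gc Hc \<phi>')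
    also have "\<bar>\<dots>\<bar> \<le> (e * M') * (b - a)"
    proof -
      have "norm (integral {a..b} (\<lambda>x. (G x - H x) * \<phi>' x)) \<le> (e * M') * (b - a)"
      proof (rule integral_bound[OF ab])
        show "continuous_on {a..b} (\<lambda>x. (G x - H x) * \<phi>' x)" by (intro continuous_intros Gc Hc \<phi>')
        show "norm ((G x - H x) * \<phi>' x) \<le> e * M'" if "x \<in> {a..b}" for x
          unfolding real_norm_def abs_mult using GH[OF that] M'[OF that] by (intro mult_mono) auto
      qed
      then show ?thesis by simp
    qed
    finally have b2: "\<bar>integral {a..b} (\<lambda>x. G x * \<phi>' x) - integral {a..b} (\<lambda>x. H x * \<phi>' x)\<bar> \<le> (e * M') * (b - a)" .
    have b3: "\<bar>G b * \<phi> b - H b * \<phi> b\<bar> \<le> e * M"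
      unfolding left_diff_distrib[symmetric] abs_mult using GH[of b] M[of b] ab e by (intro mult_mono) auto
    have Ha: "H a = G a" by (simp add: H_def)
    have Ce: "C * e = M * e + (e * M') * (b - a) + e * M" by (simp add: C_def algebra_simps)
    show ?thesis using b1 b2 b3 eq[unfolded Ha] unfolding Ce by linarith
  qed
  have "C \<ge> 0" using M0 M0' ab by (simp add: C_def)
  have "\<bar>integral {a..b} (\<lambda>x. g x * \<phi> x) - (G b * \<phi> b - G a * \<phi> a - integral {a..b} (\<lambda>x. G x * \<phi>' x))\<bar> \<le> 0"
  proof (rule field_le_epsilon)
    fix e :: real assume e: "e > 0"
    have "C * (e / (C + 1)) \<le> e" using \<open>C \<ge> 0\<close> e by (simp add: field_simps)
    moreover have "e / (C + 1) > 0" using \<open>C \<ge> 0\<close> e by simp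
    ultimately show "\<bar>integral {a..b} (\<lambda>x. g x * \<phi> x) - (G b * \<phi> b - G a * \<phi> a - integral {a..b} (\<lambda>x. G x * \<phi>' x))\<bar> \<le> 0 + e"
      using key[of "e / (C + 1)"] by linarith
  qed
  then show ?thesis by simp
qed

section \<open>Weak derivatives and functions of bounded variation\<close>

text \<open>\<open>S\<close> is open relative to \<open>Q\<close>, so derivatives within
  \<open>S\<close> and within \<open>Q\<close> coincide, and extension by 0 keeps a function with
  compact support in \<open>S\<close> differentiable on \<open>Q\<close>. The whole space as
  \<open>Q\<close> handles open intervals and rectangles; the closed quadrant handles the half-open
  rectangle, whose test functions may be nonzero on the sides belonging to it.\<close>

lemma C1c_extend:
  fixes \<phi> :: "'a::euclidean_space \<Rightarrow> 'b::euclidean_space"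
  assumes "C1c S \<phi>" and "open U" and S: "S = Q \<inter> U"
    and Q: "\<And>x i e. x \<in> Q \<Longrightarrow> i \<in> Basis \<Longrightarrow> 0 < e \<Longrightarrow> \<exists>d. 0 < \<bar>d\<bar> \<and> \<bar>d\<bar> < e \<and> x + d *\<^sub>R i \<in> Q"
  shows "\<exists>\<phi>' C. compact C \<and> C \<subseteq> S \<and>
     (\<forall>x\<in>Q. ((\<lambda>x. if x \<in> S then \<phi> x else 0) has_derivative \<phi>' x) (at x within Q)) \<and>
     (\<forall>v. continuous_on Q (\<lambda>x. \<phi>' x v)) \<and>
     (\<forall>x\<in>S. (\<phi> has_derivative \<phi>' x) (at x within S)) \<and>
     (\<forall>x\<in>S - C. \<phi> x = 0) \<and> (\<forall>x. x \<notin> C \<longrightarrow> \<phi>' x = (\<lambda>_. 0))"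
proof -
  define \<phi>0 where "\<phi>0 = (\<lambda>x. if x \<in> S then \<phi> x else 0)"
  obtain \<psi> C where \<psi>: "\<And>x. x \<in> S \<Longrightarrow> (\<phi> has_derivative \<psi> x) (at x within S)"
    and \<psi>c: "\<And>v. continuous_on S (\<lambda>x. \<psi> x v)"
    and C: "compact C" "C \<subseteq> S" "\<And>x. x \<in> S - C \<Longrightarrow> \<phi> x = 0"
    using assms(1) unfolding C1c_def by blast
  define \<phi>' where "\<phi>' = (\<lambda>x. if x \<in> C then \<psi> x else (\<lambda>_. 0))"
  have oC: "open (- C)" using compact_imp_closed[OF C(1)] by (simp add: open_Compl)
  have wS: "at x within S = at x within Q" if "x \<in> S" for x
    by (rule at_within_nhd[of x U]) (use that assms in auto)
  have d0: "(\<phi>0 has_derivative (\<lambda>_. 0)) (at x within Q)" if "x \<in> Q" "x \<notin> C" for x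
  proof -
    have "((\<lambda>x. 0) has_derivative (\<lambda>_. 0)) (at x within Q)" by simp
    then show ?thesis
      by (rule has_derivative_transform_within_open[of _ _ _ _ "- C"]) (use that oC C(3) in \<open>auto simp: \<phi>0_def\<close>)
  qed
  have dS: "(\<phi>0 has_derivative \<psi> x) (at x within Q)" if "x \<in> S" for x
  proof -
    have "(\<phi> has_derivative \<psi> x) (at x within Q)" using \<psi>[OF that] wS[OF that] by simp
    then have "(\<phi>0 has_derivative \<psi> x) (at x within S)"
      unfolding wS[OF that, symmetric]
      by (rule has_derivative_transform_within[OF _ zero_less_one that]) (simp add: \<phi>0_def)
    then show ?thesis using wS[OF that] by simp
  qed
  \<comment> \<open>Derivatives within a set are unique when it has points near \<open>x\<close> in
    every coordinate direction, which is what the hypothesis on \<open>Q\<close> provides. So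
    \<open>\<psi>\<close> already vanishes on \<open>S - C\<close>, and setting the derivative to 0
    off \<open>C\<close> agrees with it.\<close>
  have \<psi>0: "\<psi> x = (\<lambda>_. 0)" if "x \<in> S - C" for x
    using frechet_derivative_unique_within[OF dS[of x] d0[of x]] that Q[of x] S by auto
  have \<phi>'S: "\<phi>' x = \<psi> x" if "x \<in> S" for x
    using \<psi>0[of x] that by (auto simp: \<phi>'_def)
  have "(\<phi>0 has_derivative \<phi>' x) (at x within Q)" if "x \<in> Q" for x
    using dS[of x] d0[of x] C(2) that by (auto simp: \<phi>'_def)
  moreover have "continuous_on Q (\<lambda>x. \<phi>' x v)" for v
    unfolding continuous_on_eq_continuous_within
  proof
    fix x assume x: "x \<in> Q"
    show "continuous (at x within Q) (\<lambda>x. \<phi>' x v)"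
    proof (cases "x \<in> S")
      case True
      have "continuous (at x within S) (\<lambda>x. \<psi> x v)"
        using \<psi>c True continuous_on_eq_continuous_within by blast
      then have "continuous (at x within S) (\<lambda>x. \<phi>' x v)"
        by (rule continuous_transform_within[OF _ zero_less_one True]) (simp add: \<phi>'S)
      then show ?thesis using wS[OF True] by simp
    next
      case False
      then have xC: "x \<in> - C" using C(2) by auto
      have "((\<lambda>x. 0) \<longlongrightarrow> \<phi>' x v) (at x within Q)" using xC by (simp add: \<phi>'_def)
      then have "((\<lambda>x. \<phi>' x v) \<longlongrightarrow> \<phi>' x v) (at x within Q)"
        by (rule Lim_transform_within_open[OF _ oC xC]) (simp add: \<phi>'_def)
      then show ?thesis by (simp add: continuous_within)
    qed
  qed
  moreover have "(\<phi> has_derivative \<phi>' x) (at x within S)" if "x \<in> S" for x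
    using \<psi> \<phi>'S that by simp
  ultimately show ?thesis
    using C unfolding \<phi>0_def by (intro exI[of _ \<phi>'] exI[of _ C]) (auto simp: \<phi>'_def)
qed

lemma C1c_real_extend:
  fixes \<phi> :: "real \<Rightarrow> real"
  assumes "C1c {a<..<b} \<phi>"
  obtains \<phi>0 \<phi>' where "\<And>x. (\<phi>0 has_real_derivative \<phi>' x) (at x)" "continuous_on UNIV \<phi>'"
    "\<And>x. x \<in> {a<..<b} \<Longrightarrow> \<phi> x = \<phi>0 x"
    "\<And>x. x \<in> {a<..<b} \<Longrightarrow> (\<phi> has_real_derivative \<phi>' x) (at x)"
    "\<And>x. x \<notin> {a<..<b} \<Longrightarrow> \<phi>0 x = 0"
proof -
  have "\<exists>d. 0 < \<bar>d\<bar> \<and> \<bar>d\<bar> < e \<and> x + d *\<^sub>R i \<in> UNIV" if "e > 0" for e x i :: real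
    using that by (intro exI[of _ "e / 2"]) auto
  then have "\<exists>\<phi>' C. compact C \<and> C \<subseteq> {a<..<b} \<and>
     (\<forall>x\<in>UNIV. ((\<lambda>x. if x \<in> {a<..<b} then \<phi> x else 0) has_derivative \<phi>' x) (at x within UNIV)) \<and>
     (\<forall>v. continuous_on UNIV (\<lambda>x. \<phi>' x v)) \<and>
     (\<forall>x\<in>{a<..<b}. (\<phi> has_derivative \<phi>' x) (at x within {a<..<b})) \<and>
     (\<forall>x\<in>{a<..<b} - C. \<phi> x = 0) \<and> (\<forall>x. x \<notin> C \<longrightarrow> \<phi>' x = (\<lambda>_. 0))"
    by (intro C1c_extend[OF assms open_greaterThanLessThan[of a b]]) auto
  then obtain \<phi>' where
     1: "\<forall>x\<in>UNIV. ((\<lambda>x. if x \<in> {a<..<b} then \<phi> x else 0) has_derivative \<phi>' x) (at x within UNIV)" and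
     2: "\<forall>v. continuous_on UNIV (\<lambda>x. \<phi>' x v)" and
     3: "\<forall>x\<in>{a<..<b}. (\<phi> has_derivative \<phi>' x) (at x within {a<..<b})"
    by (elim exE conjE) (rule that)
  note * = bspec[OF 1 UNIV_I] spec[OF 2] bspec[OF 3]
  have lin: "\<phi>' x = (*) (\<phi>' x 1)" for x
  proof
    fix h
    have "linear (\<phi>' x)" using *(1) has_derivative_linear by blast
    then show "\<phi>' x h = \<phi>' x 1 * h"
      using linear_cmul[of "\<phi>' x" h 1] by simp
  qed
  show ?thesis
  proof (rule that[of "\<lambda>x. if x \<in> {a<..<b} then \<phi> x else 0" "\<lambda>x. \<phi>' x 1"])
    show "((\<lambda>x. if x \<in> {a<..<b} then \<phi> x else 0) has_real_derivative \<phi>' x 1) (at x)" for x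
      using *(1)[of x] unfolding has_field_derivative_def lin[of x, symmetric] .
    show "(\<phi> has_real_derivative \<phi>' x 1) (at x)" if "x \<in> {a<..<b}" for x
      using *(3)[OF that] at_within_open[OF that open_greaterThanLessThan]
      unfolding has_field_derivative_def lin[of x, symmetric] by simp
  qed (use *(2) in auto)
qed

lemma C1c_realI:
  fixes \<theta> :: "real \<Rightarrow> real"
  assumes "\<And>x. x \<in> S \<Longrightarrow> (\<theta> has_real_derivative \<theta>' x) (at x)" "continuous_on S \<theta>'"
    and "compact C" "C \<subseteq> S" "\<And>x. x \<in> S - C \<Longrightarrow> \<theta> x = 0"
  shows "C1c S \<theta>"
  unfolding C1c_def
proof
  show "\<exists>\<phi>'. (\<forall>x\<in>S. (\<theta> has_derivative \<phi>' x) (at x within S)) \<and> (\<forall>v. continuous_on S (\<lambda>x. \<phi>' x v))"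
  proof (intro exI[of _ "\<lambda>x v. \<theta>' x * v"] conjI ballI allI)
    show "(\<theta> has_derivative (\<lambda>v. \<theta>' x * v)) (at x within S)" if "x \<in> S" for x
      using assms(1)[OF that] by (simp add: has_field_derivative_def has_derivative_at_withinI)
    show "continuous_on S (\<lambda>x. \<theta>' x * v)" for v by (intro continuous_intros assms)
  qed
  show "\<exists>C. compact C \<and> C \<subseteq> S \<and> (\<forall>x\<in>S - C. \<theta> x = 0)"
    using assms by (intro exI[of _ C]) auto
qed

lemma divergence_real: "(\<theta> has_real_derivative D) (at x) \<Longrightarrow> divergence \<theta> x = D"
  unfolding divergence_def has_field_derivative_def
  by (drule frechet_derivative_at) (metis (no_types, lifting) Basis_real_def inner_real_def mult_1_right sum.empty add.right_neutral sum.insert finite.emptyI empty_iff)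

text \<open>Integration by parts; the boundary terms vanish because the test function extends by 0
  past the ends.\<close>

lemma weak_deriv_AC:
  fixes G g :: "real \<Rightarrow> real"
  assumes L: "L \<ge> 0" and g: "g absolutely_integrable_on {0..L}"
    and G: "\<And>x. x \<in> {0..L} \<Longrightarrow> G x = G 0 + integral {0..x} g"
  shows "weak_deriv {0<..<L} G g"
proof -
  have "g integrable_on {0..L}" using g by (rule set_lebesgue_integral_eq_integral)
  then have "continuous_on {0..L} (\<lambda>x. G 0 + integral {0..x} g)"
    by (intro continuous_intros indefinite_integral_continuous_1)
  then have Gc: "continuous_on {0..L} G" by (rule continuous_on_eq) (rule G[symmetric])
  have "(LINT x:{0<..<L}|lebesgue. G x * deriv \<phi> x) = - (LINT x:{0<..<L}|lebesgue. g x * \<phi> x)"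
    if \<phi>: "C1c {0<..<L} \<phi>" for \<phi>
  proof -
    obtain \<phi>0 \<phi>' where *: "\<And>x. (\<phi>0 has_real_derivative \<phi>' x) (at x)" "continuous_on UNIV \<phi>'"
      "\<And>x. x \<in> {0<..<L} \<Longrightarrow> \<phi> x = \<phi>0 x"
      "\<And>x. x \<in> {0<..<L} \<Longrightarrow> (\<phi> has_real_derivative \<phi>' x) (at x)"
      "\<And>x. x \<notin> {0<..<L} \<Longrightarrow> \<phi>0 x = 0"
      by (rule C1c_real_extend[OF \<phi>]) (rule that)
    have c': "continuous_on {0..L} \<phi>'" using *(2) continuous_on_subset by blast
    have c0: "continuous_on {0..L} \<phi>0" by (rule DERIV_continuous_on) (rule has_field_derivative_at_within[OF *(1)])
    have "(LINT x:{0<..<L}|lebesgue. G x * deriv \<phi> x) = (LINT x:{0<..<L}|lebesgue. G x * \<phi>' x)"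
      by (rule set_integral_lebesgue_cong_AE) (use DERIV_imp_deriv[OF *(4)] in \<open>auto intro!: AE_I2\<close>)
    also have "\<dots> = integral {0..L} (\<lambda>x. G x * \<phi>' x)"
      unfolding set_integral_Ioo_Icc
      by (intro set_lebesgue_integral_eq_integral absolutely_integrable_continuous_real continuous_intros Gc c')
    also have "\<dots> = - integral {0..L} (\<lambda>x. g x * \<phi>0 x)"
      using integration_by_parts_L1[OF L g has_field_derivative_at_within[OF *(1)] c' G] *(5)[of 0] *(5)[of L] by simp
    also have "integral {0..L} (\<lambda>x. g x * \<phi>0 x) = (LINT x:{0<..<L}|lebesgue. g x * \<phi>0 x)"
      unfolding set_integral_Ioo_Icc
      by (intro set_lebesgue_integral_eq_integral(2)[symmetric] absolutely_integrable_times_continuous g c0)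
    also have "\<dots> = (LINT x:{0<..<L}|lebesgue. g x * \<phi> x)"
      by (rule set_integral_lebesgue_cong_AE) (use *(3) in \<open>auto intro!: AE_I2\<close>)
    finally show ?thesis .
  qed
  then show ?thesis
    unfolding weak_deriv_def
    using absolutely_integrable_continuous_Ioo[OF Gc] g absolutely_integrable_on_Icc_iff_Ioo by blast
qed

text \<open>\<open>W\<close> is the primitive of the mollifier \<open>cutoff 0 h m z / h\<close>: a
  step smoothed over the width \<open>h\<close>, of height at most 1 because the cutoff is at most
  1. Differences of its translates are C1 test functions with mollifiers as derivatives. The range
  from \<open>-L\<close> to \<open>L\<close> contains all differences of two points of the
  arc.\<close>

lemma smooth_step_kernel:
  fixes h L :: real
  assumes h: "0 < h" "h < L"
  obtains W where
    "\<And>z. z \<in> {-L<..<L} \<Longrightarrow> (W has_real_derivative cutoff 0 h m z / h) (at z)"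
    "\<And>y z. -L \<le> y \<Longrightarrow> y \<le> z \<Longrightarrow> z \<le> L \<Longrightarrow> W y \<le> W z"
    "\<And>z. z \<le> 0 \<Longrightarrow> W z = 0" "\<And>z. h \<le> z \<Longrightarrow> z \<le> L \<Longrightarrow> W z = W h" "W h \<le> 1"
proof -
  define \<eta> where "\<eta> = (\<lambda>z. cutoff 0 h m z / h)"
  have \<eta>c: "continuous_on S \<eta>" for S
    unfolding \<eta>_def using h by (intro continuous_intros C2_continuous C2_cutoff) auto
  have \<eta>0: "\<eta> z = 0" if "z \<notin> {0<..<h}" for z using cutoff_eq_0'[OF that] by (simp add: \<eta>_def)
  have \<eta>pos: "0 \<le> \<eta> z" "\<eta> z \<le> 1 / h" for z using cutoff_bounds[of 0 h m z] h by (auto simp: \<eta>_def divide_right_mono)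
  have \<eta>i: "\<eta> integrable_on {y..z}" for y z by (rule integrable_continuous_real[OF \<eta>c])
  define W where "W = (\<lambda>z. integral {-L..z} \<eta>)"
  show ?thesis
  proof (rule that[of W])
    show "(W has_real_derivative cutoff 0 h m z / h) (at z)" if "z \<in> {-L<..<L}" for z
      using integral_has_real_derivative[OF \<eta>c, of z "-L" L] that
      unfolding W_def \<eta>_def by (simp add: at_within_Icc_at)
    show "W y \<le> W z" if "-L \<le> y" "y \<le> z" "z \<le> L" for y z
      unfolding W_def using that by (intro integral_subset_le \<eta>i) (auto simp: \<eta>pos)
    show "W z = 0" if "z \<le> 0" for z
    proof -
      have "integral {-L..z} \<eta> = integral {-L..z} (\<lambda>x. 0)"
        using that by (intro integral_cong \<eta>0) auto
      then show ?thesis by (simp add: W_def)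
    qed
    show "W z = W h" if "h \<le> z" "z \<le> L" for z
    proof -
      have "(\<eta> has_integral W h) {-L..h}" unfolding W_def using \<eta>i by (rule integrable_integral)
      then have "(\<eta> has_integral W h) {-L..z}"
        by (rule has_integral_on_superset) (use that \<eta>0 h in auto)
      then show ?thesis unfolding W_def by (rule integral_unique)
    qed
    show "W h \<le> 1"
    proof -
      have "(\<eta> has_integral integral {0..h} \<eta>) {0..h}" using \<eta>i by (rule integrable_integral)
      then have "(\<eta> has_integral integral {0..h} \<eta>) {-L..h}"
        by (rule has_integral_on_superset) (use \<eta>0 h in auto)
      then have "W h = integral {0..h} \<eta>" unfolding W_def by (rule integral_unique)
      also have "\<dots> \<le> integral {0..h} (\<lambda>x. 1 / h)" by (intro integral_le \<eta>i \<eta>pos) auto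
      also have "\<dots> = 1" using h by simp
      finally show ?thesis .
    qed
  qed
qed

text \<open>Off a null set of points every variation sum is a limit of integrals against the derivatives
  of smoothed step functions.\<close>

lemma variation_le:
  fixes f :: "real \<Rightarrow> real"
  assumes f: "f absolutely_integrable_on {0<..<L}"
    and V: "\<And>\<theta>. C1c {0<..<L} \<theta> \<Longrightarrow> (\<forall>x\<in>{0<..<L}. norm (\<theta> x) \<le> 1) \<Longrightarrow>
               (LINT x:{0<..<L}|lebesgue. f x * divergence \<theta> x) \<le> V"
  shows "\<exists>N. negligible N \<and> (\<forall>(n::nat) y. (\<forall>k\<le>n. y k \<in> {0<..<L} - N) \<longrightarrow> (\<forall>k<n. y k < y (Suc k)) \<longrightarrow>
        (\<Sum>k<n. \<bar>f (y (Suc k)) - f (y k)\<bar>) \<le> V)"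
proof -
  define fh where "fh = (\<lambda>x. indicat_real {0<..<L} x * f x)"
  have fhi: "integrable lebesgue fh" using f by (simp add: set_integrable_def fh_def)
  have fhi': "set_integrable lebesgue A fh" if "A \<in> sets lebesgue" for A
    unfolding set_integrable_def by (rule integrable_mult_indicator[OF that fhi])
  have fhab: "fh integrable_on {a..b}" "(LINT x:{a..b}|lebesgue. fh x) = integral {a..b} fh" for a b
    by (intro set_lebesgue_integral_eq_integral fhi'; simp)+
  obtain N where N: "negligible N"
    and pt: "\<And>x. x \<notin> N \<Longrightarrow> ((\<lambda>h. integral {x..x + h} fh / h) \<longlongrightarrow> fh x) (at_right 0)"
    by (rule lebesgue_point[OF fhab(1)]) (rule that)
  define A where "A = (\<lambda>h x. integral {x..x + h} fh / h)"
  have main: "(\<Sum>k<n. \<bar>f (y (Suc k)) - f (y k)\<bar>) \<le> V"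
    if y: "\<And>k. k \<le> n \<Longrightarrow> y k \<in> {0<..<L} - N" and yi: "\<And>k. k < n \<Longrightarrow> y k < y (Suc k)" for n :: nat and y
  proof -
    have ymono: "y i \<le> y j" if "i \<le> j" "j \<le> n" for i j
      using that
    proof (induction j rule: dec_induct)
      case (step k)
      then show ?case using yi[of k] by auto
    qed simp
    have yb: "0 < y k" "y k < L" if "k \<le> n" for k using y[OF that] by auto
    have Vh: "(\<Sum>k<n. \<bar>A h (y (Suc k)) - A h (y k)\<bar>) \<le> V" if h: "0 < h" "y n + h < L" for h
    proof -
      have hL: "h < L" using h yb[of 0] yb[of n] by linarith
      \<comment> \<open>The signs turn the sum of absolute values into a linear expression, which a
        single test function can represent.\<close>
      define \<sigma> where "\<sigma> = (\<lambda>k. sgn (A h (y (Suc k)) - A h (y k)))"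
      \<comment> \<open>The mean \<open>A h x\<close> with its indicator smoothed; the exact mean
        would need a test function with a jumping derivative. The limits are taken in the order
        \<open>m\<close> to infinity, then \<open>h\<close> to 0 at Lebesgue points.\<close>
      define B where "B = (\<lambda>m x. \<integral>s. fh s * (cutoff 0 h m (s - x) / h) \<partial>lebesgue)"
      have cutm: "(\<lambda>s. cutoff 0 h m (s - x) / h) \<in> borel_measurable lebesgue" for m x
        using h by (intro borel_measurable_continuous_lebesgue continuous_intros
            continuous_on_compose2[OF C2_continuous[OF C2_cutoff, of UNIV]]) auto
      have cutb: "0 \<le> cutoff 0 h m (s - x) / h" "cutoff 0 h m (s - x) / h \<le> 1 / h" for m s x
        using cutoff_bounds[of 0 h m "s - x"] h by (auto simp: divide_right_mono)
      have dom: "norm (fh s * (cutoff 0 h m (s - x) / h)) \<le> 1 / h * \<bar>fh s\<bar>" for s m x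
      proof -
        have "\<bar>fh s\<bar> * (cutoff 0 h m (s - x) / h) \<le> \<bar>fh s\<bar> * (1 / h)"
          by (intro mult_left_mono cutb) simp
        then show ?thesis unfolding real_norm_def abs_mult abs_of_nonneg[OF cutb(1)] by (simp only: mult.commute)
      qed
      have wi: "integrable lebesgue (\<lambda>s. 1 / h * \<bar>fh s\<bar>)" using fhi by (intro integrable_mult_right integrable_abs)
      have Bi: "integrable lebesgue (\<lambda>s. fh s * (cutoff 0 h m (s - x) / h))" for m x
      proof (rule Bochner_Integration.integrable_bound[OF wi])
        show "(\<lambda>s. fh s * (cutoff 0 h m (s - x) / h)) \<in> borel_measurable lebesgue"
          by (rule borel_measurable_times[OF borel_measurable_integrable[OF fhi] cutm])
        show "AE s in lebesgue. norm (fh s * (cutoff 0 h m (s - x) / h)) \<le> norm (1 / h * \<bar>fh s\<bar>)"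
          using order_trans[OF dom abs_ge_self] by (intro AE_I2) (simp only: real_norm_def)
      qed
      have Bconv: "(\<lambda>m. B m x) \<longlonglongrightarrow> A h x" for x
      proof -
        have lim: "(\<lambda>m. B m x) \<longlonglongrightarrow> (\<integral>s. fh s * (indicat_real {0<..<h} (s - x) / h) \<partial>lebesgue)"
          unfolding B_def
        proof (rule integral_dominated_convergence[OF _ _ wi])
          show "(\<lambda>s. fh s * (cutoff 0 h m (s - x) / h)) \<in> borel_measurable lebesgue" for m
            using Bi by (rule borel_measurable_integrable)
          have "(\<lambda>s. fh s * (indicat_real {x<..<x + h} s / h)) \<in> borel_measurable lebesgue"
            using fhi by (intro borel_measurable_times borel_measurable_divide borel_measurable_indicator) auto
          moreover have "indicat_real {x<..<x + h} s = indicat_real {0<..<h} (s - x)" for s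
            by (auto simp: indicator_def)
          ultimately show "(\<lambda>s. fh s * (indicat_real {0<..<h} (s - x) / h)) \<in> borel_measurable lebesgue"
            by simp
          show "AE s in lebesgue. (\<lambda>m. fh s * (cutoff 0 h m (s - x) / h)) \<longlonglongrightarrow> fh s * (indicat_real {0<..<h} (s - x) / h)"
            using h by (intro AE_I2 tendsto_intros cutoff_tendsto) auto
          show "AE s in lebesgue. norm (fh s * (cutoff 0 h m (s - x) / h)) \<le> 1 / h * \<bar>fh s\<bar>" for m
            using dom by (intro AE_I2)
        qed
        have e1: "(\<integral>s. fh s * (indicat_real {0<..<h} (s - x) / h) \<partial>lebesgue) = (LINT s:{x<..<x + h}|lebesgue. fh s / h)"
          unfolding set_lebesgue_integral_def by (intro Bochner_Integration.integral_cong) (auto simp: indicator_def)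
        have e2: "(LINT s:{x<..<x + h}|lebesgue. fh s / h) = A h x"
          using fhab(2)[of x "x + h"] unfolding A_def by (simp add: set_integral_Ioo_Icc)
        show ?thesis using lim unfolding e1 e2 .
      qed
      have "(\<Sum>k<n. \<sigma> k * (B m (y (Suc k)) - B m (y k))) \<le> V" for m
      proof -
        obtain W where W: "\<And>z. z \<in> {-L<..<L} \<Longrightarrow> (W has_real_derivative cutoff 0 h m z / h) (at z)"
          "\<And>y z. -L \<le> y \<Longrightarrow> y \<le> z \<Longrightarrow> z \<le> L \<Longrightarrow> W y \<le> W z"
          "\<And>z. z \<le> 0 \<Longrightarrow> W z = 0" "\<And>z. h \<le> z \<Longrightarrow> z \<le> L \<Longrightarrow> W z = W h" "W h \<le> 1"
          by (rule smooth_step_kernel[OF h(1) hL, of m]) (rule that)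
        \<comment> \<open>The functions \<open>W (s - y k) - W (s - y (Suc k))\<close> are
          nonnegative and their sum telescopes to at most 1, so coefficients of modulus at most 1
          keep \<open>\<theta>\<close> within the bound. Its derivative reproduces the differences
          of \<open>B m\<close>.\<close>
        define \<theta> where "\<theta> = (\<lambda>s. \<Sum>k<n. \<sigma> k * (W (s - y (Suc k)) - W (s - y k)))"
        define \<theta>' where "\<theta>' = (\<lambda>s. \<Sum>k<n. \<sigma> k * (cutoff 0 h m (s - y (Suc k)) / h - cutoff 0 h m (s - y k) / h))"
        have Wd: "((\<lambda>s. W (s - y k)) has_real_derivative cutoff 0 h m (s - y k) / h) (at s)"
          if "s \<in> {0<..<L}" "k \<le> n" for s k
        proof -
          have "((\<lambda>s. s - y k) has_real_derivative 1) (at s)" by (auto intro!: derivative_eq_intros)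
          moreover have "s - y k \<in> {-L<..<L}" using that yb[OF that(2)] by auto
          ultimately show ?thesis using DERIV_chain2[OF W(1)] by fastforce
        qed
        have \<theta>d: "(\<theta> has_real_derivative \<theta>' s) (at s)" if "s \<in> {0<..<L}" for s
          unfolding \<theta>_def \<theta>'_def using that by (intro DERIV_sum DERIV_cmult DERIV_diff Wd) auto
        have \<theta>c: "continuous_on {0<..<L} \<theta>'"
          unfolding \<theta>'_def using h by (intro continuous_intros
            continuous_on_compose2[OF C2_continuous[OF C2_cutoff, of UNIV]]) auto
        have C1: "C1c {0<..<L} \<theta>"
        proof (rule C1c_realI[OF \<theta>d \<theta>c])
          show "compact {y 0..y n + h}" by simp
          show "{y 0..y n + h} \<subseteq> {0<..<L}" using yb[of 0] h by auto
          show "\<theta> s = 0" if s: "s \<in> {0<..<L} - {y 0..y n + h}" for s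
          proof -
            have "W (s - y (Suc k)) = W (s - y k)" if k: "k < n" for k
            proof (cases "s < y 0")
              case True
              then have "s - y k \<le> 0" "s - y (Suc k) \<le> 0"
                using ymono[of 0 k] ymono[of 0 "Suc k"] k by auto
              then show ?thesis using W(3) by simp
            next
              case False
              then have "s > y n + h" using s by auto
              then have "s - y k \<ge> h" "s - y (Suc k) \<ge> h" "s - y k \<le> L" "s - y (Suc k) \<le> L"
                using ymono[of k n] ymono[of "Suc k" n] k s yb[of k] yb[of "Suc k"] by auto
              then have "W (s - y k) = W h" "W (s - y (Suc k)) = W h" by (auto intro: W(4))
              then show ?thesis by simp
            qed
            then show ?thesis by (simp add: \<theta>_def)
          qed
        qed
        have \<theta>b: "norm (\<theta> s) \<le> 1" if s: "s \<in> {0<..<L}" for s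
        proof -
          have "norm (\<theta> s) \<le> (\<Sum>k<n. \<bar>\<sigma> k * (W (s - y (Suc k)) - W (s - y k))\<bar>)"
            unfolding \<theta>_def real_norm_def by (rule sum_abs)
          also have "\<dots> \<le> (\<Sum>k<n. W (s - y k) - W (s - y (Suc k)))"
          proof (rule sum_mono)
            fix k assume "k \<in> {..<n}"
            then have k: "k < n" by simp
            have "W (s - y (Suc k)) \<le> W (s - y k)"
              using yi[OF k] yb[of k] yb[of "Suc k"] k s by (intro W(2)) auto
            moreover have "\<bar>\<sigma> k\<bar> \<le> 1" by (simp add: \<sigma>_def abs_sgn_eq)
            ultimately show "\<bar>\<sigma> k * (W (s - y (Suc k)) - W (s - y k))\<bar> \<le> W (s - y k) - W (s - y (Suc k))"
              unfolding abs_mult using mult_right_mono[of "\<bar>\<sigma> k\<bar>" 1 "\<bar>W (s - y (Suc k)) - W (s - y k)\<bar>"] by simp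
          qed
          also have "\<dots> = W (s - y 0) - W (s - y n)"
            using sum_lessThan_telescope'[of "\<lambda>k. W (s - y k)" n] by simp
          also have "\<dots> \<le> 1"
          proof -
            have "W (-L) \<le> W (s - y n)" using s yb[of n] by (intro W(2)) auto
            moreover have "W (-L) = 0" using h hL by (intro W(3)) auto
            moreover have "W (s - y 0) \<le> W L" using s yb[of 0] by (intro W(2)) auto
            moreover have "W L = W h" using hL by (intro W(4)) auto
            ultimately show ?thesis using W(5) by linarith
          qed
          finally show ?thesis .
        qed
        have "(\<Sum>k<n. \<sigma> k * (B m (y (Suc k)) - B m (y k)))
          = (\<integral>s. (\<Sum>k<n. \<sigma> k * (fh s * (cutoff 0 h m (s - y (Suc k)) / h) - fh s * (cutoff 0 h m (s - y k) / h))) \<partial>lebesgue)"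
          unfolding B_def using Bi by (subst Bochner_Integration.integral_sum) auto
        also have "\<dots> = (\<integral>s. fh s * \<theta>' s \<partial>lebesgue)"
          unfolding \<theta>'_def sum_distrib_left by (intro Bochner_Integration.integral_cong refl sum.cong) (simp add: algebra_simps)
        also have "\<dots> = (LINT x:{0<..<L}|lebesgue. f x * divergence \<theta> x)"
          unfolding set_lebesgue_integral_def fh_def
          by (intro Bochner_Integration.integral_cong) (auto simp: indicator_def divergence_real[OF \<theta>d])
        also have "\<dots> \<le> V" using V[OF C1] \<theta>b by blast
        finally show ?thesis .
      qed
      moreover have "(\<lambda>m. \<Sum>k<n. \<sigma> k * (B m (y (Suc k)) - B m (y k))) \<longlonglongrightarrow> (\<Sum>k<n. \<sigma> k * (A h (y (Suc k)) - A h (y k)))"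
        by (intro tendsto_intros Bconv)
      ultimately have "(\<Sum>k<n. \<sigma> k * (A h (y (Suc k)) - A h (y k))) \<le> V"
        by (intro LIMSEQ_le_const2) auto
      then show ?thesis unfolding \<sigma>_def by (simp add: sgn_mult_self_eq mult.commute[of "sgn _"] flip: abs_sgn)
    qed
    have lim: "((\<lambda>h. \<Sum>k<n. \<bar>A h (y (Suc k)) - A h (y k)\<bar>) \<longlongrightarrow> (\<Sum>k<n. \<bar>fh (y (Suc k)) - fh (y k)\<bar>)) (at_right 0)"
      unfolding A_def using y by (intro tendsto_intros pt) auto
    have "eventually (\<lambda>h. (\<Sum>k<n. \<bar>A h (y (Suc k)) - A h (y k)\<bar>) \<le> V) (at_right 0)"
      unfolding eventually_at_right_field using Vh yb[of n] by (intro exI[of _ "L - y n"]) auto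
    then have "(\<Sum>k<n. \<bar>fh (y (Suc k)) - fh (y k)\<bar>) \<le> V"
      by (intro tendsto_upperbound[OF lim]) auto
    moreover have "fh (y k) = f (y k)" if "k \<le> n" for k using yb[OF that] by (simp add: fh_def)
    ultimately show ?thesis by simp
  qed
  show ?thesis
    by (intro exI[of _ N] conjI N allI impI main) auto
qed

text \<open>\<open>f\<close> minus the primitive of \<open>g\<close> has weak derivative 0, so its
  variation sums are at most 0; \<open>variation_le\<close> with this bound makes it constant off a
  null set.\<close>

lemma weak_deriv_imp_AC:
  assumes w: "weak_deriv {0<..<L} f g" and L: "L > 0"
  shows "\<exists>c. AE x in lebesgue. x \<in> {0<..<L} \<longrightarrow> f x = c + integral {0..x} g"
proof -
  have f: "f absolutely_integrable_on {0<..<L}" and g: "g absolutely_integrable_on {0<..<L}"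
    and wf: "\<And>\<phi>. C1c {0<..<L} \<phi> \<Longrightarrow> (LINT x:{0<..<L}|lebesgue. f x * deriv \<phi> x) = - (LINT x:{0<..<L}|lebesgue. g x * \<phi> x)"
    using w unfolding weak_deriv_def by auto
  have g': "g absolutely_integrable_on {0..L}" using g absolutely_integrable_on_Icc_iff_Ioo by blast
  define G where "G = (\<lambda>x. integral {0..x} g)"
  have wG: "weak_deriv {0<..<L} G g"
    by (rule weak_deriv_AC[OF _ g']) (use L in \<open>auto simp: G_def\<close>)
  then have G: "G absolutely_integrable_on {0<..<L}"
    and wG: "\<And>\<phi>. C1c {0<..<L} \<phi> \<Longrightarrow> (LINT x:{0<..<L}|lebesgue. G x * deriv \<phi> x) = - (LINT x:{0<..<L}|lebesgue. g x * \<phi> x)"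
    unfolding weak_deriv_def by auto
  define d where "d = (\<lambda>x. f x - G x)"
  have di: "d absolutely_integrable_on {0<..<L}" unfolding d_def by (intro set_integral_diff f G)
  have dz: "(LINT x:{0<..<L}|lebesgue. d x * divergence \<theta> x) \<le> 0"
    if \<theta>: "C1c {0<..<L} \<theta>" and "\<forall>x\<in>{0<..<L}. norm (\<theta> x) \<le> 1" for \<theta>
  proof -
    obtain \<phi>0 \<phi>' where *: "\<And>x. (\<phi>0 has_real_derivative \<phi>' x) (at x)" "continuous_on UNIV \<phi>'"
      "\<And>x. x \<in> {0<..<L} \<Longrightarrow> (\<theta> has_real_derivative \<phi>' x) (at x)"
      by (rule C1c_real_extend[OF \<theta>]) (rule that)
    have c': "continuous_on {0..L} \<phi>'" using *(2) continuous_on_subset by blast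
    have int: "(\<lambda>x. u x * \<phi>' x) absolutely_integrable_on {0<..<L}" if "u absolutely_integrable_on {0<..<L}" for u
      using absolutely_integrable_times_continuous[OF _ c', of u] that absolutely_integrable_on_Icc_iff_Ioo by blast
    have "(LINT x:{0<..<L}|lebesgue. d x * divergence \<theta> x) = (LINT x:{0<..<L}|lebesgue. f x * \<phi>' x - G x * \<phi>' x)"
      by (rule set_integral_lebesgue_cong_AE) (use divergence_real[OF *(3)] in \<open>auto intro!: AE_I2 simp: d_def left_diff_distrib\<close>)
    also have "\<dots> = (LINT x:{0<..<L}|lebesgue. f x * \<phi>' x) - (LINT x:{0<..<L}|lebesgue. G x * \<phi>' x)"
      by (intro set_integral_diff int f G)
    also have "(LINT x:{0<..<L}|lebesgue. f x * \<phi>' x) = (LINT x:{0<..<L}|lebesgue. f x * deriv \<theta> x)"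
      by (rule set_integral_lebesgue_cong_AE) (use DERIV_imp_deriv[OF *(3)] in \<open>auto intro!: AE_I2\<close>)
    also have "(LINT x:{0<..<L}|lebesgue. G x * \<phi>' x) = (LINT x:{0<..<L}|lebesgue. G x * deriv \<theta> x)"
      by (rule set_integral_lebesgue_cong_AE) (use DERIV_imp_deriv[OF *(3)] in \<open>auto intro!: AE_I2\<close>)
    finally show ?thesis using wf[OF \<theta>] wG[OF \<theta>] by simp
  qed
  obtain N where N: "negligible N" and var: "\<forall>(n::nat) y. (\<forall>k\<le>n. y k \<in> {0<..<L} - N) \<longrightarrow> (\<forall>k<n. y k < y (Suc k)) \<longrightarrow>
        (\<Sum>k<n. \<bar>d (y (Suc k)) - d (y k)\<bar>) \<le> 0"
  proof -
    have "\<exists>N. negligible N \<and> (\<forall>(n::nat) y. (\<forall>k\<le>n. y k \<in> {0<..<L} - N) \<longrightarrow> (\<forall>k<n. y k < y (Suc k)) \<longrightarrow>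
        (\<Sum>k<n. \<bar>d (y (Suc k)) - d (y k)\<bar>) \<le> 0)"
      by (rule variation_le[OF di]) (rule dz)
    then show ?thesis by (elim exE conjE) (rule that)
  qed
  have lt: "d x = d y" if "x \<in> {0<..<L} - N" "y \<in> {0<..<L} - N" "x < y" for x y
    using var[rule_format, of 1 "\<lambda>k. if k = 0 then x else y"] that by auto
  have "\<not> negligible {0<..<L}" using L by (simp add: open_not_negligible)
  then have "\<not> {0<..<L} \<subseteq> N" using N negligible_subset by blast
  then obtain z where z: "z \<in> {0<..<L} - N" by blast
  have "f x = d z + integral {0..x} g" if "x \<in> {0<..<L} - N" for x
  proof -
    have "d x = d z" using lt[of x z] lt[of z x] z that by (cases x z rule: linorder_cases) auto
    then show ?thesis unfolding d_def G_def by linarith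
  qed
  then have "AE x in lebesgue. x \<in> {0<..<L} \<longrightarrow> f x = d z + integral {0..x} g"
    using AE_lebesgue_not_mem[OF N] by (auto elim!: eventually_mono)
  then show ?thesis by blast
qed

lemma C1c_cutoff:
  assumes "a0 \<le> a" "b \<le> b0"
  shows "C1c {a0<..<b0} (cutoff a b m)"
proof -
  obtain p' p'' where p: "\<forall>x. (cutoff a b m has_real_derivative p' x) (at x)"
     "\<forall>x. (p' has_real_derivative p'' x) (at x)"
    using C2_cutoff[of a b m] unfolding C2_def by (elim exE conjE) (rule that)
  have pc: "continuous_on {a0<..<b0} p'"
    by (rule DERIV_continuous_on) (rule has_field_derivative_at_within[OF spec[OF p(2)]])
  define q where "q = 1 / real (Suc m)"
  have "q > 0" by (simp add: q_def)
  then have sub: "{a + 1 / Suc m..b - 1 / Suc m} \<subseteq> {a0<..<b0}" unfolding q_def[symmetric] using assms by auto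
  show ?thesis
  proof (rule C1c_realI[OF spec[OF p(1)] pc compact_Icc sub])
    show "cutoff a b m x = 0" if "x \<in> {a0<..<b0} - {a + 1 / real (Suc m)..b - 1 / real (Suc m)}" for x
      by (rule cutoff_eq_0) (use that in auto)
  qed
qed

text \<open>Cutoffs tend boundedly to indicators of intervals, so all interval integrals vanish.
  Cutoffs are used because, with ends in the arc, they are themselves test functions.\<close>

lemma AE_zero_of_cutoff:
  assumes d: "d absolutely_integrable_on {0<..<L}"
    and zero: "\<And>a b m. 0 \<le> a \<Longrightarrow> b \<le> L \<Longrightarrow> (LINT x:{0<..<L}|lebesgue. d x * cutoff a b m x) = 0"
  shows "AE x in lebesgue. x \<in> {0<..<L} \<longrightarrow> d x = 0"
proof -
  define dh where "dh = (\<lambda>x. indicat_real {0<..<L} x * d x)"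
  have dhi: "integrable lebesgue dh" using d by (simp add: set_integrable_def dh_def)
  have dhi': "set_integrable lebesgue A dh" if "A \<in> sets lebesgue" for A
    unfolding set_integrable_def by (rule integrable_mult_indicator[OF that dhi])
  have dhab: "dh integrable_on {a..b}" "(LINT x:{a..b}|lebesgue. dh x) = integral {a..b} dh" for a b
    by (intro set_lebesgue_integral_eq_integral dhi'; simp)+
  have "integral {a..b} dh = 0" for a b
  proof -
    define a' b' where "a' = max a 0" and "b' = min b L"
    have ab': "0 \<le> a'" "b' \<le> L" by (auto simp: a'_def b'_def)
    have lim: "(\<lambda>m. \<integral>x. dh x * cutoff a' b' m x \<partial>lebesgue) \<longlonglongrightarrow> (\<integral>x. dh x * indicat_real {a'<..<b'} x \<partial>lebesgue)"
    proof (rule integral_dominated_convergence[where w = "\<lambda>x. \<bar>dh x\<bar>"])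
      show "integrable lebesgue (\<lambda>x. \<bar>dh x\<bar>)" using dhi by (rule integrable_abs)
      show "(\<lambda>x. dh x * cutoff a' b' m x) \<in> borel_measurable lebesgue" for m
        by (rule borel_measurable_times[OF borel_measurable_integrable[OF dhi]
              borel_measurable_continuous_lebesgue[OF C2_continuous[OF C2_cutoff]]])
      show "(\<lambda>x. dh x * indicat_real {a'<..<b'} x) \<in> borel_measurable lebesgue"
        using dhi by (intro borel_measurable_times borel_measurable_indicator) auto
      show "AE x in lebesgue. (\<lambda>m. dh x * cutoff a' b' m x) \<longlonglongrightarrow> dh x * indicat_real {a'<..<b'} x"
        by (intro AE_I2 tendsto_intros cutoff_tendsto)
      show "AE x in lebesgue. norm (dh x * cutoff a' b' m x) \<le> \<bar>dh x\<bar>" for m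
        using cutoff_bounds[of a' b' m] by (intro AE_I2) (auto simp: abs_mult intro: mult_left_le)
    qed
    have z: "(\<integral>x. dh x * cutoff a' b' m x \<partial>lebesgue) = 0" for m
    proof -
      have "(\<integral>x. dh x * cutoff a' b' m x \<partial>lebesgue) = (LINT x:{0<..<L}|lebesgue. d x * cutoff a' b' m x)"
        unfolding set_lebesgue_integral_def dh_def by (intro Bochner_Integration.integral_cong refl) simp
      then show ?thesis using zero[OF ab'] by simp
    qed
    have "(\<lambda>m. 0) \<longlonglongrightarrow> (\<integral>x. dh x * indicat_real {a'<..<b'} x \<partial>lebesgue)" using lim unfolding z .
    then have 0: "(\<integral>x. dh x * indicat_real {a'<..<b'} x \<partial>lebesgue) = 0"
      using LIMSEQ_unique tendsto_const by blast
    have "integral {a..b} dh = (LINT x:{a<..<b}|lebesgue. dh x)"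
      unfolding dhab(2)[symmetric] set_integral_Ioo_Icc ..
    also have "\<dots> = (\<integral>x. dh x * indicat_real {a'<..<b'} x \<partial>lebesgue)"
      unfolding set_lebesgue_integral_def dh_def a'_def b'_def
      by (intro Bochner_Integration.integral_cong refl) (auto simp: indicator_def)
    finally show ?thesis using 0 by simp
  qed
  then have "AE x in lebesgue. dh x = 0"
    using dhab(1) by (intro AE_zero_of_box_integrals) (auto simp: cbox_interval)
  then show ?thesis by eventually_elim (auto simp: dh_def)
qed

lemma weak_deriv_unique:
  assumes "weak_deriv {0<..<L} f g" "weak_deriv {0<..<L} f g'"
  shows "AE x in lebesgue. x \<in> {0<..<L} \<longrightarrow> g x = g' x"
proof -
  have gi: "g absolutely_integrable_on {0<..<L}" "g' absolutely_integrable_on {0<..<L}"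
    using assms unfolding weak_deriv_def by auto
  have "AE x in lebesgue. x \<in> {0<..<L} \<longrightarrow> g x - g' x = 0"
  proof (rule AE_zero_of_cutoff)
    show "(\<lambda>x. g x - g' x) absolutely_integrable_on {0<..<L}" by (intro set_integral_diff gi)
    fix a b :: real and m assume ab: "0 \<le> a" "b \<le> L"
    have c: "continuous_on {0..L} (cutoff a b m)" by (rule C2_continuous[OF C2_cutoff])
    have int: "(\<lambda>x. u x * cutoff a b m x) absolutely_integrable_on {0<..<L}" if "u absolutely_integrable_on {0<..<L}" for u
      using absolutely_integrable_times_continuous[OF _ c, of u] that absolutely_integrable_on_Icc_iff_Ioo by blast
    have "(LINT x:{0<..<L}|lebesgue. (g x - g' x) * cutoff a b m x)
      = (LINT x:{0<..<L}|lebesgue. g x * cutoff a b m x) - (LINT x:{0<..<L}|lebesgue. g' x * cutoff a b m x)"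
      unfolding left_diff_distrib by (intro set_integral_diff int gi)
    also have "\<dots> = 0"
      using assms C1c_cutoff[OF ab, of m] unfolding weak_deriv_def by fastforce
    finally show "(LINT x:{0<..<L}|lebesgue. (g x - g' x) * cutoff a b m x) = 0" .
  qed
  then show ?thesis by eventually_elim auto
qed

section \<open>Continuously differentiable representatives\<close>

lemma weak_deriv_cong_AE:
  assumes "weak_deriv S f h" "AE x in lebesgue. x \<in> S \<longrightarrow> f x = g x"
  shows "weak_deriv S g h"
proof -
  have "(LINT x:S|lebesgue. g x * deriv \<phi> x) = (LINT x:S|lebesgue. f x * deriv \<phi> x)" for \<phi>
    by (rule set_integral_lebesgue_cong_AE) (use assms(2) in \<open>auto elim!: eventually_mono\<close>)
  then show ?thesis
    using assms absolutely_integrable_cong_AE[OF assms(2)] unfolding weak_deriv_def by auto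
qed

lemma weak_deriv_Dx: "weak_deriv S f g \<Longrightarrow> weak_deriv S f (Dx S f)"
  unfolding Dx_def by (rule someI[where P = "weak_deriv S f"])

text \<open>\<open>Dx\<close> selects some representative of each weak derivative, so the statement
  refers to exactly the selected functions. \<open>F\<close> is a C1 representative of
  \<open>f\<close>, \<open>Y\<close> the derivative of \<open>F\<close>, and \<open>Y\<close> is a
  primitive of the selected second derivative. In this form the equation, the node condition and the
  boundary traces can be used together.\<close>

lemma W21_representative:
  assumes W: "W21 {0<..<L} f" and L: "L > 0"
  shows "\<exists>F Y. (\<forall>x\<in>{0..L}. (F has_real_derivative Y x) (at x within {0..L})) \<and>
    continuous_on {0..L} Y \<and>
    (\<forall>x\<in>{0..L}. Y x = Y 0 + integral {0..x} (Dx {0<..<L} (Dx {0<..<L} f))) \<and>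
    Dx {0<..<L} (Dx {0<..<L} f) absolutely_integrable_on {0..L} \<and>
    f absolutely_integrable_on {0<..<L} \<and> Dx {0<..<L} f absolutely_integrable_on {0<..<L} \<and>
    (AE x in lebesgue. x \<in> {0<..<L} \<longrightarrow> f x = F x) \<and>
    (AE x in lebesgue. x \<in> {0<..<L} \<longrightarrow> Dx {0<..<L} f x = Y x)"
proof -
  obtain g h where gh: "weak_deriv {0<..<L} f g" "weak_deriv {0<..<L} g h"
    using W unfolding W21_def by blast
  define D H where "D = Dx {0<..<L} f" and "H = Dx {0<..<L} D"
  have wD: "weak_deriv {0<..<L} f D" unfolding D_def by (rule weak_deriv_Dx[OF gh(1)])
  \<comment> \<open>The weak derivative at hand is one of the witness \<open>g\<close>; it passes to
    \<open>D\<close>, which equals \<open>g\<close> almost everywhere.\<close>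
  have wH: "weak_deriv {0<..<L} D H"
    unfolding H_def by (rule weak_deriv_Dx[OF weak_deriv_cong_AE[OF gh(2) weak_deriv_unique[OF gh(1) wD]]])
  have int: "f absolutely_integrable_on {0<..<L}" "D absolutely_integrable_on {0<..<L}" "H absolutely_integrable_on {0<..<L}"
    using wD wH unfolding weak_deriv_def by auto
  have H': "H absolutely_integrable_on {0..L}" using int(3) absolutely_integrable_on_Icc_iff_Ioo by blast
  obtain c1 where c1: "AE x in lebesgue. x \<in> {0<..<L} \<longrightarrow> D x = c1 + integral {0..x} H"
    using weak_deriv_imp_AC[OF wH L] by blast
  obtain c0 where c0: "AE x in lebesgue. x \<in> {0<..<L} \<longrightarrow> f x = c0 + integral {0..x} D"
    using weak_deriv_imp_AC[OF wD L] by blast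
  define Y where "Y = (\<lambda>x. c1 + integral {0..x} H)"
  define F where "F = (\<lambda>x. c0 + integral {0..x} Y)"
  have Yc: "continuous_on {0..L} Y"
    unfolding Y_def by (intro continuous_intros indefinite_integral_continuous_1 set_lebesgue_integral_eq_integral H')
  have F': "(F has_real_derivative Y x) (at x within {0..L})" if "x \<in> {0..L}" for x
    unfolding F_def using integral_has_real_derivative[OF Yc that] by (auto intro!: derivative_eq_intros)
  have aY: "AE x in lebesgue. x \<in> {0<..<L} \<longrightarrow> D x = Y x" using c1 unfolding Y_def .
  then obtain N where N: "negligible N" "\<And>x. x \<notin> N \<Longrightarrow> x \<in> {0<..<L} \<longrightarrow> D x = Y x"
    by (rule AE_lebesgueE) blast
  have eq: "integral {0..x} D = integral {0..x} Y" if "x \<in> {0..L}" for x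
    by (rule integral_spike[of "N \<union> {0, L}"]) (use N that in auto)
  have aF: "AE x in lebesgue. x \<in> {0<..<L} \<longrightarrow> f x = F x"
    using c0 unfolding F_def by eventually_elim (use eq in auto)
  have Y0: "\<forall>x\<in>{0..L}. Y x = Y 0 + integral {0..x} H" by (simp add: Y_def)
  have F'': "\<forall>x\<in>{0..L}. (F has_real_derivative Y x) (at x within {0..L})" using F' by blast
  show ?thesis
    unfolding D_def[symmetric] H_def[symmetric]
    by (intro exI[of _ F] exI[of _ Y] conjI F'' Yc Y0 H' int aF aY)
qed

text \<open>The extension at \<open>x\<close> is the supremum of \<open>u\<close> over the points of
  \<open>E\<close> up to \<open>x\<close>. Inserting \<open>- C\<close> keeps this set nonempty to
  the left of \<open>E\<close> and respects the bound.\<close>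

lemma mono_extension:
  fixes u :: "real \<Rightarrow> real"
  assumes mono: "\<And>x y. x \<in> E \<Longrightarrow> y \<in> E \<Longrightarrow> x \<le> y \<Longrightarrow> u x \<le> u y"
    and bd: "\<And>x. x \<in> E \<Longrightarrow> \<bar>u x\<bar> \<le> C" and C: "C \<ge> 0"
  shows "\<exists>m. mono m \<and> (\<forall>x. \<bar>m x\<bar> \<le> C) \<and> (\<forall>x\<in>E. m x = u x)"
proof -
  define A where "A = (\<lambda>x. insert (- C) (u ` {y\<in>E. y \<le> x}))"
  define m where "m = (\<lambda>x. Sup (A x))"
  have Ab: "a \<le> C" if "a \<in> A x" for a x using that bd C by (force simp: A_def abs_le_iff)
  then have bA: "bdd_above (A x)" for x by (intro bdd_aboveI)
  have ne: "A x \<noteq> {}" for x by (simp add: A_def)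
  have "mono m"
    unfolding m_def by (intro monoI cSup_subset_mono ne bA) (auto simp: A_def)
  moreover have "\<bar>m x\<bar> \<le> C" for x
  proof -
    have "m x \<le> C" unfolding m_def by (intro cSup_least ne Ab)
    moreover have "- C \<le> m x" unfolding m_def by (intro cSup_upper bA) (simp add: A_def)
    ultimately show ?thesis by simp
  qed
  moreover have "m x = u x" if x: "x \<in> E" for x
    unfolding m_def
  proof (rule cSup_eq_maximum)
    show "u x \<in> A x" using x by (auto simp: A_def)
    show "a \<le> u x" if "a \<in> A x" for a
      using that x mono bd[OF x] by (auto simp: A_def)
  qed
  ultimately show ?thesis by blast
qed

text \<open>The Jordan decomposition, with variations taken over chains that avoid the exceptional
  null set of \<open>variation_le\<close>. Both \<open>v\<close> and \<open>v - f\<close> increase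
  on the good set and are then extended to the line.\<close>

lemma BV_imp_diff_mono:
  fixes f :: "real \<Rightarrow> real"
  assumes f: "BV {0<..<L} f" and L: "L > 0"
  shows "\<exists>m1 m2 C. mono m1 \<and> mono m2 \<and> (\<forall>x. \<bar>m1 x\<bar> \<le> C \<and> \<bar>m2 x\<bar> \<le> (C::real)) \<and>
    (AE x in lebesgue. x \<in> {0<..<L} \<longrightarrow> f x = m1 x - m2 x)"
proof -
  have fi: "f absolutely_integrable_on {0<..<L}" and bdd: "bdd_above (variation_sums {0<..<L} f)"
    using f by (auto simp: BV_def)
  define V where "V = Sup (variation_sums {0<..<L} f)"
  have "(LINT x:{0<..<L}|lebesgue. f x * divergence \<theta> x) \<le> V"
    if "C1c {0<..<L} \<theta>" "\<forall>x\<in>{0<..<L}. norm (\<theta> x) \<le> 1" for \<theta>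
    unfolding V_def using that by (intro cSup_upper bdd) (auto simp: variation_sums_def)
  then have "\<exists>N. negligible N \<and> (\<forall>(n::nat) y. (\<forall>k\<le>n. y k \<in> {0<..<L} - N) \<longrightarrow> (\<forall>k<n. y k < y (Suc k)) \<longrightarrow>
        (\<Sum>k<n. \<bar>f (y (Suc k)) - f (y k)\<bar>) \<le> V)"
    by (intro variation_le[OF fi])
  then obtain N where N: "negligible N" and var: "\<forall>(n::nat) y. (\<forall>k\<le>n. y k \<in> {0<..<L} - N) \<longrightarrow> (\<forall>k<n. y k < y (Suc k)) \<longrightarrow>
        (\<Sum>k<n. \<bar>f (y (Suc k)) - f (y k)\<bar>) \<le> V"
    by (elim exE conjE) (rule that)
  define E where "E = {0<..<L} - N"
  \<comment> \<open>Chains end exactly at \<open>x\<close>; the chain with \<open>n = 0\<close>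
    contributes 0, so the set is nonempty at good points. Appending a point \<open>x'\<close> to a
    chain gives the increment estimate \<open>step\<close>.\<close>
  define VS where "VS = (\<lambda>x. {(\<Sum>k<n. \<bar>f (y (Suc k)) - f (y k)\<bar>) | (n::nat) y.
      (\<forall>k\<le>n. y k \<in> E) \<and> (\<forall>k<n. y k < y (Suc k)) \<and> y n = x})"
  define v where "v = (\<lambda>x. Sup (VS x))"
  have VSb: "s \<le> V" if "s \<in> VS x" for s x using that var by (auto simp: VS_def E_def)
  have bVS: "bdd_above (VS x)" for x using VSb by (intro bdd_aboveI)
  have zVS: "0 \<in> VS x" if "x \<in> E" for x
    unfolding VS_def using that by (intro CollectI exI[of _ 0] exI[of _ "\<lambda>_. x"]) auto
  have step: "v x + \<bar>f x' - f x\<bar> \<le> v x'" if x: "x \<in> E" "x' \<in> E" "x < x'" for x x'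
  proof -
    have "v x \<le> v x' - \<bar>f x' - f x\<bar>"
      unfolding v_def
    proof (rule cSup_least)
      show "VS x \<noteq> {}" using zVS[OF x(1)] by auto
      fix s assume "s \<in> VS x"
      then obtain n y where ny: "s = (\<Sum>k<n. \<bar>f (y (Suc k)) - f (y k)\<bar>)" "\<forall>k\<le>n. y k \<in> E"
        "\<forall>k<n. y k < y (Suc k)" "y n = x" by (auto simp: VS_def)
      define z where "z = (\<lambda>k. if k \<le> n then y k else x')"
      have sum_z: "s + \<bar>f x' - f x\<bar> = (\<Sum>k<Suc n. \<bar>f (z (Suc k)) - f (z k)\<bar>)"
        using ny(1,4) by (simp add: z_def)
      have chain_z: "(\<forall>k\<le>Suc n. z k \<in> E) \<and> (\<forall>k<Suc n. z k < z (Suc k)) \<and> z (Suc n) = x'"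
        using ny x by (auto simp: z_def less_Suc_eq)
      have "s + \<bar>f x' - f x\<bar> \<in> VS x'"
        unfolding VS_def by (rule CollectI, rule exI[of _ "Suc n"], rule exI[of _ z]) (intro conjI sum_z chain_z)
      then have "s + \<bar>f x' - f x\<bar> \<le> Sup (VS x')" by (intro cSup_upper bVS)
      then show "s \<le> Sup (VS x') - \<bar>f x' - f x\<bar>" by simp
    qed
    then show ?thesis by simp
  qed
  have v0: "0 \<le> v x" if "x \<in> E" for x unfolding v_def by (intro cSup_upper zVS that bVS)
  have vV: "v x \<le> V" if "x \<in> E" for x unfolding v_def using zVS[OF that] VSb by (intro cSup_least) auto
  have "\<not> negligible {0<..<L}" using L by (simp add: open_not_negligible)
  then have "\<not> {0<..<L} \<subseteq> N" using N negligible_subset by blast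
  then obtain z where z: "z \<in> E" unfolding E_def by blast
  \<comment> \<open>On \<open>E\<close> the function \<open>v\<close> is at most \<open>V\<close>
    and \<open>f\<close> is at most \<open>\<bar>f z\<bar> + V\<close> in modulus, so
    \<open>C\<close> serves both monotone functions.\<close>
  define C where "C = \<bar>f z\<bar> + 2 * V"
  have V0: "V \<ge> 0" using v0[OF z] vV[OF z] by linarith
  have fb: "\<bar>f x\<bar> \<le> \<bar>f z\<bar> + V" if "x \<in> E" for x
    using step[of x z] step[of z x] v0[OF that] vV[OF that] v0[OF z] vV[OF z] that z V0
    by (cases x z rule: linorder_cases) auto
  have "\<exists>m. mono m \<and> (\<forall>x. \<bar>m x\<bar> \<le> C) \<and> (\<forall>x\<in>E. m x = v x)"
  proof (rule mono_extension[where u = v and E = E and C = C])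
    show "v x \<le> v y" if "x \<in> E" "y \<in> E" "x \<le> y" for x y
      using step[of x y] that by (cases "x = y") auto
    show "\<bar>v x\<bar> \<le> C" if "x \<in> E" for x using v0[OF that] vV[OF that] by (simp add: C_def)
    show "C \<ge> 0" using V0 by (simp add: C_def)
  qed
  then obtain m1 where m1: "mono m1" "\<forall>x. \<bar>m1 x\<bar> \<le> C" "\<forall>x\<in>E. m1 x = v x" by (elim exE conjE) (rule that)
  have "\<exists>m. mono m \<and> (\<forall>x. \<bar>m x\<bar> \<le> C) \<and> (\<forall>x\<in>E. m x = v x - f x)"
  proof (rule mono_extension[where u = "\<lambda>x. v x - f x" and E = E and C = C])
    show "v x - f x \<le> v y - f y" if "x \<in> E" "y \<in> E" "x \<le> y" for x y
      using step[of x y] that by (cases "x = y") auto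
    show "\<bar>v x - f x\<bar> \<le> C" if "x \<in> E" for x using v0[OF that] vV[OF that] fb[OF that] by (simp add: C_def)
    show "C \<ge> 0" using V0 by (simp add: C_def)
  qed
  then obtain m2 where m2: "mono m2" "\<forall>x. \<bar>m2 x\<bar> \<le> C" "\<forall>x\<in>E. m2 x = v x - f x" by (elim exE conjE) (rule that)
  have "AE x in lebesgue. x \<in> {0<..<L} \<longrightarrow> f x = m1 x - m2 x"
    using AE_lebesgue_not_mem[OF N]
  proof eventually_elim
    case (elim x)
    then show ?case using m1(3) m2(3) by (simp add: E_def)
  qed
  then show ?thesis using m1 m2 by (intro exI[of _ m1] exI[of _ m2] exI[of _ C] conjI) auto
qed

section \<open>Traces\<close>

lemma lmeasurable_ball_Int: "S \<in> sets lebesgue \<Longrightarrow> ball p r \<inter> S \<in> lmeasurable"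
  by (intro fmeasurable_Int_fmeasurable) auto

text \<open>Since \<open>p\<close> lies outside \<open>S\<close>, the punctured limit controls
  \<open>F\<close> at all points of \<open>S\<close> near \<open>p\<close>; the deviation is small
  almost everywhere there, hence so is its mean.\<close>

lemma has_traceI:
  fixes S :: "'a::euclidean_space set"
  assumes S: "S \<in> sets lebesgue" and p: "p \<notin> S"
    and eq: "AE x in lebesgue. x \<in> S \<longrightarrow> f x = F x"
    and lim: "(F \<longlongrightarrow> y) (at p within S)"
  shows "has_trace S f p y"
  unfolding has_trace_def tendsto_iff
proof (intro allI impI)
  fix e :: real assume e: "e > 0"
  obtain d where d: "d > 0" "\<And>x. x \<in> S \<Longrightarrow> x \<noteq> p \<Longrightarrow> dist x p < d \<Longrightarrow> dist (F x) y < e / 2"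
    using tendstoD[OF lim, of "e / 2"] e unfolding eventually_at by auto
  have "dist ((LINT x:ball p r \<inter> S|lebesgue. \<bar>f x - y\<bar>) / measure lebesgue (ball p r \<inter> S)) 0 < e"
    if r: "0 < r" "r < d" for r
  proof -
    let ?\<mu> = "measure lebesgue (ball p r \<inter> S)"
    have "AE x in lebesgue. x \<in> ball p r \<inter> S \<longrightarrow> \<bar>f x - y\<bar> \<le> e / 2"
      using eq
    proof eventually_elim
      case (elim x)
      show ?case
      proof
        assume x: "x \<in> ball p r \<inter> S"
        then have "dist x p < d" "x \<noteq> p" "x \<in> S" using r p by (auto simp: dist_commute)
        then show "\<bar>f x - y\<bar> \<le> e / 2" using d(2)[of x] elim by (simp add: dist_real_def)
      qed
    qed
    then have "L1_norm (ball p r \<inter> S) (\<lambda>x. f x - y) \<le> e / 2 * ?\<mu>"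
      by (rule L1_norm_le_const[OF lmeasurable_ball_Int[OF S]])
    \<comment> \<open>If the ball meets \<open>S\<close> in a set of measure 0, the quotient is 0 by
      the convention for division by zero.\<close>
    then have "L1_norm (ball p r \<inter> S) (\<lambda>x. f x - y) / ?\<mu> \<le> e / 2"
      using e by (cases "?\<mu> = 0") (auto simp: divide_le_eq measure_nonneg less_le)
    moreover have "0 \<le> L1_norm (ball p r \<inter> S) (\<lambda>x. f x - y) / ?\<mu>"
      by (intro divide_nonneg_nonneg L1_norm_nonneg measure_nonneg)
    ultimately have "\<bar>L1_norm (ball p r \<inter> S) (\<lambda>x. f x - y) / ?\<mu>\<bar> < e" using e by linarith
    then show ?thesis by (simp only: L1_norm_def dist_real_def diff_0_right)
  qed
  then show "eventually (\<lambda>r. dist ((LINT x:ball p r \<inter> S|lebesgue. \<bar>f x - y\<bar>) / measure lebesgue (ball p r \<inter> S)) 0 < e) (at_right 0)"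
    unfolding eventually_at_right_field using d(1) by (intro exI[of _ d]) auto
qed

lemma measure_ball_Int_pos:
  fixes S :: "'a::euclidean_space set"
  assumes "open S" "p \<in> closure S" "r > 0"
  shows "measure lebesgue (ball p r \<inter> S) > 0"
proof -
  obtain y where "y \<in> S" "dist y p < r" using assms(2,3) unfolding closure_approachable by blast
  then have "y \<in> ball p r \<inter> S" by (simp add: dist_commute)
  then have "ball p r \<inter> S \<noteq> {}" by blast
  moreover have "open (ball p r \<inter> S)" using assms by auto
  ultimately have "\<not> negligible (ball p r \<inter> S)" by (rule open_not_negligible[rotated])
  moreover have "ball p r \<inter> S \<in> lmeasurable" using assms by (intro lmeasurable_ball_Int) auto
  ultimately show ?thesis using negligible_iff_measure0 measure_nonneg[of lebesgue "ball p r \<inter> S"] by (metis less_le)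
qed

text \<open>The constant \<open>\<bar>y - y'\<bar>\<close> is at most the sum of the two deviations,
  hence at most the sum of their means. Openness of \<open>S\<close> and \<open>p\<close> in its
  closure give the averaging sets positive measure.\<close>

lemma has_trace_unique:
  fixes S :: "'a::euclidean_space set"
  assumes S: "open S" "p \<in> closure S" and f: "f absolutely_integrable_on S"
    and t: "has_trace S f p y" "has_trace S f p y'"
  shows "y = y'"
proof -
  define q where "q = (\<lambda>y r. (LINT x:ball p r \<inter> S|lebesgue. \<bar>f x - y\<bar>) / measure lebesgue (ball p r \<inter> S))"
  have "((\<lambda>r. q y r + q y' r) \<longlongrightarrow> 0 + 0) (at_right 0)"
    unfolding q_def using t unfolding has_trace_def by (rule tendsto_add)
  moreover have "eventually (\<lambda>r. \<bar>y - y'\<bar> \<le> q y r + q y' r) (at_right 0)"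
    unfolding eventually_at_right_field
  proof (intro exI[of _ 1] conjI allI impI)
    fix r :: real assume r: "0 < r"
    let ?B = "ball p r \<inter> S"
    have pos: "measure lebesgue ?B > 0" by (rule measure_ball_Int_pos[OF S r])
    have lm: "?B \<in> lmeasurable" using S by (intro lmeasurable_ball_Int) auto
    have fB: "f absolutely_integrable_on ?B" by (rule set_integrable_subset[OF f]) (use S in auto)
    have c: "(\<lambda>x. c) absolutely_integrable_on ?B" for c :: real using lm by (rule absolutely_integrable_on_const)
    have "L1_norm ?B (\<lambda>x. y - y') = \<bar>y - y'\<bar> * measure lebesgue ?B"
      unfolding L1_norm_def using lm by (subst set_integral_const) (auto simp: fmeasurable_def)
    moreover have "L1_norm ?B (\<lambda>x. y - y') \<le> L1_norm ?B (\<lambda>x. y - f x) + L1_norm ?B (\<lambda>x. f x - y')"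
      by (rule L1_norm_triangle_diff[OF c fB c])
    ultimately have "\<bar>y - y'\<bar> * measure lebesgue ?B \<le> L1_norm ?B (\<lambda>x. f x - y) + L1_norm ?B (\<lambda>x. f x - y')"
      by (simp add: L1_norm_diff_commute[of _ "\<lambda>_. y"])
    then show "\<bar>y - y'\<bar> \<le> q y r + q y' r"
      unfolding q_def L1_norm_def add_divide_distrib[symmetric] using pos by (simp add: pos_le_divide_eq)
  qed simp
  ultimately have "\<bar>y - y'\<bar> \<le> 0 + 0" by (intro tendsto_lowerbound) auto
  then show ?thesis by simp
qed

lemma boundary_trace_eq:
  fixes S :: "'a::euclidean_space set"
  assumes "open S" "p \<in> closure S" "f absolutely_integrable_on S" "has_trace S f p y"
  shows "boundary_trace S f p = y"
  unfolding boundary_trace_def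
  by (rule the_equality[where P = "has_trace S f p", OF assms(4)]) (rule has_trace_unique[OF assms(1-3) _ assms(4)])

lemma boundary_trace_edge:
  fixes F :: "real \<Rightarrow> real"
  assumes L: "L > 0" and f: "f absolutely_integrable_on {0<..<L}"
    and eq: "AE x in lebesgue. x \<in> {0<..<L} \<longrightarrow> f x = F x" and F: "continuous_on {0..L} F"
  shows "boundary_trace {0<..<L} f 0 = F 0" "boundary_trace {0<..<L} f L = F L"
proof -
  have "boundary_trace {0<..<L} f p = F p" if "p = 0 \<or> p = L" for p
  proof (rule boundary_trace_eq[OF _ _ f])
    show "p \<in> closure {0<..<L}" using that L by auto
    have "(F \<longlongrightarrow> F p) (at p within {0..L})" using F that L by (auto simp: continuous_on_def)
    then have "(F \<longlongrightarrow> F p) (at p within {0<..<L})" by (rule tendsto_within_subset) auto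
    then show "has_trace {0<..<L} f p (F p)" by (intro has_traceI[OF _ _ eq]) (use that in auto)
  qed simp
  then show "boundary_trace {0<..<L} f 0 = F 0" "boundary_trace {0<..<L} f L = F L" by auto
qed

section \<open>L1 contraction for the parabolic problem\<close>

text \<open>A smooth substitute for the absolute value in the test-function argument for the contraction.\<close>

definition soft_abs :: "real \<Rightarrow> real \<Rightarrow> real" where
  "soft_abs \<eta> s = sqrt (s\<^sup>2 + \<eta>\<^sup>2)"

definition soft_sgn :: "real \<Rightarrow> real \<Rightarrow> real" where
  "soft_sgn \<eta> s = s / soft_abs \<eta> s"

lemma soft_abs_pos: "\<eta> > 0 \<Longrightarrow> soft_abs \<eta> s > 0"
  by (simp add: soft_abs_def add_nonneg_pos)

lemma soft_abs_square: "(soft_abs \<eta> s)\<^sup>2 = s\<^sup>2 + \<eta>\<^sup>2"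
  by (simp add: soft_abs_def)

lemma DERIV_soft_abs:
  assumes "\<eta> > 0"
  shows "(soft_abs \<eta> has_real_derivative soft_sgn \<eta> s) (at s)"
proof -
  have "s\<^sup>2 + \<eta>\<^sup>2 > 0" using assms by (simp add: add_nonneg_pos)
  then show ?thesis
    unfolding soft_abs_def[abs_def] soft_sgn_def
    by (auto intro!: derivative_eq_intros simp: divide_simps)
qed

lemma DERIV_soft_sgn:
  assumes "\<eta> > 0"
  shows "(soft_sgn \<eta> has_real_derivative \<eta>\<^sup>2 / soft_abs \<eta> s ^ 3) (at s)"
proof -
  have p: "soft_abs \<eta> s \<noteq> 0" using soft_abs_pos[OF assms, of s] by simp
  have "((\<lambda>s. s / soft_abs \<eta> s) has_real_derivative (1 * soft_abs \<eta> s - s * soft_sgn \<eta> s) / (soft_abs \<eta> s * soft_abs \<eta> s)) (at s)"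
    by (rule DERIV_divide[OF DERIV_ident DERIV_soft_abs[OF assms] p])
  moreover have "(1 * soft_abs \<eta> s - s * soft_sgn \<eta> s) / (soft_abs \<eta> s * soft_abs \<eta> s) = \<eta>\<^sup>2 / soft_abs \<eta> s ^ 3"
  proof -
    have "1 * soft_abs \<eta> s - s * soft_sgn \<eta> s = ((soft_abs \<eta> s)\<^sup>2 - s\<^sup>2) / soft_abs \<eta> s"
      using p by (simp add: soft_sgn_def field_simps power2_eq_square)
    also have "\<dots> = \<eta>\<^sup>2 / soft_abs \<eta> s" by (simp add: soft_abs_square)
    finally show ?thesis by (simp add: power3_eq_cube)
  qed
  ultimately show ?thesis by (simp add: soft_sgn_def[abs_def])
qed

lemma soft_abs_ge: "\<bar>s\<bar> \<le> soft_abs \<eta> s"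
  unfolding soft_abs_def using real_sqrt_le_mono[of "s\<^sup>2" "s\<^sup>2 + \<eta>\<^sup>2"] by simp

lemma abs_soft_sgn_le: "\<eta> > 0 \<Longrightarrow> \<bar>soft_sgn \<eta> s\<bar> \<le> 1"
  using soft_abs_ge[of s \<eta>] soft_abs_pos[of \<eta> s] by (simp add: soft_sgn_def abs_divide)

text \<open>The difference equals \<open>\<eta>\<^sup>2 / soft_abs \<eta> s\<close>. It measures how
  far the soft absolute value is from being homogeneous of degree one, for which Euler's identity
  would make it 0.\<close>

lemma soft_abs_diff:
  assumes "\<eta> > 0"
  shows "0 \<le> soft_abs \<eta> s - s * soft_sgn \<eta> s" "soft_abs \<eta> s - s * soft_sgn \<eta> s \<le> \<eta>"
proof -
  have p: "soft_abs \<eta> s > 0" by (rule soft_abs_pos[OF assms])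
  have e: "soft_abs \<eta> s - s * soft_sgn \<eta> s = \<eta>\<^sup>2 / soft_abs \<eta> s"
    using p soft_abs_square[of \<eta> s] by (simp add: soft_sgn_def field_simps power2_eq_square)
  have "\<eta> \<le> soft_abs \<eta> s"
    unfolding soft_abs_def using real_sqrt_le_mono[of "\<eta>\<^sup>2" "s\<^sup>2 + \<eta>\<^sup>2"] assms by simp
  then have "\<eta> * \<eta> \<le> \<eta> * soft_abs \<eta> s" using assms by simp
  then show "0 \<le> soft_abs \<eta> s - s * soft_sgn \<eta> s" "soft_abs \<eta> s - s * soft_sgn \<eta> s \<le> \<eta>"
    unfolding e using p by (auto simp: pos_divide_le_eq power2_eq_square)
qed

lemma abs_le_soft_sgn: "\<eta> > 0 \<Longrightarrow> \<bar>s\<bar> \<le> soft_sgn \<eta> s * s + \<eta>"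
  using soft_abs_diff(2)[of \<eta> s] soft_abs_ge[of s \<eta>] by (simp add: mult.commute)

lemma soft_sgn_mono:
  assumes "\<eta> > 0" "s \<le> t"
  shows "soft_sgn \<eta> s \<le> soft_sgn \<eta> t"
proof (rule DERIV_nonneg_imp_nondecreasing[OF assms(2)])
  fix x
  show "\<exists>y. (soft_sgn \<eta> has_real_derivative y) (at x) \<and> 0 \<le> y"
    using DERIV_soft_sgn[OF assms(1), of x] soft_abs_pos[OF assms(1), of x]
    by (intro exI[of _ "\<eta>\<^sup>2 / soft_abs \<eta> x ^ 3"]) auto
qed

lemma soft_sgn_0 [simp]: "soft_sgn \<eta> 0 = 0" by (simp add: soft_sgn_def)

text \<open>The operator is multiplied by \<open>soft_sgn \<eta> (Z x)\<close> and integrated. The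
  diffusive part gives boundary terms minus a nonnegative integral, because \<open>soft_sgn\<close>
  increases; the transport part is the exact derivative of \<open>soft_abs \<eta> (Z x)\<close>.
  Replacing \<open>soft_abs\<close> at the ends by \<open>Z\<close> times its soft sign costs
  \<open>c * \<eta>\<close> and collects the whole flux in one bracket at each end.\<close>

lemma edge_accretive:
  assumes L: "L \<ge> 0" and eps: "\<epsilon> \<ge> 0" and lam: "c \<ge> 0" and \<eta>: "\<eta> > 0"
    and Z: "\<And>x. x \<in> {0..L} \<Longrightarrow> (Z has_real_derivative Y x) (at x within {0..L})"
    and H: "H absolutely_integrable_on {0..L}"
    and Y: "\<And>x. x \<in> {0..L} \<Longrightarrow> Y x = Y 0 + integral {0..x} H"
  shows "integral {0..L} (\<lambda>x. soft_sgn \<eta> (Z x) * (\<epsilon> * H x - c * Y x)) \<le>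
     soft_sgn \<eta> (Z L) * (\<epsilon> * Y L - c * Z L) - soft_sgn \<eta> (Z 0) * (\<epsilon> * Y 0 - c * Z 0) + c * \<eta>"
proof -
  let ?S = "soft_sgn \<eta>" and ?J = "soft_abs \<eta>" and ?S' = "\<lambda>s. \<eta>\<^sup>2 / soft_abs \<eta> s ^ 3"
  have Yc: "continuous_on {0..L} Y"
  proof -
    have "continuous_on {0..L} (\<lambda>x. Y 0 + integral {0..x} H)"
      by (intro continuous_intros indefinite_integral_continuous_1 set_lebesgue_integral_eq_integral H)
    then show ?thesis by (rule continuous_on_eq) (rule Y[symmetric])
  qed
  have SZ: "((\<lambda>x. ?S (Z x)) has_real_derivative ?S' (Z x) * Y x) (at x within {0..L})" if "x \<in> {0..L}" for x
    using DERIV_chain2[OF DERIV_soft_sgn[OF \<eta>] Z[OF that]] .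
  have JZ: "((\<lambda>x. ?J (Z x)) has_real_derivative ?S (Z x) * Y x) (at x within {0..L})" if "x \<in> {0..L}" for x
    using DERIV_chain2[OF DERIV_soft_abs[OF \<eta>] Z[OF that]] .
  have SZc: "continuous_on {0..L} (\<lambda>x. ?S (Z x))" using SZ by (rule DERIV_continuous_on)
  have JZc: "continuous_on {0..L} (\<lambda>x. ?J (Z x))" using JZ by (rule DERIV_continuous_on)
  have c': "continuous_on {0..L} (\<lambda>x. ?S' (Z x) * Y x)"
    using soft_abs_pos[OF \<eta>] by (intro continuous_intros JZc Yc) (simp add: less_imp_neq[THEN not_sym])
  have i1: "(\<lambda>x. H x * ?S (Z x)) absolutely_integrable_on {0..L}"
    by (rule absolutely_integrable_times_continuous[OF H SZc])
  have parts: "integral {0..L} (\<lambda>x. H x * ?S (Z x)) = Y L * ?S (Z L) - Y 0 * ?S (Z 0) - integral {0..L} (\<lambda>x. Y x * (?S' (Z x) * Y x))"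
    by (rule integration_by_parts_L1[OF L H SZ c' Y])
  have "0 \<le> integral {0..L} (\<lambda>x. Y x * (?S' (Z x) * Y x))"
  proof (rule integral_nonneg)
    show "(\<lambda>x. Y x * (?S' (Z x) * Y x)) integrable_on {0..L}"
      by (intro integrable_continuous_real continuous_on_mult Yc c')
    fix x
    have "Y x * (?S' (Z x) * Y x) = ?S' (Z x) * (Y x)\<^sup>2" by (simp add: power2_eq_square)
    also have "\<dots> \<ge> 0" using soft_abs_pos[OF \<eta>, of "Z x"] by simp
    finally show "0 \<le> Y x * (?S' (Z x) * Y x)" .
  qed
  then have b1: "integral {0..L} (\<lambda>x. H x * ?S (Z x)) \<le> Y L * ?S (Z L) - Y 0 * ?S (Z 0)"
    using parts by linarith
  have "((\<lambda>x. ?S (Z x) * Y x) has_integral (?J (Z L) - ?J (Z 0))) {0..L}"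
    by (rule fundamental_theorem_of_calculus[OF L])
      (use JZ in \<open>simp add: has_real_derivative_iff_has_vector_derivative\<close>)
  then have i2: "(\<lambda>x. ?S (Z x) * Y x) integrable_on {0..L}" and
    b2: "integral {0..L} (\<lambda>x. ?S (Z x) * Y x) = ?J (Z L) - ?J (Z 0)"
    by (auto simp: has_integral_iff)
  have "integral {0..L} (\<lambda>x. ?S (Z x) * (\<epsilon> * H x - c * Y x))
     = integral {0..L} (\<lambda>x. \<epsilon> * (H x * ?S (Z x)) - c * (?S (Z x) * Y x))"
    by (rule integral_cong) (simp add: algebra_simps)
  also have "\<dots> = \<epsilon> * integral {0..L} (\<lambda>x. H x * ?S (Z x)) - c * integral {0..L} (\<lambda>x. ?S (Z x) * Y x)"
    using integrable_on_cmult_left[OF set_lebesgue_integral_eq_integral(1)[OF i1], of \<epsilon>]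
      integrable_on_cmult_left[OF i2, of c]
    by (subst integral_diff) auto
  also have "\<dots> \<le> \<epsilon> * (Y L * ?S (Z L) - Y 0 * ?S (Z 0)) - c * (?J (Z L) - ?J (Z 0))"
    using mult_left_mono[OF b1 eps] unfolding b2 by simp
  also have "\<dots> \<le> ?S (Z L) * (\<epsilon> * Y L - c * Z L) - ?S (Z 0) * (\<epsilon> * Y 0 - c * Z 0) + c * \<eta>"
  proof -
    have "- (?J (Z L) - ?J (Z 0)) \<le> - Z L * ?S (Z L) + Z 0 * ?S (Z 0) + \<eta>"
      using soft_abs_diff(1)[OF \<eta>, of "Z L"] soft_abs_diff(2)[OF \<eta>, of "Z 0"] by linarith
    from mult_left_mono[OF this lam] show ?thesis by (simp add: algebra_simps)
  qed
  finally show ?thesis .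
qed

text \<open>Adding the double sum to its transpose pairs the exchange terms of \<open>i\<close> and
  \<open>j\<close> into \<open>- (K i j * ((?S i - ?S j) * (z i - z j)))\<close>, nonpositive
  because \<open>soft_sgn\<close> increases. Symmetry of \<open>K\<close> permits the
  pairing.\<close>

lemma node_dissipation:
  assumes M: "finite M" and K: "\<And>i j. i \<in> M \<Longrightarrow> j \<in> M \<Longrightarrow> K i j \<ge> 0"
    and Ks: "\<And>i j. i \<in> M \<Longrightarrow> j \<in> M \<Longrightarrow> K i j = K j i" and \<eta>: "\<eta> > 0"
  shows "(\<Sum>i\<in>M. soft_sgn \<eta> (z i) * (\<Sum>j\<in>M. K i j * (z j - z i))) \<le> 0"
proof -
  let ?S = "\<lambda>i. soft_sgn \<eta> (z i)"
  let ?X = "\<Sum>i\<in>M. ?S i * (\<Sum>j\<in>M. K i j * (z j - z i))"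
  have X1: "?X = (\<Sum>i\<in>M. \<Sum>j\<in>M. ?S i * (K i j * (z j - z i)))" by (simp add: sum_distrib_left)
  also have "\<dots> = (\<Sum>j\<in>M. \<Sum>i\<in>M. ?S i * (K i j * (z j - z i)))" by (rule sum.swap)
  also have "\<dots> = (\<Sum>i\<in>M. \<Sum>j\<in>M. ?S j * (K i j * (z i - z j)))"
    using Ks by (intro sum.cong refl) simp
  finally have "?X + ?X = (\<Sum>i\<in>M. \<Sum>j\<in>M. ?S i * (K i j * (z j - z i)) + ?S j * (K i j * (z i - z j)))"
    unfolding sum.distrib using X1 by linarith
  also have "\<dots> \<le> 0"
  proof (intro sum_nonpos)
    fix i j assume ij: "i \<in> M" "j \<in> M"
    have "?S i * (K i j * (z j - z i)) + ?S j * (K i j * (z i - z j)) = - (K i j * ((?S i - ?S j) * (z i - z j)))"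
      by (simp add: algebra_simps)
    moreover have "(?S i - ?S j) * (z i - z j) \<ge> 0"
      using soft_sgn_mono[OF \<eta>, of "z i" "z j"] soft_sgn_mono[OF \<eta>, of "z j" "z i"]
      by (cases "z i \<le> z j") (auto intro: mult_nonneg_nonneg mult_nonpos_nonpos)
    ultimately show "?S i * (K i j * (z j - z i)) + ?S j * (K i j * (z i - z j)) \<le> 0"
      using K[OF ij] by simp
  qed
  finally show ?thesis by simp
qed

text \<open>The resolvent estimate in L1: without defects \<open>\<rho> i\<close>, the norm of
  \<open>Z\<close> is at most that of \<open>Z\<close> minus \<open>h\<close> times the operator
  applied to it. At the outer ends \<open>Z\<close> vanishes and with it the soft sign; the fluxes
  at the node combine over all arcs into the dissipative sum plus the defects.\<close>

lemma network_accretive: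
  assumes fin: "finite (In \<union> Out)" and disj: "In \<inter> Out = {}"
    and K: "\<And>i j. i \<in> In \<union> Out \<Longrightarrow> j \<in> In \<union> Out \<Longrightarrow> K i j \<ge> 0"
    and Ks: "\<And>i j. i \<in> In \<union> Out \<Longrightarrow> j \<in> In \<union> Out \<Longrightarrow> K i j = K j i"
    and L: "\<And>i. i \<in> In \<union> Out \<Longrightarrow> L i > 0" and eps: "\<epsilon> \<ge> 0"
    and lam: "\<And>i. i \<in> In \<union> Out \<Longrightarrow> lam i \<ge> 0" and h: "h \<ge> 0"
    and Z: "\<And>i x. i \<in> In \<union> Out \<Longrightarrow> x \<in> {0..L i} \<Longrightarrow> (Z i has_real_derivative Y i x) (at x within {0..L i})"
    and H: "\<And>i. i \<in> In \<union> Out \<Longrightarrow> H i absolutely_integrable_on {0..L i}"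
    and Y: "\<And>i x. i \<in> In \<union> Out \<Longrightarrow> x \<in> {0..L i} \<Longrightarrow> Y i x = Y i 0 + integral {0..x} (H i)"
    and bin: "\<And>i. i \<in> In \<Longrightarrow> Z i 0 = 0" and bout: "\<And>i. i \<in> Out \<Longrightarrow> Z i (L i) = 0"
    and nodeq: "\<And>i. i \<in> In \<union> Out \<Longrightarrow>
       beta In i * (\<epsilon> * Y i (node In L i) - lam i * Z i (node In L i))
       = (\<Sum>j\<in>In \<union> Out. K i j * (Z j (node In L j) - Z i (node In L i))) + \<rho> i"
  shows "(\<Sum>i\<in>In \<union> Out. L1_norm {0..L i} (Z i)) \<le>
     (\<Sum>i\<in>In \<union> Out. L1_norm {0..L i} (\<lambda>x. Z i x - h * (\<epsilon> * H i x - lam i * Y i x))) + h * (\<Sum>i\<in>In \<union> Out. \<bar>\<rho> i\<bar>)"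
proof (rule field_le_epsilon)
  fix e :: real assume e: "e > 0"
  let ?M = "In \<union> Out"
  define g where "g = (\<lambda>i x. \<epsilon> * H i x - lam i * Y i x)"
  \<comment> \<open>\<open>C * \<eta>\<close> is the total cost of the regularisation:
    \<open>h * lam i * \<eta>\<close> from the boundary terms of arc \<open>i\<close>, and
    \<open>L i * \<eta>\<close> from bounding \<open>\<bar>Z i x\<bar>\<close> by means of the soft
    sign.\<close>
  define C where "C = (\<Sum>i\<in>?M. h * lam i + L i)"
  have C0: "C \<ge> 0" unfolding C_def using h lam L by (intro sum_nonneg add_nonneg_nonneg mult_nonneg_nonneg) (auto simp: less_imp_le)
  define \<eta> where "\<eta> = e / (C + 1)"
  have \<eta>: "\<eta> > 0" using e C0 by (simp add: \<eta>_def)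
  have C\<eta>: "C * \<eta> \<le> e" using e C0 by (simp add: \<eta>_def field_simps)
  define z where "z = (\<lambda>i. Z i (node In L i))"
  have edge: "L1_norm {0..L i} (Z i) \<le> L1_norm {0..L i} (\<lambda>x. Z i x - h * g i x)
      + h * (soft_sgn \<eta> (z i) * (beta In i * (\<epsilon> * Y i (node In L i) - lam i * z i))) + (h * lam i + L i) * \<eta>"
    if i: "i \<in> ?M" for i
  proof -
    have Zc: "continuous_on {0..L i} (Z i)" by (rule DERIV_continuous_on) (rule Z[OF i])
    have Yc: "continuous_on {0..L i} (Y i)"
    proof -
      have "continuous_on {0..L i} (\<lambda>x. Y i 0 + integral {0..x} (H i))"
        by (intro continuous_intros indefinite_integral_continuous_1 set_lebesgue_integral_eq_integral H i)
      then show ?thesis by (rule continuous_on_eq) (rule Y[OF i, symmetric])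
    qed
    have Sc: "continuous_on {0..L i} (\<lambda>x. soft_sgn \<eta> (Z i x))"
      by (rule DERIV_continuous_on) (rule DERIV_chain2[OF DERIV_soft_sgn[OF \<eta>] Z[OF i]])
    have gi: "g i absolutely_integrable_on {0..L i}"
      unfolding g_def using H[OF i] absolutely_integrable_continuous_real[OF Yc]
      by (intro set_integral_diff(1) set_integrable_mult_right) auto
    have Zi: "Z i absolutely_integrable_on {0..L i}" by (rule absolutely_integrable_continuous_real[OF Zc])
    have di: "(\<lambda>x. Z i x - h * g i x) absolutely_integrable_on {0..L i}"
      using gi Zi by (intro set_integral_diff(1) set_integrable_mult_right) auto
    have Sg: "(\<lambda>x. soft_sgn \<eta> (Z i x) * g i x) integrable_on {0..L i}"
      using set_lebesgue_integral_eq_integral(1)[OF absolutely_integrable_times_continuous[OF gi Sc]]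
      by (simp add: mult.commute)
    have i1: "(\<lambda>x. \<bar>Z i x - h * g i x\<bar>) integrable_on {0..L i}"
      by (rule absolutely_integrable_imp_integrable_abs[OF di])
    have i2: "(\<lambda>x. h * (soft_sgn \<eta> (Z i x) * g i x)) integrable_on {0..L i}"
      using integrable_on_cmult_left[OF Sg, of h] by simp
    have i3: "(\<lambda>x. \<bar>Z i x - h * g i x\<bar> + h * (soft_sgn \<eta> (Z i x) * g i x)) integrable_on {0..L i}"
      by (rule integrable_add[OF i1 i2])
    have "L1_norm {0..L i} (Z i) = integral {0..L i} (\<lambda>x. \<bar>Z i x\<bar>)" by (rule L1_norm_eq_integral[OF Zi])
    also have "\<dots> \<le> integral {0..L i} (\<lambda>x. (\<bar>Z i x - h * g i x\<bar> + h * (soft_sgn \<eta> (Z i x) * g i x)) + \<eta>)"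
    proof (rule integral_le[OF absolutely_integrable_imp_integrable_abs[OF Zi]])
      show "(\<lambda>x. (\<bar>Z i x - h * g i x\<bar> + h * (soft_sgn \<eta> (Z i x) * g i x)) + \<eta>) integrable_on {0..L i}"
        by (rule integrable_add[OF i3 integrable_const_ivl])
      fix x
      have "soft_sgn \<eta> (Z i x) * (Z i x - h * g i x) \<le> \<bar>soft_sgn \<eta> (Z i x) * (Z i x - h * g i x)\<bar>" by (rule abs_ge_self)
      also have "\<dots> \<le> 1 * \<bar>Z i x - h * g i x\<bar>"
        unfolding abs_mult by (intro mult_right_mono abs_soft_sgn_le \<eta>) simp
      finally have "soft_sgn \<eta> (Z i x) * Z i x \<le> \<bar>Z i x - h * g i x\<bar> + h * (soft_sgn \<eta> (Z i x) * g i x)"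
        by (simp add: algebra_simps)
      then show "\<bar>Z i x\<bar> \<le> (\<bar>Z i x - h * g i x\<bar> + h * (soft_sgn \<eta> (Z i x) * g i x)) + \<eta>"
        using abs_le_soft_sgn[OF \<eta>, of "Z i x"] by linarith
    qed
    also have "\<dots> = integral {0..L i} (\<lambda>x. \<bar>Z i x - h * g i x\<bar>) + h * integral {0..L i} (\<lambda>x. soft_sgn \<eta> (Z i x) * g i x) + L i * \<eta>"
      using L[OF i] by (subst integral_add[OF i3 integrable_const_ivl]) (simp_all add: integral_add[OF i1 i2])
    also have "\<dots> \<le> L1_norm {0..L i} (\<lambda>x. Z i x - h * g i x)
      + h * (soft_sgn \<eta> (z i) * (beta In i * (\<epsilon> * Y i (node In L i) - lam i * z i)) + lam i * \<eta>) + L i * \<eta>"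
    proof -
      have "integral {0..L i} (\<lambda>x. soft_sgn \<eta> (Z i x) * g i x) \<le>
        soft_sgn \<eta> (Z i (L i)) * (\<epsilon> * Y i (L i) - lam i * Z i (L i)) - soft_sgn \<eta> (Z i 0) * (\<epsilon> * Y i 0 - lam i * Z i 0) + lam i * \<eta>"
        unfolding g_def using L[OF i] lam[OF i] eps \<eta> by (intro edge_accretive Z[OF i] H[OF i] Y[OF i]) auto
      also have "\<dots> = soft_sgn \<eta> (z i) * (beta In i * (\<epsilon> * Y i (node In L i) - lam i * z i)) + lam i * \<eta>"
        using bin[of i] bout[of i] i disj by (cases "i \<in> In") (auto simp: beta_def node_def z_def algebra_simps)
      finally have "integral {0..L i} (\<lambda>x. soft_sgn \<eta> (Z i x) * g i x) \<le> soft_sgn \<eta> (z i) * (beta In i * (\<epsilon> * Y i (node In L i) - lam i * z i)) + lam i * \<eta>" .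
      from mult_left_mono[OF this h] show ?thesis using L1_norm_eq_integral[OF di] by simp
    qed
    finally show ?thesis by (simp add: algebra_simps)
  qed
  have "(\<Sum>i\<in>?M. soft_sgn \<eta> (z i) * (beta In i * (\<epsilon> * Y i (node In L i) - lam i * z i)))
     = (\<Sum>i\<in>?M. soft_sgn \<eta> (z i) * (\<Sum>j\<in>?M. K i j * (z j - z i))) + (\<Sum>i\<in>?M. soft_sgn \<eta> (z i) * \<rho> i)"
    unfolding sum.distrib[symmetric] using nodeq by (intro sum.cong refl) (simp add: z_def distrib_left)
  also have "\<dots> \<le> 0 + (\<Sum>i\<in>?M. \<bar>\<rho> i\<bar>)"
  proof (intro add_mono node_dissipation[OF fin K Ks \<eta>] sum_mono)
    fix i
    have "soft_sgn \<eta> (z i) * \<rho> i \<le> \<bar>soft_sgn \<eta> (z i)\<bar> * \<bar>\<rho> i\<bar>" unfolding abs_mult[symmetric] by (rule abs_ge_self)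
    also have "\<dots> \<le> 1 * \<bar>\<rho> i\<bar>" by (intro mult_right_mono abs_soft_sgn_le \<eta>) simp
    finally show "soft_sgn \<eta> (z i) * \<rho> i \<le> \<bar>\<rho> i\<bar>" by simp
  qed
  finally have nod: "(\<Sum>i\<in>?M. soft_sgn \<eta> (z i) * (beta In i * (\<epsilon> * Y i (node In L i) - lam i * z i))) \<le> (\<Sum>i\<in>?M. \<bar>\<rho> i\<bar>)" by simp
  have "(\<Sum>i\<in>?M. L1_norm {0..L i} (Z i)) \<le> (\<Sum>i\<in>?M. L1_norm {0..L i} (\<lambda>x. Z i x - h * g i x)
      + h * (soft_sgn \<eta> (z i) * (beta In i * (\<epsilon> * Y i (node In L i) - lam i * z i))) + (h * lam i + L i) * \<eta>)"
    by (intro sum_mono edge)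
  also have "\<dots> = (\<Sum>i\<in>?M. L1_norm {0..L i} (\<lambda>x. Z i x - h * g i x))
      + h * (\<Sum>i\<in>?M. soft_sgn \<eta> (z i) * (beta In i * (\<epsilon> * Y i (node In L i) - lam i * z i))) + C * \<eta>"
  proof -
    have "C * \<eta> = (\<Sum>i\<in>?M. (h * lam i + L i) * \<eta>)" by (simp only: C_def sum_distrib_right)
    then show ?thesis by (simp only: sum.distrib sum_distrib_left)
  qed
  also have "\<dots> \<le> (\<Sum>i\<in>?M. L1_norm {0..L i} (\<lambda>x. Z i x - h * g i x)) + h * (\<Sum>i\<in>?M. \<bar>\<rho> i\<bar>) + e"
    using mult_left_mono[OF nod h] C\<eta> by linarith
  finally show "(\<Sum>i\<in>?M. L1_norm {0..L i} (Z i)) \<le>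
     (\<Sum>i\<in>?M. L1_norm {0..L i} (\<lambda>x. Z i x - h * (\<epsilon> * H i x - lam i * Y i x))) + h * (\<Sum>i\<in>?M. \<bar>\<rho> i\<bar>) + e"
    unfolding g_def .
qed

text \<open>The evolution is compared with one implicit Euler step, which controls differences to the left of t.\<close>

lemma left_dini_growth:
  fixes f :: "real \<Rightarrow> real"
  assumes c: "continuous_on {0..T} f" and T: "T \<ge> 0"
    and D: "\<And>t e. 0 < t \<Longrightarrow> t \<le> T \<Longrightarrow> 0 < e \<Longrightarrow> \<exists>d>0. \<forall>h. 0 < h \<and> h < d \<and> h \<le> t \<longrightarrow> f t - f (t - h) \<le> h * (R + e)"
  shows "f T \<le> f 0 + R * T"
proof (rule field_le_epsilon)
  fix e :: real assume e: "e > 0"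
  define q where "q = e / (T + 1)"
  have q: "q > 0" using e T by (simp add: q_def)
  have qT: "q * T \<le> e" using e T by (simp add: q_def field_simps)
  \<comment> \<open>The extra slope \<open>q\<close> makes the contradiction strict: at a maximum
    \<open>s > 0\<close> of \<open>g\<close> the left differences of \<open>f\<close> would be at
    least \<open>h * (R + q)\<close>.\<close>
  define g where "g = (\<lambda>t. f t - (R + q) * t)"
  have "continuous_on {0..T} g" unfolding g_def by (intro continuous_intros c)
  then obtain s where s: "s \<in> {0..T}" "\<And>t. t \<in> {0..T} \<Longrightarrow> g t \<le> g s"
    using continuous_attains_sup[of "{0..T}" g] T by auto
  have "s = 0"
  proof (rule ccontr)
    assume "s \<noteq> 0"
    then have s0: "0 < s" "s \<le> T" using s(1) by auto
    then obtain d where d: "d > 0" "\<And>h. 0 < h \<and> h < d \<and> h \<le> s \<Longrightarrow> f s - f (s - h) \<le> h * (R + q / 2)"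
      using D[OF s0, of "q / 2"] q by auto
    define h where "h = min (d / 2) s"
    have h: "0 < h" "h < d" "h \<le> s" using d(1) s0 by (auto simp: h_def)
    have "f s - f (s - h) \<le> h * (R + q / 2)" using d(2) h by blast
    moreover have "g (s - h) \<le> g s" using s0 h by (intro s(2)) auto
    moreover have "h * (R + q / 2) < h * (R + q)" using h q by simp
    ultimately show False unfolding g_def by (simp add: algebra_simps)
  qed
  then have "g T \<le> g 0" using s(2)[of T] T by auto
  then show "f T \<le> f 0 + R * T + e" using qT unfolding g_def by (simp add: algebra_simps)
qed

section \<open>Comparison of the evolution with approximate solutions\<close>

lemma absolutely_integrable_minus:
  fixes f :: "'a::euclidean_space \<Rightarrow> real"
  assumes "f absolutely_integrable_on S"
  shows "(\<lambda>x. - f x) absolutely_integrable_on S"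
  using absolutely_integrable_scaleR_left[OF assms, of "-1"] by simp

text \<open>\<open>w\<close> is an approximate solution: exact at the outer ends, with defects at
  most \<open>\<rho>\<close> at the node and in L1 inside each arc. The defects accumulate linearly
  in time; the factor 2 counts those at the node and those inside. The second-order condition
  \<open>w3\<close> makes the error of one backward Euler step of order \<open>h\<^sup>2\<close>, so
  \<open>A\<close> disappears from the estimate as the step shrinks.\<close>

lemma parabolic_stability:
  fixes w wx wxx wt :: "nat \<Rightarrow> real \<Rightarrow> real \<Rightarrow> real" and \<rho> T :: real
  assumes fin: "finite (In \<union> Out)" and disj: "In \<inter> Out = {}"
    and K: "\<And>i j. i \<in> In \<union> Out \<Longrightarrow> j \<in> In \<union> Out \<Longrightarrow> K i j \<ge> 0"
    and Ks: "\<And>i j. i \<in> In \<union> Out \<Longrightarrow> j \<in> In \<union> Out \<Longrightarrow> K i j = K j i"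
    and L: "\<And>i. i \<in> In \<union> Out \<Longrightarrow> L i > 0" and eps: "\<epsilon> > 0"
    and lam: "\<And>i. i \<in> In \<union> Out \<Longrightarrow> lam i > 0"
    and par: "parabolic_solution In Out L lam K B \<epsilon> v u"
    and w1: "\<And>i t x. i \<in> In \<union> Out \<Longrightarrow> t \<ge> 0 \<Longrightarrow> x \<in> {0..L i} \<Longrightarrow> (w i t has_real_derivative wx i t x) (at x within {0..L i})"
    and w2: "\<And>i t x. i \<in> In \<union> Out \<Longrightarrow> t \<ge> 0 \<Longrightarrow> x \<in> {0..L i} \<Longrightarrow> (wx i t has_real_derivative wxx i t x) (at x within {0..L i})"
    and wxxc: "\<And>i t. i \<in> In \<union> Out \<Longrightarrow> t \<ge> 0 \<Longrightarrow> continuous_on {0..L i} (wxx i t)"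
    and wtc: "\<And>i t. i \<in> In \<union> Out \<Longrightarrow> t \<ge> 0 \<Longrightarrow> continuous_on {0..L i} (wt i t)"
    and w3: "\<And>i s t x. i \<in> In \<union> Out \<Longrightarrow> s \<ge> 0 \<Longrightarrow> t \<ge> 0 \<Longrightarrow> x \<in> {0..L i} \<Longrightarrow> \<bar>w i s x - w i t x - (s - t) * wt i t x\<bar> \<le> A * (s - t)\<^sup>2"
    and win: "\<And>i t. i \<in> In \<Longrightarrow> t > 0 \<Longrightarrow> w i t 0 = B i"
    and wout: "\<And>i t. i \<in> Out \<Longrightarrow> t > 0 \<Longrightarrow> w i t (L i) = boundary_trace (edge L i) (v i) (L i)"
    and wnode: "\<And>i t. i \<in> In \<union> Out \<Longrightarrow> t > 0 \<Longrightarrow>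
       \<bar>beta In i * (\<epsilon> * wx i t (node In L i) - lam i * w i t (node In L i))
         - (\<Sum>j\<in>In \<union> Out. K i j * (w j t (node In L j) - w i t (node In L i)))\<bar> \<le> \<rho>"
    and wres: "\<And>i t. i \<in> In \<union> Out \<Longrightarrow> t \<ge> 0 \<Longrightarrow> L1_norm {0..L i} (\<lambda>x. wt i t x + lam i * wx i t x - \<epsilon> * wxx i t x) \<le> \<rho>"
    and T: "T \<ge> 0"
  shows "(\<Sum>i\<in>In \<union> Out. L1_norm (edge L i) (\<lambda>x. u i (x, T) - w i T x))
     \<le> (\<Sum>i\<in>In \<union> Out. L1_norm (edge L i) (\<lambda>x. v i x - w i 0 x)) + 2 * real (card (In \<union> Out)) * \<rho> * T"
proof -
  let ?M = "In \<union> Out"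
  have W: "\<And>i t. i \<in> ?M \<Longrightarrow> t \<ge> 0 \<Longrightarrow> W21 (edge L i) (\<lambda>x. u i (x, t))"
    and ex: "\<exists>u\<^sub>t. \<forall>i\<in>In \<union> Out.
        (\<forall>t\<ge>0. u\<^sub>t i t absolutely_integrable_on edge L i) \<and>
        time_derivative (L1_norm (edge L i)) (\<lambda>t x. u i (x, t)) (u\<^sub>t i) \<and>
        time_continuous (L1_norm (edge L i)) (u\<^sub>t i) \<and>
        (\<forall>t>0. AE x in lebesgue. x \<in> edge L i \<longrightarrow>
           u\<^sub>t i t x = - lam i * Dx (edge L i) (\<lambda>x. u i (x, t)) x
                      + \<epsilon> * Dx (edge L i) (Dx (edge L i) (\<lambda>x. u i (x, t))) x)"
    and init: "\<And>i. i \<in> ?M \<Longrightarrow> AE x in lebesgue. x \<in> edge L i \<longrightarrow> u i (x, 0) = v i x"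
    and trans: "\<And>t. t > 0 \<Longrightarrow> transmission_condition In Out L lam K \<epsilon> (\<lambda>i x. u i (x, t))"
    and bin: "\<And>t i. t > 0 \<Longrightarrow> i \<in> In \<Longrightarrow> boundary_trace (edge L i) (\<lambda>x. u i (x, t)) 0 = B i"
    and bout: "\<And>t i. t > 0 \<Longrightarrow> i \<in> Out \<Longrightarrow> boundary_trace (edge L i) (\<lambda>x. u i (x, t)) (L i) = boundary_trace (edge L i) (v i) (L i)"
    using par unfolding parabolic_solution_def by blast+
  obtain ut where ut: "\<forall>i\<in>In \<union> Out.
        (\<forall>t\<ge>0. ut i t absolutely_integrable_on edge L i) \<and>
        time_derivative (L1_norm (edge L i)) (\<lambda>t x. u i (x, t)) (ut i) \<and>
        time_continuous (L1_norm (edge L i)) (ut i) \<and>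
        (\<forall>t>0. AE x in lebesgue. x \<in> edge L i \<longrightarrow>
           ut i t x = - lam i * Dx (edge L i) (\<lambda>x. u i (x, t)) x
                      + \<epsilon> * Dx (edge L i) (Dx (edge L i) (\<lambda>x. u i (x, t))) x)"
    using ex by (elim exE) (rule that)
  have uti: "ut i t absolutely_integrable_on edge L i" if "i \<in> ?M" "t \<ge> 0" for i t using ut that by blast
  have utd: "((\<lambda>s. L1_norm (edge L i) (\<lambda>x. (u i (x, s) - u i (x, t)) / (s - t) - ut i t x)) \<longlongrightarrow> 0) (at t within {0..})"
    if "i \<in> ?M" "t \<ge> 0" for i t
    using ut that unfolding time_derivative_def by blast
  have ute: "AE x in lebesgue. x \<in> edge L i \<longrightarrow>
           ut i t x = - lam i * Dx (edge L i) (\<lambda>x. u i (x, t)) x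
                      + \<epsilon> * Dx (edge L i) (Dx (edge L i) (\<lambda>x. u i (x, t))) x"
    if "i \<in> ?M" "t > 0" for i t using ut that by blast
  have ui: "(\<lambda>x. u i (x, t)) absolutely_integrable_on edge L i" if "i \<in> ?M" "t \<ge> 0" for i t
    using W[OF that] unfolding W21_def weak_deriv_def by blast
  have wc: "continuous_on {0..L i} (w i t)" "continuous_on {0..L i} (wx i t)" if "i \<in> ?M" "t \<ge> 0" for i t
  proof -
    show "continuous_on {0..L i} (w i t)" by (rule DERIV_continuous_on) (rule w1[OF that])
    show "continuous_on {0..L i} (wx i t)" by (rule DERIV_continuous_on) (rule w2[OF that])
  qed
  have wi: "w i t absolutely_integrable_on edge L i" "wt i t absolutely_integrable_on edge L i"
     if "i \<in> ?M" "t \<ge> 0" for i t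
    by (intro absolutely_integrable_continuous_Ioo wc(1) wtc that)+
  define r where "r = (\<lambda>i t x. wt i t x + lam i * wx i t x - \<epsilon> * wxx i t x)"
  have ri: "r i t absolutely_integrable_on edge L i" if "i \<in> ?M" "t \<ge> 0" for i t
    unfolding r_def by (intro absolutely_integrable_continuous_Ioo continuous_intros wc(2)[OF that] wtc[OF that] wxxc[OF that])
  define q where "q = (\<lambda>i t s. L1_norm (edge L i) (\<lambda>x. (u i (x, s) - u i (x, t)) / (s - t) - ut i t x))"
  define N where "N = (\<lambda>t. \<Sum>i\<in>?M. L1_norm (edge L i) (\<lambda>x. u i (x, t) - w i t x))"
  have diff_u: "L1_norm (edge L i) (\<lambda>x. u i (x, s) - u i (x, t) - (s - t) * ut i t x) = \<bar>s - t\<bar> * q i t s"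
    if "s \<noteq> t" for i s t
  proof -
    have "(\<lambda>x. u i (x, s) - u i (x, t) - (s - t) * ut i t x) = (\<lambda>x. (s - t) * ((u i (x, s) - u i (x, t)) / (s - t) - ut i t x))"
    proof
      have "(s - t) * (a / (s - t)) = a" for a using that by simp
      then show "u i (x, s) - u i (x, t) - (s - t) * ut i t x = (s - t) * ((u i (x, s) - u i (x, t)) / (s - t) - ut i t x)" for x
        unfolding right_diff_distrib[of "s - t" "_ / _"] by simp
    qed
    then show ?thesis unfolding q_def by (simp only: L1_norm_cmult)
  qed
  have ii: "(\<lambda>x. u i (x, s) - u i (x, t) - (s - t) * ut i t x) absolutely_integrable_on edge L i"
     "(\<lambda>x. w i s x - w i t x - (s - t) * wt i t x) absolutely_integrable_on edge L i"
     "(\<lambda>x. u i (x, t) - w i t x) absolutely_integrable_on edge L i"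
    if "i \<in> ?M" "s \<ge> 0" "t \<ge> 0" for i s t
    using ui[OF that(1,2)] ui[OF that(1,3)] uti[OF that(1,3)] wi[OF that(1,2)] wi[OF that(1,3)]
    by (intro set_integral_diff(1) set_integrable_mult_right; simp)+
  have diff_w: "L1_norm (edge L i) (\<lambda>x. w i s x - w i t x - (s - t) * wt i t x) \<le> A * (s - t)\<^sup>2 * L i"
    if "i \<in> ?M" "s \<ge> 0" "t \<ge> 0" for i s t
  proof -
    have "L1_norm {0..L i} (\<lambda>x. w i s x - w i t x - (s - t) * wt i t x) \<le> A * (s - t)\<^sup>2 * measure lebesgue {0..L i}"
      by (rule L1_norm_le_const) (use w3[OF that] in \<open>auto intro!: AE_I2\<close>)
    then show ?thesis using L[OF that(1)] by (simp add: L1_norm_Ioo_Icc)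
  qed
  have cont: "continuous_on {0..T} N"
    unfolding continuous_on_def
  proof
    fix t assume t: "t \<in> {0..T}"
    then have t0: "t \<ge> 0" by simp
    have "((\<lambda>s. L1_norm (edge L i) (\<lambda>x. u i (x, s) - w i s x)) \<longlongrightarrow> L1_norm (edge L i) (\<lambda>x. u i (x, t) - w i t x)) (at t within {0..})"
      if i: "i \<in> ?M" for i
    proof -
      \<comment> \<open>A modulus of continuity in time: the remainders of the two first-order
        expansions plus the contribution of the difference of the time derivatives.\<close>
      define Q where "Q = (\<lambda>s. \<bar>s - t\<bar> * q i t s + A * (s - t)\<^sup>2 * L i + \<bar>s - t\<bar> * L1_norm (edge L i) (\<lambda>x. ut i t x - wt i t x))"
      have "(Q \<longlongrightarrow> \<bar>t - t\<bar> * 0 + A * (t - t)\<^sup>2 * L i + \<bar>t - t\<bar> * L1_norm (edge L i) (\<lambda>x. ut i t x - wt i t x)) (at t within {0..})"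
        unfolding Q_def q_def by (intro tendsto_intros utd[OF i t0])
      then have Q0: "(Q \<longlongrightarrow> 0) (at t within {0..})" by simp
      have bound: "norm (L1_norm (edge L i) (\<lambda>x. u i (x, s) - w i s x) - L1_norm (edge L i) (\<lambda>x. u i (x, t) - w i t x)) \<le> Q s"
        if s: "s \<ge> 0" "s \<noteq> t" for s
      proof -
        note I = ii[OF i s(1) t0] ii(3)[OF i t0 s(1)]
        have J: "(\<lambda>x. ut i t x - wt i t x) absolutely_integrable_on edge L i" by (intro set_integral_diff(1) uti wi i t0)
        have e: "(\<lambda>x. (u i (x, s) - w i s x) - (u i (x, t) - w i t x)) = (\<lambda>x. ((u i (x, s) - u i (x, t) - (s - t) * ut i t x)
           + - (w i s x - w i t x - (s - t) * wt i t x)) + (s - t) * (ut i t x - wt i t x))"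
          by (auto simp: algebra_simps)
        have "L1_norm (edge L i) (\<lambda>x. (u i (x, s) - w i s x) - (u i (x, t) - w i t x)) \<le>
          L1_norm (edge L i) (\<lambda>x. (u i (x, s) - u i (x, t) - (s - t) * ut i t x) + - (w i s x - w i t x - (s - t) * wt i t x))
            + L1_norm (edge L i) (\<lambda>x. (s - t) * (ut i t x - wt i t x))"
          unfolding e using I J
          by (intro L1_norm_triangle set_integral_add(1) set_integrable_mult_right absolutely_integrable_minus) auto
        also have "\<dots> \<le> (L1_norm (edge L i) (\<lambda>x. u i (x, s) - u i (x, t) - (s - t) * ut i t x) +
            L1_norm (edge L i) (\<lambda>x. - (w i s x - w i t x - (s - t) * wt i t x)))
            + L1_norm (edge L i) (\<lambda>x. (s - t) * (ut i t x - wt i t x))"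
          using I by (intro add_right_mono L1_norm_triangle absolutely_integrable_minus) auto
        also have "\<dots> \<le> Q s"
          unfolding Q_def L1_norm_minus L1_norm_cmult diff_u[OF s(2)] using diff_w[OF i s(1) t0] by simp
        finally have d: "L1_norm (edge L i) (\<lambda>x. (u i (x, s) - w i s x) - (u i (x, t) - w i t x)) \<le> Q s" .
        have "L1_norm (edge L i) (\<lambda>x. u i (x, s) - w i s x) \<le> L1_norm (edge L i) (\<lambda>x. (u i (x, s) - w i s x) - (u i (x, t) - w i t x)) + L1_norm (edge L i) (\<lambda>x. u i (x, t) - w i t x)"
          using L1_norm_triangle[OF set_integral_diff(1)[OF I(4) I(3)] I(3)] by simp
        moreover have "L1_norm (edge L i) (\<lambda>x. u i (x, t) - w i t x) \<le> L1_norm (edge L i) (\<lambda>x. (u i (x, t) - w i t x) - (u i (x, s) - w i s x)) + L1_norm (edge L i) (\<lambda>x. u i (x, s) - w i s x)"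
          using L1_norm_triangle[OF set_integral_diff(1)[OF I(3) I(4)] I(4)] by simp
        ultimately show ?thesis
          using d L1_norm_diff_commute[of "edge L i" "\<lambda>x. u i (x, t) - w i t x" "\<lambda>x. u i (x, s) - w i s x"]
          unfolding real_norm_def by linarith
      qed
      have "((\<lambda>s. L1_norm (edge L i) (\<lambda>x. u i (x, s) - w i s x) - L1_norm (edge L i) (\<lambda>x. u i (x, t) - w i t x)) \<longlongrightarrow> 0) (at t within {0..})"
        by (rule Lim_null_comparison[OF _ Q0]) (use bound in \<open>auto simp: eventually_at intro!: exI[of _ 1]\<close>)
      then show ?thesis by (simp only: LIM_zero_iff)
    qed
    then have "(N \<longlongrightarrow> N t) (at t within {0..})" unfolding N_def by (rule tendsto_sum)
    then show "(N \<longlongrightarrow> N t) (at t within {0..T})" by (rule tendsto_within_subset) auto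
  qed
  have step: "N t \<le> N (t - h) + h * (\<Sum>i\<in>?M. q i t (t - h)) + A * h\<^sup>2 * (\<Sum>i\<in>?M. L i) + h * (2 * real (card ?M) * \<rho>)"
    if t: "0 < t" and h: "0 < h" "h \<le> t" for t h
  proof -
    have t0: "t \<ge> 0" and s0: "t - h \<ge> 0" using t h by auto
    have "\<forall>i\<in>?M. \<exists>F Y. (\<forall>x\<in>{0..L i}. (F has_real_derivative Y x) (at x within {0..L i})) \<and>
       continuous_on {0..L i} Y \<and>
       (\<forall>x\<in>{0..L i}. Y x = Y 0 + integral {0..x} (Dx (edge L i) (Dx (edge L i) (\<lambda>x. u i (x, t))))) \<and>
       Dx (edge L i) (Dx (edge L i) (\<lambda>x. u i (x, t))) absolutely_integrable_on {0..L i} \<and>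
       (\<lambda>x. u i (x, t)) absolutely_integrable_on edge L i \<and> Dx (edge L i) (\<lambda>x. u i (x, t)) absolutely_integrable_on edge L i \<and>
       (AE x in lebesgue. x \<in> edge L i \<longrightarrow> u i (x, t) = F x) \<and>
       (AE x in lebesgue. x \<in> edge L i \<longrightarrow> Dx (edge L i) (\<lambda>x. u i (x, t)) x = Y x)"
      using W21_representative[OF W L] t0 by simp
    then obtain F Y where FY: "\<forall>i\<in>?M. (\<forall>x\<in>{0..L i}. (F i has_real_derivative Y i x) (at x within {0..L i})) \<and>
       continuous_on {0..L i} (Y i) \<and>
       (\<forall>x\<in>{0..L i}. Y i x = Y i 0 + integral {0..x} (Dx (edge L i) (Dx (edge L i) (\<lambda>x. u i (x, t))))) \<and>
       Dx (edge L i) (Dx (edge L i) (\<lambda>x. u i (x, t))) absolutely_integrable_on {0..L i} \<and>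
       (\<lambda>x. u i (x, t)) absolutely_integrable_on edge L i \<and> Dx (edge L i) (\<lambda>x. u i (x, t)) absolutely_integrable_on edge L i \<and>
       (AE x in lebesgue. x \<in> edge L i \<longrightarrow> u i (x, t) = F i x) \<and>
       (AE x in lebesgue. x \<in> edge L i \<longrightarrow> Dx (edge L i) (\<lambda>x. u i (x, t)) x = Y i x)"
      unfolding bchoice_iff by (elim exE) (rule that)
    define D2 where "D2 = (\<lambda>i. Dx (edge L i) (Dx (edge L i) (\<lambda>x. u i (x, t))))"
    have F: "\<And>x. x \<in> {0..L i} \<Longrightarrow> (F i has_real_derivative Y i x) (at x within {0..L i})"
      and Yc: "continuous_on {0..L i} (Y i)"
      and YD: "\<And>x. x \<in> {0..L i} \<Longrightarrow> Y i x = Y i 0 + integral {0..x} (D2 i)"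
      and D2i: "D2 i absolutely_integrable_on {0..L i}"
      and Di: "Dx (edge L i) (\<lambda>x. u i (x, t)) absolutely_integrable_on edge L i"
      and aF: "AE x in lebesgue. x \<in> edge L i \<longrightarrow> u i (x, t) = F i x"
      and aY: "AE x in lebesgue. x \<in> edge L i \<longrightarrow> Dx (edge L i) (\<lambda>x. u i (x, t)) x = Y i x"
      if "i \<in> ?M" for i
      using FY that unfolding D2_def by blast+
    have Fc: "continuous_on {0..L i} (F i)" if "i \<in> ?M" for i by (rule DERIV_continuous_on) (rule F[OF that])
    have trF: "at_node In L (\<lambda>i x. u i (x, t)) i = F i (node In L i)"
      "at_node In L (\<lambda>k. Dx (edge L k) (\<lambda>x. u k (x, t))) i = Y i (node In L i)" if "i \<in> ?M" for i
      using boundary_trace_edge[OF L[OF that] ui[OF that t0] aF[OF that] Fc[OF that]]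
        boundary_trace_edge[OF L[OF that] Di[OF that] aY[OF that] Yc[OF that]]
      by (auto simp: at_node_def node_def)
    define Z ZY H where "Z = (\<lambda>i x. F i x - w i t x)" and "ZY = (\<lambda>i x. Y i x - wx i t x)"
      and "H = (\<lambda>i x. D2 i x - wxx i t x)"
    \<comment> \<open>\<open>u\<close> satisfies the node condition exactly, so the defect of the
      difference is minus that of \<open>w\<close>.\<close>
    define \<rho>' where "\<rho>' = (\<lambda>i. - (beta In i * (\<epsilon> * wx i t (node In L i) - lam i * w i t (node In L i))
         - (\<Sum>j\<in>?M. K i j * (w j t (node In L j) - w i t (node In L i)))))"
    have "(\<Sum>i\<in>?M. L1_norm {0..L i} (Z i)) \<le>
       (\<Sum>i\<in>?M. L1_norm {0..L i} (\<lambda>x. Z i x - h * (\<epsilon> * H i x - lam i * ZY i x))) + h * (\<Sum>i\<in>?M. \<bar>\<rho>' i\<bar>)"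
    proof (rule network_accretive[OF fin disj K Ks L])
      show "(Z i has_real_derivative ZY i x) (at x within {0..L i})" if "i \<in> ?M" "x \<in> {0..L i}" for i x
        unfolding Z_def ZY_def by (intro DERIV_diff F w1 that t0)
      have wxxi: "wxx i t absolutely_integrable_on {0..L i}" if "i \<in> ?M" for i
        by (intro absolutely_integrable_continuous_real wxxc that t0)
      show "H i absolutely_integrable_on {0..L i}" if "i \<in> ?M" for i
        unfolding H_def by (intro set_integral_diff(1) D2i wxxi that)
      show "ZY i x = ZY i 0 + integral {0..x} (H i)" if i: "i \<in> ?M" and x: "x \<in> {0..L i}" for i x
      proof -
        have sub: "{0..x} \<subseteq> {0..L i}" using x by auto
        have "(wxx i t has_integral (wx i t x - wx i t 0)) {0..x}"
        proof (rule fundamental_theorem_of_calculus)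
          show "0 \<le> x" using x by simp
          show "(wx i t has_vector_derivative wxx i t y) (at y within {0..x})" if "y \<in> {0..x}" for y
            using DERIV_subset[OF w2[OF i t0, of y] sub] that x
            by (simp add: has_real_derivative_iff_has_vector_derivative)
        qed
        moreover have "D2 i integrable_on {0..x}"
          by (rule set_lebesgue_integral_eq_integral(1)[OF set_integrable_subset[OF D2i[OF i] _ sub]]) simp
        ultimately have "integral {0..x} (H i) = integral {0..x} (D2 i) - (wx i t x - wx i t 0)"
          unfolding H_def by (subst integral_diff) (auto simp: has_integral_iff)
        then show ?thesis unfolding ZY_def using YD[OF i x] by linarith
      qed
      show "Z i 0 = 0" if "i \<in> In" for i
      proof -
        have i: "i \<in> ?M" using that by simp
        show ?thesis
          using boundary_trace_edge(1)[OF L[OF i] ui[OF i t0] aF[OF i] Fc[OF i]] bin[OF t that] win[OF that t]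
          by (simp add: Z_def)
      qed
      show "Z i (L i) = 0" if "i \<in> Out" for i
      proof -
        have i: "i \<in> ?M" using that by simp
        show ?thesis
          using boundary_trace_edge(2)[OF L[OF i] ui[OF i t0] aF[OF i] Fc[OF i]] bout[OF t that] wout[OF that t]
          by (simp add: Z_def)
      qed
      show "beta In i * (\<epsilon> * ZY i (node In L i) - lam i * Z i (node In L i))
       = (\<Sum>j\<in>?M. K i j * (Z j (node In L j) - Z i (node In L i))) + \<rho>' i" if i: "i \<in> ?M" for i
      proof -
        have "beta In i * (- lam i * F i (node In L i) + \<epsilon> * Y i (node In L i))
          = (\<Sum>j\<in>?M. K i j * (F j (node In L j) - F i (node In L i)))"
          using trans[OF t] i trF unfolding transmission_condition_def by simp
        moreover have "(\<Sum>j\<in>?M. K i j * (Z j (node In L j) - Z i (node In L i))) =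
          (\<Sum>j\<in>?M. K i j * (F j (node In L j) - F i (node In L i))) - (\<Sum>j\<in>?M. K i j * (w j t (node In L j) - w i t (node In L i)))"
          unfolding Z_def sum_subtractf[symmetric] by (rule sum.cong) (simp_all add: algebra_simps)
        ultimately show ?thesis unfolding \<rho>'_def ZY_def Z_def by (simp add: algebra_simps)
      qed
    qed (use eps lam h in \<open>auto simp: less_imp_le\<close>)
    moreover have "(\<Sum>i\<in>?M. \<bar>\<rho>' i\<bar>) \<le> real (card ?M) * \<rho>"
    proof -
      have "(\<Sum>i\<in>?M. \<bar>\<rho>' i\<bar>) \<le> (\<Sum>i\<in>?M. \<rho>)"
        by (rule sum_mono) (use wnode[OF _ t] in \<open>simp add: \<rho>'_def abs_minus_commute\<close>)
      then show ?thesis by simp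
    qed
    moreover have "N t = (\<Sum>i\<in>?M. L1_norm {0..L i} (Z i))"
      unfolding N_def
    proof (rule sum.cong[OF refl])
      fix i assume i: "i \<in> ?M"
      have "L1_norm (edge L i) (\<lambda>x. u i (x, t) - w i t x) = L1_norm (edge L i) (Z i)"
        by (rule L1_norm_cong_AE) (use aF[OF i] in \<open>auto simp: Z_def elim!: eventually_mono\<close>)
      then show "L1_norm (edge L i) (\<lambda>x. u i (x, t) - w i t x) = L1_norm {0..L i} (Z i)" by (simp add: L1_norm_Ioo_Icc)
    qed
    moreover have "(\<Sum>i\<in>?M. L1_norm {0..L i} (\<lambda>x. Z i x - h * (\<epsilon> * H i x - lam i * ZY i x))) \<le>
       (\<Sum>i\<in>?M. L1_norm (edge L i) (\<lambda>x. u i (x, t - h) - w i (t - h) x) + h * q i t (t - h) + A * h\<^sup>2 * L i + h * \<rho>)"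
    proof (rule sum_mono)
      fix i assume i: "i \<in> ?M"
      let ?a = "\<lambda>x. u i (x, t - h) - w i (t - h) x"
      let ?b = "\<lambda>x. u i (x, t - h) - u i (x, t) - ((t - h) - t) * ut i t x"
      let ?c = "\<lambda>x. w i (t - h) x - w i t x - ((t - h) - t) * wt i t x"
      let ?d = "\<lambda>x. h * r i t x"
      \<comment> \<open>The backward Euler step. By the equation for \<open>u\<close> at time
        \<open>t\<close> and the definition of \<open>r\<close>, the resolvent side is the
        difference \<open>u - w\<close> at time \<open>t - h\<close>, up to the two expansion
        remainders and \<open>h\<close> times the defect of \<open>w\<close>.\<close>
      have ae: "AE x in lebesgue. x \<in> edge L i \<longrightarrow>
         Z i x - h * (\<epsilon> * H i x - lam i * ZY i x) = ((?a x + - ?b x) + ?c x) + - ?d x"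
        using aF[OF i] aY[OF i] ute[OF i t]
      proof eventually_elim
        case (elim x)
        show ?case
        proof
          assume x: "x \<in> edge L i"
          then have e: "ut i t x = - lam i * Y i x + \<epsilon> * D2 i x" "u i (x, t) = F i x" using elim by (simp_all add: D2_def)
          show "Z i x - h * (\<epsilon> * H i x - lam i * ZY i x) = ((?a x + - ?b x) + ?c x) + - ?d x"
            unfolding Z_def H_def ZY_def r_def e by (simp add: algebra_simps)
        qed
      qed
      note I = ii(3)[OF i s0 s0] ii(1,2)[OF i s0 t0] set_integrable_mult_right[OF ri[OF i t0], of h]
      have "L1_norm {0..L i} (\<lambda>x. Z i x - h * (\<epsilon> * H i x - lam i * ZY i x)) = L1_norm (edge L i) (\<lambda>x. ((?a x + - ?b x) + ?c x) + - ?d x)"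
        unfolding L1_norm_Ioo_Icc[symmetric] by (rule L1_norm_cong_AE[OF ae])
      also have "\<dots> \<le> L1_norm (edge L i) (\<lambda>x. (?a x + - ?b x) + ?c x) + L1_norm (edge L i) (\<lambda>x. - ?d x)"
        using I by (intro L1_norm_triangle set_integral_add(1) absolutely_integrable_minus) auto
      also have "\<dots> \<le> (L1_norm (edge L i) (\<lambda>x. ?a x + - ?b x) + L1_norm (edge L i) ?c) + L1_norm (edge L i) (\<lambda>x. - ?d x)"
        using I by (intro add_right_mono L1_norm_triangle set_integral_add(1) absolutely_integrable_minus) auto
      also have "\<dots> \<le> ((L1_norm (edge L i) ?a + L1_norm (edge L i) (\<lambda>x. - ?b x)) + L1_norm (edge L i) ?c) + L1_norm (edge L i) (\<lambda>x. - ?d x)"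
        using I by (intro add_right_mono L1_norm_triangle absolutely_integrable_minus) auto
      also have "\<dots> \<le> L1_norm (edge L i) ?a + h * q i t (t - h) + A * h\<^sup>2 * L i + h * \<rho>"
      proof -
        have "L1_norm (edge L i) (\<lambda>x. - ?b x) = h * q i t (t - h)"
          unfolding L1_norm_minus using diff_u[of "t - h" t i] h by simp
        moreover have "L1_norm (edge L i) ?c \<le> A * h\<^sup>2 * L i" using diff_w[OF i s0 t0] by simp
        moreover have "L1_norm (edge L i) (\<lambda>x. - ?d x) \<le> h * \<rho>"
          unfolding L1_norm_minus L1_norm_cmult using h wres[OF i t0] by (simp add: r_def L1_norm_Ioo_Icc)
        ultimately show ?thesis by linarith
      qed
      finally show "L1_norm {0..L i} (\<lambda>x. Z i x - h * (\<epsilon> * H i x - lam i * ZY i x)) \<le>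
         L1_norm (edge L i) ?a + h * q i t (t - h) + A * h\<^sup>2 * L i + h * \<rho>" .
    qed
    moreover have "\<dots> = N (t - h) + h * (\<Sum>i\<in>?M. q i t (t - h)) + A * h\<^sup>2 * (\<Sum>i\<in>?M. L i) + h * (real (card ?M) * \<rho>)"
      unfolding N_def sum.distrib by (simp add: sum_distrib_left)
    moreover have "h * (2 * real (card ?M) * \<rho>) = h * (real (card ?M) * \<rho>) + h * (real (card ?M) * \<rho>)" by simp
    moreover have "h * (\<Sum>i\<in>?M. \<bar>\<rho>' i\<bar>) \<le> h * (real (card ?M) * \<rho>)"
      using \<open>(\<Sum>i\<in>?M. \<bar>\<rho>' i\<bar>) \<le> real (card ?M) * \<rho>\<close> h by (intro mult_left_mono) auto
    ultimately show ?thesis by linarith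
  qed
  have "N T \<le> N 0 + (2 * real (card ?M) * \<rho>) * T"
  proof (rule left_dini_growth[OF cont T])
    fix t e :: real assume t: "0 < t" "t \<le> T" and e: "0 < e"
    \<comment> \<open>The remainders in \<open>step\<close> divided by the step length; they vanish
      as \<open>s\<close> tends to \<open>t\<close>.\<close>
    define Q where "Q = (\<lambda>s. (\<Sum>i\<in>?M. q i t s) + A * (t - s) * (\<Sum>i\<in>?M. L i))"
    have "(Q \<longlongrightarrow> (\<Sum>i\<in>?M. 0) + A * (t - t) * (\<Sum>i\<in>?M. L i)) (at t within {0..})"
      unfolding Q_def q_def using t by (intro tendsto_intros utd) auto
    then have "(Q \<longlongrightarrow> 0) (at t within {0..})" by simp
    then have "eventually (\<lambda>s. Q s < e) (at t within {0..})" using e by (rule order_tendstoD(2))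
    then obtain d where d: "d > 0" "\<And>s. s \<in> {0..} \<Longrightarrow> s \<noteq> t \<Longrightarrow> dist s t < d \<Longrightarrow> Q s < e"
      unfolding eventually_at by auto
    show "\<exists>d>0. \<forall>h. 0 < h \<and> h < d \<and> h \<le> t \<longrightarrow> N t - N (t - h) \<le> h * (2 * real (card ?M) * \<rho> + e)"
    proof (intro exI[of _ d] conjI allI impI d(1))
      fix h assume h: "0 < h \<and> h < d \<and> h \<le> t"
      have "Q (t - h) < e" using h by (intro d(2)) (auto simp: dist_real_def)
      then have "h * Q (t - h) \<le> h * e" using h by simp
      moreover have "h * Q (t - h) = h * (\<Sum>i\<in>?M. q i t (t - h)) + A * h\<^sup>2 * (\<Sum>i\<in>?M. L i)"
        by (simp add: Q_def distrib_left power2_eq_square)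
      ultimately show "N t - N (t - h) \<le> h * (2 * real (card ?M) * \<rho> + e)"
        using step[of t h] t h by (simp add: distrib_left)
    qed
  qed
  moreover have "N 0 = (\<Sum>i\<in>?M. L1_norm (edge L i) (\<lambda>x. v i x - w i 0 x))"
    unfolding N_def
    by (intro sum.cong refl L1_norm_cong_AE) (use init in \<open>auto elim!: eventually_mono\<close>)
  ultimately show ?thesis unfolding N_def by simp
qed

section \<open>Boundary layers\<close>

text \<open>The solution of \<epsilon> w'' = a w' with w = 0 at 0 and w = 1 at L.\<close>

definition layer :: "real \<Rightarrow> real \<Rightarrow> real \<Rightarrow> real \<Rightarrow> real" where
  "layer \<epsilon> a L x = (exp (a * (x - L) / \<epsilon>) - exp (- (a * L / \<epsilon>))) / (1 - exp (- (a * L / \<epsilon>)))"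

definition layer_dx :: "real \<Rightarrow> real \<Rightarrow> real \<Rightarrow> real \<Rightarrow> real" where
  "layer_dx \<epsilon> a L x = a / \<epsilon> * (exp (a * (x - L) / \<epsilon>) / (1 - exp (- (a * L / \<epsilon>))))"

text \<open>The layer is shifted and renormalised so as to be exactly 0 at the left end. This is the
  resulting correction of the slopes at both ends, exponentially small in
  \<open>1 / \<epsilon>\<close>.\<close>

definition layer_tail :: "real \<Rightarrow> real \<Rightarrow> real \<Rightarrow> real" where
  "layer_tail \<epsilon> a L = exp (- (a * L / \<epsilon>)) / (1 - exp (- (a * L / \<epsilon>)))"

context
  fixes \<epsilon> a L :: real
  assumes eps: "\<epsilon> > 0" and a: "a > 0" and L: "L > 0"
begin

lemma layer_denominator: "1 - exp (- (a * L / \<epsilon>)) > 0"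
  using eps a L by simp

lemma layer_tail_nonneg: "layer_tail \<epsilon> a L \<ge> 0"
  using layer_denominator by (simp add: layer_tail_def)

lemma DERIV_layer: "(layer \<epsilon> a L has_real_derivative layer_dx \<epsilon> a L x) (at x)"
  unfolding layer_def[abs_def] layer_dx_def using eps layer_denominator
  by (auto intro!: derivative_eq_intros)

lemma DERIV_layer_dx: "(layer_dx \<epsilon> a L has_real_derivative a / \<epsilon> * layer_dx \<epsilon> a L x) (at x)"
  unfolding layer_dx_def[abs_def] using eps layer_denominator
  by (auto intro!: derivative_eq_intros)

lemma layer_bounds:
  assumes x: "x \<in> {0..L}"
  shows "0 \<le> layer \<epsilon> a L x" "layer \<epsilon> a L x \<le> 1"
proof -
  have "- (a * L / \<epsilon>) \<le> a * (x - L) / \<epsilon>" using x eps a by (simp add: field_simps)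
  then show "0 \<le> layer \<epsilon> a L x" unfolding layer_def using layer_denominator by simp
  have "a * (x - L) / \<epsilon> \<le> 0" using x eps a by (simp add: divide_nonpos_pos mult_nonneg_nonpos)
  then show "layer \<epsilon> a L x \<le> 1" unfolding layer_def using layer_denominator by simp
qed

lemma layer_ends: "layer \<epsilon> a L 0 = 0" "layer \<epsilon> a L L = 1"
  unfolding layer_def using layer_denominator by auto

lemma layer_dx_ends:
  "\<epsilon> * layer_dx \<epsilon> a L 0 = a * layer_tail \<epsilon> a L" "\<epsilon> * layer_dx \<epsilon> a L L = a + a * layer_tail \<epsilon> a L"
proof -
  define d where "d = exp (- (a * L / \<epsilon>))"
  have d: "1 - d > 0" using layer_denominator by (simp add: d_def)
  show "\<epsilon> * layer_dx \<epsilon> a L 0 = a * layer_tail \<epsilon> a L"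
    unfolding layer_dx_def layer_tail_def using eps by simp
  have "\<epsilon> * layer_dx \<epsilon> a L L = a * (1 / (1 - d))"
    unfolding layer_dx_def d_def[symmetric] using eps by simp
  also have "1 / (1 - d) = 1 + d / (1 - d)" using d by (simp add: field_simps)
  finally show "\<epsilon> * layer_dx \<epsilon> a L L = a + a * layer_tail \<epsilon> a L"
    unfolding layer_tail_def d_def[symmetric] by (simp add: distrib_left)
qed

lemma L1_norm_layer: "L1_norm {0..L} (layer \<epsilon> a L) \<le> \<epsilon> / a"
proof -
  let ?\<delta> = "exp (- (a * L / \<epsilon>))"
  have c: "continuous_on {0..L} (layer \<epsilon> a L)"
    by (rule DERIV_continuous_on) (rule has_field_derivative_at_within[OF DERIV_layer])
  have "((\<lambda>x. exp (a * (x - L) / \<epsilon>)) has_integral (\<epsilon> / a * exp (a * (L - L) / \<epsilon>) - \<epsilon> / a * exp (a * (0 - L) / \<epsilon>))) {0..L}"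
  proof (rule fundamental_theorem_of_calculus)
    show "((\<lambda>x. \<epsilon> / a * exp (a * (x - L) / \<epsilon>)) has_vector_derivative exp (a * (x - L) / \<epsilon>)) (at x within {0..L})" for x
      unfolding has_real_derivative_iff_has_vector_derivative[symmetric]
      using eps a by (auto intro!: derivative_eq_intros)
  qed (use L in simp)
  then have "((\<lambda>x. exp (a * (x - L) / \<epsilon>) - ?\<delta>) has_integral (\<epsilon> / a * (1 - ?\<delta>) - L * ?\<delta>)) {0..L}"
    using has_integral_diff[OF _ has_integral_const_real[of ?\<delta> 0 L]] L by (simp add: right_diff_distrib)
  then have "((\<lambda>x. (exp (a * (x - L) / \<epsilon>) - ?\<delta>) / (1 - ?\<delta>)) has_integral (\<epsilon> / a * (1 - ?\<delta>) - L * ?\<delta>) / (1 - ?\<delta>)) {0..L}"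
    by (rule has_integral_divide)
  then have "integral {0..L} (layer \<epsilon> a L) = (\<epsilon> / a * (1 - ?\<delta>) - L * ?\<delta>) / (1 - ?\<delta>)"
    unfolding layer_def[abs_def] by (rule integral_unique)
  also have "\<dots> \<le> (\<epsilon> / a * (1 - ?\<delta>)) / (1 - ?\<delta>)"
    using layer_denominator L by (intro divide_right_mono) auto
  also have "\<dots> = \<epsilon> / a"
    by (rule nonzero_mult_div_cancel_right[OF less_imp_neq[OF layer_denominator, THEN not_sym]])
  finally have "integral {0..L} (layer \<epsilon> a L) \<le> \<epsilon> / a" .
  moreover have "integral {0..L} (\<lambda>x. \<bar>layer \<epsilon> a L x\<bar>) = integral {0..L} (layer \<epsilon> a L)"
    by (rule integral_cong) (use layer_bounds in auto)
  ultimately show ?thesis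
    using L1_norm_eq_integral[OF absolutely_integrable_continuous_real[OF c]] by simp
qed

end

lemma layer_tail_tendsto:
  assumes "\<And>n. \<epsilon> n > 0" "\<epsilon> \<longlonglongrightarrow> 0" "a > 0" "L > 0"
  shows "(\<lambda>n. layer_tail (\<epsilon> n) a L) \<longlonglongrightarrow> 0"
proof -
  have "filterlim \<epsilon> (at_right 0) sequentially"
    using assms(2) by (auto simp: filterlim_at assms(1) less_imp_neq[OF assms(1), symmetric] intro!: always_eventually)
  then have "filterlim (\<lambda>n. a * L / \<epsilon> n) at_top sequentially"
    using assms by (intro LIM_at_top_divide[OF tendsto_const]) (auto simp: filterlim_at)
  then have "filterlim (\<lambda>n. - (a * L / \<epsilon> n)) at_bot sequentially"
    by (simp add: filterlim_uminus_at_top)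
  then have "(\<lambda>n. exp (- (a * L / \<epsilon> n))) \<longlonglongrightarrow> 0"
    by (rule filterlim_compose[OF exp_at_bot])
  then have "(\<lambda>n. exp (- (a * L / \<epsilon> n)) / (1 - exp (- (a * L / \<epsilon> n)))) \<longlonglongrightarrow> 0 / (1 - 0)"
    by (intro tendsto_intros) auto
  then show ?thesis by (simp add: layer_tail_def)
qed

section \<open>Convergence for smooth profiles\<close>

text \<open>One mean value step and the Lipschitz bound of \<open>p'\<close>; hence the constant
  \<open>C\<close> rather than \<open>C / 2\<close>.\<close>

lemma C2_taylor:
  fixes p :: "real \<Rightarrow> real"
  assumes p: "\<And>x. (p has_real_derivative p' x) (at x)" and p': "\<And>x. (p' has_real_derivative p'' x) (at x)"
    and b: "\<And>x. \<bar>p'' x\<bar> \<le> C"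
  shows "\<bar>p (y + h) - p y - h * p' y\<bar> \<le> C * h\<^sup>2"
proof -
  have lip: "\<bar>p' z - p' y\<bar> \<le> C * \<bar>z - y\<bar>" for z y
    using field_differentiable_bound[of UNIV p' p'' C z y] has_field_derivative_at_within[OF p'] b by auto
  have "\<exists>z. \<bar>z - y\<bar> \<le> \<bar>h\<bar> \<and> p (y + h) - p y = h * p' z"
  proof (cases "h = 0")
    case False
    then consider "y < y + h" | "y + h < y" by linarith
    then show ?thesis
    proof cases
      case 1
      then obtain z where "z > y" "z < y + h" "p (y + h) - p y = (y + h - y) * p' z"
        using MVT2[of y "y + h" p p'] p by auto
      then show ?thesis by (intro exI[of _ z]) auto
    next
      case 2
      then obtain z where z: "z > y + h" "z < y" "p y - p (y + h) = (y - (y + h)) * p' z"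
        using MVT2[of "y + h" y p p'] p by auto
      then show ?thesis by (intro exI[of _ z]) auto
    qed
  qed auto
  then obtain z where z: "\<bar>z - y\<bar> \<le> \<bar>h\<bar>" "p (y + h) - p y = h * p' z" by blast
  have C: "C \<ge> 0" using b[of 0] by linarith
  have "\<bar>p (y + h) - p y - h * p' y\<bar> = \<bar>h\<bar> * \<bar>p' z - p' y\<bar>"
    unfolding z(2) abs_mult[symmetric] by (simp add: right_diff_distrib)
  also have "\<dots> \<le> \<bar>h\<bar> * (C * \<bar>h\<bar>)"
    using lip[of z y] mult_left_mono[OF z(1) C] by (intro mult_left_mono) auto
  also have "\<dots> = C * h\<^sup>2" by (simp add: power2_eq_square abs_mult_self_eq[of h, symmetric] del: abs_mult_self_eq)
  finally show ?thesis .
qed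

text \<open>\<open>w\<close> adds to the travelling profile a layer at \<open>x = L i\<close> with
  amplitude \<open>c i t\<close>. On an incoming arc the amplitude lifts the transported value to
  the node value \<open>nv i t\<close>, on an outgoing arc to the value prescribed at the outer end.
  By \<open>balIn\<close> and \<open>balOut\<close> the fluxes of the profiles satisfy the limiting
  node system exactly, so the defects consist of terms of order \<open>\<epsilon>\<close> and of
  layer tails.\<close>

lemma ansatz_estimate:
  fixes P P1 P2 c c1 :: "nat \<Rightarrow> real \<Rightarrow> real" and T C \<epsilon> :: real
  assumes fin: "finite (In \<union> Out)" and disj: "In \<inter> Out = {}"
    and K: "\<And>i j. i \<in> In \<union> Out \<Longrightarrow> j \<in> In \<union> Out \<Longrightarrow> K i j \<ge> 0"
    and Ks: "\<And>i j. i \<in> In \<union> Out \<Longrightarrow> j \<in> In \<union> Out \<Longrightarrow> K i j = K j i"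
    and L: "\<And>i. i \<in> In \<union> Out \<Longrightarrow> L i > 0" and eps: "\<epsilon> > 0"
    and lam: "\<And>i. i \<in> In \<union> Out \<Longrightarrow> lam i > 0"
    and par: "parabolic_solution In Out L lam K B \<epsilon> v u"
    and vi: "\<And>i. i \<in> In \<union> Out \<Longrightarrow> v i absolutely_integrable_on edge L i"
    and P1: "\<And>i x. i \<in> In \<union> Out \<Longrightarrow> (P i has_real_derivative P1 i x) (at x)"
    and P2: "\<And>i x. i \<in> In \<union> Out \<Longrightarrow> (P1 i has_real_derivative P2 i x) (at x)"
    and P2c: "\<And>i. i \<in> In \<union> Out \<Longrightarrow> continuous_on UNIV (P2 i)"
    and Pb: "\<And>i x. i \<in> In \<union> Out \<Longrightarrow> \<bar>P1 i x\<bar> \<le> C" "\<And>i x. i \<in> In \<union> Out \<Longrightarrow> \<bar>P2 i x\<bar> \<le> C"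
    and PIn: "\<And>i y. i \<in> In \<Longrightarrow> y \<le> 0 \<Longrightarrow> P i y = B i"
    and cb: "\<And>i t. i \<in> In \<union> Out \<Longrightarrow> t \<ge> 0 \<Longrightarrow> \<bar>c i t\<bar> \<le> C" "\<And>i t. i \<in> In \<union> Out \<Longrightarrow> t \<ge> 0 \<Longrightarrow> \<bar>c1 i t\<bar> \<le> C"
    and ct: "\<And>i s t. i \<in> In \<union> Out \<Longrightarrow> s \<ge> 0 \<Longrightarrow> t \<ge> 0 \<Longrightarrow> \<bar>c i s - c i t - (s - t) * c1 i t\<bar> \<le> C * (s - t)\<^sup>2"
    and cOut: "\<And>i t. i \<in> Out \<Longrightarrow> t \<ge> 0 \<Longrightarrow> P i (L i - lam i * t) + c i t = boundary_trace (edge L i) (v i) (L i)"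
    and nv: "\<And>i t. i \<in> In \<Longrightarrow> t \<ge> 0 \<Longrightarrow> P i (L i - lam i * t) + c i t = nv i t"
      "\<And>i t. i \<in> Out \<Longrightarrow> t \<ge> 0 \<Longrightarrow> P i (- lam i * t) = nv i t"
    and balIn: "\<And>i t. i \<in> In \<Longrightarrow> t \<ge> 0 \<Longrightarrow> - lam i * P i (L i - lam i * t) = (\<Sum>j\<in>In \<union> Out. K i j * (nv j t - nv i t))"
    and balOut: "\<And>i t. i \<in> Out \<Longrightarrow> t \<ge> 0 \<Longrightarrow> lam i * nv i t = (\<Sum>j\<in>In \<union> Out. K i j * (nv j t - nv i t))"
    and T: "T \<ge> 0"
  shows "(\<Sum>i\<in>In \<union> Out. L1_norm (edge L i) (\<lambda>x. u i (x, T) - P i (x - lam i * T)))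
     \<le> (\<Sum>i\<in>In \<union> Out. L1_norm (edge L i) (\<lambda>x. v i x - P i x)) + 2 * (\<Sum>i\<in>In \<union> Out. C * \<epsilon> / lam i)
       + 2 * real (card (In \<union> Out)) * (\<Sum>i\<in>In \<union> Out. C * \<epsilon> / lam i + \<epsilon> * C * L i + \<epsilon> * C + C * lam i * layer_tail \<epsilon> (lam i) (L i)) * T"
proof -
  let ?M = "In \<union> Out"
  define E where "E = (\<lambda>i. layer \<epsilon> (lam i) (L i))"
  define Ex where "Ex = (\<lambda>i. layer_dx \<epsilon> (lam i) (L i))"
  define w where "w = (\<lambda>i t x. P i (x - lam i * t) + c i t * E i x)"
  define wx where "wx = (\<lambda>i t x. P1 i (x - lam i * t) + c i t * Ex i x)"
  define wxx where "wxx = (\<lambda>i t x. P2 i (x - lam i * t) + c i t * (lam i / \<epsilon> * Ex i x))"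
  define wt where "wt = (\<lambda>i t x. - lam i * P1 i (x - lam i * t) + c1 i t * E i x)"
  define \<kappa> where "\<kappa> = (\<lambda>i. layer_tail \<epsilon> (lam i) (L i))"
  \<comment> \<open>In order: the time derivative of the amplitude times the L1 norm of the layer,
    the viscous term of the profile inside the arc, its viscous flux at the node, and the layer tail
    in the node flux. The sum bounds the defects of both kinds.\<close>
  define \<rho>i where "\<rho>i = (\<lambda>i. C * \<epsilon> / lam i + \<epsilon> * C * L i + \<epsilon> * C + C * lam i * \<kappa> i)"
  define \<rho> where "\<rho> = (\<Sum>i\<in>?M. \<rho>i i)"
  have C0: "C \<ge> 0" if "i \<in> ?M" for i using Pb(1)[OF that, of 0] by linarith
  have \<kappa>0: "\<kappa> i \<ge> 0" if "i \<in> ?M" for i unfolding \<kappa>_def by (rule layer_tail_nonneg[OF eps lam[OF that] L[OF that]])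
  have \<rho>i0: "\<rho>i i \<ge> 0" if "i \<in> ?M" for i
    unfolding \<rho>i_def using C0[OF that] eps lam[OF that] L[OF that] \<kappa>0[OF that]
    by (intro add_nonneg_nonneg mult_nonneg_nonneg divide_nonneg_nonneg) auto
  have \<rho>ge: "\<rho>i i \<le> \<rho>" if "i \<in> ?M" for i
    unfolding \<rho>_def using that \<rho>i0 fin by (intro member_le_sum) auto
  have Ed: "(E i has_real_derivative Ex i x) (at x)" "(Ex i has_real_derivative lam i / \<epsilon> * Ex i x) (at x)"
    if "i \<in> ?M" for i x
    unfolding E_def Ex_def by (rule DERIV_layer[OF eps lam[OF that] L[OF that]], rule DERIV_layer_dx[OF eps lam[OF that] L[OF that]])
  have Eb: "0 \<le> E i x" "E i x \<le> 1" if "i \<in> ?M" "x \<in> {0..L i}" for i x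
    unfolding E_def by (rule layer_bounds[OF eps lam[OF that(1)] L[OF that(1)] that(2)])+
  have Ee: "E i 0 = 0" "E i (L i) = 1" "\<epsilon> * Ex i 0 = lam i * \<kappa> i" "\<epsilon> * Ex i (L i) = lam i + lam i * \<kappa> i" if "i \<in> ?M" for i
    unfolding E_def Ex_def \<kappa>_def
    by (rule layer_ends[OF eps lam[OF that] L[OF that]] layer_dx_ends[OF eps lam[OF that] L[OF that]])+
  have EL1: "L1_norm {0..L i} (E i) \<le> \<epsilon> / lam i" if "i \<in> ?M" for i
    unfolding E_def by (rule L1_norm_layer[OF eps lam[OF that] L[OF that]])
  have Ec: "continuous_on A (E i)" "continuous_on A (Ex i)" if "i \<in> ?M" for i A
    by (rule DERIV_continuous_on, rule has_field_derivative_at_within[OF Ed(1)[OF that]])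
      (rule DERIV_continuous_on, rule has_field_derivative_at_within[OF Ed(2)[OF that]])
  have Pc: "continuous_on A (P i)" "continuous_on A (P1 i)" if "i \<in> ?M" for i A
    by (rule DERIV_continuous_on, rule has_field_derivative_at_within[OF P1[OF that]])
      (rule DERIV_continuous_on, rule has_field_derivative_at_within[OF P2[OF that]])
  have sh: "((\<lambda>x. x - b) has_real_derivative 1) (at x)" for b x :: real by (auto intro!: derivative_eq_intros)
  have wd: "(w i t has_real_derivative wx i t x) (at x)" if "i \<in> ?M" for i t x
    unfolding w_def wx_def using DERIV_chain2[OF P1[OF that] sh] by (intro DERIV_add DERIV_cmult Ed that) simp
  have wxd: "(wx i t has_real_derivative wxx i t x) (at x)" if "i \<in> ?M" for i t x
    unfolding wxx_def wx_def using DERIV_chain2[OF P2[OF that] sh] by (intro DERIV_add DERIV_cmult Ed that) simp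
  have PL1: "L1_norm (edge L i) (\<lambda>x. w i t x - P i (x - lam i * t)) \<le> C * \<epsilon> / lam i" if i: "i \<in> ?M" and t: "t \<ge> 0" for i t
  proof -
    have "L1_norm (edge L i) (\<lambda>x. w i t x - P i (x - lam i * t)) = \<bar>c i t\<bar> * L1_norm {0..L i} (E i)"
      by (simp add: w_def L1_norm_cmult L1_norm_Ioo_Icc)
    also have "\<dots> \<le> C * (\<epsilon> / lam i)" using cb(1)[OF i t] EL1[OF i] C0[OF i] by (intro mult_mono L1_norm_nonneg) auto
    finally show ?thesis by simp
  qed
  \<comment> \<open>The profile moves with speed \<open>lam i\<close>, so its expansion in time
    carries the square of the speed; the amplitude contributes \<open>C\<close> because the layer is
    at most 1.\<close>
  define A where "A = (\<Sum>i\<in>?M. C * (lam i)\<^sup>2 + C)"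
  have Age: "C * (lam i)\<^sup>2 + C \<le> A" if "i \<in> ?M" for i
    unfolding A_def using that C0 fin by (intro member_le_sum add_nonneg_nonneg mult_nonneg_nonneg) auto
  have main: "(\<Sum>i\<in>?M. L1_norm (edge L i) (\<lambda>x. u i (x, T) - w i T x))
     \<le> (\<Sum>i\<in>?M. L1_norm (edge L i) (\<lambda>x. v i x - w i 0 x)) + 2 * real (card ?M) * \<rho> * T"
  proof (rule parabolic_stability[OF fin disj K Ks L eps lam par, where wx = wx and wxx = wxx and wt = wt and A = A])
    show "(w i t has_real_derivative wx i t x) (at x within {0..L i})" if "i \<in> ?M" for i t x
      by (rule has_field_derivative_at_within[OF wd[OF that]])
    show "(wx i t has_real_derivative wxx i t x) (at x within {0..L i})" if "i \<in> ?M" for i t x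
      by (rule has_field_derivative_at_within[OF wxd[OF that]])
    show "continuous_on {0..L i} (wxx i t)" if "i \<in> ?M" for i t
      unfolding wxx_def by (intro continuous_intros continuous_on_compose2[OF P2c[OF that]] Ec that) auto
    show "continuous_on {0..L i} (wt i t)" if "i \<in> ?M" for i t
      unfolding wt_def by (intro continuous_intros continuous_on_compose2[OF Pc(2)[OF that, of UNIV]] Ec that) auto
    show "\<bar>w i s x - w i t x - (s - t) * wt i t x\<bar> \<le> A * (s - t)\<^sup>2"
      if i: "i \<in> ?M" and st: "s \<ge> 0" "t \<ge> 0" and x: "x \<in> {0..L i}" for i s t x
    proof -
      let ?h = "- lam i * (s - t)"
      have sx: "x - lam i * s = (x - lam i * t) + ?h" by (simp add: algebra_simps)
      have "w i s x - w i t x - (s - t) * wt i t x = (P i ((x - lam i * t) + ?h) - P i (x - lam i * t) - ?h * P1 i (x - lam i * t))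
         + (c i s - c i t - (s - t) * c1 i t) * E i x"
        unfolding w_def wt_def sx by (simp add: algebra_simps)
      also have "\<bar>\<dots>\<bar> \<le> C * ?h\<^sup>2 + C * (s - t)\<^sup>2 * 1"
      proof (rule order_trans[OF abs_triangle_ineq add_mono])
        show "\<bar>P i ((x - lam i * t) + ?h) - P i (x - lam i * t) - ?h * P1 i (x - lam i * t)\<bar> \<le> C * ?h\<^sup>2"
          by (rule C2_taylor[OF P1[OF i] P2[OF i] Pb(2)[OF i]])
        show "\<bar>(c i s - c i t - (s - t) * c1 i t) * E i x\<bar> \<le> C * (s - t)\<^sup>2 * 1"
          unfolding abs_mult using ct[OF i st] Eb[OF i x] C0[OF i] by (intro mult_mono) auto
      qed
      also have "\<dots> = (C * (lam i)\<^sup>2 + C) * (s - t)\<^sup>2" by (simp only: power_mult_distrib power2_minus) (simp add: algebra_simps)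
      also have "\<dots> \<le> A * (s - t)\<^sup>2" by (intro mult_right_mono Age i) simp
      finally show ?thesis .
    qed
    show "w i t 0 = B i" if i: "i \<in> In" and t: "t > 0" for i t
      using PIn[OF i, of "- (lam i * t)"] lam[of i] i t Ee(1)[of i] by (simp add: w_def)
    show "w i t (L i) = boundary_trace (edge L i) (v i) (L i)" if i: "i \<in> Out" and t: "t > 0" for i t
      using cOut[OF i, of t] t i Ee(2)[of i] by (simp add: w_def)
    show "\<bar>beta In i * (\<epsilon> * wx i t (node In L i) - lam i * w i t (node In L i))
         - (\<Sum>j\<in>?M. K i j * (w j t (node In L j) - w i t (node In L i)))\<bar> \<le> \<rho>" if i: "i \<in> ?M" and t: "t > 0" for i t
    proof -
      have wn: "w j t (node In L j) = nv j t" if "j \<in> ?M" for j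
        using nv(1)[of j t] nv(2)[of j t] Ee(1,2)[OF that] that t disj
        by (cases "j \<in> In") (auto simp: w_def node_def)
      have S: "(\<Sum>j\<in>?M. K i j * (w j t (node In L j) - w i t (node In L i))) = (\<Sum>j\<in>?M. K i j * (nv j t - nv i t))"
        using i by (intro sum.cong refl) (simp add: wn)
      have b: "\<bar>\<epsilon> * P1 i y + c i t * (lam i * \<kappa> i)\<bar> \<le> \<rho>" for y
      proof -
        have "\<bar>\<epsilon> * P1 i y + c i t * (lam i * \<kappa> i)\<bar> \<le> \<epsilon> * C + C * (lam i * \<kappa> i)"
        proof (rule order_trans[OF abs_triangle_ineq add_mono])
          show "\<bar>\<epsilon> * P1 i y\<bar> \<le> \<epsilon> * C" using Pb(1)[OF i, of y] eps by (simp add: abs_mult)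
          show "\<bar>c i t * (lam i * \<kappa> i)\<bar> \<le> C * (lam i * \<kappa> i)"
            using cb(1)[OF i, of t] t lam[OF i] \<kappa>0[OF i] by (simp add: abs_mult mult_right_mono)
        qed
        also have "\<dots> \<le> \<rho>i i" unfolding \<rho>i_def using C0[OF i] eps lam[OF i] L[OF i] by simp
        finally show ?thesis using \<rho>ge[OF i] by linarith
      qed
      show ?thesis
      proof (cases "i \<in> In")
        case True
        \<comment> \<open>The leading part \<open>c i t * lam i\<close> of the viscous flux of the
          layer cancels its transport flux; what remains to leading order is the flux of the
          travelling profile alone.\<close>
        have "\<epsilon> * wx i t (L i) - lam i * w i t (L i) = \<epsilon> * P1 i (L i - lam i * t) + c i t * (\<epsilon> * Ex i (L i)) - lam i * P i (L i - lam i * t) - lam i * c i t"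
          unfolding wx_def w_def Ee(2)[OF i] by (simp add: algebra_simps)
        also have "\<dots> = (\<epsilon> * P1 i (L i - lam i * t) + c i t * (lam i * \<kappa> i)) + (\<Sum>j\<in>?M. K i j * (nv j t - nv i t))"
          unfolding Ee(4)[OF i] balIn[OF True less_imp_le[OF t], symmetric] by (simp add: algebra_simps)
        finally show ?thesis unfolding S using True b by (simp add: beta_def node_def)
      next
        case False
        then have o: "i \<in> Out" using i by auto
        have "\<epsilon> * wx i t 0 - lam i * w i t 0 = \<epsilon> * P1 i (- lam i * t) + c i t * (\<epsilon> * Ex i 0) - lam i * P i (- lam i * t)"
          unfolding wx_def w_def Ee(1)[OF i] by (simp add: algebra_simps)
        also have "\<dots> = (\<epsilon> * P1 i (- lam i * t) + c i t * (lam i * \<kappa> i)) - (\<Sum>j\<in>?M. K i j * (nv j t - nv i t))"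
          unfolding Ee(3)[OF i] nv(2)[OF o less_imp_le[OF t]] balOut[OF o less_imp_le[OF t]] by simp
        finally have e: "\<epsilon> * wx i t 0 - lam i * w i t 0 = (\<epsilon> * P1 i (- lam i * t) + c i t * (lam i * \<kappa> i)) - (\<Sum>j\<in>?M. K i j * (nv j t - nv i t))" .
        show ?thesis unfolding S using False e b[of "- lam i * t"] by (simp add: beta_def node_def abs_minus_commute)
      qed
    qed
    show "L1_norm {0..L i} (\<lambda>x. wt i t x + lam i * wx i t x - \<epsilon> * wxx i t x) \<le> \<rho>" if i: "i \<in> ?M" and t: "t \<ge> 0" for i t
    proof -
      have e: "(\<lambda>x. wt i t x + lam i * wx i t x - \<epsilon> * wxx i t x) = (\<lambda>x. c1 i t * E i x + (- \<epsilon>) * P2 i (x - lam i * t))"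
        unfolding wt_def wx_def wxx_def using eps by (auto simp: algebra_simps)
      have Pc2: "continuous_on {0..L i} (\<lambda>x. P2 i (x - lam i * t))"
        by (intro continuous_intros continuous_on_compose2[OF P2c[OF i]]) auto
      have "L1_norm {0..L i} (\<lambda>x. c1 i t * E i x + (- \<epsilon>) * P2 i (x - lam i * t)) \<le>
         L1_norm {0..L i} (\<lambda>x. c1 i t * E i x) + L1_norm {0..L i} (\<lambda>x. (- \<epsilon>) * P2 i (x - lam i * t))"
        by (intro L1_norm_triangle absolutely_integrable_continuous_real continuous_intros Ec(1)[OF i] Pc2)
      also have "\<dots> \<le> C * (\<epsilon> / lam i) + \<epsilon> * (C * L i)"
      proof (rule add_mono)
        show "L1_norm {0..L i} (\<lambda>x. c1 i t * E i x) \<le> C * (\<epsilon> / lam i)"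
          unfolding L1_norm_cmult using cb(2)[OF i t] EL1[OF i] C0[OF i] by (intro mult_mono L1_norm_nonneg) auto
        have "L1_norm {0..L i} (\<lambda>x. P2 i (x - lam i * t)) \<le> C * measure lebesgue {0..L i}"
          by (rule L1_norm_le_const) (use Pb(2)[OF i] in \<open>auto intro!: AE_I2\<close>)
        then show "L1_norm {0..L i} (\<lambda>x. (- \<epsilon>) * P2 i (x - lam i * t)) \<le> \<epsilon> * (C * L i)"
          unfolding L1_norm_cmult using eps L[OF i] by simp
      qed
      also have "\<dots> \<le> \<rho>i i" unfolding \<rho>i_def using C0[OF i] eps lam[OF i] L[OF i] \<kappa>0[OF i] by simp
      finally show ?thesis unfolding e using \<rho>ge[OF i] by linarith
    qed
  qed (use T in auto)
  have ui: "(\<lambda>x. u i (x, T)) absolutely_integrable_on edge L i" if "i \<in> ?M" for i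
    using par that T unfolding parabolic_solution_def W21_def weak_deriv_def by blast
  have wi: "w i t absolutely_integrable_on edge L i" if "i \<in> ?M" for i t
    by (rule absolutely_integrable_continuous_Ioo, rule DERIV_continuous_on, rule has_field_derivative_at_within[OF wd[OF that]])
  have Pi: "(\<lambda>x. P i (x - lam i * t)) absolutely_integrable_on edge L i" if "i \<in> ?M" for i t
    by (intro absolutely_integrable_continuous_Ioo continuous_intros continuous_on_compose2[OF Pc(1)[OF that, of UNIV]]) auto
  have "(\<Sum>i\<in>?M. L1_norm (edge L i) (\<lambda>x. u i (x, T) - P i (x - lam i * T)))
     \<le> (\<Sum>i\<in>?M. L1_norm (edge L i) (\<lambda>x. u i (x, T) - w i T x) + C * \<epsilon> / lam i)"
  proof (rule sum_mono)
    fix i assume i: "i \<in> ?M"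
    show "L1_norm (edge L i) (\<lambda>x. u i (x, T) - P i (x - lam i * T)) \<le> L1_norm (edge L i) (\<lambda>x. u i (x, T) - w i T x) + C * \<epsilon> / lam i"
      using L1_norm_triangle_diff[OF ui[OF i] wi[OF i] Pi[OF i], of T T] PL1[OF i T] by linarith
  qed
  moreover have "(\<Sum>i\<in>?M. L1_norm (edge L i) (\<lambda>x. v i x - w i 0 x))
     \<le> (\<Sum>i\<in>?M. L1_norm (edge L i) (\<lambda>x. v i x - P i x) + C * \<epsilon> / lam i)"
  proof (rule sum_mono)
    fix i assume i: "i \<in> ?M"
    show "L1_norm (edge L i) (\<lambda>x. v i x - w i 0 x) \<le> L1_norm (edge L i) (\<lambda>x. v i x - P i x) + C * \<epsilon> / lam i"
      using L1_norm_triangle_diff[OF vi[OF i] Pi[OF i, of 0] wi[OF i, of 0]] PL1[OF i, of 0]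
        L1_norm_diff_commute[of "edge L i" "\<lambda>x. P i x" "w i 0"] by simp
  qed
  ultimately show ?thesis using main unfolding \<rho>_def \<rho>i_def \<kappa>_def sum.distrib by linarith
qed

text \<open>All that depends on the regularity of \<open>P\<close> goes into \<open>X n\<close>,
  which tends to 0; what is left is the distance of the initial data, with factor 1 by contraction.
  \<open>X\<close> does not depend on \<open>t\<close>, as integration over time will demand. The
  uniform bound \<open>Db\<close> on the outer values keeps the layer amplitudes bounded in
  \<open>n\<close>.\<close>

lemma smooth_profile_estimate:
  fixes P P1 P2 :: "nat \<Rightarrow> real \<Rightarrow> real" and \<epsilon> :: "nat \<Rightarrow> real" and T Cp Db :: real
  assumes fin: "finite (In \<union> Out)" and disj: "In \<inter> Out = {}"
    and K: "\<And>i j. i \<in> In \<union> Out \<Longrightarrow> j \<in> In \<union> Out \<Longrightarrow> K i j \<ge> 0"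
    and Ks: "\<And>i j. i \<in> In \<union> Out \<Longrightarrow> j \<in> In \<union> Out \<Longrightarrow> K i j = K j i"
    and lam: "\<And>i. i \<in> In \<union> Out \<Longrightarrow> lam i > 0"
    and G: "\<And>i k. i \<in> In \<union> Out \<Longrightarrow> k \<in> In \<Longrightarrow>
      node_op (In \<union> Out) (\<lambda>i. if i \<in> In then 0 else lam i) K (\<lambda>i. G i k) i = (if i = k then 1 else 0)"
    and L: "\<And>i. i \<in> In \<union> Out \<Longrightarrow> L i > 0"
    and eps: "\<And>n. \<epsilon> n > 0" "\<epsilon> \<longlonglongrightarrow> 0"
    and par: "\<And>n. parabolic_solution In Out L lam K B (\<epsilon> n) (v n) (u n)"
    and vi: "\<And>n i. i \<in> In \<union> Out \<Longrightarrow> v n i absolutely_integrable_on edge L i"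
    and u0i: "\<And>i. i \<in> In \<union> Out \<Longrightarrow> u0 i absolutely_integrable_on edge L i"
    and vconv: "(\<lambda>n. \<Sum>i\<in>In \<union> Out. L1_norm (edge L i) (\<lambda>x. v n i x - u0 i x)) \<longlonglongrightarrow> 0"
    and Db: "\<And>n i. i \<in> Out \<Longrightarrow> \<bar>boundary_trace (edge L i) (v n i) (L i)\<bar> \<le> Db" "Db \<ge> 0"
    and P1: "\<And>i x. i \<in> In \<union> Out \<Longrightarrow> (P i has_real_derivative P1 i x) (at x)"
    and P2: "\<And>i x. i \<in> In \<union> Out \<Longrightarrow> (P1 i has_real_derivative P2 i x) (at x)"
    and P2c: "\<And>i. i \<in> In \<union> Out \<Longrightarrow> continuous_on UNIV (P2 i)"
    and Pb: "\<And>i x. i \<in> In \<union> Out \<Longrightarrow> \<bar>P i x\<bar> \<le> Cp" "\<And>i x. i \<in> In \<union> Out \<Longrightarrow> \<bar>P1 i x\<bar> \<le> Cp"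
       "\<And>i x. i \<in> In \<union> Out \<Longrightarrow> \<bar>P2 i x\<bar> \<le> Cp"
    and PIn: "\<And>i y. i \<in> In \<Longrightarrow> y \<le> 0 \<Longrightarrow> P i y = B i"
    and POut: "\<And>i t. i \<in> Out \<Longrightarrow> t \<ge> 0 \<Longrightarrow> P i (- lam i * t) = (\<Sum>k\<in>In. lam k * P k (L k - lam k * t) * G i k)"
    and T: "T \<ge> 0"
  shows "\<exists>X. X \<longlonglongrightarrow> 0 \<and> (\<forall>n. \<forall>t\<in>{0..T}. (\<Sum>i\<in>In \<union> Out. L1_norm (edge L i) (\<lambda>x. u n i (x, t) - P i (x - lam i * t)))
     \<le> (\<Sum>i\<in>In \<union> Out. L1_norm (edge L i) (\<lambda>x. u0 i x - P i x)) + X n)"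
proof (cases "In \<union> Out = {}")
  case True
  then show ?thesis by (intro exI[of _ "\<lambda>_. 0"]) auto
next
  case ne: False
  let ?M = "In \<union> Out"
  have Cp0: "Cp \<ge> 0" using ne Pb(1) abs_ge_zero order_trans by (metis all_not_in_conv)
  \<comment> \<open>By linearity these are the node values for the fluxes
    \<open>lam k * P k (L k - lam k * t)\<close> arriving at time \<open>t\<close>;
    \<open>nv1\<close> is the time derivative.\<close>
  define nv where "nv = (\<lambda>i t. \<Sum>k\<in>In. lam k * P k (L k - lam k * t) * G i k)"
  define nv1 where "nv1 = (\<lambda>i t. \<Sum>k\<in>In. lam k * (- lam k * P1 k (L k - lam k * t)) * G i k)"
  \<comment> \<open>The outer value of an outgoing arc depends on \<open>n\<close> but not on
    \<open>t\<close>, so the derivative \<open>c1\<close> is the same for all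
    \<open>n\<close>.\<close>
  define c where "c = (\<lambda>n i t. (if i \<in> In then nv i t else boundary_trace (edge L i) (v n i) (L i)) - P i (L i - lam i * t))"
  define c1 where "c1 = (\<lambda>i t. (if i \<in> In then nv1 i t else 0) + lam i * P1 i (L i - lam i * t))"
  \<comment> \<open>One factor dominating 1, \<open>lam i\<close> and its square, the powers of the
    speed in the travelling profile and its first two derivatives in time.\<close>
  define \<Lambda> where "\<Lambda> = (\<lambda>i. 1 + lam i + (lam i)\<^sup>2)"
  define S where "S = (\<lambda>i. \<Sum>k\<in>In. lam k * \<Lambda> k * Cp * \<bar>G i k\<bar>)"
  define C where "C = (\<Sum>i\<in>?M. S i + \<Lambda> i * Cp) + Db"
  have \<Lambda>: "1 \<le> \<Lambda> i" "lam i \<le> \<Lambda> i" "(lam i)\<^sup>2 \<le> \<Lambda> i" if "i \<in> ?M" for i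
    using lam[OF that] by (auto simp: \<Lambda>_def)
  have S0: "S i \<ge> 0" for i
    unfolding S_def using Cp0 lam \<Lambda> by (intro sum_nonneg mult_nonneg_nonneg) (auto simp: less_imp_le intro: order_trans[of 0 1])
  have C1: "S i + \<Lambda> i * Cp + Db \<le> C" if "i \<in> ?M" for i
  proof -
    have "S j + \<Lambda> j * Cp \<ge> 0" if "j \<in> ?M" for j
      using S0[of j] \<Lambda>(1)[OF that] Cp0 by (intro add_nonneg_nonneg mult_nonneg_nonneg) auto
    then have "S i + \<Lambda> i * Cp \<le> (\<Sum>i\<in>?M. S i + \<Lambda> i * Cp)" using that fin by (intro member_le_sum) auto
    then show ?thesis by (simp add: C_def)
  qed
  have C0: "C \<ge> 0"
  proof -
    obtain i where i: "i \<in> ?M" using ne by blast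
    have "0 \<le> \<Lambda> i * Cp" using \<Lambda>(1)[OF i] Cp0 by simp
    then show ?thesis using C1[OF i] S0[of i] Db(2) by linarith
  qed
  have Sb: "\<bar>\<Sum>k\<in>In. lam k * a k * G i k\<bar> \<le> S i * b" if a: "\<And>k. k \<in> In \<Longrightarrow> \<bar>a k\<bar> \<le> \<Lambda> k * Cp * b" for a i b
  proof -
    have "\<bar>\<Sum>k\<in>In. lam k * a k * G i k\<bar> \<le> (\<Sum>k\<in>In. \<bar>lam k * a k * G i k\<bar>)" by (rule sum_abs)
    also have "\<dots> \<le> (\<Sum>k\<in>In. lam k * \<Lambda> k * Cp * \<bar>G i k\<bar> * b)"
    proof (rule sum_mono)
      fix k assume k: "k \<in> In"
      then have "lam k > 0" using lam by simp
      have "\<bar>lam k * a k * G i k\<bar> = lam k * \<bar>a k\<bar> * \<bar>G i k\<bar>" using \<open>lam k > 0\<close> by (simp add: abs_mult)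
      also have "\<dots> \<le> lam k * (\<Lambda> k * Cp * b) * \<bar>G i k\<bar>"
        using a[OF k] \<open>lam k > 0\<close> by (intro mult_right_mono mult_left_mono) auto
      finally show "\<bar>lam k * a k * G i k\<bar> \<le> lam k * \<Lambda> k * Cp * \<bar>G i k\<bar> * b" by (simp add: mult_ac)
    qed
    finally show ?thesis by (simp add: S_def sum_distrib_right)
  qed
  have taylor: "\<bar>P i (L i - lam i * s) - P i (L i - lam i * t) - (s - t) * (- lam i * P1 i (L i - lam i * t))\<bar> \<le> \<Lambda> i * Cp * (s - t)\<^sup>2"
    if i: "i \<in> ?M" for i s t
  proof -
    let ?h = "- lam i * (s - t)"
    have "\<bar>P i ((L i - lam i * t) + ?h) - P i (L i - lam i * t) - ?h * P1 i (L i - lam i * t)\<bar> \<le> Cp * ?h\<^sup>2"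
      by (rule C2_taylor[OF P1[OF i] P2[OF i] Pb(3)[OF i]])
    also have "Cp * ?h\<^sup>2 = (lam i)\<^sup>2 * Cp * (s - t)\<^sup>2" by (simp only: power_mult_distrib power2_minus) simp
    also have "\<dots> \<le> \<Lambda> i * Cp * (s - t)\<^sup>2" using \<Lambda>(3)[OF i] Cp0 by (intro mult_right_mono) auto
    finally show ?thesis by (simp add: algebra_simps)
  qed
  have lamP: "\<bar>P i x\<bar> \<le> \<Lambda> i * Cp" "\<bar>lam i * P1 i x\<bar> \<le> \<Lambda> i * Cp" if i: "i \<in> ?M" for i x
  proof -
    have "Cp \<le> \<Lambda> i * Cp" using mult_right_mono[OF \<Lambda>(1)[OF i] Cp0] by simp
    then show "\<bar>P i x\<bar> \<le> \<Lambda> i * Cp" using Pb(1)[OF i, of x] by linarith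
    show "\<bar>lam i * P1 i x\<bar> \<le> \<Lambda> i * Cp"
      unfolding abs_mult using \<Lambda>(2)[OF i] lam[OF i] Pb(2)[OF i, of x] by (intro mult_mono) auto
  qed
  have cb: "\<bar>c n i t\<bar> \<le> C" if i: "i \<in> ?M" for n i t
  proof -
    have "\<bar>nv i t\<bar> \<le> S i * 1" unfolding nv_def by (rule Sb) (use lamP(1) in auto)
    then have "\<bar>if i \<in> In then nv i t else boundary_trace (edge L i) (v n i) (L i)\<bar> \<le> S i + Db"
      using Db(1)[of i n] Db(2) S0[of i] i by auto
    then show ?thesis unfolding c_def using lamP(1)[OF i, of "L i - lam i * t"] C1[OF i] by linarith
  qed
  have c1b: "\<bar>c1 i t\<bar> \<le> C" if i: "i \<in> ?M" for i t
  proof -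
    have "\<bar>nv1 i t\<bar> \<le> S i * 1" unfolding nv1_def by (rule Sb) (use lamP(2) in auto)
    then have "\<bar>if i \<in> In then nv1 i t else 0\<bar> \<le> S i" using S0[of i] by auto
    then show ?thesis unfolding c1_def using lamP(2)[OF i, of "L i - lam i * t"] C1[OF i] Db(2) by linarith
  qed
  have ct: "\<bar>c n i s - c n i t - (s - t) * c1 i t\<bar> \<le> C * (s - t)\<^sup>2" if i: "i \<in> ?M" for n i s t
  proof -
    have e: "nv i s - nv i t - (s - t) * nv1 i t =
        (\<Sum>k\<in>In. lam k * (P k (L k - lam k * s) - P k (L k - lam k * t) - (s - t) * (- lam k * P1 k (L k - lam k * t))) * G i k)"
      unfolding nv_def nv1_def sum_distrib_left sum_subtractf[symmetric] by (rule sum.cong) (simp_all add: algebra_simps)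
    have "\<bar>nv i s - nv i t - (s - t) * nv1 i t\<bar> \<le> S i * (s - t)\<^sup>2"
      unfolding e by (rule Sb) (use taylor in auto)
    moreover have "0 \<le> S i * (s - t)\<^sup>2" using S0[of i] by simp
    ultimately have "\<bar>c n i s - c n i t - (s - t) * c1 i t\<bar> \<le> S i * (s - t)\<^sup>2 + \<Lambda> i * Cp * (s - t)\<^sup>2"
      using taylor[OF i, of s t] unfolding c_def c1_def by (cases "i \<in> In") (simp_all add: algebra_simps abs_le_iff)
    also have "\<dots> = (S i + \<Lambda> i * Cp) * (s - t)\<^sup>2" by (simp add: distrib_right)
    also have "\<dots> \<le> C * (s - t)\<^sup>2" using C1[OF i] Db(2) by (intro mult_right_mono) auto
    finally show ?thesis .
  qed
  have bal: "(if i \<in> In then 0 else lam i) * nv i t + (\<Sum>j\<in>?M. K i j * (nv i t - nv j t)) = (if i \<in> In then lam i * P i (L i - lam i * t) else 0)"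
    if i: "i \<in> ?M" for i t
  proof -
    have fI: "finite In" using fin by simp
    have "node_op ?M (\<lambda>i. if i \<in> In then 0 else lam i) K (\<lambda>i. nv i t) i
      = (\<Sum>k\<in>In. lam k * P k (L k - lam k * t) * node_op ?M (\<lambda>i. if i \<in> In then 0 else lam i) K (\<lambda>i. G i k) i)"
      unfolding nv_def by (rule node_op_sum[OF fI])
    also have "\<dots> = (\<Sum>k\<in>In. if k = i then lam k * P k (L k - lam k * t) else 0)"
      using G[OF i] by (intro sum.cong refl) auto
    also have "\<dots> = (if i \<in> In then lam i * P i (L i - lam i * t) else 0)" using fI by simp
    finally show ?thesis unfolding node_op_def .
  qed
  have neg: "(\<Sum>j\<in>?M. K i j * (nv i t - nv j t)) = - (\<Sum>j\<in>?M. K i j * (nv j t - nv i t))" for i t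
    unfolding sum_negf[symmetric] by (rule sum.cong) (simp_all add: algebra_simps)
  have balIn: "- lam i * P i (L i - lam i * t) = (\<Sum>j\<in>?M. K i j * (nv j t - nv i t))" if "i \<in> In" for i t
    using bal[of i t] that neg[of i t] by simp
  have balOut: "lam i * nv i t = (\<Sum>j\<in>?M. K i j * (nv j t - nv i t))" if "i \<in> Out" for i t
  proof -
    have "i \<notin> In" using that disj by auto
    then show ?thesis using bal[of i t] that neg[of i t] by simp
  qed
  define R where "R = (\<lambda>n. \<Sum>i\<in>?M. C * \<epsilon> n / lam i + \<epsilon> n * C * L i + \<epsilon> n * C + C * lam i * layer_tail (\<epsilon> n) (lam i) (L i))"
  define X where "X = (\<lambda>n. (\<Sum>i\<in>?M. L1_norm (edge L i) (\<lambda>x. v n i x - u0 i x)) + 2 * (\<Sum>i\<in>?M. C * \<epsilon> n / lam i) + 2 * real (card ?M) * R n * T)"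
  have R0: "R n \<ge> 0" for n
    unfolding R_def using C0 eps(1)[of n] lam L layer_tail_nonneg[OF eps(1) lam L]
    by (intro sum_nonneg add_nonneg_nonneg mult_nonneg_nonneg divide_nonneg_nonneg) (auto simp: less_imp_le)
  have tl: "(\<lambda>n. layer_tail (\<epsilon> n) (lam i) (L i)) \<longlonglongrightarrow> 0" if "i \<in> ?M" for i
    by (rule layer_tail_tendsto[OF eps lam[OF that] L[OF that]])
  have "R \<longlonglongrightarrow> (\<Sum>i\<in>?M. C * 0 / lam i + 0 * C * L i + 0 * C + C * lam i * 0)"
    unfolding R_def using lam by (intro tendsto_intros eps(2) tl) (auto simp: less_imp_neq[THEN not_sym])
  then have "R \<longlonglongrightarrow> 0" by simp
  then have "X \<longlonglongrightarrow> 0 + 2 * (\<Sum>i\<in>?M. C * 0 / lam i) + 2 * real (card ?M) * 0 * T"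
    unfolding X_def using lam by (intro tendsto_intros eps(2) vconv) (auto simp: less_imp_neq[THEN not_sym])
  then have X0: "X \<longlonglongrightarrow> 0" by simp
  have Pi: "P i absolutely_integrable_on edge L i" if "i \<in> ?M" for i
    by (rule absolutely_integrable_continuous_Ioo, rule DERIV_continuous_on, rule has_field_derivative_at_within[OF P1[OF that]])
  have "(\<Sum>i\<in>?M. L1_norm (edge L i) (\<lambda>x. u n i (x, t) - P i (x - lam i * t)))
     \<le> (\<Sum>i\<in>?M. L1_norm (edge L i) (\<lambda>x. u0 i x - P i x)) + X n" if t: "t \<in> {0..T}" for n t
  proof -
    have t0: "t \<ge> 0" using t by simp
    have "(\<Sum>i\<in>?M. L1_norm (edge L i) (\<lambda>x. u n i (x, t) - P i (x - lam i * t)))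
     \<le> (\<Sum>i\<in>?M. L1_norm (edge L i) (\<lambda>x. v n i x - P i x)) + 2 * (\<Sum>i\<in>?M. C * \<epsilon> n / lam i)
       + 2 * real (card ?M) * R n * t"
      unfolding R_def
    proof (rule ansatz_estimate[where c = "c n" and ?c1.0 = c1 and nv = nv,
          OF fin disj K Ks L eps(1) lam par vi P1 P2 P2c _ _ PIn cb c1b ct _ _ _ balIn balOut t0])
      show "\<bar>P1 i x\<bar> \<le> C" if i: "i \<in> ?M" for i x
      proof -
        have "Cp \<le> \<Lambda> i * Cp" using mult_right_mono[OF \<Lambda>(1)[OF i] Cp0] by simp
        then show ?thesis using Pb(2)[OF i, of x] C1[OF i] S0[of i] Db(2) by linarith
      qed
      show "\<bar>P2 i x\<bar> \<le> C" if i: "i \<in> ?M" for i x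
      proof -
        have "Cp \<le> \<Lambda> i * Cp" using mult_right_mono[OF \<Lambda>(1)[OF i] Cp0] by simp
        then show ?thesis using Pb(3)[OF i, of x] C1[OF i] S0[of i] Db(2) by linarith
      qed
      show "P i (L i - lam i * t) + c n i t = boundary_trace (edge L i) (v n i) (L i)" if "i \<in> Out" for i t
        using that disj by (auto simp: c_def)
      show "P i (L i - lam i * t) + c n i t = nv i t" if "i \<in> In" for i t
        using that by (auto simp: c_def)
      show "P i (- lam i * t) = nv i t" if "i \<in> Out" "t \<ge> 0" for i t
        using POut[OF that] by (simp add: nv_def)
    qed
    moreover have "(\<Sum>i\<in>?M. L1_norm (edge L i) (\<lambda>x. v n i x - P i x)) \<le>
       (\<Sum>i\<in>?M. L1_norm (edge L i) (\<lambda>x. v n i x - u0 i x)) + (\<Sum>i\<in>?M. L1_norm (edge L i) (\<lambda>x. u0 i x - P i x))"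
      unfolding sum.distrib[symmetric] by (intro sum_mono L1_norm_triangle_diff vi u0i Pi)
    moreover have "2 * real (card ?M) * R n * t \<le> 2 * real (card ?M) * R n * T"
      using t R0[of n] by (intro mult_left_mono) auto
    ultimately show ?thesis unfolding X_def by linarith
  qed
  then show ?thesis using X0 by (intro exI[of _ X]) blast
qed

section \<open>From time slices to space-time integrals\<close>

lemma AE_lborel_pair_snd:
  assumes "N \<in> null_sets (lborel :: (real \<times> real) measure)"
  shows "AE t in lborel. AE x in lborel. (x, t) \<notin> N"
proof -
  have N: "N \<in> sets (lborel \<Otimes>\<^sub>M lborel)" "emeasure (lborel \<Otimes>\<^sub>M lborel) N = 0"
    using assms unfolding lborel_prod null_sets_def by auto
  have m: "(\<lambda>p. indicator N p :: ennreal) \<in> borel_measurable (lborel \<Otimes>\<^sub>M lborel)"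
    using N(1) by (rule borel_measurable_indicator)
  have "(\<integral>\<^sup>+ t. (\<integral>\<^sup>+ x. indicator N (x, t) \<partial>lborel) \<partial>lborel) = integral\<^sup>N (lborel \<Otimes>\<^sub>M lborel) (indicator N)"
    by (rule lborel_pair.nn_integral_snd[OF m])
  also have "\<dots> = 0" using N by simp
  finally have z: "(\<integral>\<^sup>+ t. (\<integral>\<^sup>+ x. indicator N (x, t) \<partial>lborel) \<partial>lborel) = 0" .
  have sec: "(\<lambda>x. indicator N (x, t) :: ennreal) \<in> borel_measurable lborel" for t
    by (rule measurable_compose[OF measurable_Pair2' m]) simp
  have "(\<lambda>t. \<integral>\<^sup>+ x. indicator N (x, t) \<partial>lborel) \<in> borel_measurable lborel"
    using m by (intro lborel.borel_measurable_nn_integral) (auto intro: measurable_pair_swap simp: split_beta')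
  then have "AE t in lborel. (\<integral>\<^sup>+ x. indicator N (x, t) \<partial>lborel) = 0"
    using z by (simp add: nn_integral_0_iff_AE)
  then show ?thesis
  proof eventually_elim
    case (elim t)
    then have "AE x in lborel. (indicator N (x, t) :: ennreal) = 0"
      using sec by (simp add: nn_integral_0_iff_AE)
    then show ?case by eventually_elim (auto simp: indicator_def split: if_splits)
  qed
qed

text \<open>Tonelli's theorem is stated for the product of Borel measures, whereas \<open>f\<close>
  is Lebesgue measurable in the plane. It is exchanged for a Borel function \<open>g\<close> off a
  Borel null set \<open>N\<close>; for almost every \<open>t\<close> the slice of \<open>N\<close>
  is null, so \<open>f\<close> and \<open>g\<close> have the same slice norms there.\<close>

lemma space_time_L1:
  fixes f :: "real \<times> real \<Rightarrow> real"
  assumes m: "set_borel_measurable lebesgue (A \<times> {0<..}) f" and A: "A \<in> sets borel" and T: "T > 0"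
    and int: "\<And>t. 0 < t \<Longrightarrow> t < T \<Longrightarrow> (\<lambda>x. f (x, t)) absolutely_integrable_on A"
    and le: "\<And>t. 0 < t \<Longrightarrow> t < T \<Longrightarrow> L1_norm A (\<lambda>x. f (x, t)) \<le> C"
  shows "f absolutely_integrable_on A \<times> {0<..<T}" "L1_norm (A \<times> {0<..<T}) f \<le> C * T"
proof -
  have C: "C \<ge> 0" using le[of "T / 2"] L1_norm_nonneg[of A "\<lambda>x. f (x, T / 2)"] T by auto
  let ?S = "A \<times> {0<..<T}"
  define fS where "fS = (\<lambda>p. indicat_real ?S p * f p)"
  have "?S \<in> sets (borel :: (real \<times> real) measure)"
  proof -
    have "?S \<in> sets (borel \<Otimes>\<^sub>M borel)" using A by (intro pair_measureI) auto
    then show ?thesis unfolding borel_prod .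
  qed
  then have Sl: "?S \<in> sets lebesgue" by (simp add: sets_completionI_sets)
  have "(\<lambda>p. indicat_real ?S p * (indicat_real (A \<times> {0<..}) p *\<^sub>R f p)) \<in> borel_measurable lebesgue"
    using m Sl unfolding set_borel_measurable_def by (intro borel_measurable_times borel_measurable_indicator)
  moreover have "(\<lambda>p. indicat_real ?S p * (indicat_real (A \<times> {0<..}) p *\<^sub>R f p)) = fS"
    by (auto simp: fS_def indicator_def)
  ultimately have fSm: "fS \<in> borel_measurable lebesgue" by simp
  then obtain g where g: "g \<in> borel_measurable lborel" and ae: "AE p in lborel. fS p = g p"
    using completion_ex_borel_measurable_real[OF fSm] by blast
  obtain N where N: "N \<in> null_sets lborel" "{p \<in> space lborel. fS p \<noteq> g p} \<subseteq> N"
    using ae unfolding eventually_ae_filter by blast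
  have gm: "(\<lambda>p. ennreal \<bar>g p\<bar>) \<in> borel_measurable (lborel \<Otimes>\<^sub>M lborel)"
    using g unfolding lborel_prod by measurable
  have slice: "(\<integral>\<^sup>+ x. ennreal \<bar>g (x, t)\<bar> \<partial>lborel) \<le> ennreal C * indicator {0<..<T} t"
    if t: "AE x in lborel. (x, t) \<notin> N" for t
  proof -
    have gt: "(\<lambda>x. g (x, t)) \<in> borel_measurable lborel"
      by (rule measurable_compose[OF measurable_Pair2' g[folded lborel_prod]]) simp
    have "(\<integral>\<^sup>+ x. ennreal \<bar>g (x, t)\<bar> \<partial>lborel) = (\<integral>\<^sup>+ x. ennreal \<bar>g (x, t)\<bar> \<partial>lebesgue)"
      using gt by (intro nn_integral_completion[symmetric])
    also have "\<dots> = (\<integral>\<^sup>+ x. ennreal \<bar>fS (x, t)\<bar> \<partial>lebesgue)"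
    proof (rule nn_integral_cong_AE)
      show "AE x in lebesgue. ennreal \<bar>g (x, t)\<bar> = ennreal \<bar>fS (x, t)\<bar>"
        using AE_completion[OF t]
      proof eventually_elim
        case (elim x)
        then have "(x, t) \<notin> {p \<in> space lborel. fS p \<noteq> g p}" using N(2) by blast
        then show ?case by simp
      qed
    qed
    also have "\<dots> \<le> ennreal C * indicator {0<..<T} t"
    proof (cases "t \<in> {0<..<T}")
      case True
      have "integrable lebesgue (\<lambda>x. indicat_real A x *\<^sub>R \<bar>f (x, t)\<bar>)"
        using set_integrable_abs[OF int[of t]] True by (simp add: set_integrable_def)
      then have "(\<integral>\<^sup>+ x. ennreal (indicat_real A x *\<^sub>R \<bar>f (x, t)\<bar>) \<partial>lebesgue) = ennreal (L1_norm A (\<lambda>x. f (x, t)))"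
        unfolding L1_norm_def set_lebesgue_integral_def by (rule nn_integral_eq_integral) simp
      moreover have "\<bar>fS (x, t)\<bar> = indicat_real A x *\<^sub>R \<bar>f (x, t)\<bar>" for x
        using True by (auto simp: fS_def indicator_def)
      ultimately show ?thesis using le[of t] True by (simp add: ennreal_leI)
    next
      case False
      then have "fS (x, t) = 0" for x by (auto simp: fS_def indicator_def)
      then show ?thesis by simp
    qed
    finally show ?thesis .
  qed
  have "(\<integral>\<^sup>+ p. ennreal \<bar>fS p\<bar> \<partial>lebesgue) = (\<integral>\<^sup>+ p. ennreal \<bar>g p\<bar> \<partial>lebesgue)"
    by (rule nn_integral_cong_AE) (use AE_completion[OF ae] in \<open>auto elim!: eventually_mono\<close>)
  also have "\<dots> = (\<integral>\<^sup>+ p. ennreal \<bar>g p\<bar> \<partial>(lborel \<Otimes>\<^sub>M lborel))"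
    using g unfolding lborel_prod by (intro nn_integral_completion) measurable
  also have "\<dots> = (\<integral>\<^sup>+ t. (\<integral>\<^sup>+ x. ennreal \<bar>g (x, t)\<bar> \<partial>lborel) \<partial>lborel)"
    by (rule lborel_pair.nn_integral_snd[OF gm, symmetric])
  also have "\<dots> \<le> (\<integral>\<^sup>+ t. ennreal C * indicator {0<..<T} t \<partial>lborel)"
    by (rule nn_integral_mono_AE) (use AE_lborel_pair_snd[OF N(1)] slice in \<open>auto elim!: eventually_mono\<close>)
  also have "\<dots> = ennreal (C * T)"
    using C T by (simp add: nn_integral_cmult_indicator ennreal_mult)
  finally have b: "(\<integral>\<^sup>+ p. ennreal \<bar>fS p\<bar> \<partial>lebesgue) \<le> ennreal (C * T)" .
  have i: "integrable lebesgue fS"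
    using fSm b by (intro integrableI_bounded) (auto simp: less_top[symmetric] top_unique)
  then show "f absolutely_integrable_on ?S" by (simp add: set_integrable_def fS_def)
  have "ennreal (\<integral>p. \<bar>fS p\<bar> \<partial>lebesgue) = (\<integral>\<^sup>+ p. ennreal \<bar>fS p\<bar> \<partial>lebesgue)"
    using i by (intro nn_integral_eq_integral[symmetric]) auto
  then have "ennreal (\<integral>p. \<bar>fS p\<bar> \<partial>lebesgue) \<le> ennreal (C * T)" using b by simp
  then have "(\<integral>p. \<bar>fS p\<bar> \<partial>lebesgue) \<le> C * T" using C T by (subst (asm) ennreal_le_iff) auto
  moreover have "L1_norm ?S f = (\<integral>p. \<bar>fS p\<bar> \<partial>lebesgue)"
    unfolding L1_norm_def set_lebesgue_integral_def fS_def by (simp add: abs_mult)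
  ultimately show "L1_norm ?S f \<le> C * T" by simp
qed

section \<open>Approximation of the data by smooth profiles\<close>

definition C2b :: "(real \<Rightarrow> real) \<Rightarrow> bool" where
  "C2b p \<longleftrightarrow> (\<exists>p' p'' C. (\<forall>x. (p has_real_derivative p' x) (at x)) \<and>
     (\<forall>x. (p' has_real_derivative p'' x) (at x)) \<and> continuous_on UNIV p'' \<and>
     (\<forall>x. \<bar>p x\<bar> \<le> C) \<and> (\<forall>x. \<bar>p' x\<bar> \<le> C) \<and> (\<forall>x. \<bar>p'' x\<bar> \<le> C))"

lemma C2bE:
  assumes "C2b p"
  obtains p' p'' C where "\<forall>x. (p has_real_derivative p' x) (at x)" "\<forall>x. (p' has_real_derivative p'' x) (at x)"
    "continuous_on UNIV p''" "\<forall>x. \<bar>p x\<bar> \<le> C" "\<forall>x. \<bar>p' x\<bar> \<le> C" "\<forall>x. \<bar>p'' x\<bar> \<le> C"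
  using assms unfolding C2b_def by (elim exE conjE) (rule that)

lemma C2bI:
  assumes "\<And>x. (p has_real_derivative p' x) (at x)" "\<And>x. (p' has_real_derivative p'' x) (at x)"
    "continuous_on UNIV p''" "\<And>x. \<bar>p x\<bar> \<le> C" "\<And>x. \<bar>p' x\<bar> \<le> C" "\<And>x. \<bar>p'' x\<bar> \<le> C"
  shows "C2b p"
  unfolding C2b_def by (intro exI[of _ p'] exI[of _ p''] exI[of _ C] conjI allI assms)

lemma C2b_add:
  assumes "C2b p" "C2b q"
  shows "C2b (\<lambda>x. p x + q x)"
proof -
  obtain p' p'' C where p: "\<forall>x. (p has_real_derivative p' x) (at x)" "\<forall>x. (p' has_real_derivative p'' x) (at x)"
    "continuous_on UNIV p''" "\<forall>x. \<bar>p x\<bar> \<le> C" "\<forall>x. \<bar>p' x\<bar> \<le> C" "\<forall>x. \<bar>p'' x\<bar> \<le> C"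
    using assms(1) by (rule C2bE) (rule that)
  obtain q' q'' D where q: "\<forall>x. (q has_real_derivative q' x) (at x)" "\<forall>x. (q' has_real_derivative q'' x) (at x)"
    "continuous_on UNIV q''" "\<forall>x. \<bar>q x\<bar> \<le> D" "\<forall>x. \<bar>q' x\<bar> \<le> D" "\<forall>x. \<bar>q'' x\<bar> \<le> D"
    using assms(2) by (rule C2bE) (rule that)
  show ?thesis
  proof (rule C2bI[of _ "\<lambda>x. p' x + q' x" "\<lambda>x. p'' x + q'' x" "C + D"])
    show "((\<lambda>x. p x + q x) has_real_derivative p' x + q' x) (at x)" for x
      by (rule DERIV_add[OF spec[OF p(1)] spec[OF q(1)]])
    show "((\<lambda>x. p' x + q' x) has_real_derivative p'' x + q'' x) (at x)" for x
      by (rule DERIV_add[OF spec[OF p(2)] spec[OF q(2)]])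
    show "continuous_on UNIV (\<lambda>x. p'' x + q'' x)" by (rule continuous_on_add[OF p(3) q(3)])
    show "\<bar>p x + q x\<bar> \<le> C + D" for x using spec[OF p(4), of x] spec[OF q(4), of x] by linarith
    show "\<bar>p' x + q' x\<bar> \<le> C + D" for x using spec[OF p(5), of x] spec[OF q(5), of x] by linarith
    show "\<bar>p'' x + q'' x\<bar> \<le> C + D" for x using spec[OF p(6), of x] spec[OF q(6), of x] by linarith
  qed
qed

lemma C2b_cmult:
  assumes "C2b p"
  shows "C2b (\<lambda>x. c * p x)"
proof -
  obtain p' p'' C where p: "\<forall>x. (p has_real_derivative p' x) (at x)" "\<forall>x. (p' has_real_derivative p'' x) (at x)"
    "continuous_on UNIV p''" "\<forall>x. \<bar>p x\<bar> \<le> C" "\<forall>x. \<bar>p' x\<bar> \<le> C" "\<forall>x. \<bar>p'' x\<bar> \<le> C"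
    using assms(1) by (rule C2bE) (rule that)
  show ?thesis
  proof (rule C2bI[of _ "\<lambda>x. c * p' x" "\<lambda>x. c * p'' x" "\<bar>c\<bar> * C"])
    show "continuous_on UNIV (\<lambda>x. c * p'' x)" by (intro continuous_intros p(3))
    show "((\<lambda>x. c * p x) has_real_derivative c * p' x) (at x)" for x by (rule DERIV_cmult[OF spec[OF p(1)]])
    show "((\<lambda>x. c * p' x) has_real_derivative c * p'' x) (at x)" for x by (rule DERIV_cmult[OF spec[OF p(2)]])
    show "\<bar>c * p x\<bar> \<le> \<bar>c\<bar> * C" for x using spec[OF p(4), of x] by (simp add: abs_mult mult_left_mono)
    show "\<bar>c * p' x\<bar> \<le> \<bar>c\<bar> * C" for x using spec[OF p(5), of x] by (simp add: abs_mult mult_left_mono)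
    show "\<bar>c * p'' x\<bar> \<le> \<bar>c\<bar> * C" for x using spec[OF p(6), of x] by (simp add: abs_mult mult_left_mono)
  qed
qed

lemma C2b_sum: "finite A \<Longrightarrow> (\<And>i. i \<in> A \<Longrightarrow> C2b (p i)) \<Longrightarrow> C2b (\<lambda>x. \<Sum>i\<in>A. p i x)"
proof (induction A rule: finite_induct)
  case empty
  show ?case by (rule C2bI[of _ "\<lambda>_. 0" "\<lambda>_. 0" 0]) auto
next
  case (insert a A)
  then have "C2b (\<lambda>x. p a x + (\<Sum>i\<in>A. p i x))" by (intro C2b_add) auto
  then show ?case using insert by simp
qed

lemma C2b_affine:
  assumes "C2b p"
  shows "C2b (\<lambda>x. p (a * x + b))"
proof -
  obtain p' p'' C where p: "\<forall>x. (p has_real_derivative p' x) (at x)" "\<forall>x. (p' has_real_derivative p'' x) (at x)"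
    "continuous_on UNIV p''" "\<forall>x. \<bar>p x\<bar> \<le> C" "\<forall>x. \<bar>p' x\<bar> \<le> C" "\<forall>x. \<bar>p'' x\<bar> \<le> C"
    using assms(1) by (rule C2bE) (rule that)
  have l: "((\<lambda>x. a * x + b) has_real_derivative a) (at x)" for x
    by (auto intro!: derivative_eq_intros)
  have C: "C \<ge> 0" using spec[OF p(4), of 0] by linarith
  define D where "D = C * (1 + \<bar>a\<bar> + \<bar>a\<bar> * \<bar>a\<bar>)"
  have D: "C \<le> D" "C * \<bar>a\<bar> \<le> D" "C * \<bar>a\<bar> * \<bar>a\<bar> \<le> D" using C by (auto simp: D_def algebra_simps)
  show ?thesis
  proof (rule C2bI[of _ "\<lambda>x. p' (a * x + b) * a" "\<lambda>x. p'' (a * x + b) * a * a" D])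
    show "((\<lambda>x. p (a * x + b)) has_real_derivative p' (a * x + b) * a) (at x)" for x
      by (rule DERIV_chain2[OF spec[OF p(1)] l])
    show "((\<lambda>x. p' (a * x + b) * a) has_real_derivative p'' (a * x + b) * a * a) (at x)" for x
      by (rule DERIV_cmult_right[OF DERIV_chain2[OF spec[OF p(2)] l]])
    show "continuous_on UNIV (\<lambda>x. p'' (a * x + b) * a * a)"
      by (intro continuous_intros continuous_on_compose2[OF p(3)]) auto
    show "\<bar>p (a * x + b)\<bar> \<le> D" for x using spec[OF p(4), of "a * x + b"] D by linarith
    show "\<bar>p' (a * x + b) * a\<bar> \<le> D" for x
      using mult_right_mono[OF spec[OF p(5), of "a * x + b"] abs_ge_zero[of a]] D unfolding abs_mult by linarith
    show "\<bar>p'' (a * x + b) * a * a\<bar> \<le> D" for x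
      using mult_right_mono[OF mult_right_mono[OF spec[OF p(6), of "a * x + b"] abs_ge_zero[of a]] abs_ge_zero[of a]] D
      unfolding abs_mult by linarith
  qed
qed

lemma DERIV_locally_const_zero:
  fixes p :: "real \<Rightarrow> real"
  assumes "(p has_real_derivative D) (at x)" "open U" "x \<in> U" "\<And>y. y \<in> U \<Longrightarrow> p y = c"
  shows "D = 0"
proof -
  have "((\<lambda>_. c) has_real_derivative D) (at x)"
    by (rule has_field_derivative_transform_within_open[OF assms(1-3)]) (use assms(4) in auto)
  then show ?thesis using DERIV_unique[OF _ DERIV_const[of c]] by blast
qed

text \<open>Both derivatives vanish off \<open>{l..r}\<close>, and on this compact interval
  continuity bounds them.\<close>

lemma C2b_const_outside:
  assumes "C2 p" and l: "\<And>x. x \<le> l \<Longrightarrow> p x = a" and r: "\<And>x. x \<ge> r \<Longrightarrow> p x = b"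
  shows "C2b p"
proof -
  obtain p' p'' where p: "\<forall>x. (p has_real_derivative p' x) (at x)" "\<forall>x. (p' has_real_derivative p'' x) (at x)"
    "continuous_on UNIV p''"
    using assms(1) unfolding C2_def by (elim exE conjE) (rule that)
  have p'l: "p' x = 0" if "x < l" for x
    by (rule DERIV_locally_const_zero[OF spec[OF p(1)], of "{..<l}" x a]) (use that l in auto)
  have p'r: "p' x = 0" if "x > r" for x
    by (rule DERIV_locally_const_zero[OF spec[OF p(1)], of "{r<..}" x b]) (use that r in auto)
  have p''l: "p'' x = 0" if "x < l" for x
    by (rule DERIV_locally_const_zero[OF spec[OF p(2)], of "{..<l}" x 0]) (use that p'l in auto)
  have p''r: "p'' x = 0" if "x > r" for x
    by (rule DERIV_locally_const_zero[OF spec[OF p(2)], of "{r<..}" x 0]) (use that p'r in auto)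
  have c: "continuous_on {l..r} p" "continuous_on {l..r} p'" "continuous_on {l..r} p''"
  proof -
    show "continuous_on {l..r} p" by (rule DERIV_continuous_on) (rule has_field_derivative_at_within[OF spec[OF p(1)]])
    show "continuous_on {l..r} p'" by (rule DERIV_continuous_on) (rule has_field_derivative_at_within[OF spec[OF p(2)]])
    show "continuous_on {l..r} p''" by (rule continuous_on_subset[OF p(3)]) simp
  qed
  obtain C0 where C0: "C0 \<ge> 0" "\<And>x. x \<in> {l..r} \<Longrightarrow> \<bar>p x\<bar> \<le> C0" by (rule continuous_on_Icc_bounded[OF c(1)]) (rule that)
  obtain C1 where C1: "C1 \<ge> 0" "\<And>x. x \<in> {l..r} \<Longrightarrow> \<bar>p' x\<bar> \<le> C1" by (rule continuous_on_Icc_bounded[OF c(2)]) (rule that)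
  obtain C2 where C2: "C2 \<ge> 0" "\<And>x. x \<in> {l..r} \<Longrightarrow> \<bar>p'' x\<bar> \<le> C2" by (rule continuous_on_Icc_bounded[OF c(3)]) (rule that)
  define C where "C = C0 + C1 + C2 + \<bar>a\<bar> + \<bar>b\<bar>"
  show ?thesis
  proof (rule C2bI[OF spec[OF p(1)] spec[OF p(2)] p(3), of C])
    fix x
    consider "x < l" | "x > r" | "x \<in> {l..r}" by force
    note cs = this
    show "\<bar>p x\<bar> \<le> C" using cs C0 C1(1) C2(1) l[of x] r[of x] by cases (auto simp: C_def intro: order_trans[of _ C0])
    show "\<bar>p' x\<bar> \<le> C" using cs C1 C0(1) C2(1) p'l[of x] p'r[of x] by cases (auto simp: C_def intro: order_trans[of _ C1])
    show "\<bar>p'' x\<bar> \<le> C" using cs C2 C0(1) C1(1) p''l[of x] p''r[of x] by cases (auto simp: C_def intro: order_trans[of _ C2])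
  qed
qed

text \<open>On an incoming arc a smooth transition from \<open>B i\<close> to 0 is subtracted from
  the datum, and the remainder is approximated by a C2 function \<open>q i\<close> vanishing off the
  arc. Adding the transition back gives \<open>PI i\<close>, equal to \<open>B i\<close> left of 0
  and to 0 right of \<open>L i\<close>. An outgoing profile is \<open>q i\<close> plus the
  superposition prescribed for \<open>y \<le> 0\<close>. For \<open>y \<ge> 0\<close> the
  superposition samples incoming profiles beyond their ends and is 0, so it does not disturb the
  datum, and the sum is C2 across 0.\<close>

lemma smooth_profile_exists:
  fixes lam L B :: "nat \<Rightarrow> real"
  assumes fin: "finite (In \<union> Out)" and disj: "In \<inter> Out = {}"
    and lam: "\<And>i. i \<in> In \<union> Out \<Longrightarrow> lam i > 0"
    and L: "\<And>i. i \<in> In \<union> Out \<Longrightarrow> L i > 0"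
    and u0i: "\<And>i. i \<in> In \<union> Out \<Longrightarrow> u0 i absolutely_integrable_on edge L i" and e: "e > 0"
  shows "\<exists>P. (\<forall>i\<in>In \<union> Out. C2b (P i) \<and> L1_norm (edge L i) (\<lambda>x. u0 i x - P i x) < e) \<and>
    (\<forall>i\<in>In. \<forall>y\<le>0. P i y = B i) \<and>
    (\<forall>i\<in>Out. \<forall>y\<le>0. P i y = (\<Sum>k\<in>In. lam k * P k (L k + lam k / lam i * y) * G i k))"
proof -
  let ?M = "In \<union> Out"
  define f where "f = (\<lambda>i x. if i \<in> In then u0 i x - B i * (1 - smooth_step (L i) x) else u0 i x)"
  have sc: "C2 (\<lambda>x. B i * (1 - smooth_step (L i) x))" if "i \<in> ?M" for i
    using L[OF that] by (intro C2_cmult C2_diff C2_const C2_smooth_step)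
  have fi: "f i absolutely_integrable_on edge L i" if i: "i \<in> ?M" for i
  proof (cases "i \<in> In")
    case True
    then have "f i = (\<lambda>x. u0 i x - B i * (1 - smooth_step (L i) x))" by (auto simp: f_def)
    then show ?thesis
      using set_integral_diff(1)[OF u0i[OF i] absolutely_integrable_continuous_Ioo[OF C2_continuous[OF sc[OF i]]]] by simp
  next
    case False
    then have "f i = u0 i" by (auto simp: f_def)
    then show ?thesis using u0i[OF i] by simp
  qed
  have "\<forall>i\<in>?M. \<exists>p. C2 p \<and> (\<forall>x. x \<notin> {0<..<L i} \<longrightarrow> p x = 0) \<and> L1_norm {0<..<L i} (\<lambda>x. f i x - p x) < e"
    using L1_dense_C2[OF fi e L] by blast
  then obtain q where q: "\<forall>i\<in>?M. C2 (q i) \<and> (\<forall>x. x \<notin> {0<..<L i} \<longrightarrow> q i x = 0) \<and> L1_norm {0<..<L i} (\<lambda>x. f i x - q i x) < e"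
    unfolding bchoice_iff by (elim exE) (rule that)
  define PI where "PI = (\<lambda>i y. q i y + B i * (1 - smooth_step (L i) y))"
  define P where "P = (\<lambda>i y. if i \<in> In then PI i y else q i y + (\<Sum>k\<in>In. lam k * PI k (L k + lam k / lam i * y) * G i k))"
  have PI0: "PI i y = B i" if "i \<in> In" "y \<le> 0" for i y
    using q that smooth_step_0[of y "L i"] by (auto simp: PI_def)
  have PI1: "PI i y = 0" if "i \<in> In" "y \<ge> L i" for i y
    using q that smooth_step_1[of "L i" y] L[of i] by (auto simp: PI_def)
  have PIb: "C2b (PI i)" if "i \<in> In" for i
  proof (rule C2b_const_outside)
    show "C2 (PI i)" unfolding PI_def using q sc that by (intro C2_add) auto
  qed (use PI0[OF that] PI1[OF that] in auto)
  have qb: "C2b (q i)" if "i \<in> ?M" for i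
    by (rule C2b_const_outside[of _ 0 0 "L i" 0]) (use q that in auto)
  have Pb: "C2b (P i)" if i: "i \<in> ?M" for i
  proof (cases "i \<in> In")
    case True
    then have "P i = PI i" by (auto simp: P_def)
    then show ?thesis using PIb[OF True] by simp
  next
    case False
    have "C2b (\<lambda>y. q i y + (\<Sum>k\<in>In. (G i k * lam k) * PI k (lam k / lam i * y + L k)))"
      using fin by (intro C2b_add qb i C2b_sum C2b_cmult C2b_affine PIb) auto
    moreover have "P i = (\<lambda>y. q i y + (\<Sum>k\<in>In. (G i k * lam k) * PI k (lam k / lam i * y + L k)))"
      using False by (auto simp: P_def add.commute mult_ac)
    ultimately show ?thesis by simp
  qed
  have "L1_norm (edge L i) (\<lambda>x. u0 i x - P i x) < e" if i: "i \<in> ?M" for i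
  proof -
    have "L1_norm (edge L i) (\<lambda>x. u0 i x - P i x) = L1_norm (edge L i) (\<lambda>x. f i x - q i x)"
    proof (rule L1_norm_cong_AE, intro AE_I2 impI)
      fix x assume x: "x \<in> edge L i"
      show "u0 i x - P i x = f i x - q i x"
      proof (cases "i \<in> In")
        case True
        then show ?thesis by (simp add: P_def PI_def f_def)
      next
        case False
        have "PI k (L k + lam k / lam i * x) = 0" if "k \<in> In" for k
          using that x lam[of k] lam[OF i] by (intro PI1) auto
        then show ?thesis using False by (simp add: P_def f_def)
      qed
    qed
    then show ?thesis using q i by simp
  qed
  moreover have "P i y = B i" if "i \<in> In" "y \<le> 0" for i y using PI0[OF that] that by (simp add: P_def)
  moreover have "P i y = (\<Sum>k\<in>In. lam k * P k (L k + lam k / lam i * y) * G i k)" if "i \<in> Out" "y \<le> 0" for i y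
    using that q disj by (auto simp: P_def)
  ultimately show ?thesis using Pb by (intro exI[of _ P]) auto
qed

section \<open>The transport problem\<close>

lemma integrable_bounded_support:
  fixes f :: "'a::euclidean_space \<Rightarrow> real"
  assumes m: "f \<in> borel_measurable borel" and b: "\<And>x. \<bar>f x\<bar> \<le> C" and z: "\<And>x. x \<notin> cbox a b \<Longrightarrow> f x = 0"
  shows "integrable lborel f"
proof (rule Bochner_Integration.integrable_bound)
  have "emeasure lborel (cbox a b) < \<infinity>" by (rule emeasure_lborel_cbox_finite)
  then show "integrable lborel (\<lambda>x. C * indicat_real (cbox a b) x)" by (intro integrable_mult_right integrable_real_indicator) auto
  show "f \<in> borel_measurable lborel" using m by simp
  show "AE x in lborel. norm (f x) \<le> norm (C * indicat_real (cbox a b) x)"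
  proof (intro AE_I2)
    fix x
    show "norm (f x) \<le> norm (C * indicat_real (cbox a b) x)"
      using b[of x] z[of x] by (cases "x \<in> cbox a b") auto
  qed
qed

lemma has_derivative_characteristic:
  fixes \<phi>0 :: "real \<times> real \<Rightarrow> real"
  assumes d: "\<And>z. z \<in> Q \<Longrightarrow> (\<phi>0 has_derivative \<phi>' z) (at z within Q)"
    and s: "\<And>t. t \<in> A \<Longrightarrow> (y + a * t, t) \<in> Q" and t: "t \<in> A"
  shows "((\<lambda>t. \<phi>0 (y + a * t, t)) has_vector_derivative \<phi>' (y + a * t, t) (a, 1)) (at t within A)"
proof -
  have "((\<lambda>t. (y + a * t, t)) has_derivative (\<lambda>h. (a * h, h))) (at t within A)"
    by (auto intro!: derivative_eq_intros)
  then have "((\<lambda>t. \<phi>0 (y + a * t, t)) has_derivative (\<lambda>h. \<phi>' (y + a * t, t) (a * h, h))) (at t within A)"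
    by (intro has_derivative_in_compose2[where t = Q, OF d]) (use s t in auto)
  moreover have "\<phi>' (y + a * t, t) (a * h, h) = h *\<^sub>R \<phi>' (y + a * t, t) (a, 1)" for h
  proof -
    have "linear (\<phi>' (y + a * t, t))" using d[OF s[OF t]] by (rule has_derivative_linear)
    from linear_cmul[OF this, of h "(a, 1)"] show ?thesis by (simp add: mult.commute)
  qed
  ultimately show ?thesis by (simp add: has_vector_derivative_def)
qed

lemma quadrant_directions:
  fixes x i :: "real \<times> real"
  assumes "x \<in> {0..} \<times> {0..}" "i \<in> Basis" "0 < e"
  shows "\<exists>d. 0 < \<bar>d\<bar> \<and> \<bar>d\<bar> < e \<and> x + d *\<^sub>R i \<in> {0..} \<times> {0..}"
  using assms by (intro exI[of _ "e / 2"]) (auto simp: Basis_prod_def)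

text \<open>The shear \<open>y = x - a * t\<close> preserves the measure and makes \<open>p\<close>
  a function of \<open>y\<close> alone; along each line of constant \<open>y\<close> the bracket is
  the derivative of the test function. What contributes is the point where the line enters the
  quadrant: for \<open>y > 0\<close> on the initial line, for \<open>y < 0\<close> on the side
  \<open>x = 0\<close>.\<close>

lemma transport_identity:
  fixes p :: "real \<Rightarrow> real" and \<phi> :: "real \<times> real \<Rightarrow> real"
  assumes a: "a > 0" and L: "L > 0" and T: "T > 0"
    and pm: "p \<in> borel_measurable borel" and pb: "\<And>x. \<bar>p x\<bar> \<le> C"
    and \<phi>: "C1c ({0..<L} \<times> {0..<T}) \<phi>"
  shows "(LINT z:{0<..<L} \<times> {0<..<T}|lebesgue. p (fst z - a * snd z) *
      (frechet_derivative \<phi> (at z) (0, 1) + a * frechet_derivative \<phi> (at z) (1, 0)))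
     + (LINT x:{0<..<L}|lebesgue. p x * \<phi> (x, 0))
     = - a * (LINT t:{0<..<T}|lebesgue. p (- a * t) * \<phi> (0, t))"
proof -
  let ?S = "{0..<L} \<times> {0..<T}" and ?Q = "{0..} \<times> {0..} :: (real \<times> real) set"
  let ?I = "{0<..<L} \<times> {0<..<T}" and ?Qo = "{0<..} \<times> {0<..} :: (real \<times> real) set"
  have "open ({..<L} \<times> {..<T})" by (intro open_Times) auto
  moreover have "?S = ?Q \<inter> ({..<L} \<times> {..<T})" by auto
  ultimately have "\<exists>\<phi>' Cc. compact Cc \<and> Cc \<subseteq> ?S \<and>
     (\<forall>x\<in>?Q. ((\<lambda>x. if x \<in> ?S then \<phi> x else 0) has_derivative \<phi>' x) (at x within ?Q)) \<and>
     (\<forall>v. continuous_on ?Q (\<lambda>x. \<phi>' x v)) \<and>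
     (\<forall>x\<in>?S. (\<phi> has_derivative \<phi>' x) (at x within ?S)) \<and>
     (\<forall>x\<in>?S - Cc. \<phi> x = 0) \<and> (\<forall>x. x \<notin> Cc \<longrightarrow> \<phi>' x = (\<lambda>_. 0))"
    by (rule C1c_extend[OF \<phi>]) (rule quadrant_directions)
  then obtain \<phi>' Cc where Cc: "compact Cc" "Cc \<subseteq> ?S" and
     d0: "\<forall>x\<in>?Q. ((\<lambda>x. if x \<in> ?S then \<phi> x else 0) has_derivative \<phi>' x) (at x within ?Q)" and
     dc: "\<forall>v. continuous_on ?Q (\<lambda>x. \<phi>' x v)" and
     dS: "\<forall>x\<in>?S. (\<phi> has_derivative \<phi>' x) (at x within ?S)" and
     d1: "\<forall>x\<in>?S - Cc. \<phi> x = 0" and d2: "\<forall>x. x \<notin> Cc \<longrightarrow> \<phi>' x = (\<lambda>_. 0)"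
    by (elim exE conjE) (rule that)
  define \<phi>0 where "\<phi>0 = (\<lambda>x. if x \<in> ?S then \<phi> x else 0)"
  define D where "D = (\<lambda>z. \<phi>' z (a, 1))"
  have Dc: "continuous_on ?Q D" unfolding D_def using dc by blast
  have D0: "D z = 0" if "z \<notin> Cc" for z using spec[OF d2, of z] that by (simp add: D_def)
  have CQ: "Cc \<subseteq> ?Q" using Cc(2) by auto
  obtain M where M: "M \<ge> 0" "\<And>z. \<bar>D z\<bar> \<le> M"
  proof -
    have "bounded (D ` Cc)"
      by (intro compact_imp_bounded compact_continuous_image Cc continuous_on_subset[OF Dc CQ])
    then obtain M where "\<forall>y\<in>D ` Cc. norm y \<le> M" unfolding bounded_iff by blast
    then have "\<bar>D z\<bar> \<le> max 0 M" for z
      using D0[of z] by (cases "z \<in> Cc") (auto simp: max.coboundedI2)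
    then show ?thesis by (intro that[of "max 0 M"]) auto
  qed
  have C0: "C \<ge> 0" using pb[of 0] by linarith
  \<comment> \<open>A Borel integrand on the whole plane, cut to the open quadrant and vanishing
    with \<open>D\<close> beyond the rectangle; Fubini is applied to it over
    \<open>lborel\<close>.\<close>
  define h where "h = (\<lambda>z. p (fst z - a * snd z) * (indicat_real ?Qo z * D z))"
  have Qo: "?Qo \<in> sets borel" by (intro borel_open open_Times) auto
  have Dm: "(\<lambda>z. indicat_real ?Qo z *\<^sub>R D z) \<in> borel_measurable borel"
    by (rule borel_measurable_continuous_on_indicator[OF Qo]) (rule continuous_on_subset[OF Dc], auto)
  have shm: "(\<lambda>z::real \<times> real. fst z - a * snd z) \<in> borel_measurable borel"
    by (intro borel_measurable_continuous_onI continuous_intros)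
  have hm: "h \<in> borel_measurable borel"
    unfolding h_def by (rule borel_measurable_times[OF measurable_compose[OF shm pm] Dm[unfolded real_scaleR_def]])
  have hb: "\<bar>h z\<bar> \<le> C * M" for z
    unfolding h_def abs_mult using pb M(2)[of z] M(1) C0
    by (intro mult_mono) (auto simp: indicator_def)
  have h0: "h z = 0" if "z \<notin> Cc" for z using D0[OF that] by (simp add: h_def)
  have hi: "integrable lborel h"
    by (rule integrable_bounded_support[OF hm hb, of "(0, 0)" "(L, T)"]) (rule h0, use Cc(2) in \<open>auto simp: cbox_Pair_eq\<close>)
  have lin: "linear (\<phi>' z)" if "z \<in> ?Q" for z
    using has_derivative_linear[OF bspec[OF d0 that]] .
  have s1: "(LINT z:?I|lebesgue. p (fst z - a * snd z) *
      (frechet_derivative \<phi> (at z) (0, 1) + a * frechet_derivative \<phi> (at z) (1, 0))) = (\<integral>z. h z \<partial>lborel)"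
  proof -
    have "(LINT z:?I|lebesgue. p (fst z - a * snd z) *
      (frechet_derivative \<phi> (at z) (0, 1) + a * frechet_derivative \<phi> (at z) (1, 0))) = (\<integral>z. h z \<partial>lebesgue)"
      unfolding set_lebesgue_integral_def
    proof (rule Bochner_Integration.integral_cong[OF refl])
      fix z :: "real \<times> real"
      show "indicat_real ?I z *\<^sub>R (p (fst z - a * snd z) * (frechet_derivative \<phi> (at z) (0, 1) + a * frechet_derivative \<phi> (at z) (1, 0))) = h z"
      proof (cases "z \<in> ?I")
        case True
        have "open ?I" by (intro open_Times) auto
        then have "at z within ?S = at z" using True by (intro at_within_open_subset[of z ?I]) auto
        then have "(\<phi> has_derivative \<phi>' z) (at z)" using bspec[OF dS, of z] True by auto
        then have e: "frechet_derivative \<phi> (at z) = \<phi>' z" using frechet_derivative_at by metis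
        have zQ: "z \<in> ?Q" using True by auto
        have "\<phi>' z (0, 1) + a * \<phi>' z (1, 0) = \<phi>' z ((0, 1) + a *\<^sub>R (1, 0))"
          by (simp only: linear_add[OF lin[OF zQ]] linear_cmul[OF lin[OF zQ]] real_scaleR_def)
        then show ?thesis using True by (auto simp: e h_def D_def)
      next
        case False
        have "z \<notin> Cc" if "z \<in> ?Qo" using that False Cc(2) by (cases z) auto
        then have "h z = 0" using D0 by (auto simp: h_def indicator_def)
        then show ?thesis using False by simp
      qed
    qed
    then show ?thesis using hm by (simp add: integral_completion)
  qed
  define h2 where "h2 = (\<lambda>y t. h (y + a * t, t))"
  have "(\<lambda>z::real \<times> real. (fst z + a * snd z, snd z)) \<in> borel_measurable borel"
    by (intro borel_measurable_continuous_onI continuous_intros)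
  then have h2m: "case_prod h2 \<in> borel_measurable borel"
    using measurable_compose[OF _ hm] by (simp add: h2_def case_prod_beta')
  have h2i: "integrable (lborel \<Otimes>\<^sub>M lborel) (case_prod h2)"
    unfolding lborel_prod
  proof (rule integrable_bounded_support[OF h2m, of "C * M" "(- a * T, 0)" "(L, T)"])
    show "\<bar>case_prod h2 z\<bar> \<le> C * M" for z using hb by (simp add: h2_def case_prod_beta')
    fix z :: "real \<times> real" assume z: "z \<notin> cbox (- a * T, 0) (L, T)"
    obtain y t where yt: "z = (y, t)" by (cases z)
    have "(y + a * t, t) \<notin> Cc"
    proof
      assume "(y + a * t, t) \<in> Cc"
      then have c: "0 \<le> y + a * t" "y + a * t < L" "0 \<le> t" "t < T" using Cc(2) by auto
      then have "0 \<le> a * t" "a * t \<le> a * T" using a by auto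
      then have "y \<ge> - a * T" "y \<le> L" using c by auto
      then show False using z c by (simp add: yt cbox_Pair_eq)
    qed
    then show "case_prod h2 z = 0" using h0 by (simp add: yt h2_def)
  qed
  have "(\<integral>z. h z \<partial>lborel) = (\<integral>t. (\<integral>x. h (x, t) \<partial>lborel) \<partial>lborel)"
    using lborel_pair.integral_snd[of "\<lambda>x t. h (x, t)"] hi by (simp add: lborel_prod)
  also have "\<dots> = (\<integral>t. (\<integral>y. h2 y t \<partial>lborel) \<partial>lborel)"
  proof (rule Bochner_Integration.integral_cong[OF refl])
    fix t
    show "(\<integral>x. h (x, t) \<partial>lborel) = (\<integral>y. h2 y t \<partial>lborel)"
      using lborel_integral_real_affine[of 1 "\<lambda>x. h (x, t)" "a * t"] by (simp add: h2_def add.commute)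
  qed
  also have "\<dots> = (\<integral>y. (\<integral>t. h2 y t \<partial>lborel) \<partial>lborel)"
    by (rule lborel_pair.Fubini_integral[OF h2i])
  finally have s2: "(\<integral>z. h z \<partial>lborel) = (\<integral>y. (\<integral>t. h2 y t \<partial>lborel) \<partial>lborel)" .
  \<comment> \<open>The time at which the line of parameter \<open>y\<close> enters the closed
    quadrant.\<close>
  define \<tau> where "\<tau> = (\<lambda>y. max 0 (- y / a))"
  define k where "k = (\<lambda>y. p y * \<phi>0 (y + a * \<tau> y, \<tau> y))"
  have s3: "(\<integral>t. h2 y t \<partial>lborel) = - k y" for y
  proof -
    \<comment> \<open>Later than \<open>T\<close>, where the extended test function is 0, so the
      upper end of the line contributes nothing.\<close>
    define t1 where "t1 = max (\<tau> y) T + 1"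
    have t1: "\<tau> y < t1" "T < t1" by (auto simp: t1_def)
    have \<tau>: "0 \<le> \<tau> y" "0 \<le> y + a * \<tau> y"
    proof -
      show "0 \<le> \<tau> y" by (simp add: \<tau>_def)
      have "- y / a \<le> \<tau> y" by (simp add: \<tau>_def)
      then show "0 \<le> y + a * \<tau> y" using a by (simp add: field_simps)
    qed
    have inQ: "(y + a * t, t) \<in> ?Q" if "t \<ge> \<tau> y" for t
    proof -
      have "a * \<tau> y \<le> a * t" using that a by simp
      then show ?thesis using \<tau> that by auto
    qed
    have Qo_iff: "(y + a * t, t) \<in> ?Qo \<longleftrightarrow> t > \<tau> y" for t
      using a by (auto simp: \<tau>_def field_simps)
    have "h2 y t = p y * (indicat_real {\<tau> y<..t1} t * D (y + a * t, t))" for t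
    proof -
      have "D (y + a * t, t) = 0" if "t > t1"
      proof (rule D0)
        show "(y + a * t, t) \<notin> Cc" using that t1 Cc(2) by auto
      qed
      then show ?thesis using Qo_iff[of t] by (auto simp: h2_def h_def indicator_def)
    qed
    then have "(\<integral>t. h2 y t \<partial>lborel) = p y * (LINT t:{\<tau> y<..t1}|lborel. D (y + a * t, t))"
      by (simp add: set_lebesgue_integral_def)
    also have "(LINT t:{\<tau> y<..t1}|lborel. D (y + a * t, t)) = (LINT t:{\<tau> y..t1}|lborel. D (y + a * t, t))"
      by (rule set_integral_discrete_difference[where X = "{\<tau> y}"]) auto
    also have "\<dots> = \<phi>0 (y + a * t1, t1) - \<phi>0 (y + a * \<tau> y, \<tau> y)"
      unfolding set_lebesgue_integral_def
    proof (rule integral_FTC_atLeastAtMost)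
      show "\<tau> y \<le> t1" using t1 by simp
      show "((\<lambda>t. \<phi>0 (y + a * t, t)) has_vector_derivative D (y + a * t, t)) (at t within {\<tau> y..t1})"
        if "\<tau> y \<le> t" "t \<le> t1" for t
        unfolding D_def
      proof (rule has_derivative_characteristic[where Q = ?Q])
        show "(\<phi>0 has_derivative \<phi>' z) (at z within ?Q)" if "z \<in> ?Q" for z
          unfolding \<phi>0_def by (rule bspec[OF d0 that])
        show "(y + a * t, t) \<in> ?Q" if "t \<in> {\<tau> y..t1}" for t using that inQ by simp
      qed (use that in simp)
      show "continuous_on {\<tau> y..t1} (\<lambda>t. D (y + a * t, t))"
        by (intro continuous_on_compose2[OF Dc] continuous_intros) (use inQ in auto)
    qed
    also have "\<phi>0 (y + a * t1, t1) = 0" using t1 by (auto simp: \<phi>0_def)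
    finally show ?thesis by (simp add: k_def)
  qed
  have ki: "integrable lborel k"
  proof -
    have "integrable lborel (\<lambda>y. \<integral>t. h2 y t \<partial>lborel)" by (rule lborel_pair.integrable_fst[OF h2i])
    then show ?thesis unfolding s3 by simp
  qed
  have kp: "integrable lborel (\<lambda>y. indicat_real {0<..} y * k y)" "integrable lborel (\<lambda>y. indicat_real {..<0} y * k y)"
    using integrable_mult_indicator[OF _ ki, of "{0<..}"] integrable_mult_indicator[OF _ ki, of "{..<0}"] by auto
  have "(\<integral>y. k y \<partial>lborel) = (\<integral>y. indicat_real {0<..} y * k y + indicat_real {..<0} y * k y \<partial>lborel)"
  proof (rule integral_discrete_difference[where X = "{0}"])
    show "k y = indicat_real {0<..} y * k y + indicat_real {..<0} y * k y" if "y \<notin> {0}" for y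
      using that by (auto simp: indicator_def)
  qed auto
  also have "\<dots> = (\<integral>y. indicat_real {0<..} y * k y \<partial>lborel) + (\<integral>y. indicat_real {..<0} y * k y \<partial>lborel)"
    by (rule Bochner_Integration.integral_add[OF kp])
  finally have s4: "(\<integral>y. k y \<partial>lborel) = (\<integral>y. indicat_real {0<..} y * k y \<partial>lborel) + (\<integral>y. indicat_real {..<0} y * k y \<partial>lborel)" .
  have s5: "(\<integral>y. indicat_real {0<..} y * k y \<partial>lborel) = (LINT x:{0<..<L}|lebesgue. p x * \<phi> (x, 0))"
  proof -
    have "(LINT x:{0<..<L}|lebesgue. p x * \<phi> (x, 0)) = (\<integral>y. indicat_real {0<..} y * k y \<partial>lebesgue)"
      unfolding set_lebesgue_integral_def
    proof (rule Bochner_Integration.integral_cong[OF refl])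
      fix y
      have "\<tau> y = 0" if "y > 0" using divide_pos_pos[OF that a] by (simp add: \<tau>_def)
      then show "indicat_real {0<..<L} y *\<^sub>R (p y * \<phi> (y, 0)) = indicat_real {0<..} y * k y"
        using T by (auto simp: k_def \<phi>0_def indicator_def)
    qed
    also have "\<dots> = (\<integral>y. indicat_real {0<..} y * k y \<partial>lborel)"
      using kp(1) by (intro integral_completion) auto
    finally show ?thesis by simp
  qed
  have s6: "(\<integral>y. indicat_real {..<0} y * k y \<partial>lborel) = a * (LINT t:{0<..<T}|lebesgue. p (- a * t) * \<phi> (0, t))"
  proof -
    \<comment> \<open>The substitution \<open>y = - a * t\<close> turns the negative half-line into
      the boundary times and produces the factor \<open>a\<close>.\<close>
    have af: "(\<integral>y. indicat_real {..<0} y * k y \<partial>lborel) = a * (\<integral>t. indicat_real {..<0} (- a * t) * k (- a * t) \<partial>lborel)"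
      using lborel_integral_real_affine[of "- a" "\<lambda>y. indicat_real {..<0} y * k y" 0] a by simp
    have "(LINT t:{0<..<T}|lebesgue. p (- a * t) * \<phi> (0, t)) = (\<integral>t. indicat_real {..<0} (- a * t) * k (- a * t) \<partial>lebesgue)"
      unfolding set_lebesgue_integral_def
    proof (rule Bochner_Integration.integral_cong[OF refl])
      fix t
      have e: "\<tau> (- a * t) = t" if "t > 0" using that a by (simp add: \<tau>_def)
      have i: "indicat_real {..<0} (- a * t) = indicat_real {0<..} t" using a by (auto simp: indicator_def mult_less_0_iff zero_less_mult_iff)
      show "indicat_real {0<..<T} t *\<^sub>R (p (- a * t) * \<phi> (0, t)) = indicat_real {..<0} (- a * t) * k (- a * t)"
      proof (cases "t > 0")
        case True
        then show ?thesis unfolding i k_def e[OF True] using L by (auto simp: \<phi>0_def indicator_def)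
      next
        case False
        then show ?thesis unfolding i by simp
      qed
    qed
    also have "\<dots> = (\<integral>t. indicat_real {..<0} (- a * t) * k (- a * t) \<partial>lborel)"
    proof (rule integral_completion)
      have "(\<lambda>t. - a * t) \<in> borel_measurable lborel" by measurable
      then have "(\<lambda>t. - a * t) \<in> lborel \<rightarrow>\<^sub>M lborel" by simp
      from measurable_compose[OF this borel_measurable_integrable[OF kp(2)]]
      show "(\<lambda>t. indicat_real {..<0} (- a * t) * k (- a * t)) \<in> borel_measurable lborel" .
    qed
    finally show ?thesis using af by simp
  qed
  have "(\<integral>z. h z \<partial>lborel) = - (\<integral>y. k y \<partial>lborel)" unfolding s2 s3 by simp
  then show ?thesis unfolding s1 s4 s5 s6 by simp
qed

text \<open>Bounded variation on the whole line in Jordan form. In contrast to the variational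
  \<open>BV\<close> it speaks about points, so profiles can be shifted, rescaled, summed and joined;
  it yields Borel measurability, boundedness and at most countably many discontinuities.\<close>

definition diff_mono :: "(real \<Rightarrow> real) \<Rightarrow> bool" where
  "diff_mono p \<longleftrightarrow> (\<exists>m1 m2 C. mono m1 \<and> mono m2 \<and> (\<forall>x. \<bar>m1 x\<bar> \<le> C) \<and> (\<forall>x. \<bar>m2 x\<bar> \<le> C) \<and>
     (\<forall>x. p x = m1 x - m2 x))"

lemma diff_monoI:
  assumes "mono m1" "mono m2" "\<And>x. \<bar>m1 x\<bar> \<le> C" "\<And>x. \<bar>m2 x\<bar> \<le> C" "\<And>x. p x = m1 x - m2 x"
  shows "diff_mono p"
  unfolding diff_mono_def by (intro exI[of _ m1] exI[of _ m2] exI[of _ C] conjI allI assms)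

lemma diff_monoE:
  assumes "diff_mono p"
  obtains m1 m2 C where "mono m1" "mono m2" "\<forall>x. \<bar>m1 x\<bar> \<le> C" "\<forall>x. \<bar>m2 x\<bar> \<le> C" "\<forall>x. p x = m1 x - m2 x"
  using assms unfolding diff_mono_def by (elim exE conjE) (rule that)

lemma diff_mono_const: "diff_mono (\<lambda>x. c)"
  by (rule diff_monoI[of "\<lambda>_. c" "\<lambda>_. 0" "\<bar>c\<bar>"]) (auto simp: mono_def)

lemma diff_mono_add:
  assumes "diff_mono p" "diff_mono q"
  shows "diff_mono (\<lambda>x. p x + q x)"
proof -
  obtain m1 m2 C where p: "mono m1" "mono m2" "\<forall>x. \<bar>m1 x\<bar> \<le> C" "\<forall>x. \<bar>m2 x\<bar> \<le> C" "\<forall>x. p x = m1 x - m2 x"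
    using assms(1) by (rule diff_monoE) (rule that)
  obtain n1 n2 D where q: "mono n1" "mono n2" "\<forall>x. \<bar>n1 x\<bar> \<le> D" "\<forall>x. \<bar>n2 x\<bar> \<le> D" "\<forall>x. q x = n1 x - n2 x"
    using assms(2) by (rule diff_monoE) (rule that)
  show ?thesis
  proof (rule diff_monoI[of "\<lambda>x. m1 x + n1 x" "\<lambda>x. m2 x + n2 x" "C + D"])
    show "mono (\<lambda>x. m1 x + n1 x)" "mono (\<lambda>x. m2 x + n2 x)"
      using p(1,2) q(1,2) by (auto simp: mono_def intro!: add_mono)
    show "\<bar>m1 x + n1 x\<bar> \<le> C + D" for x using spec[OF p(3), of x] spec[OF q(3), of x] by linarith
    show "\<bar>m2 x + n2 x\<bar> \<le> C + D" for x using spec[OF p(4), of x] spec[OF q(4), of x] by linarith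
    show "p x + q x = m1 x + n1 x - (m2 x + n2 x)" for x using spec[OF p(5), of x] spec[OF q(5), of x] by linarith
  qed
qed

lemma diff_mono_cmult:
  assumes "diff_mono p"
  shows "diff_mono (\<lambda>x. c * p x)"
proof -
  obtain m1 m2 C where p: "mono m1" "mono m2" "\<forall>x. \<bar>m1 x\<bar> \<le> C" "\<forall>x. \<bar>m2 x\<bar> \<le> C" "\<forall>x. p x = m1 x - m2 x"
    using assms(1) by (rule diff_monoE) (rule that)
  have b: "\<bar>d * m1 x\<bar> \<le> \<bar>d\<bar> * C" "\<bar>d * m2 x\<bar> \<le> \<bar>d\<bar> * C" for d x
    unfolding abs_mult using p(3,4) by (auto intro: mult_left_mono)
  have m: "mono (\<lambda>x. d * m1 x)" "mono (\<lambda>x. d * m2 x)" if "d \<ge> 0" for d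
    using p(1,2) that by (auto simp: mono_def intro: mult_left_mono)
  show ?thesis
  proof (cases "c \<ge> 0")
    case True
    show ?thesis
      by (rule diff_monoI[of "\<lambda>x. c * m1 x" "\<lambda>x. c * m2 x" "\<bar>c\<bar> * C"])
        (use m[OF True] b[of c] p(5) in \<open>auto simp: right_diff_distrib\<close>)
  next
    case False
    then have "- c \<ge> 0" by simp
    show ?thesis
      by (rule diff_monoI[of "\<lambda>x. - c * m2 x" "\<lambda>x. - c * m1 x" "\<bar>- c\<bar> * C"])
        (use m[OF \<open>- c \<ge> 0\<close>] b[of "- c"] p(5) in \<open>auto simp: right_diff_distrib\<close>)
  qed
qed

lemma diff_mono_sum: "finite A \<Longrightarrow> (\<And>i. i \<in> A \<Longrightarrow> diff_mono (p i)) \<Longrightarrow> diff_mono (\<lambda>x. \<Sum>i\<in>A. p i x)"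
proof (induction A rule: finite_induct)
  case empty
  show ?case by (simp add: diff_mono_const)
next
  case (insert a A)
  then have "diff_mono (\<lambda>x. p a x + (\<Sum>i\<in>A. p i x))" by (intro diff_mono_add) auto
  then show ?case using insert by simp
qed

lemma diff_mono_affine:
  assumes "diff_mono p" "a > 0"
  shows "diff_mono (\<lambda>x. p (b + a * x))"
proof -
  obtain m1 m2 C where p: "mono m1" "mono m2" "\<forall>x. \<bar>m1 x\<bar> \<le> C" "\<forall>x. \<bar>m2 x\<bar> \<le> C" "\<forall>x. p x = m1 x - m2 x"
    using assms(1) by (rule diff_monoE) (rule that)
  show ?thesis
  proof (rule diff_monoI[of "\<lambda>x. m1 (b + a * x)" "\<lambda>x. m2 (b + a * x)" C])
    show "mono (\<lambda>x. m1 (b + a * x))" "mono (\<lambda>x. m2 (b + a * x))"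
      using assms(2) by (auto intro!: monoI monoD[OF p(1)] monoD[OF p(2)])
  qed (use p in auto)
qed

text \<open>Lowering the left pieces of both monotone functions by \<open>C + D\<close> keeps their
  difference and makes the passage through 0 increasing.\<close>

lemma diff_mono_concat:
  assumes "diff_mono p" "diff_mono q"
  shows "diff_mono (\<lambda>x. if x < 0 then p x else q x)"
proof -
  obtain m1 m2 C where p: "mono m1" "mono m2" "\<forall>x. \<bar>m1 x\<bar> \<le> C" "\<forall>x. \<bar>m2 x\<bar> \<le> C" "\<forall>x. p x = m1 x - m2 x"
    using assms(1) by (rule diff_monoE) (rule that)
  obtain n1 n2 D where q: "mono n1" "mono n2" "\<forall>x. \<bar>n1 x\<bar> \<le> D" "\<forall>x. \<bar>n2 x\<bar> \<le> D" "\<forall>x. q x = n1 x - n2 x"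
    using assms(2) by (rule diff_monoE) (rule that)
  have C: "C \<ge> 0" "D \<ge> 0" using spec[OF p(3), of 0] spec[OF q(3), of 0] by linarith+
  have mono: "mono (\<lambda>x. if x < 0 then m x - (C + D) else n x)"
    if "mono m" "mono n" "\<forall>x. \<bar>m x\<bar> \<le> C" "\<forall>x. \<bar>n x\<bar> \<le> D" for m n :: "real \<Rightarrow> real"
  proof (rule monoI)
    fix x y :: real assume xy: "x \<le> y"
    show "(if x < 0 then m x - (C + D) else n x) \<le> (if y < 0 then m y - (C + D) else n y)"
      using monoD[OF that(1) xy] monoD[OF that(2) xy] spec[OF that(3), of x] spec[OF that(4), of y] xy
      by (auto simp: abs_le_iff)
  qed
  have bd: "\<bar>if x < 0 then m x - (C + D) else n x\<bar> \<le> 2 * C + 2 * D"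
    if "\<forall>x. \<bar>m x\<bar> \<le> C" "\<forall>x. \<bar>n x\<bar> \<le> D" for m n :: "real \<Rightarrow> real" and x :: real
    using spec[OF that(1), of x] spec[OF that(2), of x] C by (auto simp: abs_le_iff)
  show ?thesis
  proof (rule diff_monoI[of "\<lambda>x. if x < 0 then m1 x - (C + D) else n1 x" "\<lambda>x. if x < 0 then m2 x - (C + D) else n2 x" "2 * C + 2 * D"])
    show "mono (\<lambda>x. if x < 0 then m1 x - (C + D) else n1 x)" by (rule mono[OF p(1) q(1) p(3) q(3)])
    show "mono (\<lambda>x. if x < 0 then m2 x - (C + D) else n2 x)" by (rule mono[OF p(2) q(2) p(4) q(4)])
    show "\<bar>if x < 0 then m1 x - (C + D) else n1 x\<bar> \<le> 2 * C + 2 * D" for x by (rule bd[OF p(3) q(3)])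
    show "\<bar>if x < 0 then m2 x - (C + D) else n2 x\<bar> \<le> 2 * C + 2 * D" for x by (rule bd[OF p(4) q(4)])
    show "(if x < 0 then p x else q x) = (if x < 0 then m1 x - (C + D) else n1 x) - (if x < 0 then m2 x - (C + D) else n2 x)" for x
      using p(5) q(5) by simp
  qed
qed

lemma diff_mono_regular:
  assumes "diff_mono p"
  shows "p \<in> borel_measurable borel" "\<exists>C. \<forall>x. \<bar>p x\<bar> \<le> C" "countable {x. \<not> isCont p x}"
proof -
  obtain m1 m2 C where p: "mono m1" "mono m2" "\<forall>x. \<bar>m1 x\<bar> \<le> C" "\<forall>x. \<bar>m2 x\<bar> \<le> C" "\<forall>x. p x = m1 x - m2 x"
    using assms(1) by (rule diff_monoE) (rule that)
  have e: "p = (\<lambda>x. m1 x - m2 x)" using p(5) by auto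
  show "p \<in> borel_measurable borel"
    unfolding e by (intro borel_measurable_diff borel_measurable_mono p)
  have "\<bar>p x\<bar> \<le> 2 * C" for x using spec[OF p(3), of x] spec[OF p(4), of x] spec[OF p(5), of x] by linarith
  then show "\<exists>C. \<forall>x. \<bar>p x\<bar> \<le> C" by blast
  have "{x. \<not> isCont p x} \<subseteq> {x. \<not> isCont m1 x} \<union> {x. \<not> isCont m2 x}"
    unfolding e by auto
  then show "countable {x. \<not> isCont p x}"
    by (rule countable_subset) (intro countable_Un mono_ctble_discont p)
qed

section \<open>Bounded variation of travelling profiles\<close>

lemma mono_variation_le:
  fixes m \<theta> \<theta>' :: "real \<Rightarrow> real"
  assumes m: "mono m" "\<And>x. \<bar>m x\<bar> \<le> C" and bc: "b \<le> c"
    and d: "\<And>x. x \<in> {b..c} \<Longrightarrow> (\<theta> has_real_derivative \<theta>' x) (at x within {b..c})"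
    and z: "\<theta> b = 0" "\<theta> c = 0" and K: "\<And>x. x \<in> {b..c} \<Longrightarrow> \<bar>\<theta> x\<bar> \<le> K"
  shows "\<bar>integral {b..c} (\<lambda>x. m x * \<theta>' x)\<bar> \<le> 2 * C * K"
proof -
  have ftc: "(\<theta>' has_integral (\<theta> s - \<theta> r)) {r..s}" if "b \<le> r" "r \<le> s" "s \<le> c" for r s
  proof (rule fundamental_theorem_of_calculus[OF that(2)])
    fix x assume x: "x \<in> {r..s}"
    have "{r..s} \<subseteq> {b..c}" using that by auto
    then show "(\<theta> has_vector_derivative \<theta>' x) (at x within {r..s})"
      using DERIV_subset[OF d[of x]] x by (auto simp: has_real_derivative_iff_has_vector_derivative)
  qed
  have i: "\<theta>' integrable_on {b..c}" using ftc[of b c] bc by blast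
  \<comment> \<open>The second mean value theorem freezes the monotone factor at its two end values,
    so no derivative of \<open>m\<close> is involved.\<close>
  obtain r where r: "r \<in> {b..c}" "integral {b..c} (\<lambda>x. m x * \<theta>' x) = m b * integral {b..r} \<theta>' + m c * integral {r..c} \<theta>'"
    by (rule second_mean_value_theorem[OF i bc, of m]) (use monoD[OF m(1)] in auto)
  have "integral {b..r} \<theta>' = \<theta> r" "integral {r..c} \<theta>' = - \<theta> r"
    using integral_unique[OF ftc[of b r]] integral_unique[OF ftc[of r c]] r(1) z by auto
  then have "integral {b..c} (\<lambda>x. m x * \<theta>' x) = (m b - m c) * \<theta> r" using r(2) by (simp add: algebra_simps)
  also have "\<bar>\<dots>\<bar> \<le> (2 * C) * K"
    unfolding abs_mult using K[OF r(1)] m(2)[of b] m(2)[of c] by (intro mult_mono) linarith+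
  finally show ?thesis by simp
qed

lemma Basis_real_pair: "(Basis :: (real \<times> real) set) = {(1, 0), (0, 1)}"
  by (auto simp: Basis_prod_def)

text \<open>For components \<phi>1 and \<phi>2 of the test field, the divergence is the x-derivative
  of \<phi>1 - a * \<phi>2 plus the transport derivative of \<phi>2. The latter integrates to 0
  against the travelling profile by \<open>transport_identity\<close>; the former is, on each time
  slice, a one-dimensional variation of a difference of monotone functions.\<close>

lemma BV_transport:
  fixes p :: "real \<Rightarrow> real"
  assumes a: "a > 0" and L: "L > 0" and T: "T > 0" and p: "diff_mono p"
  shows "BV ({0<..<L} \<times> {0<..<T}) (\<lambda>z. p (fst z - a * snd z))"
proof -
  let ?I = "{0<..<L} \<times> {0<..<T}" and ?S = "{0..<L} \<times> {0..<T}"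
  define U where "U = (\<lambda>z::real \<times> real. p (fst z - a * snd z))"
  obtain m1 m2 C where m: "mono m1" "mono m2" "\<forall>x. \<bar>m1 x\<bar> \<le> C" "\<forall>x. \<bar>m2 x\<bar> \<le> C" "\<forall>x. p x = m1 x - m2 x"
    using p by (rule diff_monoE) (rule that)
  have C0: "C \<ge> 0" using spec[OF m(3), of 0] by linarith
  have pb: "\<bar>p x\<bar> \<le> 2 * C" for x using spec[OF m(3), of x] spec[OF m(4), of x] spec[OF m(5), of x] by linarith
  have pm: "p \<in> borel_measurable borel" by (rule diff_mono_regular(1)[OF p])
  have shm: "(\<lambda>z::real \<times> real. fst z - a * snd z) \<in> borel_measurable borel"
    by (intro borel_measurable_continuous_onI continuous_intros)
  have Um: "U \<in> borel_measurable borel" unfolding U_def by (rule measurable_compose[OF shm pm])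
  have Io: "open ?I" by (intro open_Times) auto
  have Isub: "?I \<subseteq> cbox (0, 0) (L, T)" by (auto simp: cbox_Pair_eq)
  have "integrable lborel (\<lambda>z. indicat_real ?I z * U z)"
  proof (rule integrable_bounded_support[of _ "2 * C" "(0, 0)" "(L, T)"])
    show "(\<lambda>z. indicat_real ?I z * U z) \<in> borel_measurable borel"
      by (intro borel_measurable_times borel_measurable_indicator borel_open Io Um)
    show "\<bar>indicat_real ?I z * U z\<bar> \<le> 2 * C" for z using pb C0 by (auto simp: U_def indicator_def)
    show "indicat_real ?I z * U z = 0" if "z \<notin> cbox (0, 0) (L, T)" for z
    proof -
      have "z \<notin> ?I" using that Isub by blast
      then show ?thesis by simp
    qed
  qed
  then have Ui: "U absolutely_integrable_on ?I"
    unfolding set_integrable_def by (simp add: integrable_completion)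
  have bound: "(LINT z:?I|lebesgue. U z * divergence \<phi> z) \<le> 4 * C * (1 + a) * T"
    if \<phi>: "C1c ?I \<phi>" and \<phi>1: "\<forall>z\<in>?I. norm (\<phi> z) \<le> 1" for \<phi> :: "real \<times> real \<Rightarrow> real \<times> real"
  proof -
    have UN: "\<exists>d. 0 < \<bar>d\<bar> \<and> \<bar>d\<bar> < e \<and> x + d *\<^sub>R i \<in> UNIV" if "e > 0" for e :: real and x i :: "real \<times> real"
      using that by (intro exI[of _ "e / 2"]) auto
    have "\<exists>\<phi>' Cc. compact Cc \<and> Cc \<subseteq> ?I \<and>
     (\<forall>x\<in>UNIV. ((\<lambda>x. if x \<in> ?I then \<phi> x else 0) has_derivative \<phi>' x) (at x within UNIV)) \<and>
     (\<forall>v. continuous_on UNIV (\<lambda>x. \<phi>' x v)) \<and>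
     (\<forall>x\<in>?I. (\<phi> has_derivative \<phi>' x) (at x within ?I)) \<and>
     (\<forall>x\<in>?I - Cc. \<phi> x = 0) \<and> (\<forall>x. x \<notin> Cc \<longrightarrow> \<phi>' x = (\<lambda>_. 0))"
      by (rule C1c_extend[OF \<phi> Io]) (simp, rule UN)
    then obtain \<phi>' Cc where Cc: "compact Cc" "Cc \<subseteq> ?I" and
     d0: "\<forall>x\<in>UNIV. ((\<lambda>x. if x \<in> ?I then \<phi> x else 0) has_derivative \<phi>' x) (at x within UNIV)" and
     dc: "\<forall>v. continuous_on UNIV (\<lambda>x. \<phi>' x v)" and
     dI: "\<forall>x\<in>?I. (\<phi> has_derivative \<phi>' x) (at x within ?I)" and
     d1: "\<forall>x\<in>?I - Cc. \<phi> x = 0" and d2: "\<forall>x. x \<notin> Cc \<longrightarrow> \<phi>' x = (\<lambda>_. 0)"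
      by (elim exE conjE) (rule that)
    define \<phi>0 where "\<phi>0 = (\<lambda>x. if x \<in> ?I then \<phi> x else 0)"
    have D: "(\<phi>0 has_derivative \<phi>' z) (at z)" for z using bspec[OF d0 UNIV_I, of z] by (simp add: \<phi>0_def)
    have \<phi>0b: "norm (\<phi>0 z) \<le> 1" for z using bspec[OF \<phi>1, of z] by (cases "z \<in> ?I") (simp_all only: \<phi>0_def if_True if_False norm_zero zero_le_one)
    have Z: "\<phi>0 z = 0" if "z \<notin> ?I" for z using that by (simp add: \<phi>0_def)
    have dz: "\<phi>' z v = 0" if "z \<notin> Cc" for z v using spec[OF d2, of z] that by simp
    have div: "divergence \<phi> z = fst (\<phi>' z (1, 0)) + snd (\<phi>' z (0, 1))" if "z \<in> ?I" for z
    proof -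
      have "(\<phi> has_derivative \<phi>' z) (at z)" using bspec[OF dI that] at_within_open[OF that Io] by simp
      then have "frechet_derivative \<phi> (at z) = \<phi>' z" using frechet_derivative_at by metis
      then show ?thesis unfolding divergence_def Basis_real_pair by (simp add: inner_prod_def)
    qed
    \<comment> \<open>It vanishes for \<open>x = 0\<close> and for \<open>t = 0\<close>, so the
      initial and boundary terms of the transport identity are 0.\<close>
    define f2 where "f2 = (\<lambda>z. snd (\<phi>0 z))"
    have f2d: "(f2 has_derivative (\<lambda>v. snd (\<phi>' z v))) (at z)" for z
      unfolding f2_def by (rule has_derivative_snd[OF D])
    have f2C: "C1c ?S f2"
      unfolding C1c_def
    proof
      show "\<exists>\<phi>'. (\<forall>x\<in>?S. (f2 has_derivative \<phi>' x) (at x within ?S)) \<and> (\<forall>v. continuous_on ?S (\<lambda>x. \<phi>' x v))"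
      proof (intro exI[of _ "\<lambda>z v. snd (\<phi>' z v)"] conjI ballI allI)
        show "(f2 has_derivative (\<lambda>v. snd (\<phi>' z v))) (at z within ?S)" for z
          by (rule has_derivative_at_withinI[OF f2d])
        show "continuous_on ?S (\<lambda>x. snd (\<phi>' x v))" for v
          by (intro continuous_on_snd continuous_on_subset[OF spec[OF dc]]) simp
      qed
      show "\<exists>C. compact C \<and> C \<subseteq> ?S \<and> (\<forall>x\<in>?S - C. f2 x = 0)"
      proof (intro exI[of _ Cc] conjI ballI Cc(1))
        show "Cc \<subseteq> ?S" using Cc(2) by auto
        show "f2 z = 0" if "z \<in> ?S - Cc" for z
          using d1 that by (cases "z \<in> ?I") (auto simp: f2_def \<phi>0_def)
      qed
    qed
    have f2f: "frechet_derivative f2 (at z) = (\<lambda>v. snd (\<phi>' z v))" for z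
      using frechet_derivative_at[OF f2d] by metis
    have z1: "f2 (x, 0) = 0" "f2 (0, t) = 0" for x t by (simp_all add: f2_def \<phi>0_def)
    have ti: "(LINT z:?I|lebesgue. U z * (snd (\<phi>' z (0, 1)) + a * snd (\<phi>' z (1, 0)))) = 0"
      using transport_identity[OF a L T pm pb f2C] unfolding f2f z1 U_def by simp
    \<comment> \<open>Bounded by \<open>1 + a\<close> because the test field has norm at most 1.
      Each of the two monotone parts then contributes at most \<open>2 * C * (1 + a)\<close> per
      unit of time.\<close>
    define \<theta> where "\<theta> = (\<lambda>z. fst (\<phi>0 z) - a * snd (\<phi>0 z))"
    define \<theta>x where "\<theta>x = (\<lambda>z. fst (\<phi>' z (1, 0)) - a * snd (\<phi>' z (1, 0)))"
    have \<theta>xc: "continuous_on UNIV \<theta>x" unfolding \<theta>x_def by (intro continuous_intros spec[OF dc])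
    have \<theta>x0: "\<theta>x z = 0" if "z \<notin> Cc" for z using dz[OF that] by (simp add: \<theta>x_def)
    have bnd: "\<exists>M\<ge>0. \<forall>z. \<bar>g z\<bar> \<le> M" if "continuous_on UNIV g" "\<And>z. z \<notin> Cc \<Longrightarrow> g z = 0" for g :: "real \<times> real \<Rightarrow> real"
    proof -
      have "bounded (g ` Cc)"
        by (intro compact_imp_bounded compact_continuous_image Cc continuous_on_subset[OF that(1)]) simp
      then obtain M where M: "\<forall>y\<in>g ` Cc. norm y \<le> M" unfolding bounded_iff by blast
      then have "\<bar>g z\<bar> \<le> max 0 M" for z using that(2)[of z] by (cases "z \<in> Cc") (auto simp: max.coboundedI2)
      then show ?thesis by (intro exI[of _ "max 0 M"]) auto
    qed
    have Ug: "integrable lborel (\<lambda>z. U z * g z)" if g: "continuous_on UNIV g" "\<And>z. z \<notin> Cc \<Longrightarrow> g z = 0" for g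
    proof -
      obtain M where M: "M \<ge> 0" "\<forall>z. \<bar>g z\<bar> \<le> M" using bnd[OF g] by blast
      show ?thesis
      proof (rule integrable_bounded_support[of _ "2 * C * M" "(0, 0)" "(L, T)"])
        show "(\<lambda>z. U z * g z) \<in> borel_measurable borel"
          by (intro borel_measurable_times Um borel_measurable_continuous_onI g)
        show "\<bar>U z * g z\<bar> \<le> 2 * C * M" for z
          unfolding abs_mult U_def using pb spec[OF M(2), of z] M(1) C0 by (intro mult_mono) simp_all
        show "U z * g z = 0" if "z \<notin> cbox (0, 0) (L, T)" for z
        proof -
          have "z \<notin> Cc" using that Isub Cc(2) by blast
          then show ?thesis using g(2) by simp
        qed
      qed
    qed
    have Ugl: "(\<lambda>z. U z * g z) absolutely_integrable_on ?I" if g: "continuous_on UNIV g" "\<And>z. z \<notin> Cc \<Longrightarrow> g z = 0" for g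
      unfolding set_integrable_def
    proof (rule integrable_mult_indicator)
      show "integrable lebesgue (\<lambda>z. U z * g z)"
        using Ug[OF g] borel_measurable_integrable[OF Ug[OF g]] by (simp add: integrable_completion)
    qed (simp add: Io borel_open)
    define g2 where "g2 = (\<lambda>z. snd (\<phi>' z (0, 1)) + a * snd (\<phi>' z (1, 0)))"
    have g2: "continuous_on UNIV g2" "\<And>z. z \<notin> Cc \<Longrightarrow> g2 z = 0"
      unfolding g2_def using dz by (auto intro!: continuous_intros spec[OF dc])
    have "(LINT z:?I|lebesgue. U z * divergence \<phi> z) = (LINT z:?I|lebesgue. U z * \<theta>x z + U z * g2 z)"
      by (rule set_integral_lebesgue_cong_AE) (auto simp: div \<theta>x_def g2_def algebra_simps intro!: AE_I2)
    also have "\<dots> = (LINT z:?I|lebesgue. U z * \<theta>x z) + (LINT z:?I|lebesgue. U z * g2 z)"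
      by (rule set_integral_add(2)[OF Ugl[OF \<theta>xc \<theta>x0] Ugl[OF g2]])
    also have "(LINT z:?I|lebesgue. U z * g2 z) = 0" using ti by (simp add: g2_def)
    also have "(LINT z:?I|lebesgue. U z * \<theta>x z) = (\<integral>z. U z * \<theta>x z \<partial>lborel)"
    proof -
      have e: "indicat_real ?I z *\<^sub>R (U z * \<theta>x z) = U z * \<theta>x z" for z
        using \<theta>x0[of z] Cc(2) by (cases "z \<in> Cc") (auto simp: indicator_def)
      have "(LINT z:?I|lebesgue. U z * \<theta>x z) = (\<integral>z. U z * \<theta>x z \<partial>lebesgue)"
        by (simp only: set_lebesgue_integral_def e)
      then show ?thesis using borel_measurable_integrable[OF Ug[OF \<theta>xc \<theta>x0]] by (simp add: integral_completion)
    qed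
    also have "\<dots> = (\<integral>t. (\<integral>x. U (x, t) * \<theta>x (x, t) \<partial>lborel) \<partial>lborel)"
      using lborel_pair.integral_snd[of "\<lambda>x t. U (x, t) * \<theta>x (x, t)"] Ug[OF \<theta>xc \<theta>x0] by (simp add: lborel_prod case_prod_beta')
    also have "\<dots> \<le> (\<integral>t. 4 * C * (1 + a) * indicat_real {0<..<T} t \<partial>lborel)"
    proof (rule integral_mono')
      show "integrable lborel (\<lambda>t. 4 * C * (1 + a) * indicat_real {0<..<T} t)"
        using T by (intro integrable_mult_right integrable_real_indicator) auto
      fix t :: real
      show "0 \<le> 4 * C * (1 + a) * indicat_real {0<..<T} t" using C0 a by simp
      show "(\<integral>x. U (x, t) * \<theta>x (x, t) \<partial>lborel) \<le> 4 * C * (1 + a) * indicat_real {0<..<T} t"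
      proof (cases "t \<in> {0<..<T}")
        case False
        then have "(x, t) \<notin> ?I" for x by simp
        then have "\<theta>x (x, t) = 0" for x using \<theta>x0 Cc(2) by blast
        then show ?thesis using False by simp
      next
        case True
        have o: "\<theta>x (x, t) = 0" if "x \<notin> {0<..<L}" for x
        proof -
          have "(x, t) \<notin> ?I" using that by auto
          then show ?thesis using \<theta>x0 Cc(2) by blast
        qed
        have \<theta>xt: "continuous_on A (\<lambda>x. \<theta>x (x, t))" for A
          by (intro continuous_on_compose2[OF \<theta>xc] continuous_intros) auto
        have der: "((\<lambda>x. \<theta> (x, t)) has_real_derivative \<theta>x (x, t)) (at x within {0..L})" for x
        proof -
          have "((\<lambda>x. (x, t)) has_derivative (\<lambda>h. (h, 0))) (at x within {0..L})"
            by (auto intro!: derivative_eq_intros)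
          from has_derivative_compose[OF this D]
          have c: "((\<lambda>x. \<phi>0 (x, t)) has_derivative (\<lambda>h. \<phi>' (x, t) (h, 0))) (at x within {0..L})" .
          have "((\<lambda>x. \<theta> (x, t)) has_derivative (\<lambda>h. fst (\<phi>' (x, t) (h, 0)) - a * snd (\<phi>' (x, t) (h, 0)))) (at x within {0..L})"
            unfolding \<theta>_def
            by (intro has_derivative_diff has_derivative_fst[OF c] has_derivative_mult_right has_derivative_snd[OF c])
          moreover have "fst (\<phi>' (x, t) (h, 0)) - a * snd (\<phi>' (x, t) (h, 0)) = \<theta>x (x, t) * h" for h
          proof -
            have "\<phi>' (x, t) (h *\<^sub>R (1, 0)) = h *\<^sub>R \<phi>' (x, t) (1, 0)"
              by (rule linear_cmul[OF has_derivative_linear[OF D]])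
            then show ?thesis by (simp add: \<theta>x_def algebra_simps)
          qed
          ultimately show ?thesis unfolding has_field_derivative_def by simp
        qed
        obtain M where M: "M \<ge> 0" "\<forall>z. \<bar>\<theta>x z\<bar> \<le> M" using bnd[OF \<theta>xc \<theta>x0] by blast
        have key: "integrable lborel (\<lambda>x. m (x - a * t) * \<theta>x (x, t))"
          "\<bar>\<integral>x. m (x - a * t) * \<theta>x (x, t) \<partial>lborel\<bar> \<le> 2 * C * (1 + a)"
          if m: "mono m" "\<forall>x. \<bar>m x\<bar> \<le> C" for m :: "real \<Rightarrow> real"
        proof -
          have sh: "(\<lambda>x. x - a * t) \<in> borel_measurable borel" by measurable
          show i: "integrable lborel (\<lambda>x. m (x - a * t) * \<theta>x (x, t))"
          proof (rule integrable_bounded_support[of _ "C * M" 0 L])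
            show "(\<lambda>x. m (x - a * t) * \<theta>x (x, t)) \<in> borel_measurable borel"
              by (intro borel_measurable_times measurable_compose[OF sh borel_measurable_mono[OF m(1)]]
                  borel_measurable_continuous_onI \<theta>xt)
            show "\<bar>m (x - a * t) * \<theta>x (x, t)\<bar> \<le> C * M" for x
              unfolding abs_mult using m(2) M C0 by (intro mult_mono) auto
            show "m (x - a * t) * \<theta>x (x, t) = 0" if "x \<notin> cbox 0 L" for x
              using o[of x] that by (auto simp: cbox_interval)
          qed
          have "set_integrable lborel {0..L} (\<lambda>x. m (x - a * t) * \<theta>x (x, t))"
            unfolding set_integrable_def by (rule integrable_mult_indicator[OF _ i]) simp
          then have "integral {0..L} (\<lambda>x. m (x - a * t) * \<theta>x (x, t)) = (LINT x:{0..L}|lborel. m (x - a * t) * \<theta>x (x, t))"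
            by (rule set_borel_integral_eq_integral(2)[symmetric])
          also have "\<dots> = (\<integral>x. m (x - a * t) * \<theta>x (x, t) \<partial>lborel)"
            unfolding set_lebesgue_integral_def
          proof (rule Bochner_Integration.integral_cong[OF refl])
            show "indicat_real {0..L} x *\<^sub>R (m (x - a * t) * \<theta>x (x, t)) = m (x - a * t) * \<theta>x (x, t)" for x
            proof (cases "x \<in> {0..L}")
              case False
              then have "x \<notin> {0<..<L}" by auto
              then show ?thesis using o by simp
            qed simp
          qed
          finally have e: "integral {0..L} (\<lambda>x. m (x - a * t) * \<theta>x (x, t)) = (\<integral>x. m (x - a * t) * \<theta>x (x, t) \<partial>lborel)" .
          have "\<bar>integral {0..L} (\<lambda>x. m (x - a * t) * \<theta>x (x, t))\<bar> \<le> 2 * C * (1 + a)"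
          proof (rule mono_variation_le)
            show "mono (\<lambda>x. m (x - a * t))" by (intro monoI monoD[OF m(1)]) simp
            show "\<bar>m (x - a * t)\<bar> \<le> C" for x using m(2) by simp
            show "0 \<le> L" using L by simp
            show "((\<lambda>x. \<theta> (x, t)) has_real_derivative \<theta>x (x, t)) (at x within {0..L})" for x by (rule der)
            show "\<theta> (0, t) = 0" "\<theta> (L, t) = 0" using Z by (simp_all add: \<theta>_def)
            show "\<bar>\<theta> (x, t)\<bar> \<le> 1 + a" for x
            proof -
              have "\<bar>fst (\<phi>0 (x, t))\<bar> \<le> 1" "\<bar>snd (\<phi>0 (x, t))\<bar> \<le> 1"
                using norm_fst_le[of "fst (\<phi>0 (x, t))" "snd (\<phi>0 (x, t))"] norm_snd_le[of "snd (\<phi>0 (x, t))" "fst (\<phi>0 (x, t))"] \<phi>0b[of "(x, t)"]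
                by auto
              then have "\<bar>fst (\<phi>0 (x, t))\<bar> \<le> 1" "\<bar>a * snd (\<phi>0 (x, t))\<bar> \<le> a * 1"
                using a by (auto simp: abs_mult mult_left_le)
              then show ?thesis unfolding \<theta>_def by linarith
            qed
          qed
          then show "\<bar>\<integral>x. m (x - a * t) * \<theta>x (x, t) \<partial>lborel\<bar> \<le> 2 * C * (1 + a)" unfolding e .
        qed
        have "(\<integral>x. U (x, t) * \<theta>x (x, t) \<partial>lborel) = (\<integral>x. m1 (x - a * t) * \<theta>x (x, t) - m2 (x - a * t) * \<theta>x (x, t) \<partial>lborel)"
          using m(5) by (simp add: U_def left_diff_distrib)
        also have "\<dots> = (\<integral>x. m1 (x - a * t) * \<theta>x (x, t) \<partial>lborel) - (\<integral>x. m2 (x - a * t) * \<theta>x (x, t) \<partial>lborel)"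
          by (rule Bochner_Integration.integral_diff[OF key(1)[OF m(1,3)] key(1)[OF m(2,4)]])
        also have "\<dots> \<le> 4 * C * (1 + a)" using key(2)[OF m(1,3)] key(2)[OF m(2,4)] by linarith
        finally show ?thesis using True by simp
      qed
    qed
    also have "\<dots> = 4 * C * (1 + a) * T" using T by simp
    finally show ?thesis by simp
  qed
  have "bdd_above (variation_sums ?I U)"
    unfolding variation_sums_def using bound by (intro bdd_aboveI[of _ "4 * C * (1 + a) * T"]) auto
  then show ?thesis using Ui unfolding BV_def U_def by blast
qed

lemma has_trace_transport:
  fixes p :: "real \<Rightarrow> real"
  assumes "isCont p (L - a * t)"
  shows "has_trace ({0<..<L} \<times> {0<..<T}) (\<lambda>z. p (fst z - a * snd z)) (L, t) (p (L - a * t))"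
proof (rule has_traceI)
  show "{0<..<L} \<times> {0<..<T} \<in> sets lebesgue" by (intro lmeasurable_open[THEN fmeasurableD] open_Times bounded_Times) auto
  have "((\<lambda>z. fst z - a * snd z) \<longlongrightarrow> fst (L, t) - a * snd (L, t)) (at (L, t) within {0<..<L} \<times> {0<..<T})"
    by (intro tendsto_intros)
  then show "((\<lambda>z. p (fst z - a * snd z)) \<longlongrightarrow> p (L - a * t)) (at (L, t) within {0<..<L} \<times> {0<..<T})"
    using isCont_tendsto_compose[OF assms] by simp
qed auto

lemma AE_lebesgue_countable: "countable {t. \<not> P t} \<Longrightarrow> AE t in (lebesgue :: real measure). P t"
  using AE_completion[OF AE_not_in[OF countable_imp_null_set_lborel]] by fastforce

text \<open>At \<open>x = 0\<close> the identity for travelling profiles produces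
  \<open>P i (- lam i * t)\<close>; the conditions on negative arguments turn it into
  \<open>B i\<close> or into the traces \<open>P j (L j - lam j * t)\<close> with their weights. The
  traces are attained for all but countably many times, since each discontinuity of
  \<open>P j\<close> reaches the node at one time only.\<close>

lemma transport_solution_profile:
  fixes P :: "nat \<Rightarrow> real \<Rightarrow> real"
  assumes lam: "\<And>i. i \<in> In \<union> Out \<Longrightarrow> lam i > 0"
    and L: "\<And>i. i \<in> In \<union> Out \<Longrightarrow> L i > 0" and T: "T > 0"
    and P: "\<And>i. i \<in> In \<union> Out \<Longrightarrow> diff_mono (P i)"
    and u0: "\<And>i. i \<in> In \<union> Out \<Longrightarrow> AE x in lebesgue. x \<in> edge L i \<longrightarrow> u0 i x = P i x"
    and PIn: "\<And>i y. i \<in> In \<Longrightarrow> y < 0 \<Longrightarrow> P i y = B i"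
    and POut: "\<And>i y. i \<in> Out \<Longrightarrow> y < 0 \<Longrightarrow> P i y = (\<Sum>k\<in>In. lam k * P k (L k + lam k / lam i * y) * G i k)"
  shows "transport_solution In Out L lam (\<lambda>i j. lam i * G i j) B u0 T (\<lambda>i z. P i (fst z - lam i * snd z))"
  unfolding transport_solution_def
proof (intro conjI ballI exI[of _ "\<lambda>j t. P j (L j - lam j * t)"] allI impI)
  show "BV (edge L i \<times> {0<..<T}) (\<lambda>z. P i (fst z - lam i * snd z))" if "i \<in> In \<union> Out" for i
    by (rule BV_transport[OF lam[OF that] L[OF that] T P[OF that]])
  show "(\<lambda>t. P j (L j - lam j * t)) absolutely_integrable_on {0<..<T}" if "j \<in> In" for j
  proof -
    have j: "j \<in> In \<union> Out" using that by simp
    obtain C where C: "\<forall>x. \<bar>P j x\<bar> \<le> C" using diff_mono_regular(2)[OF P[OF j]] by blast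
    have C0: "C \<ge> 0" using spec[OF C, of 0] by linarith
    have sh: "(\<lambda>t. L j - lam j * t) \<in> borel_measurable borel" by measurable
    have "integrable lborel (\<lambda>t. indicat_real {0<..<T} t * P j (L j - lam j * t))"
    proof (rule integrable_bounded_support[of _ C 0 T])
      show "(\<lambda>t. indicat_real {0<..<T} t * P j (L j - lam j * t)) \<in> borel_measurable borel"
        by (intro borel_measurable_times borel_measurable_indicator measurable_compose[OF sh diff_mono_regular(1)[OF P[OF j]]]) simp
      show "\<bar>indicat_real {0<..<T} t * P j (L j - lam j * t)\<bar> \<le> C" for t
        using C C0 by (auto simp: indicator_def)
      show "indicat_real {0<..<T} t * P j (L j - lam j * t) = 0" if "t \<notin> cbox 0 T" for t
        using that by (auto simp: indicator_def cbox_interval)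
    qed
    then show ?thesis unfolding set_integrable_def by (simp add: integrable_completion)
  qed
  show "AE t in lebesgue. t \<in> {0<..<T} \<longrightarrow>
      has_trace (edge L j \<times> {0<..<T}) (\<lambda>z. P j (fst z - lam j * snd z)) (L j, t) (P j (L j - lam j * t))" if "j \<in> In" for j
  proof -
    have j: "j \<in> In \<union> Out" using that by simp
    have "{t. \<not> isCont (P j) (L j - lam j * t)} \<subseteq> (\<lambda>x. (L j - x) / lam j) ` {x. \<not> isCont (P j) x}"
    proof
      fix t assume "t \<in> {t. \<not> isCont (P j) (L j - lam j * t)}"
      then show "t \<in> (\<lambda>x. (L j - x) / lam j) ` {x. \<not> isCont (P j) x}"
        using lam[OF j] by (intro image_eqI[of _ _ "L j - lam j * t"]) auto
    qed
    then have "countable {t. \<not> isCont (P j) (L j - lam j * t)}"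
      using countable_image[OF diff_mono_regular(3)[OF P[OF j]]] by (rule countable_subset)
    then have "AE t in lebesgue. isCont (P j) (L j - lam j * t)" by (rule AE_lebesgue_countable)
    then show ?thesis by eventually_elim (auto intro: has_trace_transport)
  qed
  fix i and \<phi> :: "real \<times> real \<Rightarrow> real" assume i: "i \<in> In \<union> Out" and \<phi>: "C1c ({0..<L i} \<times> {0..<T}) \<phi>"
  obtain C where C: "\<And>x. \<bar>P i x\<bar> \<le> C" using diff_mono_regular(2)[OF P[OF i]] by blast
  have id: "(LINT z:edge L i \<times> {0<..<T}|lebesgue. P i (fst z - lam i * snd z) *
      (frechet_derivative \<phi> (at z) (0, 1) + lam i * frechet_derivative \<phi> (at z) (1, 0)))
     + (LINT x:edge L i|lebesgue. P i x * \<phi> (x, 0))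
     = - lam i * (LINT t:{0<..<T}|lebesgue. P i (- lam i * t) * \<phi> (0, t))"
    by (rule transport_identity[OF lam[OF i] L[OF i] T diff_mono_regular(1)[OF P[OF i]] C \<phi>])
  have e0: "(LINT x:edge L i|lebesgue. u0 i x * \<phi> (x, 0)) = (LINT x:edge L i|lebesgue. P i x * \<phi> (x, 0))"
    by (rule set_integral_lebesgue_cong_AE) (use u0[OF i] in \<open>auto elim!: eventually_mono\<close>)
  have e1: "- lam i * (LINT t:{0<..<T}|lebesgue. P i (- lam i * t) * \<phi> (0, t))
    = (if i \<in> In then - lam i * B i * (LINT t:{0<..<T}|lebesgue. \<phi> (0, t))
       else - (LINT t:{0<..<T}|lebesgue. \<phi> (0, t) * (\<Sum>j\<in>In. lam i * G i j * lam j * P j (L j - lam j * t))))"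
  proof (cases "i \<in> In")
    case True
    have "(LINT t:{0<..<T}|lebesgue. P i (- lam i * t) * \<phi> (0, t)) = (LINT t:{0<..<T}|lebesgue. B i * \<phi> (0, t))"
      by (rule set_integral_lebesgue_cong_AE) (use PIn[OF True] lam[OF i] in \<open>auto intro!: AE_I2\<close>)
    then show ?thesis using True by simp
  next
    case False
    then have o: "i \<in> Out" using i by simp
    have "lam i * (LINT t:{0<..<T}|lebesgue. P i (- lam i * t) * \<phi> (0, t)) = (LINT t:{0<..<T}|lebesgue. lam i * (P i (- lam i * t) * \<phi> (0, t)))"
      by simp
    also have "\<dots> = (LINT t:{0<..<T}|lebesgue. \<phi> (0, t) * (\<Sum>j\<in>In. lam i * G i j * lam j * P j (L j - lam j * t)))"
    proof (rule set_integral_lebesgue_cong_AE, intro AE_I2 impI)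
      fix t assume t: "t \<in> {0<..<T}"
      have "lam i * P i (- lam i * t) = (\<Sum>j\<in>In. lam i * G i j * lam j * P j (L j - lam j * t))"
        using POut[OF o, of "- lam i * t"] t lam[OF i] by (simp add: sum_distrib_left mult_ac)
      then show "lam i * (P i (- lam i * t) * \<phi> (0, t)) = \<phi> (0, t) * (\<Sum>j\<in>In. lam i * G i j * lam j * P j (L j - lam j * t))"
        by (metis mult.assoc mult.commute)
    qed
    finally show ?thesis using False by simp
  qed
  show "(LINT z:edge L i \<times> {0<..<T}|lebesgue. P i (fst z - lam i * snd z) *
      (frechet_derivative \<phi> (at z) (0, 1) + lam i * frechet_derivative \<phi> (at z) (1, 0)))
     + (LINT x:edge L i|lebesgue. u0 i x * \<phi> (x, 0))
     = (if i \<in> In then - lam i * B i * (LINT t:{0<..<T}|lebesgue. \<phi> (0, t))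
       else - (LINT t:{0<..<T}|lebesgue. \<phi> (0, t) * (\<Sum>j\<in>In. lam i * G i j * lam j * P j (L j - lam j * t))))"
    unfolding e0 e1[symmetric] by (rule id)
qed

text \<open>Solving the transport equation for the test function turns the weak formulation into a uniqueness
  statement.\<close>

lemma transport_test_function:
  assumes a: "a > 0" and T: "T > 0" and x12: "x2 \<le> L" and t12: "t2 \<le> T"
  shows "\<exists>\<phi>. C1c ({0..<L} \<times> {0..<T}) \<phi> \<and> (\<forall>z\<in>{0<..<L} \<times> {0<..<T}.
     frechet_derivative \<phi> (at z) (0, 1) + a * frechet_derivative \<phi> (at z) (1, 0)
      = cutoff x1 x2 n (fst z) * cutoff t1 t2 n (snd z))"
proof -
  let ?\<alpha> = "cutoff x1 x2 n" and ?\<beta> = "cutoff t1 t2 n"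
  obtain \<alpha>' \<alpha>'' where \<alpha>: "\<forall>x. (?\<alpha> has_real_derivative \<alpha>' x) (at x)" "\<forall>x. (\<alpha>' has_real_derivative \<alpha>'' x) (at x)"
    using C2_cutoff[of x1 x2 n] unfolding C2_def by (elim exE conjE) (rule that)
  obtain \<beta>' \<beta>'' where \<beta>: "\<forall>x. (?\<beta> has_real_derivative \<beta>' x) (at x)" "\<forall>x. (\<beta>' has_real_derivative \<beta>'' x) (at x)"
    using C2_cutoff[of t1 t2 n] unfolding C2_def by (elim exE conjE) (rule that)
  have c: "continuous_on UNIV ?\<alpha>" "continuous_on UNIV ?\<beta>" by (rule C2_continuous[OF C2_cutoff])+
  have c\<alpha>': "continuous_on UNIV \<alpha>'" by (rule DERIV_continuous_on) (rule has_field_derivative_at_within[OF spec[OF \<alpha>(2)]])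
  have c\<beta>': "continuous_on UNIV \<beta>'" by (rule DERIV_continuous_on) (rule has_field_derivative_at_within[OF spec[OF \<beta>(2)]])
  define f where "f = (\<lambda>(z::real \<times> real) s. ?\<alpha> (fst z + a * s) * ?\<beta> (snd z + s))"
  \<comment> \<open>The derivative takes values in bounded linear maps, the form in which the
    Leibniz rule wants a continuous total derivative.\<close>
  define fx where "fx = (\<lambda>(z::real \<times> real) s. (\<alpha>' (fst z + a * s) * ?\<beta> (snd z + s)) *\<^sub>R fst_blinfun
     + (?\<alpha> (fst z + a * s) * \<beta>' (snd z + s)) *\<^sub>R (snd_blinfun :: (real \<times> real) \<Rightarrow>\<^sub>L real))"
  \<comment> \<open>Minus the integral of the source along the forward characteristic. The source is
    0 from time \<open>t2 \<le> T\<close> on, so a stretch of duration \<open>T\<close> starting at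
    a nonnegative time runs past it.\<close>
  define \<phi> where "\<phi> = (\<lambda>z. - integral {0..T} (f z))"
  have comp: "continuous_on A (\<lambda>x. u (v x))" if "continuous_on UNIV u" "continuous_on A v" for u :: "real \<Rightarrow> real" and v :: "'c::topological_space \<Rightarrow> real" and A
    by (rule continuous_on_compose2[OF that]) simp
  have fxc: "continuous_on (UNIV \<times> cbox 0 T) (\<lambda>(z, s). fx z s)"
    unfolding fx_def case_prod_beta'
    by (intro continuous_intros comp[OF c(1)] comp[OF c(2)] comp[OF c\<alpha>'] comp[OF c\<beta>'])
  have fc: "continuous_on {0..T} (f z)" for z
    unfolding f_def by (intro continuous_intros comp[OF c(1)] comp[OF c(2)])
  have fxcz: "continuous_on {0..T} (fx z)" for z
    unfolding fx_def by (intro continuous_intros comp[OF c(1)] comp[OF c(2)] comp[OF c\<alpha>'] comp[OF c\<beta>'])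
  have fd: "((\<lambda>z. f z s) has_derivative blinfun_apply (fx z s)) (at z within UNIV)" for z s
  proof -
    have 1: "((\<lambda>z. ?\<alpha> (fst z + a * s)) has_derivative (\<lambda>v. \<alpha>' (fst z + a * s) * fst v)) (at z)"
    proof -
      have "((\<lambda>z. fst z + a * s) has_derivative fst) (at z)" by (auto intro!: derivative_eq_intros)
      from has_derivative_compose[OF this spec[OF \<alpha>(1), unfolded has_field_derivative_def]] show ?thesis .
    qed
    have 2: "((\<lambda>z. ?\<beta> (snd z + s)) has_derivative (\<lambda>v. \<beta>' (snd z + s) * snd v)) (at z)"
    proof -
      have "((\<lambda>z. snd z + s) has_derivative snd) (at z)" by (auto intro!: derivative_eq_intros)
      from has_derivative_compose[OF this spec[OF \<beta>(1), unfolded has_field_derivative_def]] show ?thesis .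
    qed
    have "((\<lambda>z. ?\<alpha> (fst z + a * s) * ?\<beta> (snd z + s)) has_derivative
       (\<lambda>v. ?\<alpha> (fst z + a * s) * (\<beta>' (snd z + s) * snd v) + \<alpha>' (fst z + a * s) * fst v * ?\<beta> (snd z + s))) (at z)"
      by (rule has_derivative_mult[OF 1 2])
    moreover have "(\<lambda>v. ?\<alpha> (fst z + a * s) * (\<beta>' (snd z + s) * snd v) + \<alpha>' (fst z + a * s) * fst v * ?\<beta> (snd z + s)) = blinfun_apply (fx z s)"
      unfolding fx_def by (auto simp: blinfun.add_left blinfun.scaleR_left fst_blinfun.rep_eq snd_blinfun.rep_eq algebra_simps)
    ultimately show ?thesis unfolding f_def by simp
  qed
  have \<phi>d: "(\<phi> has_derivative (\<lambda>v. - blinfun_apply (integral {0..T} (fx z)) v)) (at z)" for z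
  proof -
    have "((\<lambda>z. integral (cbox 0 T) (f z)) has_derivative blinfun_apply (integral (cbox 0 T) (fx z))) (at z within UNIV)"
      by (rule leibniz_rule[OF fd _ fxc]) (use fc in \<open>auto simp: cbox_interval intro: integrable_continuous_real\<close>)
    then have "((\<lambda>z. integral {0..T} (f z)) has_derivative blinfun_apply (integral {0..T} (fx z))) (at z)"
      by (simp add: cbox_interval)
    then show ?thesis unfolding \<phi>_def by (rule has_derivative_minus)
  qed
  have ic: "continuous_on UNIV (\<lambda>z. integral {0..T} (fx z))"
    using integral_continuous_on_param[OF fxc] by (simp add: cbox_interval)
  have C1: "C1c ({0..<L} \<times> {0..<T}) \<phi>"
    unfolding C1c_def
  proof
    show "\<exists>\<phi>'. (\<forall>x\<in>{0..<L} \<times> {0..<T}. (\<phi> has_derivative \<phi>' x) (at x within {0..<L} \<times> {0..<T})) \<and>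
        (\<forall>v. continuous_on ({0..<L} \<times> {0..<T}) (\<lambda>x. \<phi>' x v))"
    proof (intro exI[of _ "\<lambda>z v. - blinfun_apply (integral {0..T} (fx z)) v"] conjI ballI allI)
      show "(\<phi> has_derivative (\<lambda>v. - blinfun_apply (integral {0..T} (fx z)) v)) (at z within {0..<L} \<times> {0..<T})" for z
        by (rule has_derivative_at_withinI[OF \<phi>d])
      show "continuous_on ({0..<L} \<times> {0..<T}) (\<lambda>z. - blinfun_apply (integral {0..T} (fx z)) v)" for v
        by (intro continuous_intros continuous_on_subset[OF ic]) simp
    qed
    define q where "q = 1 / real (Suc n)"
    have q: "q > 0" by (simp add: q_def)
    show "\<exists>C. compact C \<and> C \<subseteq> {0..<L} \<times> {0..<T} \<and> (\<forall>x\<in>{0..<L} \<times> {0..<T} - C. \<phi> x = 0)"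
    proof (intro exI[of _ "{0..x2 - q} \<times> {0..t2 - q}"] conjI ballI)
      show "compact ({0..x2 - q} \<times> {0..t2 - q})" by (intro compact_Times compact_Icc)
      show "{0..x2 - q} \<times> {0..t2 - q} \<subseteq> {0..<L} \<times> {0..<T}" using q x12 t12 by auto
      fix z assume z: "z \<in> {0..<L} \<times> {0..<T} - {0..x2 - q} \<times> {0..t2 - q}"
      have "f z s = 0" if s: "s \<in> {0..T}" for s
      proof -
        have "fst z \<ge> x2 - q \<or> snd z \<ge> t2 - q" using z by (cases z) auto
        then show ?thesis
        proof
          assume "fst z \<ge> x2 - q"
          moreover have "a * s \<ge> 0" using a s by simp
          ultimately have "fst z + a * s \<ge> x2 - 1 / real (Suc n)" by (simp add: q_def)
          then show ?thesis unfolding f_def using cutoff_eq_0[of _ x1 n x2] by simp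
        next
          assume "snd z \<ge> t2 - q"
          then have "snd z + s \<ge> t2 - 1 / real (Suc n)" using s by (simp add: q_def)
          then show ?thesis unfolding f_def using cutoff_eq_0[of _ t1 n t2] by simp
        qed
      qed
      then have "integral {0..T} (f z) = integral {0..T} (\<lambda>_. 0)" by (rule integral_cong)
      then show "\<phi> z = 0" by (simp add: \<phi>_def)
    qed
  qed
  have "frechet_derivative \<phi> (at z) (0, 1) + a * frechet_derivative \<phi> (at z) (1, 0) = ?\<alpha> (fst z) * ?\<beta> (snd z)"
    if z: "z \<in> {0<..<L} \<times> {0<..<T}" for z
  proof -
    have e: "frechet_derivative \<phi> (at z) = (\<lambda>v. - blinfun_apply (integral {0..T} (fx z)) v)"
      by (rule frechet_derivative_at[OF \<phi>d, symmetric])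
    have "- blinfun_apply (integral {0..T} (fx z)) (0, 1) + a * - blinfun_apply (integral {0..T} (fx z)) (1, 0)
      = - blinfun_apply (integral {0..T} (fx z)) ((0, 1) + a *\<^sub>R (1, 0))"
      by (simp only: blinfun.add_right blinfun.scaleR_right real_scaleR_def)
    also have "\<dots> = - blinfun_apply (integral {0..T} (fx z)) (a, 1)" by simp
    also have "blinfun_apply (integral {0..T} (fx z)) (a, 1) = integral {0..T} (\<lambda>s. blinfun_apply (fx z s) (a, 1))"
      using integral_linear[OF integrable_continuous_real[OF fxcz[of z]] blinfun.bounded_linear_left[of "(a, 1)"]]
      unfolding o_def by (rule sym)
    also have "\<dots> = ?\<alpha> (fst z + a * T) * ?\<beta> (snd z + T) - ?\<alpha> (fst z + a * 0) * ?\<beta> (snd z + 0)"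
    proof (rule integral_unique, rule fundamental_theorem_of_calculus[where f = "\<lambda>s. ?\<alpha> (fst z + a * s) * ?\<beta> (snd z + s)"])
      show "0 \<le> T" using T by simp
      fix s
      have l: "((\<lambda>s. fst z + a * s) has_real_derivative a) (at s)" "((\<lambda>s. snd z + s) has_real_derivative 1) (at s)"
        by (auto intro!: derivative_eq_intros)
      have "((\<lambda>s. ?\<alpha> (fst z + a * s) * ?\<beta> (snd z + s)) has_real_derivative
          \<alpha>' (fst z + a * s) * a * ?\<beta> (snd z + s) + \<beta>' (snd z + s) * 1 * ?\<alpha> (fst z + a * s)) (at s within {0..T})"
        by (rule has_field_derivative_at_within, rule DERIV_mult[OF DERIV_chain2[OF spec[OF \<alpha>(1)] l(1)] DERIV_chain2[OF spec[OF \<beta>(1)] l(2)]])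
      moreover have "\<alpha>' (fst z + a * s) * a * ?\<beta> (snd z + s) + \<beta>' (snd z + s) * 1 * ?\<alpha> (fst z + a * s) = blinfun_apply (fx z s) (a, 1)"
        unfolding fx_def by (simp add: blinfun.add_left blinfun.scaleR_left fst_blinfun.rep_eq snd_blinfun.rep_eq)
      ultimately show "((\<lambda>s. ?\<alpha> (fst z + a * s) * ?\<beta> (snd z + s)) has_vector_derivative blinfun_apply (fx z s) (a, 1)) (at s within {0..T})"
        by (simp add: has_real_derivative_iff_has_vector_derivative)
    qed
    also have "?\<beta> (snd z + T) = 0" by (rule cutoff_eq_0') (use z t12 in auto)
    finally show ?thesis unfolding e by simp
  qed
  then have "\<forall>z\<in>{0<..<L} \<times> {0<..<T}.
     frechet_derivative \<phi> (at z) (0, 1) + a * frechet_derivative \<phi> (at z) (1, 0) = ?\<alpha> (fst z) * ?\<beta> (snd z)" by (rule ballI)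
  with C1 have "C1c ({0..<L} \<times> {0..<T}) \<phi> \<and> (\<forall>z\<in>{0<..<L} \<times> {0<..<T}.
     frechet_derivative \<phi> (at z) (0, 1) + a * frechet_derivative \<phi> (at z) (1, 0) = ?\<alpha> (fst z) * ?\<beta> (snd z))" by (rule conjI)
  then show ?thesis by (rule exI[of _ \<phi>])
qed

text \<open>Dominated convergence turns products of cutoffs into indicators of boxes. Only the upper
  right corner is clipped to the rectangle, because the test functions producing these products may
  be nonzero on the lower and left sides; \<open>dh\<close> vanishes off the rectangle, so the
  clipped integrals are those of arbitrary boxes.\<close>

lemma AE_zero_of_cutoff_pair:
  assumes d: "d absolutely_integrable_on {0<..<L} \<times> {0<..<T}"
    and zero: "\<And>x1 x2 t1 t2 n. x2 \<le> L \<Longrightarrow> t2 \<le> T \<Longrightarrow>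
       (LINT z:{0<..<L} \<times> {0<..<T}|lebesgue. d z * (cutoff x1 x2 n (fst z) * cutoff t1 t2 n (snd z))) = 0"
  shows "AE z in lebesgue. z \<in> {0<..<L} \<times> {0<..<T} \<longrightarrow> d z = 0"
proof -
  let ?I = "{0<..<L} \<times> {0<..<T}"
  define dh where "dh = (\<lambda>z. indicat_real ?I z * d z)"
  have dhi: "integrable lebesgue dh" using d by (simp add: set_integrable_def dh_def)
  have dhi': "set_integrable lebesgue A dh" if "A \<in> sets lebesgue" for A
    unfolding set_integrable_def by (rule integrable_mult_indicator[OF that dhi])
  have "integral (cbox p q) dh = 0" for p q
  proof -
    obtain x1 t1 where p: "p = (x1, t1)" by (cases p)
    obtain x2 t2 where q: "q = (x2, t2)" by (cases q)
    note pq = p q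
    let ?x = "min x2 L" and ?t = "min t2 T"
    let ?c = "\<lambda>n z. cutoff x1 ?x n (fst z) * cutoff t1 ?t n (snd z)"
    let ?i = "\<lambda>z. indicat_real {x1<..<?x} (fst z) * indicat_real {t1<..<?t} (snd z)"
    have cm: "(?c n) \<in> borel_measurable lebesgue" for n
      by (intro borel_measurable_continuous_lebesgue continuous_intros
          continuous_on_compose2[OF C2_continuous[OF C2_cutoff], of UNIV]) auto
    have conv: "(\<lambda>n. ?c n z) \<longlonglongrightarrow> ?i z" for z by (intro tendsto_intros cutoff_tendsto)
    have im: "?i \<in> borel_measurable lebesgue" by (rule borel_measurable_LIMSEQ_real[OF conv cm])
    have lim: "(\<lambda>n. \<integral>z. dh z * ?c n z \<partial>lebesgue) \<longlonglongrightarrow> (\<integral>z. dh z * ?i z \<partial>lebesgue)"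
    proof (rule integral_dominated_convergence[where w = "\<lambda>z. \<bar>dh z\<bar>"])
      show "integrable lebesgue (\<lambda>z. \<bar>dh z\<bar>)" using dhi by (rule integrable_abs)
      show "(\<lambda>z. dh z * ?c n z) \<in> borel_measurable lebesgue" for n
        by (rule borel_measurable_times[OF borel_measurable_integrable[OF dhi] cm])
      show "(\<lambda>z. dh z * ?i z) \<in> borel_measurable lebesgue"
        by (rule borel_measurable_times[OF borel_measurable_integrable[OF dhi] im])
      show "AE z in lebesgue. (\<lambda>n. dh z * ?c n z) \<longlonglongrightarrow> dh z * ?i z"
        by (intro AE_I2 tendsto_mult tendsto_const conv)
      show "AE z in lebesgue. norm (dh z * ?c n z) \<le> \<bar>dh z\<bar>" for n
      proof (intro AE_I2)
        fix z
        have "\<bar>?c n z\<bar> \<le> 1 * 1"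
          unfolding abs_mult using cutoff_bounds[of x1 ?x n "fst z"] cutoff_bounds[of t1 ?t n "snd z"] by (intro mult_mono) auto
        then show "norm (dh z * ?c n z) \<le> \<bar>dh z\<bar>" 
          unfolding real_norm_def abs_mult[of "dh z"] using mult_left_le[of "\<bar>?c n z\<bar>" "\<bar>dh z\<bar>"] by linarith
      qed
    qed
    have z: "(\<integral>z. dh z * ?c n z \<partial>lebesgue) = 0" for n
    proof -
      have "(\<integral>z. dh z * ?c n z \<partial>lebesgue) = (LINT z:?I|lebesgue. d z * ?c n z)"
        unfolding set_lebesgue_integral_def dh_def by (intro Bochner_Integration.integral_cong refl) (simp only: real_scaleR_def mult.assoc)
      then show ?thesis using zero[of ?x ?t x1 n t1] by simp
    qed
    have "(\<lambda>n. 0) \<longlonglongrightarrow> (\<integral>z. dh z * ?i z \<partial>lebesgue)" using lim unfolding z .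
    then have 0: "(\<integral>z. dh z * ?i z \<partial>lebesgue) = 0" using LIMSEQ_unique tendsto_const by blast
    have "integral (cbox p q) dh = integral (box p q) dh" by (rule integral_open_interval[symmetric])
    also have "\<dots> = (LINT z:box p q|lebesgue. dh z)"
      by (rule set_lebesgue_integral_eq_integral(2)[OF dhi', symmetric]) simp
    also have "\<dots> = (\<integral>z. dh z * ?i z \<partial>lebesgue)"
      unfolding set_lebesgue_integral_def
    proof (rule Bochner_Integration.integral_cong[OF refl])
      fix z :: "real \<times> real"
      show "indicat_real (box p q) z *\<^sub>R dh z = dh z * ?i z"
      proof (cases "z \<in> ?I")
        case True
        then have "fst z < L" "snd z < T" by auto
        then have "indicat_real (box p q) z = ?i z"
          unfolding pq by (cases z) (auto simp: mem_box Basis_prod_def indicator_def)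
        then show ?thesis by simp
      next
        case False
        then show ?thesis by (simp add: dh_def)
      qed
    qed
    finally show ?thesis using 0 by simp
  qed
  moreover have "dh integrable_on cbox p q" for p q
    by (rule set_lebesgue_integral_eq_integral(1)[OF dhi']) simp
  ultimately have "AE z in lebesgue. dh z = 0" by (rule AE_zero_of_box_integrals[rotated])
  then show ?thesis by eventually_elim (auto simp: dh_def)
qed

lemma has_trace_cong_AE:
  assumes "AE x in lebesgue. x \<in> S \<longrightarrow> f x = g x"
  shows "has_trace S f p y = has_trace S g p y"
proof -
  have "(LINT x:ball p r \<inter> S|lebesgue. \<bar>f x - y\<bar>) = (LINT x:ball p r \<inter> S|lebesgue. \<bar>g x - y\<bar>)" for r
    by (rule set_integral_lebesgue_cong_AE) (use assms in \<open>auto elim!: eventually_mono\<close>)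
  then show ?thesis unfolding has_trace_def by simp
qed

text \<open>On incoming arcs the right-hand side contains data only, so two solutions agree there.
  Then their traces at the node agree for almost every time, and with them the right-hand sides on
  the outgoing arcs.\<close>

lemma transport_solution_unique:
  assumes fin: "finite (In \<union> Out)"
    and lam: "\<And>i. i \<in> In \<union> Out \<Longrightarrow> lam i > 0"
    and L: "\<And>i. i \<in> In \<union> Out \<Longrightarrow> L i > 0" and T: "T > 0"
    and u: "transport_solution In Out L lam \<gamma> B u0 T u"
    and u': "transport_solution In Out L lam \<gamma> B u0 T u'"
    and i: "i \<in> In \<union> Out"
  shows "AE z in lebesgue. z \<in> edge L i \<times> {0<..<T} \<longrightarrow> u i z = u' i z"
proof -
  let ?M = "In \<union> Out" and ?D = "\<lambda>i \<phi> z. frechet_derivative \<phi> (at z) (0, 1) + lam i * frechet_derivative \<phi> (at z) (1, 0)"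
  let ?R = "\<lambda>g i (\<phi> :: real \<times> real \<Rightarrow> real). (if i \<in> In then - lam i * B i * (LINT t:{0<..<T}|lebesgue. \<phi> (0, t))
       else - (LINT t:{0<..<T}|lebesgue. \<phi> (0, t) * (\<Sum>j\<in>In. \<gamma> i j * lam j * g j t)))"
  have main: "\<exists>g. (\<forall>j\<in>In. AE t in lebesgue. t \<in> {0<..<T} \<longrightarrow> has_trace (edge L j \<times> {0<..<T}) (w j) (L j, t) (g j t)) \<and>
     (\<forall>i\<in>?M. w i absolutely_integrable_on edge L i \<times> {0<..<T}) \<and>
     (\<forall>i\<in>?M. \<forall>\<phi>. C1c ({0..<L i} \<times> {0..<T}) \<phi> \<longrightarrow>
       (LINT z:edge L i \<times> {0<..<T}|lebesgue. w i z * ?D i \<phi> z) + (LINT x:edge L i|lebesgue. u0 i x * \<phi> (x, 0)) = ?R g i \<phi>)"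
    if "transport_solution In Out L lam \<gamma> B u0 T w" for w
  proof -
    have BV: "\<forall>i\<in>?M. BV (edge L i \<times> {0<..<T}) (w i)" using that unfolding transport_solution_def by (rule conjunct1)
    from that[unfolded transport_solution_def, THEN conjunct2]
    obtain g where g: "\<forall>j\<in>In. g j absolutely_integrable_on {0<..<T} \<and>
             (AE t in lebesgue. t \<in> {0<..<T} \<longrightarrow> has_trace (edge L j \<times> {0<..<T}) (w j) (L j, t) (g j t))"
       "\<forall>i\<in>?M. \<forall>\<phi>. C1c ({0..<L i} \<times> {0..<T}) \<phi> \<longrightarrow>
       (LINT z:edge L i \<times> {0<..<T}|lebesgue. w i z * ?D i \<phi> z) + (LINT x:edge L i|lebesgue. u0 i x * \<phi> (x, 0)) = ?R g i \<phi>"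
      by (elim exE conjE) (rule that)
    show ?thesis
    proof (intro exI[of _ g] conjI ballI)
      show "AE t in lebesgue. t \<in> {0<..<T} \<longrightarrow> has_trace (edge L j \<times> {0<..<T}) (w j) (L j, t) (g j t)" if "j \<in> In" for j
        using bspec[OF g(1) that] by (rule conjunct2)
      show "w i absolutely_integrable_on edge L i \<times> {0<..<T}" if "i \<in> ?M" for i
        using bspec[OF BV that] unfolding BV_def by (rule conjunct1)
    qed (rule bspec[OF g(2)])
  qed
  obtain g where g: "\<forall>j\<in>In. AE t in lebesgue. t \<in> {0<..<T} \<longrightarrow> has_trace (edge L j \<times> {0<..<T}) (u j) (L j, t) (g j t)"
    "\<forall>i\<in>?M. u i absolutely_integrable_on edge L i \<times> {0<..<T}"
    "\<forall>i\<in>?M. \<forall>\<phi>. C1c ({0..<L i} \<times> {0..<T}) \<phi> \<longrightarrow>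
       (LINT z:edge L i \<times> {0<..<T}|lebesgue. u i z * ?D i \<phi> z) + (LINT x:edge L i|lebesgue. u0 i x * \<phi> (x, 0)) = ?R g i \<phi>"
    using main[OF u] by (elim exE conjE) (rule that)
  obtain g' where g': "\<forall>j\<in>In. AE t in lebesgue. t \<in> {0<..<T} \<longrightarrow> has_trace (edge L j \<times> {0<..<T}) (u' j) (L j, t) (g' j t)"
    "\<forall>i\<in>?M. u' i absolutely_integrable_on edge L i \<times> {0<..<T}"
    "\<forall>i\<in>?M. \<forall>\<phi>. C1c ({0..<L i} \<times> {0..<T}) \<phi> \<longrightarrow>
       (LINT z:edge L i \<times> {0<..<T}|lebesgue. u' i z * ?D i \<phi> z) + (LINT x:edge L i|lebesgue. u0 i x * \<phi> (x, 0)) = ?R g' i \<phi>"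
    using main[OF u'] by (elim exE conjE) (rule that)
  \<comment> \<open>Equal right-hand sides force equal integrals against every transport derivative
    of a test function. Among these are all products of cutoffs, and such products separate
    integrable functions.\<close>
  have eqI: "AE z in lebesgue. z \<in> edge L i \<times> {0<..<T} \<longrightarrow> u i z = u' i z"
    if i: "i \<in> ?M" and R: "\<And>\<phi>. ?R g i \<phi> = ?R g' i \<phi>" for i
  proof -
    let ?I = "edge L i \<times> {0<..<T}"
    have ui: "u i absolutely_integrable_on ?I" "u' i absolutely_integrable_on ?I" using g(2) g'(2) i by auto
    have "AE z in lebesgue. z \<in> ?I \<longrightarrow> u i z - u' i z = 0"
    proof (rule AE_zero_of_cutoff_pair)
      show "(\<lambda>z. u i z - u' i z) absolutely_integrable_on ?I" by (intro set_integral_diff(1) ui)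
      fix x1 x2 t1 t2 :: real and n assume xt: "x2 \<le> L i" "t2 \<le> T"
      let ?c = "\<lambda>z. cutoff x1 x2 n (fst z) * cutoff t1 t2 n (snd z)"
      obtain \<phi> where \<phi>: "C1c ({0..<L i} \<times> {0..<T}) \<phi>" "\<forall>z\<in>?I. ?D i \<phi> z = ?c z"
        using transport_test_function[OF lam[OF i] T xt, of x1 n t1] by (elim exE conjE) (rule that)
      have cb: "norm (?c z) \<le> 1" for z
      proof -
        have "\<bar>?c z\<bar> \<le> 1 * 1"
          unfolding abs_mult using cutoff_bounds[of x1 x2 n "fst z"] cutoff_bounds[of t1 t2 n "snd z"] by (intro mult_mono) auto
        then show ?thesis by simp
      qed
      have cm: "?c \<in> borel_measurable lebesgue"
        by (intro borel_measurable_continuous_lebesgue continuous_intros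
            continuous_on_compose2[OF C2_continuous[OF C2_cutoff], of UNIV]) auto
      have wc: "(\<lambda>z. w z * ?c z) absolutely_integrable_on ?I" if w: "w absolutely_integrable_on ?I" for w :: "real \<times> real \<Rightarrow> real"
      proof -
        have wi: "integrable lebesgue (\<lambda>z. indicat_real ?I z * w z)" using w by (simp add: set_integrable_def)
        have "integrable lebesgue (\<lambda>z. (indicat_real ?I z * w z) * ?c z)"
        proof (rule Bochner_Integration.integrable_bound[OF wi])
          show "(\<lambda>z. (indicat_real ?I z * w z) * ?c z) \<in> borel_measurable lebesgue"
            by (rule borel_measurable_times[OF borel_measurable_integrable[OF wi] cm])
          show "AE z in lebesgue. norm ((indicat_real ?I z * w z) * ?c z) \<le> norm (indicat_real ?I z * w z)"
            
            by (intro AE_I2, subst norm_mult) (rule mult_left_le[OF cb norm_ge_zero])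
        qed
        then show ?thesis by (simp add: set_integrable_def mult.assoc)
      qed
      have e: "(LINT z:?I|lebesgue. w z * ?D i \<phi> z) = (LINT z:?I|lebesgue. w z * ?c z)" for w :: "real \<times> real \<Rightarrow> real"
        by (rule set_integral_lebesgue_cong_AE, intro AE_I2 impI) (use bspec[OF \<phi>(2)] in simp)
      have "(LINT z:?I|lebesgue. u i z * ?D i \<phi> z) + (LINT x:edge L i|lebesgue. u0 i x * \<phi> (x, 0))
        = (LINT z:?I|lebesgue. u' i z * ?D i \<phi> z) + (LINT x:edge L i|lebesgue. u0 i x * \<phi> (x, 0))"
        unfolding mp[OF spec[OF bspec[OF g(3) i]] \<phi>(1)] mp[OF spec[OF bspec[OF g'(3) i]] \<phi>(1)] by (rule R)
      then have "(LINT z:?I|lebesgue. u i z * ?c z) = (LINT z:?I|lebesgue. u' i z * ?c z)"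
        unfolding e by simp
      moreover have "(LINT z:?I|lebesgue. (u i z - u' i z) * ?c z) = (LINT z:?I|lebesgue. u i z * ?c z) - (LINT z:?I|lebesgue. u' i z * ?c z)"
        unfolding left_diff_distrib by (rule set_integral_diff(2)[OF wc[OF ui(1)] wc[OF ui(2)]])
      ultimately show "(LINT z:?I|lebesgue. (u i z - u' i z) * ?c z) = 0" by simp
    qed
    then show ?thesis by eventually_elim auto
  qed
  have In: "AE z in lebesgue. z \<in> edge L j \<times> {0<..<T} \<longrightarrow> u j z = u' j z" if "j \<in> In" for j
    by (rule eqI) (use that in auto)
  show ?thesis
  proof (cases "i \<in> In")
    case True
    then show ?thesis by (rule In)
  next
    case False
    have gg: "AE t in lebesgue. t \<in> {0<..<T} \<longrightarrow> g j t = g' j t" if j: "j \<in> In" for j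
      using bspec[OF g(1) j] bspec[OF g'(1) j]
    proof eventually_elim
      case (elim t)
      show ?case
      proof
        assume t: "t \<in> {0<..<T}"
        let ?I = "edge L j \<times> {0<..<T}"
        have o: "open ?I" by (intro open_Times) auto
        have Lj: "L j > 0" using L j by simp
        have cl: "(L j, t) \<in> closure ?I"
          using t Lj by (simp add: closure_Times)
        have "has_trace ?I (u j) (L j, t) (g' j t)"
          using mp[OF elim(2) t] unfolding has_trace_cong_AE[OF In[OF j]] .
        then show "g j t = g' j t"
          using has_trace_unique[OF o cl bspec[OF g(2)] mp[OF elim(1) t]] j by simp
      qed
    qed
    have "AE t in lebesgue. \<forall>j\<in>In. t \<in> {0<..<T} \<longrightarrow> g j t = g' j t"
      using fin by (intro AE_finite_allI gg) simp_all
    then have ag: "AE t in lebesgue. t \<in> {0<..<T} \<longrightarrow>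
       \<phi> (0, t) * (\<Sum>j\<in>In. \<gamma> i j * lam j * g j t) = \<phi> (0, t) * (\<Sum>j\<in>In. \<gamma> i j * lam j * g' j t)" for \<phi> :: "real \<times> real \<Rightarrow> real"
    proof eventually_elim
      case (elim t)
      then show ?case by (intro impI arg_cong2[where f = "(*)"] sum.cong refl) simp
    qed
    have "(LINT t:{0<..<T}|lebesgue. \<phi> (0, t) * (\<Sum>j\<in>In. \<gamma> i j * lam j * g j t))
      = (LINT t:{0<..<T}|lebesgue. \<phi> (0, t) * (\<Sum>j\<in>In. \<gamma> i j * lam j * g' j t))" for \<phi> :: "real \<times> real \<Rightarrow> real"
      by (rule set_integral_lebesgue_cong_AE[OF ag])
    then show ?thesis by (intro eqI i) (simp only: False if_False)
  qed
qed

section \<open>Convergence for data of bounded variation\<close>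

lemma absolutely_integrable_bounded_borel:
  fixes d :: "real \<Rightarrow> real"
  assumes "d \<in> borel_measurable borel" "\<And>x. \<bar>d x\<bar> \<le> C"
  shows "d absolutely_integrable_on {a<..<b}"
proof (rule measurable_bounded_by_integrable_imp_absolutely_integrable)
  show "d \<in> borel_measurable (lebesgue_on {a<..<b})"
    by (rule measurable_restrict_space1[OF measurable_completion]) (simp add: assms(1))
  show "{a<..<b} \<in> sets lebesgue" by simp
  show "(\<lambda>x. C) integrable_on {a<..<b}" using integrable_on_const[of "{a<..<b}" C] by simp
qed (use assms(2) in simp)

lemma L1_norm_affine_le:
  fixes e :: "real \<Rightarrow> real"
  assumes m: "e \<in> borel_measurable borel" and b: "\<And>x. \<bar>e x\<bar> \<le> C" and z: "\<And>x. x \<notin> {0..M} \<Longrightarrow> e x = 0" and c: "c > 0"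
  shows "L1_norm {0<..<L} (\<lambda>x. e (h + c * x)) \<le> L1_norm {0<..<M} e / c"
proof -
  have i1: "integrable lborel (\<lambda>x. \<bar>e x\<bar>)"
    using integrable_bounded_support[OF m b, of 0 M] z by (intro integrable_abs) (simp add: cbox_interval)
  have m1: "(\<lambda>x. \<bar>e (h + c * x)\<bar>) \<in> borel_measurable borel" using m by measurable
  have i2: "integrable lborel (\<lambda>x. \<bar>e (h + c * x)\<bar>)"
    using lborel_integrable_real_affine[OF i1, of c h] c by simp
  have "L1_norm {0<..<L} (\<lambda>x. e (h + c * x)) = (\<integral>x. indicat_real {0<..<L} x * \<bar>e (h + c * x)\<bar> \<partial>lborel)"
    unfolding L1_norm_def set_lebesgue_integral_def real_scaleR_def
    by (rule integral_completion) (use m1 in measurable)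
  also have "\<dots> \<le> (\<integral>x. \<bar>e (h + c * x)\<bar> \<partial>lborel)"
  proof (rule integral_mono)
    show "integrable lborel (\<lambda>x. indicat_real {0<..<L} x * \<bar>e (h + c * x)\<bar>)"
      using integrable_mult_indicator[OF _ i2, of "{0<..<L}"] by simp
  qed (auto simp: i2 indicator_def)
  also have "\<dots> = (\<integral>x. \<bar>e x\<bar> \<partial>lborel) / c"
    using lborel_integral_real_affine[of c "\<lambda>x. \<bar>e x\<bar>" h] c by (simp add: field_simps)
  also have "(\<integral>x. \<bar>e x\<bar> \<partial>lborel) = (\<integral>x. \<bar>e x\<bar> \<partial>lebesgue)"
    by (rule integral_completion[symmetric]) (use m in measurable)
  also have "\<dots> = L1_norm {0..M} e"
    unfolding L1_norm_def set_lebesgue_integral_def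
    by (rule Bochner_Integration.integral_cong) (use z in \<open>auto simp: indicator_def\<close>)
  finally show ?thesis by (simp only: L1_norm_Ioo_Icc)
qed

text \<open>At time \<open>t\<close> an arc shows a piece of its own initial profile and, behind it
  on an outgoing arc, delayed pieces of the incoming ones. The change of variables with slope
  \<open>lam k / lam i\<close> divides by this slope, which together with the weight
  \<open>lam k * G i k\<close> leaves \<open>lam i * \<bar>G i k\<bar>\<close>; each piece has L1
  norm at most \<open>S\<close>.\<close>

lemma profile_distance:
  fixes Q G :: "nat \<Rightarrow> _ \<Rightarrow> real"
  assumes lam: "\<And>i. i \<in> In \<union> Out \<Longrightarrow> lam i > 0"
    and L: "\<And>i. i \<in> In \<union> Out \<Longrightarrow> L i > 0"
    and Qm: "\<And>i. i \<in> In \<union> Out \<Longrightarrow> Q i \<in> borel_measurable borel"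
    and Qb: "\<And>i x. i \<in> In \<union> Out \<Longrightarrow> \<bar>Q i x\<bar> \<le> C"
    and QIn: "\<And>i y. i \<in> In \<Longrightarrow> y < 0 \<Longrightarrow> Q i y = 0"
    and QOut: "\<And>i y. i \<in> Out \<Longrightarrow> y < 0 \<Longrightarrow> Q i y = (\<Sum>k\<in>In. lam k * Q k (L k + lam k / lam i * y) * G i k)"
    and S: "\<And>i. i \<in> In \<union> Out \<Longrightarrow> L1_norm (edge L i) (Q i) \<le> S" and i: "i \<in> In \<union> Out" and t: "t \<ge> 0"
  shows "L1_norm (edge L i) (\<lambda>x. Q i (x - lam i * t)) \<le> (1 + (\<Sum>k\<in>In. lam i * \<bar>G i k\<bar>)) * S"
proof -
  \<comment> \<open>\<open>Q k\<close> cut to its own arc. The arguments that occur never exceed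
    \<open>L k\<close>, and negative ones contribute 0 on incoming arcs, so the cut functions carry
    everything and have the norms bounded by \<open>S\<close>.\<close>
  define e where "e = (\<lambda>k y. if y \<in> {0..L k} then Q k y else 0)"
  have em: "e k \<in> borel_measurable borel" if "k \<in> In \<union> Out" for k
    unfolding e_def using Qm[OF that] by measurable
  have C: "C \<ge> 0" using Qb[OF i, of 0] by linarith
  have eb: "\<bar>e k y\<bar> \<le> C" if "k \<in> In \<union> Out" for k y using Qb[OF that] C by (simp add: e_def)
  have eL: "L1_norm {0<..<L'} (\<lambda>x. e k (h + c * x)) \<le> S / c" if k: "k \<in> In \<union> Out" and c: "c > 0" for k h c L'
  proof -
    have "L1_norm {0<..<L'} (\<lambda>x. e k (h + c * x)) \<le> L1_norm (edge L k) (e k) / c"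
      by (rule L1_norm_affine_le[OF em[OF k] eb[OF k] _ c]) (auto simp: e_def)
    also have "L1_norm (edge L k) (e k) = L1_norm (edge L k) (Q k)"
      by (rule L1_norm_cong_AE, intro AE_I2 impI) (simp add: e_def)
    finally show ?thesis using S[OF k] c by (meson divide_right_mono less_imp_le order_trans)
  qed
  have ei: "(\<lambda>x. e k (h + c * x)) absolutely_integrable_on {0<..<L'}" if "k \<in> In \<union> Out" for k h c L'
    by (rule absolutely_integrable_bounded_borel[of _ C]) (use em[OF that] eb[OF that] in \<open>measurable\<close>)
  define r where "r = (\<lambda>k x. \<bar>lam k * G i k * e k ((L k - lam k * t) + lam k / lam i * x)\<bar>)"
  have ri: "r k absolutely_integrable_on edge L i" if "k \<in> In" for k
    unfolding r_def by (intro set_integrable_abs set_integrable_mult_right impI ei) (use that in simp)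
  have le: "\<bar>Q i (x - lam i * t)\<bar> \<le> \<bar>e i (- lam i * t + 1 * x)\<bar> + (\<Sum>k\<in>In. r k x)" if x: "x \<in> edge L i" for x
  proof (cases "x - lam i * t < 0")
    case False
    have "lam i * t \<ge> 0" using lam[OF i] t by simp
    then have "x - lam i * t \<in> {0..L i}" using False x by auto
    then have "Q i (x - lam i * t) = e i (- lam i * t + 1 * x)" by (simp add: e_def)
    moreover have "(\<Sum>k\<in>In. r k x) \<ge> 0" by (intro sum_nonneg) (simp add: r_def)
    ultimately show ?thesis by simp
  next
    case True
    have r0: "(\<Sum>k\<in>In. r k x) \<ge> 0" by (intro sum_nonneg) (simp add: r_def)
    show ?thesis
    proof (cases "i \<in> In")
      case True
      then show ?thesis using QIn[OF True \<open>x - lam i * t < 0\<close>] r0 by simp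
    next
      case False
      then have io: "i \<in> Out" using i by simp
      have "\<bar>lam k * Q k (L k + lam k / lam i * (x - lam i * t)) * G i k\<bar> = r k x" if k: "k \<in> In" for k
      proof -
        let ?y = "L k + lam k / lam i * (x - lam i * t)"
        have "lam k / lam i > 0" using lam[of k] lam[OF i] k by simp
        then have "lam k / lam i * (x - lam i * t) < 0" using True by (rule mult_pos_neg)
        then have "?y < L k" by simp
        then have "Q k ?y = e k ?y" using QIn[OF k] by (auto simp: e_def)
        moreover have y: "?y = (L k - lam k * t) + lam k / lam i * x" using lam[OF i] by (simp add: field_simps)
        ultimately have "lam k * Q k ?y * G i k = lam k * G i k * e k ((L k - lam k * t) + lam k / lam i * x)"
          by (simp only: mult_ac)
        then show ?thesis by (simp only: r_def)
      qed
      then have "\<bar>Q i (x - lam i * t)\<bar> \<le> (\<Sum>k\<in>In. r k x)"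
        unfolding QOut[OF io True] by (intro order_trans[OF sum_abs]) simp
      then show ?thesis by simp
    qed
  qed
  have e1: "(\<lambda>x. \<bar>e i (- lam i * t + 1 * x)\<bar>) absolutely_integrable_on edge L i"
    by (rule set_integrable_abs[OF ei[OF i]])
  have rs: "(\<lambda>x. \<Sum>k\<in>In. r k x) absolutely_integrable_on edge L i"
    unfolding set_integrable_def scaleR_sum_right by (rule Bochner_Integration.integrable_sum) (rule ri[unfolded set_integrable_def])
  have "L1_norm (edge L i) (\<lambda>x. Q i (x - lam i * t))
     \<le> (LINT x:edge L i|lebesgue. \<bar>e i (- lam i * t + 1 * x)\<bar> + (\<Sum>k\<in>In. r k x))"
    by (rule L1_norm_mono_AE) (use le e1 rs in \<open>auto intro: set_integral_add(1)\<close>)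
  also have "\<dots> = (LINT x:edge L i|lebesgue. \<bar>e i (- lam i * t + 1 * x)\<bar>) + (LINT x:edge L i|lebesgue. (\<Sum>k\<in>In. r k x))"
    by (rule set_integral_add(2)[OF e1 rs])
  also have "(LINT x:edge L i|lebesgue. (\<Sum>k\<in>In. r k x)) = (\<Sum>k\<in>In. LINT x:edge L i|lebesgue. r k x)"
    unfolding set_lebesgue_integral_def scaleR_sum_right
    by (rule Bochner_Integration.integral_sum) (use ri in \<open>simp add: set_integrable_def\<close>)
  also have "(LINT x:edge L i|lebesgue. \<bar>e i (- lam i * t + 1 * x)\<bar>) \<le> S / 1"
    using eL[OF i, of 1 "L i" "- lam i * t"] unfolding L1_norm_def by simp
  also have "(\<Sum>k\<in>In. LINT x:edge L i|lebesgue. r k x) \<le> (\<Sum>k\<in>In. lam i * \<bar>G i k\<bar> * S)"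
  proof (rule sum_mono)
    fix k assume k: "k \<in> In"
    have lk: "lam k > 0" "lam i > 0" using lam[of k] lam[OF i] k by auto
    have "(LINT x:edge L i|lebesgue. r k x) = L1_norm (edge L i) (\<lambda>x. lam k * G i k * e k ((L k - lam k * t) + lam k / lam i * x))"
      by (simp add: L1_norm_def r_def)
    also have "\<dots> = \<bar>lam k * G i k\<bar> * L1_norm (edge L i) (\<lambda>x. e k ((L k - lam k * t) + lam k / lam i * x))"
      by (rule L1_norm_cmult)
    also have "\<dots> \<le> \<bar>lam k * G i k\<bar> * (S / (lam k / lam i))"
      by (rule mult_left_mono[OF eL]) (use k lk in auto)
    also have "\<dots> = lam i * \<bar>G i k\<bar> * S" using lk by (simp add: abs_mult)
    finally show "(LINT x:edge L i|lebesgue. r k x) \<le> lam i * \<bar>G i k\<bar> * S" .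
  qed
  finally show ?thesis by (simp add: algebra_simps sum_distrib_left sum_distrib_right)
qed

text \<open>The modulus at the end exceeds that at any other point by at most the L1 norm of the
  derivative; averaging over the arc replaces the other value by the L1 norm of \<open>f\<close>. It
  is used to bound the values prescribed at the outer ends uniformly along the
  approximation.\<close>

lemma W21_trace_bound:
  assumes W: "W21 {0<..<L} f" and L: "L > 0"
  shows "\<bar>boundary_trace {0<..<L} f L\<bar> \<le> L1_norm {0<..<L} f / L + L1_norm {0<..<L} (Dx {0<..<L} f)"
proof -
  obtain F Y where F: "\<forall>x\<in>{0..L}. (F has_real_derivative Y x) (at x within {0..L})"
    and Yc: "continuous_on {0..L} Y" and fi: "f absolutely_integrable_on {0<..<L}"
    and fF: "AE x in lebesgue. x \<in> {0<..<L} \<longrightarrow> f x = F x"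
    and fY: "AE x in lebesgue. x \<in> {0<..<L} \<longrightarrow> Dx {0<..<L} f x = Y x"
    using W21_representative[OF W L] by (elim exE conjE) (rule that)
  have Fc: "continuous_on {0..L} F"
    by (rule DERIV_continuous_on) (use F in auto)
  have aF: "continuous_on {0..L} (\<lambda>x. \<bar>F x\<bar>)" "continuous_on {0..L} (\<lambda>x. \<bar>Y x\<bar>)"
    by (intro continuous_intros Fc Yc)+
  have n: "L1_norm {0<..<L} g = integral {0..L} (\<lambda>x. \<bar>H x\<bar>)"
    if "continuous_on {0..L} H" "AE x in lebesgue. x \<in> {0<..<L} \<longrightarrow> g x = H x" for g H
  proof -
    have "L1_norm {0<..<L} g = L1_norm {0..L} H" unfolding L1_norm_cong_AE[OF that(2)] by (rule L1_norm_Ioo_Icc)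
    also have "\<dots> = integral {0..L} (\<lambda>x. \<bar>H x\<bar>)"
      by (rule L1_norm_eq_integral) (rule absolutely_integrable_continuous_real[OF that(1)])
    finally show ?thesis .
  qed
  let ?N = "integral {0..L} (\<lambda>x. \<bar>Y x\<bar>)"
  have low: "\<bar>F L\<bar> - ?N \<le> \<bar>F x\<bar>" if x: "x \<in> {0..L}" for x
  proof -
    have s: "{x..L} \<subseteq> {0..L}" using x by auto
    have "(Y has_integral (F L - F x)) {x..L}"
    proof (rule fundamental_theorem_of_calculus)
      show "x \<le> L" using x by simp
      fix y assume y: "y \<in> {x..L}"
      then have "(F has_real_derivative Y y) (at y within {0..L})" using F s by blast
      then show "(F has_vector_derivative Y y) (at y within {x..L})"
        using has_field_derivative_subset[OF _ s] by (simp add: has_real_derivative_iff_has_vector_derivative)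
    qed
    then have "\<bar>F L - F x\<bar> = \<bar>integral {x..L} Y\<bar>" by (simp add: integral_unique)
    also have "\<dots> \<le> integral {x..L} (\<lambda>x. \<bar>Y x\<bar>)"
      using integral_norm_bound_integral[of Y "{x..L}" "\<lambda>x. \<bar>Y x\<bar>"] integrable_continuous_real[OF continuous_on_subset[OF Yc s]]
        integrable_continuous_real[OF continuous_on_subset[OF aF(2) s]] by simp
    also have "\<dots> \<le> ?N"
      by (rule integral_subset_le[OF s]) (auto intro!: integrable_continuous_real continuous_on_subset[OF aF(2)] s)
    finally show ?thesis by linarith
  qed
  have "integral {0..L} (\<lambda>x. \<bar>F L\<bar> - ?N) \<le> integral {0..L} (\<lambda>x. \<bar>F x\<bar>)"
    by (rule integral_le) (use low integrable_continuous_real[OF aF(1)] in auto)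
  then have "L * (\<bar>F L\<bar> - ?N) \<le> integral {0..L} (\<lambda>x. \<bar>F x\<bar>)" using L by simp
  then have "\<bar>F L\<bar> \<le> integral {0..L} (\<lambda>x. \<bar>F x\<bar>) / L + ?N" using L by (simp add: field_simps)
  moreover have "boundary_trace {0<..<L} f L = F L" by (rule boundary_trace_edge(2)[OF L fi fF Fc])
  ultimately show ?thesis by (simp only: n[OF Fc fF] n[OF Yc fY])
qed

text \<open>Boundary part and datum are joined at 0 with a possible jump, which Jordan form
  survives; the jump travels along the characteristic from the corner.\<close>

lemma BV_profile_exists:
  fixes lam L B :: "nat \<Rightarrow> real"
  assumes fin: "finite (In \<union> Out)" and disj: "In \<inter> Out = {}"
    and lam: "\<And>i. i \<in> In \<union> Out \<Longrightarrow> lam i > 0"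
    and L: "\<And>i. i \<in> In \<union> Out \<Longrightarrow> L i > 0"
    and BV: "\<And>i. i \<in> In \<union> Out \<Longrightarrow> BV (edge L i) (u0 i)"
  shows "\<exists>P. (\<forall>i\<in>In \<union> Out. diff_mono (P i) \<and> (AE x in lebesgue. x \<in> edge L i \<longrightarrow> u0 i x = P i x)) \<and>
    (\<forall>i\<in>In. \<forall>y<0. P i y = B i) \<and>
    (\<forall>i\<in>Out. \<forall>y<0. P i y = (\<Sum>k\<in>In. lam k * P k (L k + lam k / lam i * y) * G i k))"
proof -
  have "\<forall>i\<in>In \<union> Out. \<exists>f. diff_mono f \<and> (AE x in lebesgue. x \<in> edge L i \<longrightarrow> u0 i x = f x)"
  proof
    fix i assume i: "i \<in> In \<union> Out"
    obtain m1 m2 C where m: "mono m1" "mono m2" "\<forall>x. \<bar>m1 x\<bar> \<le> C \<and> \<bar>m2 x\<bar> \<le> C"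
      and eq: "AE x in lebesgue. x \<in> edge L i \<longrightarrow> u0 i x = m1 x - m2 x"
      using BV_imp_diff_mono[OF BV[OF i] L[OF i]] by (elim exE conjE) (rule that)
    have "diff_mono (\<lambda>x. m1 x - m2 x)" by (rule diff_monoI[OF m(1,2)]) (use m(3) in auto)
    then show "\<exists>f. diff_mono f \<and> (AE x in lebesgue. x \<in> edge L i \<longrightarrow> u0 i x = f x)"
      using eq by (intro exI[of _ "\<lambda>x. m1 x - m2 x"] conjI)
  qed
  then obtain f where f: "\<forall>i\<in>In \<union> Out. diff_mono (f i) \<and> (AE x in lebesgue. x \<in> edge L i \<longrightarrow> u0 i x = f i x)"
    by (rule bchoice[THEN exE])
  define PI where "PI = (\<lambda>i y. if y < 0 then B i else f i y)"
  define PO where "PO = (\<lambda>i y. \<Sum>k\<in>In. lam k * PI k (L k + lam k / lam i * y) * G i k)"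
  define P where "P = (\<lambda>i y. if i \<in> In then PI i y else if y < 0 then PO i y else f i y)"
  have dPI: "diff_mono (PI k)" if "k \<in> In" for k
    unfolding PI_def using f that by (intro diff_mono_concat diff_mono_const) auto
  have dPO: "diff_mono (PO i)" if i: "i \<in> In \<union> Out" for i
    unfolding PO_def
  proof (rule diff_mono_sum)
    fix k assume k: "k \<in> In"
    have "diff_mono (\<lambda>y. (lam k * G i k) * PI k (L k + lam k / lam i * y))"
      by (rule diff_mono_cmult, rule diff_mono_affine[OF dPI[OF k]]) (use lam[OF i] lam[of k] k in simp)
    then show "diff_mono (\<lambda>y. lam k * PI k (L k + lam k / lam i * y) * G i k)" by (simp add: mult_ac)
  qed (use fin in simp)
  have dP: "diff_mono (P i)" if i: "i \<in> In \<union> Out" for i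
  proof (cases "i \<in> In")
    case True
    then show ?thesis using dPI by (simp add: P_def)
  next
    case False
    then show ?thesis using diff_mono_concat[OF dPO[OF i], of "f i"] f i by (simp add: P_def)
  qed
  have aP: "AE x in lebesgue. x \<in> edge L i \<longrightarrow> u0 i x = P i x" if i: "i \<in> In \<union> Out" for i
    using bspec[OF f i, THEN conjunct2] by eventually_elim (auto simp: P_def PI_def)
  show ?thesis
    by (intro exI[of _ P] conjI ballI dP aP) (use disj in \<open>auto simp: P_def PI_def PO_def\<close>)
qed

text \<open>\<open>X\<close> may depend on \<open>e\<close>: for each accuracy the limit in
  \<open>n\<close> comes first.\<close>

lemma tendsto_zero_approximation:
  fixes Y :: "nat \<Rightarrow> real"
  assumes nn: "\<And>n. 0 \<le> Y n" and A: "A \<ge> 0"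
    and ap: "\<And>e. e > 0 \<Longrightarrow> \<exists>X. X \<longlonglongrightarrow> 0 \<and> (\<forall>n. Y n \<le> A * e + X n)"
  shows "Y \<longlonglongrightarrow> 0"
proof (rule LIMSEQ_I)
  fix r :: real assume r: "r > 0"
  define e where "e = r / (2 * (A + 1))"
  have e: "e > 0" using r A by (simp add: e_def)
  have Ae: "A * e \<le> r / 2"
  proof -
    have "A * e \<le> (A + 1) * e" using e by (simp add: mult_right_mono)
    also have "\<dots> = r / 2" using A by (simp add: e_def field_simps)
    finally show ?thesis .
  qed
  obtain X where X: "X \<longlonglongrightarrow> 0" "\<forall>n. Y n \<le> A * e + X n" using ap[OF e] by (elim exE conjE) (rule that)
  obtain N where N: "\<forall>n\<ge>N. norm (X n - 0) < r / 2" using LIMSEQ_D[OF X(1), of "r / 2"] r by auto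
  show "\<exists>N. \<forall>n\<ge>N. norm (Y n - 0) < r"
  proof (intro exI[of _ N] allI impI)
    fix n assume "n \<ge> N"
    then have "\<bar>X n\<bar> < r / 2" using N by simp
    then show "norm (Y n - 0) < r" using nn[of n] spec[OF X(2), of n] Ae by simp
  qed
qed

text \<open>At fixed \<open>e\<close> the distance from \<open>u n\<close> to the transport solution
  \<open>w\<close> is split at a smooth profile \<open>P\<close>: one part is controlled by
  \<open>smooth_profile_estimate\<close>, the other by \<open>profile_distance\<close>. The factors
  in front of \<open>e\<close> do not depend on \<open>e\<close>, whereas \<open>X\<close> does, so
  \<open>e\<close> tends to 0 last.\<close>

lemma vanishing_viscosity_convergence:
  assumes fin: "finite (In \<union> Out)" and disj: "In \<inter> Out = {}"
    and K: "\<And>i j. i \<in> In \<union> Out \<Longrightarrow> j \<in> In \<union> Out \<Longrightarrow> K i j \<ge> 0"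
    and Ks: "\<And>i j. i \<in> In \<union> Out \<Longrightarrow> j \<in> In \<union> Out \<Longrightarrow> K i j = K j i"
    and lam: "\<And>i. i \<in> In \<union> Out \<Longrightarrow> lam i > 0"
    and G: "\<And>i k. i \<in> In \<union> Out \<Longrightarrow> k \<in> In \<Longrightarrow>
      node_op (In \<union> Out) (\<lambda>i. if i \<in> In then 0 else lam i) K (\<lambda>i. G i k) i = (if i = k then 1 else 0)"
    and L: "\<And>i. i \<in> In \<union> Out \<Longrightarrow> L i > 0"
    and BV: "\<And>i. i \<in> In \<union> Out \<Longrightarrow> BV (edge L i) (u0 i)"
    and eps: "\<And>n. \<epsilon> n > 0" "\<epsilon> \<longlonglongrightarrow> 0"
    and adm: "admissible_approximation In Out L lam K B \<epsilon> u0 v"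
    and par: "\<And>n. parabolic_solution In Out L lam K B (\<epsilon> n) (v n) (u n)"
    and T: "T > 0"
  shows "\<forall>n. \<forall>i\<in>In \<union> Out. u n i absolutely_integrable_on edge L i \<times> {0<..<T}"
    and "\<exists>w. transport_solution In Out L lam (\<lambda>i j. lam i * G i j) B u0 T w"
    and "\<forall>w. transport_solution In Out L lam (\<lambda>i j. lam i * G i j) B u0 T w \<longrightarrow>
           (\<lambda>n. \<Sum>i\<in>In \<union> Out. L1_norm (edge L i \<times> {0<..<T}) (\<lambda>p. u n i p - w i p)) \<longlonglongrightarrow> 0"
proof -
  let ?M = "In \<union> Out"
  have u0i: "u0 i absolutely_integrable_on edge L i" if "i \<in> ?M" for i using BV[OF that] by (simp add: BV_def)
  have adm1: "\<forall>n. \<forall>i\<in>?M. W21 (edge L i) (v n i)"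
    and vconv: "(\<lambda>n. \<Sum>i\<in>?M. L1_norm (edge L i) (\<lambda>x. v n i x - u0 i x)) \<longlonglongrightarrow> 0"
    using adm unfolding admissible_approximation_def by simp_all
  \<comment> \<open>The bound by a function of the BV norm of \<open>u0\<close> is a single number,
    since \<open>u0\<close> is fixed.\<close>
  have "\<exists>q. \<forall>n. (\<Sum>i\<in>?M. L1_norm (edge L i) (Dx (edge L i) (v n i))) \<le> q"
    using adm unfolding admissible_approximation_def by (elim conjE exE) (rule exI)
  then obtain q where q: "\<And>n. (\<Sum>i\<in>?M. L1_norm (edge L i) (Dx (edge L i) (v n i))) \<le> q" by (elim exE) (rule that, rule spec)
  have vW: "W21 (edge L i) (v n i)" if "i \<in> ?M" for i n using adm1 that by simp
  have vi: "v n i absolutely_integrable_on edge L i" if "i \<in> ?M" for i n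
    using vW[OF that, of n] unfolding W21_def weak_deriv_def by (elim exE conjE) assumption
  obtain b where b: "\<And>n. norm (\<Sum>i\<in>?M. L1_norm (edge L i) (\<lambda>x. v n i x - u0 i x)) \<le> b"
    using convergent_imp_Bseq[OF convergentI[OF vconv]] unfolding Bseq_def by auto
  have b0: "b \<ge> 0" using b[of 0] by (rule order_trans[OF norm_ge_zero])
  have q0: "q \<ge> 0" using q[of 0] by (rule order_trans[OF sum_nonneg, rotated]) (rule L1_norm_nonneg)
  \<comment> \<open>By the trace estimate the outer values are bounded through the L1 norms of the
    data, which converge, and those of their derivatives, bounded by \<open>q\<close>.\<close>
  define Db where "Db = (\<Sum>i\<in>?M. (L1_norm (edge L i) (u0 i) + b) / L i) + q"
  have Dt: "(L1_norm (edge L i) (u0 i) + b) / L i \<ge> 0" if "i \<in> ?M" for i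
    using L[OF that] b0 L1_norm_nonneg[of "edge L i" "u0 i"] by simp
  have Db0: "Db \<ge> 0" unfolding Db_def by (intro add_nonneg_nonneg sum_nonneg Dt q0)
  have Db: "\<bar>boundary_trace (edge L i) (v n i) (L i)\<bar> \<le> Db" if i: "i \<in> Out" for n i
  proof -
    have iM: "i \<in> ?M" using i by simp
    have "\<bar>boundary_trace (edge L i) (v n i) (L i)\<bar> \<le> L1_norm (edge L i) (v n i) / L i + L1_norm (edge L i) (Dx (edge L i) (v n i))"
      by (rule W21_trace_bound[OF vW[OF iM] L[OF iM]])
    also have "L1_norm (edge L i) (Dx (edge L i) (v n i)) \<le> q"
      by (rule order_trans[OF member_le_sum[OF iM] q]) (use fin L1_norm_nonneg in auto)
    also have "L1_norm (edge L i) (v n i) / L i \<le> (L1_norm (edge L i) (u0 i) + b) / L i"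
    proof (rule divide_right_mono)
      have "L1_norm (edge L i) (v n i) \<le> L1_norm (edge L i) (\<lambda>x. v n i x - u0 i x) + L1_norm (edge L i) (u0 i)"
        using L1_norm_triangle[OF set_integral_diff(1)[OF vi[OF iM] u0i[OF iM]] u0i[OF iM]] by simp
      moreover have "L1_norm (edge L i) (\<lambda>x. v n i x - u0 i x) \<le> (\<Sum>i\<in>?M. L1_norm (edge L i) (\<lambda>x. v n i x - u0 i x))"
        by (rule member_le_sum[OF iM]) (use fin L1_norm_nonneg in auto)
      moreover have "(\<Sum>i\<in>?M. L1_norm (edge L i) (\<lambda>x. v n i x - u0 i x)) \<le> b" using b[of n] by simp
      ultimately show "L1_norm (edge L i) (v n i) \<le> L1_norm (edge L i) (u0 i) + b" by linarith
    qed (use L[OF iM] in simp)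
    also have "(L1_norm (edge L i) (u0 i) + b) / L i \<le> (\<Sum>i\<in>?M. (L1_norm (edge L i) (u0 i) + b) / L i)"
      by (rule member_le_sum[OF iM]) (use fin Dt in auto)
    finally show ?thesis by (simp add: Db_def)
  qed
  obtain W where W: "\<forall>i\<in>?M. diff_mono (W i) \<and> (AE x in lebesgue. x \<in> edge L i \<longrightarrow> u0 i x = W i x)"
    and WIn: "\<forall>i\<in>In. \<forall>y<0. W i y = B i"
    and WOut: "\<forall>i\<in>Out. \<forall>y<0. W i y = (\<Sum>k\<in>In. lam k * W k (L k + lam k / lam i * y) * G i k)"
    proof -
    have "\<exists>P. (\<forall>i\<in>?M. diff_mono (P i) \<and> (AE x in lebesgue. x \<in> edge L i \<longrightarrow> u0 i x = P i x)) \<and>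
      (\<forall>i\<in>In. \<forall>y<0. P i y = B i) \<and>
      (\<forall>i\<in>Out. \<forall>y<0. P i y = (\<Sum>k\<in>In. lam k * P k (L k + lam k / lam i * y) * G i k))"
      by (rule BV_profile_exists[OF fin disj]) (use lam L BV in auto)
    then show ?thesis by (elim exE conjE) (rule that)
  qed
  have dW: "diff_mono (W i)" and aW: "AE x in lebesgue. x \<in> edge L i \<longrightarrow> u0 i x = W i x" if "i \<in> ?M" for i
    using bspec[OF W that] by simp_all
  define w where "w = (\<lambda>i z. W i (fst z - lam i * snd z))"
  have sol: "transport_solution In Out L lam (\<lambda>i j. lam i * G i j) B u0 T w"
    unfolding w_def by (rule transport_solution_profile[OF lam L T dW aW]) (use WIn WOut in auto)
  have "\<forall>i\<in>?M. \<exists>C. \<forall>x. \<bar>W i x\<bar> \<le> C" using diff_mono_regular(2)[OF dW] by (rule ballI)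
  then obtain CW where CW: "\<forall>i\<in>?M. \<forall>x. \<bar>W i x\<bar> \<le> CW i" by (rule bchoice[THEN exE])
  define g where "g = (\<lambda>i. 1 + (\<Sum>k\<in>In. lam i * \<bar>G i k\<bar>))"
  have key: "\<exists>X. X \<longlonglongrightarrow> 0 \<and> (\<forall>n. \<forall>i\<in>?M. u n i absolutely_integrable_on edge L i \<times> {0<..<T} \<and>
       L1_norm (edge L i \<times> {0<..<T}) (\<lambda>p. u n i p - w i p) \<le> (real (card ?M) * e + X n + g i * e) * T)"
    if e: "e > 0" for e
  proof -
    obtain P where P: "\<forall>i\<in>?M. C2b (P i) \<and> L1_norm (edge L i) (\<lambda>x. u0 i x - P i x) < e"
      and PIn: "\<forall>i\<in>In. \<forall>y\<le>0. P i y = B i"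
      and POut: "\<forall>i\<in>Out. \<forall>y\<le>0. P i y = (\<Sum>k\<in>In. lam k * P k (L k + lam k / lam i * y) * G i k)"
    proof -
      have "\<exists>P. (\<forall>i\<in>?M. C2b (P i) \<and> L1_norm (edge L i) (\<lambda>x. u0 i x - P i x) < e) \<and>
        (\<forall>i\<in>In. \<forall>y\<le>0. P i y = B i) \<and>
        (\<forall>i\<in>Out. \<forall>y\<le>0. P i y = (\<Sum>k\<in>In. lam k * P k (L k + lam k / lam i * y) * G i k))"
        by (rule smooth_profile_exists[OF fin disj]) (use lam L u0i e in auto)
      then show ?thesis by (elim exE conjE) (rule that)
    qed
    \<comment> \<open>Both derivatives and their bound are packed into a triple, so that one choice
      serves all arcs.\<close>
    have "\<forall>i\<in>?M. \<exists>r :: (real \<Rightarrow> real) \<times> (real \<Rightarrow> real) \<times> real. (\<forall>x. (P i has_real_derivative fst r x) (at x)) \<and>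
       (\<forall>x. (fst r has_real_derivative fst (snd r) x) (at x)) \<and> continuous_on UNIV (fst (snd r)) \<and>
       (\<forall>x. \<bar>P i x\<bar> \<le> snd (snd r)) \<and> (\<forall>x. \<bar>fst r x\<bar> \<le> snd (snd r)) \<and> (\<forall>x. \<bar>fst (snd r) x\<bar> \<le> snd (snd r))"
    proof
      fix i assume "i \<in> ?M"
      then have "C2b (P i)" using P by simp
      then obtain p' p'' C where "\<forall>x. (P i has_real_derivative p' x) (at x)" "\<forall>x. (p' has_real_derivative p'' x) (at x)"
        "continuous_on UNIV p''" "\<forall>x. \<bar>P i x\<bar> \<le> C" "\<forall>x. \<bar>p' x\<bar> \<le> C" "\<forall>x. \<bar>p'' x\<bar> \<le> C" by (rule C2bE)
      then show "\<exists>r :: (real \<Rightarrow> real) \<times> (real \<Rightarrow> real) \<times> real. (\<forall>x. (P i has_real_derivative fst r x) (at x)) \<and>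
       (\<forall>x. (fst r has_real_derivative fst (snd r) x) (at x)) \<and> continuous_on UNIV (fst (snd r)) \<and>
       (\<forall>x. \<bar>P i x\<bar> \<le> snd (snd r)) \<and> (\<forall>x. \<bar>fst r x\<bar> \<le> snd (snd r)) \<and> (\<forall>x. \<bar>fst (snd r) x\<bar> \<le> snd (snd r))"
        by (intro exI[of _ "(p', p'', C)"]) simp
    qed
    then obtain r :: "nat \<Rightarrow> (real \<Rightarrow> real) \<times> (real \<Rightarrow> real) \<times> real" where r: "\<forall>i\<in>?M. (\<forall>x. (P i has_real_derivative fst (r i) x) (at x)) \<and>
       (\<forall>x. (fst (r i) has_real_derivative fst (snd (r i)) x) (at x)) \<and> continuous_on UNIV (fst (snd (r i))) \<and>
       (\<forall>x. \<bar>P i x\<bar> \<le> snd (snd (r i))) \<and> (\<forall>x. \<bar>fst (r i) x\<bar> \<le> snd (snd (r i))) \<and> (\<forall>x. \<bar>fst (snd (r i)) x\<bar> \<le> snd (snd (r i)))"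
      by (rule bchoice[THEN exE])
    define C where "C = (\<Sum>i\<in>?M. \<bar>snd (snd (r i))\<bar>)"
    have C: "snd (snd (r i)) \<le> C" if "i \<in> ?M" for i
      unfolding C_def using member_le_sum[OF that, of "\<lambda>i. \<bar>snd (snd (r i))\<bar>"] fin by simp
    have Pb: "\<bar>P i x\<bar> \<le> C" "\<bar>fst (r i) x\<bar> \<le> C" "\<bar>fst (snd (r i)) x\<bar> \<le> C" if "i \<in> ?M" for i x
      using bspec[OF r that] C[OF that] by (meson order_trans)+
    have Pd: "(P i has_real_derivative fst (r i) x) (at x)" "(fst (r i) has_real_derivative fst (snd (r i)) x) (at x)"
      and P2c: "continuous_on UNIV (fst (snd (r i)))" if "i \<in> ?M" for i x
      using bspec[OF r that] by simp_all
    have POut': "P i (- lam i * t) = (\<Sum>k\<in>In. lam k * P k (L k - lam k * t) * G i k)" if i: "i \<in> Out" and t: "t \<ge> 0" for i t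
    proof -
      have li: "lam i > 0" using lam i by simp
      then have "- lam i * t \<le> 0" using t by simp
      then have "P i (- lam i * t) = (\<Sum>k\<in>In. lam k * P k (L k + lam k / lam i * (- lam i * t)) * G i k)"
        using POut i by blast
      then show ?thesis using li by simp
    qed
    have "\<exists>X. X \<longlonglongrightarrow> 0 \<and> (\<forall>n. \<forall>t\<in>{0..T}. (\<Sum>i\<in>?M. L1_norm (edge L i) (\<lambda>x. u n i (x, t) - P i (x - lam i * t)))
       \<le> (\<Sum>i\<in>?M. L1_norm (edge L i) (\<lambda>x. u0 i x - P i x)) + X n)"
      by (rule smooth_profile_estimate[OF fin disj K Ks lam G L eps par vi u0i vconv Db Db0 Pd P2c Pb _ POut'])
        (use T PIn in auto)
    then obtain X where X: "X \<longlonglongrightarrow> 0"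
      and Xe: "\<forall>n. \<forall>t\<in>{0..T}. (\<Sum>i\<in>?M. L1_norm (edge L i) (\<lambda>x. u n i (x, t) - P i (x - lam i * t)))
       \<le> (\<Sum>i\<in>?M. L1_norm (edge L i) (\<lambda>x. u0 i x - P i x)) + X n" by (elim exE conjE) (rule that)
    have s0: "(\<Sum>i\<in>?M. L1_norm (edge L i) (\<lambda>x. u0 i x - P i x)) \<le> real (card ?M) * e"
      using sum_bounded_above[of ?M "\<lambda>i. L1_norm (edge L i) (\<lambda>x. u0 i x - P i x)" e] P by (simp add: less_imp_le)
    define Q where "Q = (\<lambda>i y. P i y - W i y)"
    have Pm: "P i \<in> borel_measurable borel" if "i \<in> ?M" for i
      by (rule borel_measurable_continuous_onI, rule DERIV_continuous_on) (rule has_field_derivative_at_within[OF Pd(1)[OF that]])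
    have Wm: "W i \<in> borel_measurable borel" if "i \<in> ?M" for i by (rule diff_mono_regular(1)[OF dW[OF that]])
    define D where "D = C + (\<Sum>i\<in>?M. \<bar>CW i\<bar>)"
    have Wb: "\<bar>W i x\<bar> \<le> (\<Sum>i\<in>?M. \<bar>CW i\<bar>)" if "i \<in> ?M" for i x
      using spec[OF bspec[OF CW that], of x] member_le_sum[OF that, of "\<lambda>i. \<bar>CW i\<bar>"] fin by simp
    have Qb: "\<bar>Q i x\<bar> \<le> D" if "i \<in> ?M" for i x
      using Pb(1)[OF that, of x] Wb[OF that, of x] unfolding Q_def D_def by linarith
    have Qm: "Q i \<in> borel_measurable borel" if "i \<in> ?M" for i
      unfolding Q_def by (rule borel_measurable_diff[OF Pm[OF that] Wm[OF that]])
    have QS: "L1_norm (edge L i) (Q i) \<le> e" if i: "i \<in> ?M" for i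
    proof -
      have "L1_norm (edge L i) (Q i) = L1_norm (edge L i) (\<lambda>x. P i x - u0 i x)"
        by (rule L1_norm_cong_AE) (use aW[OF i] in eventually_elim, simp add: Q_def)
      then show ?thesis using P i L1_norm_diff_commute[of "edge L i" "P i" "u0 i"] by (simp add: less_imp_le)
    qed
    have QOut: "Q i y = (\<Sum>k\<in>In. lam k * Q k (L k + lam k / lam i * y) * G i k)" if "i \<in> Out" "y < 0" for i y
      unfolding Q_def using POut WOut that by (simp add: sum_subtractf algebra_simps)
    have Qt: "L1_norm (edge L i) (\<lambda>x. Q i (x - lam i * t)) \<le> g i * e" if "i \<in> ?M" "t \<ge> 0" for i t
      unfolding g_def
      by (rule profile_distance[OF lam L Qm Qb _ QOut QS that]) (use PIn WIn in \<open>auto simp: Q_def\<close>)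
    have am: "(\<lambda>x. f (x - c)) absolutely_integrable_on {a<..<a'}"
      if "f \<in> borel_measurable borel" "\<And>x. \<bar>f x\<bar> \<le> C'" for f :: "real \<Rightarrow> real" and c a a' C'
      by (rule absolutely_integrable_bounded_borel[of _ C']) (use that in \<open>measurable\<close>)
    have st: "u n i absolutely_integrable_on edge L i \<times> {0<..<T} \<and>
       L1_norm (edge L i \<times> {0<..<T}) (\<lambda>p. u n i p - w i p) \<le> (real (card ?M) * e + X n + g i * e) * T" if i: "i \<in> ?M" for n i
    proof -
      let ?I = "edge L i"
      have pn: "set_borel_measurable lebesgue (?I \<times> {0<..}) (u n i)" "\<forall>t\<ge>0. W21 ?I (\<lambda>x. u n i (x, t))"
        using par[of n] i unfolding parabolic_solution_def by simp_all
      have ut: "(\<lambda>x. u n i (x, t)) absolutely_integrable_on ?I" if "t \<ge> 0" for t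
        using pn(2) that unfolding W21_def weak_deriv_def by blast
      have wm: "w i \<in> borel_measurable borel"
      proof -
        have "(\<lambda>z. fst z - lam i * snd z) \<in> borel_measurable borel"
          by (intro borel_measurable_continuous_onI continuous_intros)
        then show ?thesis unfolding w_def using measurable_compose[OF _ Wm[OF i]] by blast
      qed
      have Is: "?I \<times> {0::real<..} \<in> sets lebesgue" 
      using borel_open[OF open_Times[OF open_greaterThanLessThan open_greaterThan, of 0 "L i" "0::real"]] by simp
      have wsm: "set_borel_measurable lebesgue (?I \<times> {0<..}) (w i)"
        unfolding set_borel_measurable_def
        by (intro borel_measurable_scaleR borel_measurable_indicator Is measurable_completion) (simp add: wm)
      have dm: "set_borel_measurable lebesgue (?I \<times> {0<..}) (\<lambda>p. u n i p - w i p)"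
        using borel_measurable_diff[OF pn(1)[unfolded set_borel_measurable_def] wsm[unfolded set_borel_measurable_def]]
        unfolding set_borel_measurable_def by (simp add: algebra_simps)
      have wt: "(\<lambda>x. w i (x, t)) absolutely_integrable_on ?I" for t
        unfolding w_def fst_conv snd_conv by (rule am[OF Wm[OF i] Wb[OF i]])
      have di: "(\<lambda>x. u n i (x, t) - w i (x, t)) absolutely_integrable_on ?I" if "0 < t" "t < T" for t
        by (rule set_integral_diff(1)[OF ut wt]) (use that in simp)
      have dl: "L1_norm ?I (\<lambda>x. u n i (x, t) - w i (x, t)) \<le> real (card ?M) * e + X n + g i * e" if t: "0 < t" "t < T" for t
      proof -
        have Pt: "(\<lambda>x. P i (x - lam i * t)) absolutely_integrable_on ?I" by (rule am[OF Pm[OF i] Pb(1)[OF i]])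
        have "L1_norm ?I (\<lambda>x. u n i (x, t) - w i (x, t)) \<le>
           L1_norm ?I (\<lambda>x. u n i (x, t) - P i (x - lam i * t)) + L1_norm ?I (\<lambda>x. P i (x - lam i * t) - w i (x, t))"
          by (rule L1_norm_triangle_diff[OF ut Pt wt]) (use t in simp)
        also have "L1_norm ?I (\<lambda>x. P i (x - lam i * t) - w i (x, t)) \<le> g i * e"
          using Qt[OF i, of t] t by (simp add: Q_def w_def)
        also have "L1_norm ?I (\<lambda>x. u n i (x, t) - P i (x - lam i * t)) \<le> (\<Sum>i\<in>?M. L1_norm (edge L i) (\<lambda>x. u n i (x, t) - P i (x - lam i * t)))"
          by (rule member_le_sum[OF i]) (use fin L1_norm_nonneg in auto)
        also have "\<dots> \<le> (\<Sum>i\<in>?M. L1_norm (edge L i) (\<lambda>x. u0 i x - P i x)) + X n"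
          by (rule bspec[OF spec[OF Xe]]) (use t in simp)
        finally show ?thesis using s0 by linarith
      qed
      have Ib: "?I \<in> sets borel" by simp
      have dd: "(\<lambda>p. u n i p - w i p) absolutely_integrable_on ?I \<times> {0<..<T}"
        "L1_norm (?I \<times> {0<..<T}) (\<lambda>p. u n i p - w i p) \<le> (real (card ?M) * e + X n + g i * e) * T"
        using space_time_L1[OF dm Ib T di dl] by simp_all
      have "w i absolutely_integrable_on ?I \<times> {0<..<T}"
        using sol i unfolding transport_solution_def BV_def by blast
      from set_integral_add(1)[OF dd(1) this] have "u n i absolutely_integrable_on ?I \<times> {0<..<T}" by simp
      then show ?thesis using dd(2) by (rule conjI)
    qed
    show ?thesis by (intro exI[of _ X] conjI X allI ballI st)
  qed
  show "\<forall>n. \<forall>i\<in>?M. u n i absolutely_integrable_on edge L i \<times> {0<..<T}" using key[OF zero_less_one] by (elim exE conjE) simp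
  show "\<exists>w. transport_solution In Out L lam (\<lambda>i j. lam i * G i j) B u0 T w" using sol by (intro exI[of _ w])
  have conv: "(\<lambda>n. \<Sum>i\<in>?M. L1_norm (edge L i \<times> {0<..<T}) (\<lambda>p. u n i p - w i p)) \<longlonglongrightarrow> 0"
  proof (rule tendsto_zero_approximation)
    show "0 \<le> (\<Sum>i\<in>?M. L1_norm (edge L i \<times> {0<..<T}) (\<lambda>p. u n i p - w i p))" for n by (intro sum_nonneg L1_norm_nonneg)
    have g0: "g i \<ge> 0" if "i \<in> ?M" for i
      unfolding g_def using lam[OF that] by (intro add_nonneg_nonneg sum_nonneg mult_nonneg_nonneg) auto
    show "0 \<le> (\<Sum>i\<in>?M. (real (card ?M) + g i) * T)" using T g0 by (intro sum_nonneg mult_nonneg_nonneg add_nonneg_nonneg) auto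
    fix e :: real assume e: "e > 0"
    obtain X where X: "X \<longlonglongrightarrow> 0" and b: "\<forall>n. \<forall>i\<in>?M. u n i absolutely_integrable_on edge L i \<times> {0<..<T} \<and>
       L1_norm (edge L i \<times> {0<..<T}) (\<lambda>p. u n i p - w i p) \<le> (real (card ?M) * e + X n + g i * e) * T"
      using key[OF e] by (elim exE conjE) (rule that)
    have "(\<Sum>i\<in>?M. L1_norm (edge L i \<times> {0<..<T}) (\<lambda>p. u n i p - w i p))
       \<le> (\<Sum>i\<in>?M. (real (card ?M) + g i) * T) * e + X n * (real (card ?M) * T)" for n
    proof -
      have "(\<Sum>i\<in>?M. L1_norm (edge L i \<times> {0<..<T}) (\<lambda>p. u n i p - w i p))
        \<le> (\<Sum>i\<in>?M. (real (card ?M) * e + X n + g i * e) * T)"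
        by (intro sum_mono) (rule bspec[OF spec[OF b], THEN conjunct2])
      also have "\<dots> = (\<Sum>i\<in>?M. (real (card ?M) + g i) * T * e + X n * T)"
        by (intro sum.cong refl) (simp add: algebra_simps)
      also have "\<dots> = (\<Sum>i\<in>?M. (real (card ?M) + g i) * T) * e + X n * (real (card ?M) * T)"
        unfolding sum.distrib sum_distrib_right[symmetric] by simp
      finally show ?thesis .
    qed
    moreover have "(\<lambda>n. X n * (real (card ?M) * T)) \<longlonglongrightarrow> 0" by (rule tendsto_mult_left_zero[OF X])
    ultimately show "\<exists>Y. Y \<longlonglongrightarrow> 0 \<and> (\<forall>n. (\<Sum>i\<in>?M. L1_norm (edge L i \<times> {0<..<T}) (\<lambda>p. u n i p - w i p))
       \<le> (\<Sum>i\<in>?M. (real (card ?M) + g i) * T) * e + Y n)"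
      by (intro exI[of _ "\<lambda>n. X n * (real (card ?M) * T)"] conjI allI)
  qed
  show "\<forall>w. transport_solution In Out L lam (\<lambda>i j. lam i * G i j) B u0 T w \<longrightarrow>
     (\<lambda>n. \<Sum>i\<in>?M. L1_norm (edge L i \<times> {0<..<T}) (\<lambda>p. u n i p - w i p)) \<longlonglongrightarrow> 0"
  proof (intro allI impI)
    fix w' assume w': "transport_solution In Out L lam (\<lambda>i j. lam i * G i j) B u0 T w'"
    have "L1_norm (edge L i \<times> {0<..<T}) (\<lambda>p. u n i p - w i p) = L1_norm (edge L i \<times> {0<..<T}) (\<lambda>p. u n i p - w' i p)"
      if "i \<in> ?M" for n i
      
    proof (rule L1_norm_cong_AE)
      have "AE p in lebesgue. p \<in> edge L i \<times> {0<..<T} \<longrightarrow> w i p = w' i p"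
        by (rule transport_solution_unique[OF fin _ _ T sol w' that]) (use lam L in auto)
      then show "AE p in lebesgue. p \<in> edge L i \<times> {0<..<T} \<longrightarrow> u n i p - w i p = u n i p - w' i p"
        by eventually_elim simp
    qed
    then have "(\<Sum>i\<in>?M. L1_norm (edge L i \<times> {0<..<T}) (\<lambda>p. u n i p - w i p)) = (\<Sum>i\<in>?M. L1_norm (edge L i \<times> {0<..<T}) (\<lambda>p. u n i p - w' i p))" for n
      by (rule sum.cong[OF refl])
    then show "(\<lambda>n. \<Sum>i\<in>?M. L1_norm (edge L i \<times> {0<..<T}) (\<lambda>p. u n i p - w' i p)) \<longlonglongrightarrow> 0" using conv by simp
  qed
qed

section \<open>Uniqueness of the coefficients\<close>

lemma smooth_edge_function:
  fixes F F1 F2 :: "real \<Rightarrow> real"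
  assumes F1: "\<And>x. (F has_real_derivative F1 x) (at x)" and F2: "\<And>x. (F1 has_real_derivative F2 x) (at x)"
    and F2c: "continuous_on UNIV F2" and L: "L > 0"
  shows "W21 {0<..<L} F"
    and "AE x in lebesgue. x \<in> {0<..<L} \<longrightarrow> Dx {0<..<L} F x = F1 x"
    and "AE x in lebesgue. x \<in> {0<..<L} \<longrightarrow> Dx {0<..<L} (Dx {0<..<L} F) x = F2 x"
    and "boundary_trace {0<..<L} F 0 = F 0" "boundary_trace {0<..<L} F L = F L"
    and "boundary_trace {0<..<L} (Dx {0<..<L} F) 0 = F1 0" "boundary_trace {0<..<L} (Dx {0<..<L} F) L = F1 L"
proof -
  let ?S = "{0<..<L}"
  have wd: "weak_deriv ?S f f'"
    if d: "\<And>x. (f has_real_derivative f' x) (at x)" and c: "continuous_on UNIV f'" for f f' :: "real \<Rightarrow> real"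
  proof (rule weak_deriv_AC)
    show "0 \<le> L" using L by simp
    show "f' absolutely_integrable_on {0..L}"
      by (rule absolutely_integrable_continuous_real[OF continuous_on_subset[OF c]]) simp
    fix x assume x: "x \<in> {0..L}"
    have "(f' has_integral (f x - f 0)) {0..x}"
    proof (rule fundamental_theorem_of_calculus)
      show "0 \<le> x" using x by simp
      show "(f has_vector_derivative f' y) (at y within {0..x})" for y
        using has_field_derivative_at_within[OF d] by (simp only: has_real_derivative_iff_has_vector_derivative)
    qed
    then show "f x = f 0 + integral {0..x} f'" by (simp add: integral_unique)
  qed
  have F1c: "continuous_on UNIV F1" by (rule DERIV_continuous_on) (rule has_field_derivative_at_within[OF F2])
  have Fc: "continuous_on UNIV F" by (rule DERIV_continuous_on) (rule has_field_derivative_at_within[OF F1])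
  have w1: "weak_deriv ?S F F1" by (rule wd[OF F1 F1c])
  have w2: "weak_deriv ?S F1 F2" by (rule wd[OF F2 F2c])
  show "W21 ?S F" unfolding W21_def using w1 w2 by (intro exI conjI)
  have D1: "weak_deriv ?S F (Dx ?S F)" by (rule weak_deriv_Dx[OF w1])
  show e1: "AE x in lebesgue. x \<in> ?S \<longrightarrow> Dx ?S F x = F1 x" by (rule weak_deriv_unique[OF D1 w1])
  have "AE x in lebesgue. x \<in> ?S \<longrightarrow> F1 x = Dx ?S F x" using e1 by eventually_elim simp
  then have w2': "weak_deriv ?S (Dx ?S F) F2" by (rule weak_deriv_cong_AE[OF w2])
  show "AE x in lebesgue. x \<in> ?S \<longrightarrow> Dx ?S (Dx ?S F) x = F2 x"
    by (rule weak_deriv_unique[OF weak_deriv_Dx[OF w2'] w2'])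
  have i: "F absolutely_integrable_on ?S" "Dx ?S F absolutely_integrable_on ?S"
    using D1 unfolding weak_deriv_def by simp_all
  have F0: "AE x in lebesgue. x \<in> ?S \<longrightarrow> F x = F x" by simp
  show "boundary_trace ?S F 0 = F 0" "boundary_trace ?S F L = F L"
    by (rule boundary_trace_edge[OF L i(1) F0 continuous_on_subset[OF Fc]], simp)+
  show "boundary_trace ?S (Dx ?S F) 0 = F1 0" "boundary_trace ?S (Dx ?S F) L = F1 L"
    by (rule boundary_trace_edge[OF L i(2) e1 continuous_on_subset[OF F1c]], simp)+
qed

lemma BV_const:
  fixes L c :: real
  assumes L: "L > 0"
  shows "BV {0<..<L} (\<lambda>x. c)"
proof -
  have i: "(\<lambda>x. c) absolutely_integrable_on {0<..<L}" by (rule absolutely_integrable_continuous_Ioo) simp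
  have w: "weak_deriv {0<..<L} (\<lambda>x. c) (\<lambda>x. 0)" by (rule weak_deriv_AC) (use L in auto)
  have "(LINT x:{0<..<L}|lebesgue. c * divergence \<theta> x) \<le> 0" if \<theta>: "C1c {0<..<L} \<theta>" for \<theta> :: "real \<Rightarrow> real"
  proof -
    obtain \<phi>' where d: "\<And>x. x \<in> {0<..<L} \<Longrightarrow> (\<theta> has_real_derivative \<phi>' x) (at x)"
      by (rule C1c_real_extend[OF \<theta>]) (rule that)
    have "(LINT x:{0<..<L}|lebesgue. c * divergence \<theta> x) = (LINT x:{0<..<L}|lebesgue. c * deriv \<theta> x)"
      by (rule set_integral_lebesgue_cong_AE, intro AE_I2 impI) (simp only: divergence_real[OF d] DERIV_imp_deriv[OF d])
    also have "\<dots> = - (LINT x:{0<..<L}|lebesgue. 0 * \<theta> x)" using w \<theta> unfolding weak_deriv_def by simp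
    also have "\<dots> = 0" by (simp add: set_lebesgue_integral_def)
    finally show ?thesis by (rule eq_refl)
  qed
  then have "bdd_above (variation_sums {0<..<L} (\<lambda>x. c))"
    unfolding variation_sums_def by (intro bdd_aboveI[of _ 0]) auto
  with i show ?thesis by (simp add: BV_def)
qed

text \<open>With inflow value 1 on \<open>j0\<close> and 0 on the other incoming arcs, the
  stationary node values solve the limit system perturbed by the layer tails
  \<open>\<kappa> n i\<close>, in the diagonal and on the right-hand side. The perturbation raises
  the operator on positive functions, so the supersolution of the limit system works for every
  \<open>n\<close>. The resulting uniform bound makes the residual in the limit system tend to
  0.\<close>

lemma stationary_node_values:
  fixes \<kappa> :: "nat \<Rightarrow> nat \<Rightarrow> real"
  assumes fin: "finite (In \<union> Out)" and disj: "In \<inter> Out = {}"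
    and lam: "\<And>i. i \<in> In \<union> Out \<Longrightarrow> lam i > 0"
    and K: "\<And>i j. i \<in> In \<union> Out \<Longrightarrow> j \<in> In \<union> Out \<Longrightarrow> K i j \<ge> 0"
    and KIO: "\<forall>i\<in>In. \<exists>j\<in>Out. K i j > 0"
    and G: "\<And>i. i \<in> In \<union> Out \<Longrightarrow>
      node_op (In \<union> Out) (\<lambda>i. if i \<in> In then 0 else lam i) K (\<lambda>i. G i j0) i = (if i = j0 then 1 else 0)"
    and j0: "j0 \<in> In" and \<kappa>: "\<And>n i. i \<in> In \<Longrightarrow> \<kappa> n i \<ge> 0" "\<And>i. i \<in> In \<Longrightarrow> (\<lambda>n. \<kappa> n i) \<longlonglongrightarrow> 0"
  shows "\<exists>v V. \<forall>i\<in>In \<union> Out. (\<forall>n. 0 \<le> v n i \<and> v n i \<le> V \<and>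
     (if i \<in> In then lam i * \<kappa> n i * v n i - lam i * (1 + \<kappa> n i) * (if i = j0 then 1 else 0) else lam i * v n i)
       = (\<Sum>j\<in>In \<union> Out. K i j * (v n j - v n i))) \<and> (\<lambda>n. v n i) \<longlonglongrightarrow> lam j0 * G i j0"
proof -
  let ?M = "In \<union> Out" and ?D = "\<lambda>i. if i \<in> In then 0 else lam i"
  let ?B = "\<lambda>i. if i = j0 then 1 else (0::real)"
  define D where "D = (\<lambda>n i. if i \<in> In then lam i * \<kappa> n i else lam i)"
  define r where "r = (\<lambda>n i. if i \<in> In then lam i * (1 + \<kappa> n i) * ?B i else 0)"
  have "\<exists>s. \<forall>i\<in>?M. s i > 0 \<and> node_op ?M ?D K s i > 0"
    by (rule network_supersolution[OF fin disj]) (use lam K KIO in auto)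
  then obtain s where s': "\<forall>i\<in>?M. s i > 0 \<and> node_op ?M ?D K s i > 0" by (rule exE)
  have s: "s i > 0" "node_op ?M ?D K s i > 0" if "i \<in> ?M" for i using bspec[OF s' that] by simp_all
  \<comment> \<open>The first summand absorbs \<open>lam j0\<close>; the second absorbs
    \<open>lam j0 * \<kappa> n j0\<close> through the perturbed diagonal term
    \<open>lam j0 * \<kappa> n j0 * s j0\<close>. Neither depends on \<open>n\<close>.\<close>
  define C where "C = lam j0 / node_op ?M ?D K s j0 + 1 / s j0"
  have jM: "j0 \<in> ?M" using j0 by simp
  have C0: "C \<ge> 0" using s[OF jM] lam[OF jM] by (simp add: C_def)
  have Ds: "node_op ?M (D n) K s i = node_op ?M ?D K s i + (if i \<in> In then lam i * \<kappa> n i * s i else 0)" for n i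
    by (simp add: node_op_def D_def)
  have pos: "(if i \<in> In then lam i * \<kappa> n i * s i else 0) \<ge> 0" if "i \<in> ?M" for n i
    using lam[OF that] s(1)[OF that] \<kappa>(1)[of i n] by simp
  have "\<exists>v. \<forall>i\<in>?M. 0 \<le> v i \<and> v i \<le> C * s i \<and> node_op ?M (D n) K v i = r n i" for n
  proof (rule node_op_solution[OF fin])
    show "K i j \<ge> 0" if "i \<in> ?M" "j \<in> ?M" for i j by (rule K[OF that])
    show "s i > 0" if "i \<in> ?M" for i by (rule s(1)[OF that])
    show "node_op ?M (D n) K s i > 0" if "i \<in> ?M" for i using s(2)[OF that] pos[OF that, of n] unfolding Ds by linarith
    show "0 \<le> r n i" if "i \<in> ?M" for i using lam[OF that] \<kappa>(1)[of i n] by (simp add: r_def)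
    show "r n i \<le> C * node_op ?M (D n) K s i" if i: "i \<in> ?M" for i
    proof (cases "i = j0")
      case True
      have "lam j0 / node_op ?M ?D K s j0 * node_op ?M ?D K s j0 = lam j0" using s(2)[OF jM] by simp
      moreover have "1 / s j0 * (lam j0 * \<kappa> n j0 * s j0) = lam j0 * \<kappa> n j0" using s(1)[OF jM] by simp
      moreover have "lam j0 / node_op ?M ?D K s j0 * (lam j0 * \<kappa> n j0 * s j0) \<ge> 0" "1 / s j0 * node_op ?M ?D K s j0 \<ge> 0"
        using s[OF jM] lam[OF jM] \<kappa>(1)[OF j0, of n] by simp_all
      moreover have "C * (node_op ?M ?D K s j0 + lam j0 * \<kappa> n j0 * s j0)
         = lam j0 / node_op ?M ?D K s j0 * node_op ?M ?D K s j0 + 1 / s j0 * (lam j0 * \<kappa> n j0 * s j0)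
         + lam j0 / node_op ?M ?D K s j0 * (lam j0 * \<kappa> n j0 * s j0) + 1 / s j0 * node_op ?M ?D K s j0"
        unfolding C_def distrib_left distrib_right by (simp only: add_ac)
      ultimately have "lam j0 + lam j0 * \<kappa> n j0 \<le> C * (node_op ?M ?D K s j0 + lam j0 * \<kappa> n j0 * s j0)" by linarith
      then show ?thesis unfolding True Ds r_def using j0 by (simp add: distrib_left)
    next
      case False
      then have "r n i = 0" by (simp add: r_def)
      moreover have "C * node_op ?M (D n) K s i \<ge> 0"
        unfolding Ds using C0 s(2)[OF i] pos[OF i, of n] by (intro mult_nonneg_nonneg add_nonneg_nonneg) auto
      ultimately show ?thesis by simp
    qed
  qed (rule C0)
  note ex = this
  have "\<forall>n. \<exists>v. \<forall>i\<in>?M. 0 \<le> v i \<and> v i \<le> C * s i \<and> node_op ?M (D n) K v i = r n i" by (rule allI) (rule ex)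
  then obtain v where v: "\<forall>n. \<forall>i\<in>?M. 0 \<le> v n i \<and> v n i \<le> C * s i \<and> node_op ?M (D n) K (v n) i = r n i"
    by (rule choice[THEN exE])
  have v1: "0 \<le> v n i" and v2: "v n i \<le> C * s i" and v3: "node_op ?M (D n) K (v n) i = r n i" if "i \<in> ?M" for n i
    using bspec[OF spec[OF v] that, of n] by simp_all
  define V where "V = (\<Sum>i\<in>?M. C * s i)"
  have vV: "v n i \<le> V" if i: "i \<in> ?M" for n i
  proof -
    have "C * s i \<le> V" unfolding V_def
      by (rule member_le_sum[OF i]) (use fin C0 s(1) in \<open>auto simp: less_imp_le\<close>)
    then show ?thesis using v2[OF i] by (rule order_trans[rotated])
  qed
  have bal: "(if i \<in> In then lam i * \<kappa> n i * v n i - lam i * (1 + \<kappa> n i) * ?B i else lam i * v n i)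
       = (\<Sum>j\<in>?M. K i j * (v n j - v n i))" if i: "i \<in> ?M" for n i
  proof -
    have "(\<Sum>j\<in>?M. K i j * (v n j - v n i)) = - (\<Sum>j\<in>?M. K i j * (v n i - v n j))"
      by (simp add: sum_negf[symmetric] algebra_simps)
    also have "\<dots> = D n i * v n i - r n i" using v3[OF i, of n] by (simp add: node_op_def)
    finally show ?thesis by (simp add: D_def r_def)
  qed
  let ?w = "\<lambda>n i. v n i - lam j0 * G i j0"
  have res: "node_op ?M ?D K (?w n) i = (if i \<in> In then lam i * \<kappa> n i * (?B i - v n i) else 0)" if i: "i \<in> ?M" for n i
  proof -
    have "node_op ?M ?D K (?w n) i = node_op ?M ?D K (v n) i - lam j0 * node_op ?M ?D K (\<lambda>i. G i j0) i"
      by (simp only: node_op_diff node_op_cmult)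
    also have "node_op ?M ?D K (v n) i = node_op ?M (D n) K (v n) i - (if i \<in> In then lam i * \<kappa> n i * v n i else 0)"
      by (simp add: node_op_def D_def)
    also have "\<dots> = r n i - (if i \<in> In then lam i * \<kappa> n i * v n i else 0)" by (simp only: v3[OF i])
    finally show ?thesis unfolding G[OF i] r_def using j0 by (cases "i = j0"; cases "i \<in> In") (simp_all add: right_diff_distrib distrib_left)
  qed
  have lim0: "(\<lambda>n. if i \<in> In then lam i * \<kappa> n i * (?B i - v n i) else 0) \<longlonglongrightarrow> 0" if i: "i \<in> ?M" for i
  proof (cases "i \<in> In")
    case True
    have b0: "(\<lambda>n. (lam i * (1 + V)) * \<kappa> n i) \<longlonglongrightarrow> 0" by (rule tendsto_mult_right_zero[OF \<kappa>(2)[OF True]])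
    have b1: "norm (lam i * \<kappa> n i * (?B i - v n i)) \<le> (lam i * (1 + V)) * \<kappa> n i" for n
    proof -
      have "\<bar>?B i - v n i\<bar> \<le> 1 + V" using v1[OF i, of n] vV[OF i, of n] by auto
      then have "(lam i * \<kappa> n i) * \<bar>?B i - v n i\<bar> \<le> (lam i * \<kappa> n i) * (1 + V)"
        using lam[OF i] \<kappa>(1)[OF True, of n] by (intro mult_left_mono) auto
      moreover have "\<bar>lam i * \<kappa> n i\<bar> = lam i * \<kappa> n i" using lam[OF i] \<kappa>(1)[OF True, of n] by simp
      ultimately show ?thesis unfolding real_norm_def abs_mult[of "lam i * \<kappa> n i"] by (simp only: mult_ac)
    qed
    have "(\<lambda>n. lam i * \<kappa> n i * (?B i - v n i)) \<longlonglongrightarrow> 0"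
      by (rule Lim_null_comparison[OF always_eventually[OF allI] b0]) (rule b1)
    then show ?thesis using True by simp
  qed simp
  have lim: "(\<lambda>n. v n i) \<longlonglongrightarrow> lam j0 * G i j0" if i: "i \<in> ?M" for i
  proof -
    have "(\<lambda>n. ?w n i) \<longlonglongrightarrow> 0"
    proof (rule node_op_perturbation[where M = ?M and D = ?D and K = K and s = s and w = ?w and k = i, OF fin])
      show "K i j \<ge> 0" if "i \<in> ?M" "j \<in> ?M" for i j by (rule K[OF that])
      show "s i > 0" if "i \<in> ?M" for i by (rule s(1)[OF that])
      show "node_op ?M ?D K s i > 0" if "i \<in> ?M" for i by (rule s(2)[OF that])
      show "(\<lambda>n. node_op ?M ?D K (?w n) i) \<longlonglongrightarrow> 0" if "i \<in> ?M" for i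
        unfolding res[OF that] by (rule lim0[OF that])
    qed (rule i)
    then show ?thesis by (rule LIM_zero_cancel)
  qed
  show ?thesis by (intro exI[of _ v] exI[of _ V] ballI conjI allI v1 vV bal lim)
qed

text \<open>Constants and layers both solve the stationary equation; all arcs get length 1. Outgoing
  arcs are constant because the outer value is prescribed by the initial datum, which will be the
  profile itself.\<close>

definition stationary_profile :: "nat set \<Rightarrow> (nat \<Rightarrow> real) \<Rightarrow> (nat \<Rightarrow> real) \<Rightarrow> real \<Rightarrow> (nat \<Rightarrow> real) \<Rightarrow> nat \<Rightarrow> real \<Rightarrow> real" where
  "stationary_profile In lam B \<epsilon> v i x = (if i \<in> In then B i + (v i - B i) * layer \<epsilon> (lam i) 1 x else v i)"

lemma stationary_profile_derivatives:
  fixes lam B v :: "nat \<Rightarrow> real" and \<epsilon> :: real and In :: "nat set" and i :: nat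
  assumes eps: "\<epsilon> > 0" and lam: "lam i > 0"
  defines "F1 \<equiv> \<lambda>x. if i \<in> In then (v i - B i) * layer_dx \<epsilon> (lam i) 1 x else 0"
  defines "F2 \<equiv> \<lambda>x. if i \<in> In then (v i - B i) * (lam i / \<epsilon> * layer_dx \<epsilon> (lam i) 1 x) else 0"
  shows "(stationary_profile In lam B \<epsilon> v i has_real_derivative F1 x) (at x)"
    and "(F1 has_real_derivative F2 x) (at x)" and "continuous_on UNIV F2"
    and "L1_norm {0<..<1} F1 \<le> \<bar>v i - B i\<bar>" "L1_norm {0<..<1} F2 \<le> lam i / \<epsilon> * \<bar>v i - B i\<bar>"
    and "L1_norm {0<..<1} (\<lambda>x. stationary_profile In lam B \<epsilon> v i x - (if i \<in> In then B i else v i)) \<le> \<bar>v i - B i\<bar> * (\<epsilon> / lam i)"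
proof -
  note l = eps lam zero_less_one
  let ?l = "layer \<epsilon> (lam i) 1" and ?d = "layer_dx \<epsilon> (lam i) 1"
  have d1: "(?l has_real_derivative ?d x) (at x)" for x by (rule DERIV_layer[OF l])
  have d2: "(?d has_real_derivative lam i / \<epsilon> * ?d x) (at x)" for x by (rule DERIV_layer_dx[OF l])
  have dc: "continuous_on S ?d" for S by (rule DERIV_continuous_on) (rule has_field_derivative_at_within[OF d2])
  have c: "((\<lambda>x. a + b * f x) has_real_derivative b * D) (at x)" if "(f has_real_derivative D) (at x)" for a b f D and x :: real
    using DERIV_add[OF DERIV_const[of a] DERIV_cmult[OF that, of b]] by simp
  show "(stationary_profile In lam B \<epsilon> v i has_real_derivative F1 x) (at x)" for x
    unfolding stationary_profile_def[abs_def] F1_def using c[OF d1, of "B i" "v i - B i" x] by (cases "i \<in> In") simp_all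
  show "(F1 has_real_derivative F2 x) (at x)" for x
    unfolding F1_def F2_def by (cases "i \<in> In") (simp_all only: if_True if_False DERIV_const DERIV_cmult[OF d2])
  show "continuous_on UNIV F2" unfolding F2_def by (cases "i \<in> In") (use eps in \<open>auto intro!: continuous_intros dc\<close>)
  have dn: "?d x \<ge> 0" for x using eps lam layer_denominator[OF l] by (simp add: layer_dx_def)
  have "L1_norm {0<..<1} ?d = L1_norm {0..1} ?d" by (rule L1_norm_Ioo_Icc)
  also have "\<dots> = integral {0..1} (\<lambda>x. \<bar>?d x\<bar>)"
    by (rule L1_norm_eq_integral, rule absolutely_integrable_continuous_real, rule dc)
  also have "\<dots> = integral {0..1} ?d" using dn by simp
  also have "\<dots> = ?l 1 - ?l 0"
  proof (rule integral_unique, rule fundamental_theorem_of_calculus[where f = ?l])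
    show "(?l has_vector_derivative ?d x) (at x within {0..1})" for x
      using has_field_derivative_at_within[OF d1] by (simp only: has_real_derivative_iff_has_vector_derivative)
  qed simp
  also have "\<dots> = 1" using layer_ends[OF l] by simp
  finally have n: "L1_norm {0<..<1} ?d = 1" .
  have z: "L1_norm S (\<lambda>x. 0) = 0" for S :: "real set" by (simp add: L1_norm_def set_lebesgue_integral_def)
  show "L1_norm {0<..<1} F1 \<le> \<bar>v i - B i\<bar>"
    unfolding F1_def by (cases "i \<in> In") (simp_all add: L1_norm_cmult n z)
  show "L1_norm {0<..<1} F2 \<le> lam i / \<epsilon> * \<bar>v i - B i\<bar>"
  proof (cases "i \<in> In")
    case True
    then have "L1_norm {0<..<1} F2 = L1_norm {0<..<1} (\<lambda>x. ((v i - B i) * (lam i / \<epsilon>)) * ?d x)" by (simp add: F2_def mult.assoc)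
    also have "\<dots> = \<bar>(v i - B i) * (lam i / \<epsilon>)\<bar>" unfolding L1_norm_cmult n by simp
    also have "\<dots> = lam i / \<epsilon> * \<bar>v i - B i\<bar>" using eps lam by (simp add: abs_mult)
    finally show ?thesis by simp
  next
    case False
    then show ?thesis using eps lam by (simp add: F2_def z)
  qed
  show "L1_norm {0<..<1} (\<lambda>x. stationary_profile In lam B \<epsilon> v i x - (if i \<in> In then B i else v i)) \<le> \<bar>v i - B i\<bar> * (\<epsilon> / lam i)"
  proof (cases "i \<in> In")
    case True
    then have "L1_norm {0<..<1} (\<lambda>x. stationary_profile In lam B \<epsilon> v i x - (if i \<in> In then B i else v i)) = L1_norm {0<..<1} (\<lambda>x. (v i - B i) * ?l x)"
      by (simp add: stationary_profile_def)
    also have "\<dots> = \<bar>v i - B i\<bar> * L1_norm {0..1} ?l" unfolding L1_norm_cmult L1_norm_Ioo_Icc by (rule refl)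
    also have "\<dots> \<le> \<bar>v i - B i\<bar> * (\<epsilon> / lam i)" by (rule mult_left_mono[OF L1_norm_layer[OF l]]) simp
    finally show ?thesis .
  next
    case False
    then show ?thesis using eps lam by (simp add: stationary_profile_def z)
  qed
qed

text \<open>The profile is its own initial datum, so all time derivatives are 0. The balance
  \<open>bal\<close> is the node condition with the exact end slopes of the layer inserted, tails
  included; no error term is left.\<close>

lemma stationary_solution:
  fixes lam B v :: "nat \<Rightarrow> real" and \<epsilon> :: real
  assumes lam: "\<And>i. i \<in> In \<union> Out \<Longrightarrow> lam i > 0" and eps: "\<epsilon> > 0"
    and bal: "\<And>i. i \<in> In \<union> Out \<Longrightarrow>
      (if i \<in> In then lam i * layer_tail \<epsilon> (lam i) 1 * v i - lam i * (1 + layer_tail \<epsilon> (lam i) 1) * B i else lam i * v i)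
       = (\<Sum>j\<in>In \<union> Out. K i j * (v j - v i))"
  defines "F \<equiv> stationary_profile In lam B \<epsilon> v"
  shows "\<And>i. i \<in> In \<union> Out \<Longrightarrow> W21 {0<..<1} (F i)"
    and "\<And>i. i \<in> In \<Longrightarrow> boundary_trace {0<..<1} (F i) 0 = B i"
    and "transmission_condition In Out (\<lambda>_. 1) lam K \<epsilon> F"
    and "parabolic_solution In Out (\<lambda>_. 1) lam K B \<epsilon> F (\<lambda>i z. F i (fst z))"
    and "\<And>i. i \<in> In \<union> Out \<Longrightarrow> L1_norm {0<..<1} (Dx {0<..<1} (F i)) \<le> \<bar>v i - B i\<bar>"
    and "\<And>i. i \<in> In \<union> Out \<Longrightarrow> L1_norm {0<..<1} (Dx {0<..<1} (Dx {0<..<1} (F i))) \<le> lam i / \<epsilon> * \<bar>v i - B i\<bar>"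
proof -
  let ?I = "{0<..<1::real}" and ?M = "In \<union> Out"
  define F1 where "F1 = (\<lambda>i x. if i \<in> In then (v i - B i) * layer_dx \<epsilon> (lam i) 1 x else 0)"
  define F2 where "F2 = (\<lambda>i x. if i \<in> In then (v i - B i) * (lam i / \<epsilon> * layer_dx \<epsilon> (lam i) 1 x) else 0)"
  have d: "(F i has_real_derivative F1 i x) (at x)" "(F1 i has_real_derivative F2 i x) (at x)" "continuous_on UNIV (F2 i)"
    "L1_norm ?I (F1 i) \<le> \<bar>v i - B i\<bar>" "L1_norm ?I (F2 i) \<le> lam i / \<epsilon> * \<bar>v i - B i\<bar>" if "i \<in> ?M" for i x
    unfolding F_def F1_def F2_def
    by (rule stationary_profile_derivatives[where lam = lam and i = i and In = In and v = v and B = B, OF eps lam[OF that]])+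
  note sm = smooth_edge_function[OF d(1) d(2) d(3) zero_less_one]
  show W: "W21 ?I (F i)" if "i \<in> ?M" for i by (rule sm(1)) (rule that)+
  have t0: "boundary_trace ?I (F i) 0 = F i 0" "boundary_trace ?I (F i) 1 = F i 1"
    "boundary_trace ?I (Dx ?I (F i)) 0 = F1 i 0" "boundary_trace ?I (Dx ?I (F i)) 1 = F1 i 1" if "i \<in> ?M" for i
    by (rule sm(4-7), (rule that)+)+
  have e: "AE x in lebesgue. x \<in> ?I \<longrightarrow> Dx ?I (F i) x = F1 i x"
    "AE x in lebesgue. x \<in> ?I \<longrightarrow> Dx ?I (Dx ?I (F i)) x = F2 i x" if "i \<in> ?M" for i
    by (rule sm(2-3), (rule that)+)+
  have le: "layer \<epsilon> (lam i) 1 0 = 0" "layer \<epsilon> (lam i) 1 1 = 1"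
    "\<epsilon> * layer_dx \<epsilon> (lam i) 1 1 = lam i + lam i * layer_tail \<epsilon> (lam i) 1" if "i \<in> ?M" for i
    using layer_ends[OF eps lam[OF that] zero_less_one] layer_dx_ends(2)[OF eps lam[OF that] zero_less_one] by simp_all
  show b0: "boundary_trace ?I (F i) 0 = B i" if "i \<in> In" for i
    using t0(1)[of i] that le(1)[of i] by (simp add: F_def stationary_profile_def)
  have nF: "at_node In (\<lambda>_. 1) F i = v i" if i: "i \<in> ?M" for i
    using t0(1,2)[OF i] le(1,2)[OF i] by (simp add: at_node_def node_def F_def stationary_profile_def)
  have nD: "\<epsilon> * at_node In (\<lambda>_. 1) (\<lambda>k. Dx ?I (F k)) i = (if i \<in> In then (v i - B i) * (lam i + lam i * layer_tail \<epsilon> (lam i) 1) else 0)"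
    if i: "i \<in> ?M" for i
  proof (cases "i \<in> In")
    case True
    then have "at_node In (\<lambda>_. 1) (\<lambda>k. Dx ?I (F k)) i = (v i - B i) * layer_dx \<epsilon> (lam i) 1 1"
      using t0(4)[OF i] by (simp add: at_node_def node_def F1_def)
    then have "\<epsilon> * at_node In (\<lambda>_. 1) (\<lambda>k. Dx ?I (F k)) i = (v i - B i) * (\<epsilon> * layer_dx \<epsilon> (lam i) 1 1)"
      by (simp only: mult.left_commute)
    then show ?thesis unfolding le(3)[OF i] using True by simp
  next
    case False
    then show ?thesis using t0(3)[OF i] by (simp add: at_node_def node_def F1_def)
  qed
  show tc: "transmission_condition In Out (\<lambda>_. 1) lam K \<epsilon> F"
    unfolding transmission_condition_def
  proof
    fix i assume i: "i \<in> ?M"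
    have "(\<Sum>j\<in>?M. K i j * (at_node In (\<lambda>_. 1) F j - at_node In (\<lambda>_. 1) F i)) = (\<Sum>j\<in>?M. K i j * (v j - v i))"
      using i by (intro sum.cong refl) (simp add: nF)
    then show "beta In i * (- lam i * at_node In (\<lambda>_. 1) F i + \<epsilon> * at_node In (\<lambda>_. 1) (\<lambda>k. Dx ?I (F k)) i)
        = (\<Sum>j\<in>?M. K i j * (at_node In (\<lambda>_. 1) F j - at_node In (\<lambda>_. 1) F i))"
      unfolding nD[OF i] bal[OF i, symmetric] nF[OF i] by (cases "i \<in> In") (simp_all add: beta_def algebra_simps)
  qed
  have z: "L1_norm S (\<lambda>x. 0) = 0" for S :: "real set" by (simp add: L1_norm_def set_lebesgue_integral_def)
  \<comment> \<open>The derivatives selected by \<open>Dx\<close> for the zero function are only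
    known to vanish almost everywhere, which is enough for the norm.\<close>
  have w0: "W21_norm ?I (\<lambda>x. 0) = 0"
  proof -
    have h: "((\<lambda>x. 0) has_real_derivative 0) (at x)" for x :: real by simp
    have c: "continuous_on UNIV (\<lambda>x::real. 0::real)" by simp
    note s = smooth_edge_function(2,3)[OF h h c zero_less_one]
    show ?thesis unfolding W21_norm_def L1_norm_cong_AE[OF s(1)] L1_norm_cong_AE[OF s(2)] z by simp
  qed
  show "parabolic_solution In Out (\<lambda>_. 1) lam K B \<epsilon> F (\<lambda>i z. F i (fst z))"
    unfolding parabolic_solution_def fst_conv
  proof (intro conjI ballI allI impI exI[of _ "\<lambda>i t x. 0"])
    fix i assume i: "i \<in> ?M"
    have Fc: "continuous_on UNIV (F i)" by (rule DERIV_continuous_on) (rule has_field_derivative_at_within[OF d(1)[OF i]])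
    show "set_borel_measurable lebesgue (?I \<times> {0::real<..}) (\<lambda>z. F i (fst z))"
      unfolding set_borel_measurable_def
    proof (intro borel_measurable_scaleR borel_measurable_indicator borel_measurable_continuous_lebesgue)
      show "?I \<times> {0::real<..} \<in> sets lebesgue"
        using borel_open[OF open_Times[OF open_greaterThanLessThan open_greaterThan, of 0 "1::real" "0::real"]] by simp
      show "continuous_on UNIV (\<lambda>z :: real \<times> real. F i (fst z))" by (intro continuous_on_compose2[OF Fc] continuous_intros) simp
    qed
    show "W21 ?I (F i)" by (rule W[OF i])
    show "time_continuous (W21_norm ?I) (\<lambda>t x. F i x)" by (simp add: time_continuous_def w0)
    show "time_derivative (L1_norm ?I) (\<lambda>t x. F i x) (\<lambda>t x. 0)" by (simp add: time_derivative_def z)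
    show "time_continuous (L1_norm ?I) (\<lambda>t x. 0)" by (simp add: time_continuous_def z)
    show "AE x in lebesgue. x \<in> ?I \<longrightarrow> 0 = - lam i * Dx ?I (F i) x + \<epsilon> * Dx ?I (Dx ?I (F i)) x"
      using e(1)[OF i] e(2)[OF i] by eventually_elim (use eps in \<open>simp add: F1_def F2_def\<close>)
  qed (use tc b0 in simp_all)
  show "L1_norm ?I (Dx ?I (F i)) \<le> \<bar>v i - B i\<bar>" if "i \<in> ?M" for i
    unfolding L1_norm_cong_AE[OF e(1)[OF that]] by (rule d(4)[OF that])
  show "L1_norm ?I (Dx ?I (Dx ?I (F i))) \<le> lam i / \<epsilon> * \<bar>v i - B i\<bar>" if "i \<in> ?M" for i
    unfolding L1_norm_cong_AE[OF e(2)[OF that]] by (rule d(5)[OF that])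
qed

section \<open>Recovering the coefficients from the stationary limits\<close>

lemma L1_norm_zero_imp_AE:
  fixes f :: "'a::euclidean_space \<Rightarrow> real"
  assumes f: "f absolutely_integrable_on S" and z: "L1_norm S f = 0"
  shows "AE x in lebesgue. x \<in> S \<longrightarrow> f x = 0"
proof -
  have i: "integrable lebesgue (\<lambda>x. \<bar>indicat_real S x * f x\<bar>)"
    using f unfolding set_integrable_def by (intro integrable_abs) simp
  have "(\<integral>x. \<bar>indicat_real S x * f x\<bar> \<partial>lebesgue) = 0"
    using z unfolding L1_norm_def set_lebesgue_integral_def by (simp add: abs_mult)
  then have "AE x in lebesgue. \<bar>indicat_real S x * f x\<bar> = 0"
    using integral_nonneg_eq_0_iff_AE[OF i] by simp
  then show ?thesis by eventually_elim (auto simp: indicator_def)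
qed

lemma test_function_exists:
  "\<exists>\<phi> :: real \<times> real \<Rightarrow> real. C1c ({0..<1} \<times> {0..<1}) \<phi> \<and> (LINT t:{0<..<1}|lebesgue. \<phi> (0, t)) \<noteq> 0"
proof -
  \<comment> \<open>Index 1 shrinks the interval by \<open>1 / 2\<close> on each side, so the
    support lies within distance \<open>1 / 2\<close> of 0, while the value at 0 is
    positive.\<close>
  let ?k = "cutoff (- 1) 1 1"
  obtain k' k'' where k: "\<forall>x. (?k has_real_derivative k' x) (at x)" "\<forall>x. (k' has_real_derivative k'' x) (at x)"
    using C2_cutoff[of "- 1" 1 1] unfolding C2_def by (elim exE conjE) (rule that)
  have c: "continuous_on UNIV ?k" by (rule C2_continuous[OF C2_cutoff])
  have c': "continuous_on UNIV k'" by (rule DERIV_continuous_on) (rule has_field_derivative_at_within[OF spec[OF k(2)]])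
  have comp: "continuous_on A (\<lambda>z. u (v z))" if "continuous_on UNIV u" "continuous_on A v" for u :: "real \<Rightarrow> real" and v :: "real \<times> real \<Rightarrow> real" and A
    by (rule continuous_on_compose2[OF that]) simp
  define \<phi> where "\<phi> = (\<lambda>z :: real \<times> real. ?k (fst z) * ?k (snd z))"
  define \<phi>' where "\<phi>' = (\<lambda>(z :: real \<times> real) v. ?k (fst z) * (k' (snd z) * snd v) + k' (fst z) * fst v * ?k (snd z))"
  let ?S = "{0..<1} \<times> {0..<1} :: (real \<times> real) set"
  have d: "(\<phi> has_derivative \<phi>' z) (at z)" for z
  proof -
    have "((\<lambda>z. ?k (fst z)) has_derivative (\<lambda>v. k' (fst z) * fst v)) (at z)"
      by (rule has_derivative_compose[OF has_derivative_fst[OF has_derivative_ident] spec[OF k(1), unfolded has_field_derivative_def]])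
    moreover have "((\<lambda>z. ?k (snd z)) has_derivative (\<lambda>v. k' (snd z) * snd v)) (at z)"
      by (rule has_derivative_compose[OF has_derivative_snd[OF has_derivative_ident] spec[OF k(1), unfolded has_field_derivative_def]])
    ultimately show ?thesis unfolding \<phi>_def \<phi>'_def by (rule has_derivative_mult)
  qed
  have C: "C1c ?S \<phi>"
    unfolding C1c_def
  proof
    show "\<exists>\<phi>'. (\<forall>x\<in>?S. (\<phi> has_derivative \<phi>' x) (at x within ?S)) \<and> (\<forall>v. continuous_on ?S (\<lambda>x. \<phi>' x v))"
    proof (intro exI[of _ \<phi>'] conjI ballI allI)
      show "(\<phi> has_derivative \<phi>' z) (at z within ?S)" for z by (rule has_derivative_at_withinI[OF d])
      show "continuous_on ?S (\<lambda>z. \<phi>' z v)" for v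
        unfolding \<phi>'_def by (intro continuous_intros comp[OF c] comp[OF c'])
    qed
    show "\<exists>C. compact C \<and> C \<subseteq> ?S \<and> (\<forall>x\<in>?S - C. \<phi> x = 0)"
    proof (intro exI[of _ "{0..1/2} \<times> {0..1/2}"] conjI ballI)
      show "compact ({0..1/2} \<times> {0..1/2::real} :: (real \<times> real) set)" by (intro compact_Times compact_Icc)
      show "{0..1/2} \<times> {0..1/2} \<subseteq> ?S" by auto
      fix z assume z: "z \<in> ?S - {0..1/2} \<times> {0..1/2}"
      have "fst z \<ge> 1/2 \<or> snd z \<ge> 1/2" using z by (cases z) auto
      then show "\<phi> z = 0" unfolding \<phi>_def using cutoff_eq_0[of "fst z" "- 1" 1 1] cutoff_eq_0[of "snd z" "- 1" 1 1] by auto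
    qed
  qed
  have k0: "?k 0 > 0" by (simp add: cutoff_def bump_def power_divide)
  have kc: "continuous_on {0..1} ?k" by (rule continuous_on_subset[OF c]) simp
  have "integral {0..1} ?k \<noteq> 0"
  proof
    assume "integral {0..1} ?k = 0"
    then have "(?k has_integral 0) (cbox 0 1)" using integrable_integral[OF integrable_continuous_real[OF kc]] by simp
    then have "?k 0 = 0"
      by (rule has_integral_0_cbox_imp_0[rotated 2]) (use kc cutoff_bounds(1) in \<open>auto simp: cbox_interval\<close>)
    then show False using k0 by simp
  qed
  moreover have "(LINT t:{0<..<1}|lebesgue. \<phi> (0, t)) = ?k 0 * integral {0..1} ?k"
  proof -
    have "(LINT t:{0<..<1}|lebesgue. \<phi> (0, t)) = ?k 0 * (LINT t:{0<..<1}|lebesgue. ?k t)" by (simp add: \<phi>_def)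
    also have "(LINT t:{0<..<1}|lebesgue. ?k t) = (LINT t:{0..1}|lebesgue. ?k t)" by (rule set_integral_Ioo_Icc)
    also have "\<dots> = integral {0..1} ?k"
      by (rule set_lebesgue_integral_eq_integral(2)[OF absolutely_integrable_continuous_real[OF kc]])
    finally show ?thesis .
  qed
  ultimately have "(LINT t:{0<..<1}|lebesgue. \<phi> (0, t)) \<noteq> 0" using k0 by simp
  with C show ?thesis by (intro exI[of _ \<phi>] conjI)
qed

lemma product_L1_norm_le:
  fixes f :: "real \<Rightarrow> real"
  assumes m: "f \<in> borel_measurable borel" and f: "f absolutely_integrable_on {0<..<1}"
  shows "(\<lambda>z. f (fst z)) absolutely_integrable_on {0<..<1} \<times> {0<..<1::real}"
    and "L1_norm ({0<..<1} \<times> {0<..<1::real}) (\<lambda>z. f (fst z)) \<le> L1_norm {0<..<1} f"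
proof -
  have sm: "set_borel_measurable lebesgue ({0<..<1} \<times> {0::real<..}) (\<lambda>z. f (fst z))"
    unfolding set_borel_measurable_def
  proof (intro borel_measurable_scaleR borel_measurable_indicator)
    show "{0<..<1::real} \<times> {0::real<..} \<in> sets lebesgue"
      using borel_open[OF open_Times[OF open_greaterThanLessThan open_greaterThan, of 0 "1::real" "0::real"]] by simp
    have "(\<lambda>z :: real \<times> real. f (fst z)) \<in> borel_measurable borel"
      by (rule measurable_compose[OF borel_measurable_continuous_onI m]) (intro continuous_intros)
    then show "(\<lambda>z :: real \<times> real. f (fst z)) \<in> borel_measurable lebesgue"
      by (intro measurable_completion) simp
  qed
  have A: "{0<..<1::real} \<in> sets borel" by simp
  show "(\<lambda>z. f (fst z)) absolutely_integrable_on {0<..<1} \<times> {0<..<1::real}"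
    and "L1_norm ({0<..<1} \<times> {0<..<1::real}) (\<lambda>z. f (fst z)) \<le> L1_norm {0<..<1} f"
    using space_time_L1[OF sm A zero_less_one, of "L1_norm {0<..<1} f"] f by simp_all
qed

text \<open>The stationary solutions converge in L1 to constants \<open>c i\<close>, so these
  constants solve the transport problem for every \<open>\<gamma>\<close> that describes the limit.
  On an outgoing arc the weak equation then reduces to
  \<open>lam i0 * c i0 = \<gamma> i0 j0 * lam j0\<close>, and \<open>c i0\<close> is the limit
  \<open>lam j0 * G i0 j0\<close> of the node values.\<close>

lemma viscosity_coefficients_unique:
  assumes fin: "finite (In \<union> Out)" and disj: "In \<inter> Out = {}"
    and lam: "\<And>i. i \<in> In \<union> Out \<Longrightarrow> lam i > 0"
    and K: "\<And>i j. i \<in> In \<union> Out \<Longrightarrow> j \<in> In \<union> Out \<Longrightarrow> K i j \<ge> 0"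
    and KIO: "\<forall>i\<in>In. \<exists>j\<in>Out. K i j > 0"
    and G: "\<And>i. i \<in> In \<union> Out \<Longrightarrow>
      node_op (In \<union> Out) (\<lambda>i. if i \<in> In then 0 else lam i) K (\<lambda>i. G i j0) i = (if i = j0 then 1 else 0)"
    and j0: "j0 \<in> In" and i0: "i0 \<in> Out"
    and lim: "vanishing_viscosity_limit In Out lam K \<gamma>"
  shows "\<gamma> i0 j0 = lam i0 * G i0 j0"
proof -
  let ?M = "In \<union> Out" and ?I = "{0<..<1::real}" and ?R = "{0<..<1::real} \<times> {0<..<1::real}"
  let ?B = "\<lambda>i. if i = j0 then 1 else (0::real)"
  define \<epsilon> where "\<epsilon> = (\<lambda>n. 1 / real (Suc n))"
  have eps: "\<epsilon> n > 0" for n by (simp add: \<epsilon>_def)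
  have eps1: "\<epsilon> n \<le> 1" for n by (simp add: \<epsilon>_def)
  have epsd: "decseq \<epsilon>" unfolding \<epsilon>_def by (intro decseq_SucI) (simp add: field_simps)
  have eps0: "\<epsilon> \<longlonglongrightarrow> 0" unfolding \<epsilon>_def by (rule LIMSEQ_Suc[OF lim_1_over_n])
  define \<kappa> where "\<kappa> = (\<lambda>n i. layer_tail (\<epsilon> n) (lam i) 1)"
  have \<kappa>: "\<kappa> n i \<ge> 0" "(\<lambda>n. \<kappa> n i) \<longlonglongrightarrow> 0" if "i \<in> In" for n i
    using layer_tail_nonneg[OF eps lam zero_less_one, of i n] layer_tail_tendsto[OF eps eps0 lam zero_less_one, of i] that
    by (simp_all add: \<kappa>_def)
  obtain v V where vV: "\<forall>i\<in>?M. (\<forall>n. 0 \<le> v n i \<and> v n i \<le> V \<and>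
     (if i \<in> In then lam i * \<kappa> n i * v n i - lam i * (1 + \<kappa> n i) * ?B i else lam i * v n i)
       = (\<Sum>j\<in>?M. K i j * (v n j - v n i))) \<and> (\<lambda>n. v n i) \<longlonglongrightarrow> lam j0 * G i j0"
  proof -
    have "\<exists>v V. \<forall>i\<in>?M. (\<forall>n. 0 \<le> v n i \<and> v n i \<le> V \<and>
     (if i \<in> In then lam i * \<kappa> n i * v n i - lam i * (1 + \<kappa> n i) * ?B i else lam i * v n i)
       = (\<Sum>j\<in>?M. K i j * (v n j - v n i))) \<and> (\<lambda>n. v n i) \<longlonglongrightarrow> lam j0 * G i j0"
      by (rule stationary_node_values[where G = G and \<kappa> = \<kappa>, OF fin disj _ _ KIO _ j0]) (rule lam K G \<kappa> | assumption)+
    then show ?thesis by (elim exE) (rule that)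
  qed
  have vlim: "(\<lambda>n. v n i) \<longlonglongrightarrow> lam j0 * G i j0" if "i \<in> ?M" for i using bspec[OF vV that] by (rule conjunct2)
  have vb: "\<bar>v n i - ?B i\<bar> \<le> V + 1" "0 \<le> v n i" "v n i \<le> V" if "i \<in> ?M" for n i
    using spec[OF conjunct1[OF bspec[OF vV that]], of n] by auto
  have V0: "V \<ge> 0" using vb(2,3)[of j0 0] j0 by simp
  have bal: "(if i \<in> In then lam i * layer_tail (\<epsilon> n) (lam i) 1 * v n i - lam i * (1 + layer_tail (\<epsilon> n) (lam i) 1) * ?B i else lam i * v n i)
       = (\<Sum>j\<in>?M. K i j * (v n j - v n i))" if "i \<in> ?M" for n i
    using spec[OF conjunct1[OF bspec[OF vV that]], of n] unfolding \<kappa>_def by (elim conjE)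
  define F where "F = (\<lambda>n. stationary_profile In lam ?B (\<epsilon> n) (v n))"
  have st1: "W21 ?I (F n i)" if "i \<in> ?M" for n i
    unfolding F_def by (rule stationary_solution(1)[where K = K and Out = Out and lam = lam and In = In and v = "v n" and B = ?B and \<epsilon> = "\<epsilon> n"]) (rule eps lam bal that | assumption)+
  have st2: "boundary_trace ?I (F n i) 0 = ?B i" if "i \<in> In" for n i
    unfolding F_def by (rule stationary_solution(2)[where K = K and Out = Out and lam = lam and In = In and v = "v n" and B = ?B and \<epsilon> = "\<epsilon> n"]) (rule eps lam bal that | assumption)+
  have st3: "transmission_condition In Out (\<lambda>_. 1) lam K (\<epsilon> n) (F n)" for n
    unfolding F_def by (rule stationary_solution(3)[where K = K and Out = Out and lam = lam and In = In and v = "v n" and B = ?B and \<epsilon> = "\<epsilon> n"]) (rule eps lam bal | assumption)+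
  have st4: "parabolic_solution In Out (\<lambda>_. 1) lam K ?B (\<epsilon> n) (F n) (\<lambda>i z. F n i (fst z))" for n
    unfolding F_def by (rule stationary_solution(4)[where K = K and Out = Out and lam = lam and In = In and v = "v n" and B = ?B and \<epsilon> = "\<epsilon> n"]) (rule eps lam bal | assumption)+
  have st5: "L1_norm ?I (Dx ?I (F n i)) \<le> \<bar>v n i - ?B i\<bar>" if "i \<in> ?M" for n i
    unfolding F_def by (rule stationary_solution(5)[where K = K and Out = Out and lam = lam and In = In and v = "v n" and B = ?B and \<epsilon> = "\<epsilon> n"]) (rule eps lam bal that | assumption)+
  have st6: "L1_norm ?I (Dx ?I (Dx ?I (F n i))) \<le> lam i / \<epsilon> n * \<bar>v n i - ?B i\<bar>" if "i \<in> ?M" for n i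
    unfolding F_def by (rule stationary_solution(6)[where K = K and Out = Out and lam = lam and In = In and v = "v n" and B = ?B and \<epsilon> = "\<epsilon> n"]) (rule eps lam bal that | assumption)+
  \<comment> \<open>The limit serves as the datum \<open>u0\<close>. The layers disappear in L1,
    leaving the inflow value on incoming arcs and the limiting node value on outgoing ones.\<close>
  define c where "c = (\<lambda>i. if i \<in> In then ?B i else lam j0 * G i j0)"
  have Fi: "F n i absolutely_integrable_on ?I" if "i \<in> ?M" for n i
    using st1[OF that, of n] unfolding W21_def weak_deriv_def by (elim exE conjE)
  have Fm: "F n i \<in> borel_measurable borel" if "i \<in> ?M" for n i
    unfolding F_def
    by (rule borel_measurable_continuous_onI, rule DERIV_continuous_on, rule has_field_derivative_at_within,
        rule stationary_profile_derivatives(1)[where lam = lam and i = i and In = In and v = "v n" and B = ?B, OF eps lam[OF that]])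
  have ci: "(\<lambda>x::real. a::real) absolutely_integrable_on ?I" for a
    by (rule absolutely_integrable_continuous_Ioo[of 0 1]) simp
  have Fc: "L1_norm ?I (\<lambda>x. F n i x - c i) \<le> (V + 1) * (\<epsilon> n / lam i) + \<bar>v n i - lam j0 * G i j0\<bar>" if i: "i \<in> ?M" for n i
  proof -
    have a: "L1_norm ?I (\<lambda>x. F n i x - (if i \<in> In then ?B i else v n i)) \<le> (V + 1) * (\<epsilon> n / lam i)"
      using stationary_profile_derivatives(6)[where lam = lam and i = i and In = In and v = "v n" and B = ?B, OF eps[of n] lam[OF i]] mult_right_mono[OF vb(1)[OF i, of n], of "\<epsilon> n / lam i"]
        divide_nonneg_nonneg[OF less_imp_le[OF eps[of n]] less_imp_le[OF lam[OF i]]] unfolding F_def by linarith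
    have "L1_norm ?I (\<lambda>x. F n i x - c i) \<le> L1_norm ?I (\<lambda>x. F n i x - (if i \<in> In then ?B i else v n i))
       + L1_norm ?I (\<lambda>x. (if i \<in> In then ?B i else v n i) - c i)"
      by (rule L1_norm_triangle_diff[OF Fi[OF i] ci ci])
    also have "L1_norm ?I (\<lambda>x. (if i \<in> In then ?B i else v n i) - c i) \<le> \<bar>v n i - lam j0 * G i j0\<bar> * measure lebesgue ?I"
      by (rule L1_norm_le_const) (auto simp: c_def)
    finally show ?thesis using a by simp
  qed
  have Flim: "(\<lambda>n. L1_norm ?I (\<lambda>x. F n i x - c i)) \<longlonglongrightarrow> 0" if i: "i \<in> ?M" for i
  proof (rule tendsto_sandwich[OF always_eventually always_eventually tendsto_const])
    show "\<forall>n. 0 \<le> L1_norm ?I (\<lambda>x. F n i x - c i)" by (simp add: L1_norm_nonneg)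
    show "\<forall>n. L1_norm ?I (\<lambda>x. F n i x - c i) \<le> (V + 1) * (\<epsilon> n / lam i) + \<bar>v n i - lam j0 * G i j0\<bar>" by (rule allI) (rule Fc[OF i])
    have "(\<lambda>n. (V + 1) * (\<epsilon> n / lam i) + \<bar>v n i - lam j0 * G i j0\<bar>) \<longlonglongrightarrow> (V + 1) * (0 / lam i) + \<bar>lam j0 * G i j0 - lam j0 * G i j0\<bar>"
      using lam[OF i] by (intro tendsto_intros eps0 vlim[OF i]) simp
    then show "(\<lambda>n. (V + 1) * (\<epsilon> n / lam i) + \<bar>v n i - lam j0 * G i j0\<bar>) \<longlonglongrightarrow> 0" by simp
  qed
  have adm: "admissible_approximation In Out (\<lambda>_. 1) lam K ?B \<epsilon> (\<lambda>i x. c i) F"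
    unfolding admissible_approximation_def
  proof (intro conjI allI ballI)
    show "W21 ?I (F n i)" if "i \<in> ?M" for n i by (rule st1[OF that])
    show "boundary_trace ?I (F n i) 0 = ?B i" if "i \<in> In" for n i by (rule st2[OF that])
    show "transmission_condition In Out (\<lambda>_. 1) lam K (\<epsilon> n) (F n)" for n by (rule st3)
    show "(\<lambda>n. \<Sum>i\<in>?M. L1_norm ?I (\<lambda>x. F n i x - c i)) \<longlonglongrightarrow> 0"
      using tendsto_sum[of ?M "\<lambda>i n. L1_norm ?I (\<lambda>x. F n i x - c i)" "\<lambda>_. 0" sequentially] Flim by simp
    \<comment> \<open>A constant function \<open>Q\<close> does: on each arc the derivative has L1
      norm at most the height of the layer, which is at most \<open>V + 1\<close>.\<close>
    show "\<exists>Q. \<forall>n. (\<Sum>i\<in>?M. L1_norm ?I (Dx ?I (F n i))) \<le> Q (\<Sum>i\<in>?M. BV_norm ?I (\<lambda>x. c i))"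
      by (intro exI[of _ "\<lambda>_. \<Sum>i\<in>?M. V + 1"] allI sum_mono) (rule order_trans[OF st5 vb(1)])
    \<comment> \<open>The second derivatives grow like \<open>1 / \<epsilon> n\<close>, which the
      factor \<open>\<epsilon> n\<close> compensates; the other norms are bounded and
      \<open>\<epsilon> n \<le> 1\<close>.\<close>
    show "\<exists>C. \<forall>n. \<epsilon> n * (\<Sum>i\<in>?M. W21_norm ?I (F n i)) \<le> C"
    proof (intro exI[of _ "\<Sum>i\<in>?M. (\<bar>c i\<bar> + (V + 1) / lam i + V + \<bar>lam j0 * G i j0\<bar>) + (V + 1) + lam i * (V + 1)"] allI)
      fix n
      have "\<epsilon> n * W21_norm ?I (F n i) \<le> (\<bar>c i\<bar> + (V + 1) / lam i + V + \<bar>lam j0 * G i j0\<bar>) + (V + 1) + lam i * (V + 1)" if i: "i \<in> ?M" for i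
      proof -
        have "L1_norm ?I (F n i) \<le> L1_norm ?I (\<lambda>x. F n i x - c i) + L1_norm ?I (\<lambda>x. c i)"
          using L1_norm_triangle[OF set_integral_diff(1)[OF Fi[OF i] ci] ci, of n "c i" "c i"] by simp
        also have "L1_norm ?I (\<lambda>x. c i) \<le> \<bar>c i\<bar> * measure lebesgue ?I" by (rule L1_norm_le_const) auto
        also have "L1_norm ?I (\<lambda>x. F n i x - c i) \<le> (V + 1) * (\<epsilon> n / lam i) + \<bar>v n i - lam j0 * G i j0\<bar>" by (rule Fc[OF i])
        also have "(V + 1) * (\<epsilon> n / lam i) \<le> (V + 1) * (1 / lam i)"
          using V0 eps1[of n] lam[OF i] by (intro mult_left_mono divide_right_mono) auto
        also have "\<bar>v n i - lam j0 * G i j0\<bar> \<le> V + \<bar>lam j0 * G i j0\<bar>" using vb(2,3)[OF i, of n] by linarith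
        finally have 1: "L1_norm ?I (F n i) \<le> \<bar>c i\<bar> + (V + 1) / lam i + V + \<bar>lam j0 * G i j0\<bar>" by simp
        have e1: "\<epsilon> n * x \<le> x" if "x \<ge> 0" for x using eps1[of n] eps[of n] that by (simp add: mult_left_le_one_le)
        have 2: "\<epsilon> n * L1_norm ?I (Dx ?I (F n i)) \<le> V + 1"
          using e1[OF L1_norm_nonneg, of ?I "Dx ?I (F n i)"] st5[OF i, of n] vb(1)[OF i, of n] by linarith
        have "\<epsilon> n * L1_norm ?I (Dx ?I (Dx ?I (F n i))) \<le> \<epsilon> n * (lam i / \<epsilon> n * \<bar>v n i - ?B i\<bar>)"
          by (rule mult_left_mono[OF st6[OF i]]) (use eps[of n] in simp)
        also have "\<dots> = lam i * \<bar>v n i - ?B i\<bar>" using eps[of n] by simp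
        also have "\<dots> \<le> lam i * (V + 1)" by (rule mult_left_mono[OF vb(1)[OF i]]) (use lam[OF i] in simp)
        finally have 3: "\<epsilon> n * L1_norm ?I (Dx ?I (Dx ?I (F n i))) \<le> lam i * (V + 1)" .
        have "\<epsilon> n * L1_norm ?I (F n i) \<le> L1_norm ?I (F n i)" by (rule e1[OF L1_norm_nonneg])
        moreover have "\<epsilon> n * W21_norm ?I (F n i) = \<epsilon> n * L1_norm ?I (F n i) + \<epsilon> n * L1_norm ?I (Dx ?I (F n i)) + \<epsilon> n * L1_norm ?I (Dx ?I (Dx ?I (F n i)))"
          unfolding W21_norm_def by (simp only: distrib_left)
        ultimately show ?thesis using 1 2 3 by linarith
      qed
      then show "\<epsilon> n * (\<Sum>i\<in>?M. W21_norm ?I (F n i)) \<le> (\<Sum>i\<in>?M. (\<bar>c i\<bar> + (V + 1) / lam i + V + \<bar>lam j0 * G i j0\<bar>) + (V + 1) + lam i * (V + 1))"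
        unfolding sum_distrib_left by (rule sum_mono)
    qed
  qed
  have concl: "(\<exists>u. transport_solution In Out (\<lambda>_. 1) lam \<gamma> ?B (\<lambda>i x. c i) 1 u) \<and>
       (\<forall>u. transport_solution In Out (\<lambda>_. 1) lam \<gamma> ?B (\<lambda>i x. c i) 1 u \<longrightarrow>
          (\<lambda>n. \<Sum>i\<in>?M. L1_norm ?R (\<lambda>p. F n i (fst p) - u i p)) \<longlonglongrightarrow> 0)"
    using lim[unfolded vanishing_viscosity_limit_def, THEN spec[of _ "\<lambda>_. 1"], THEN spec[of _ "\<lambda>i x. c i"], THEN spec[of _ ?B],
        THEN spec[of _ \<epsilon>], THEN spec[of _ F], THEN spec[of _ "\<lambda>n i z. F n i (fst z)"]]
      BV_const[OF zero_less_one] eps epsd eps0 adm st4 by simp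
  then obtain w where w: "transport_solution In Out (\<lambda>_. 1) lam \<gamma> ?B (\<lambda>i x. c i) 1 w"
    and wl: "(\<lambda>n. \<Sum>i\<in>?M. L1_norm ?R (\<lambda>p. F n i (fst p) - w i p)) \<longlonglongrightarrow> 0" by (elim conjE exE) (rule that, assumption, elim allE impE, assumption+)
  have wi: "w i absolutely_integrable_on ?R" if "i \<in> ?M" for i
    using bspec[OF conjunct1[OF w[unfolded transport_solution_def]] that] unfolding BV_def by (rule conjunct1)
  have cR: "(\<lambda>z. a::real) absolutely_integrable_on ?R" for a
    using product_L1_norm_le(1)[of "\<lambda>_. a"] ci by simp
  \<comment> \<open>Both \<open>w i\<close> and the constant \<open>c i\<close> are L1 limits of the
    same stationary solutions.\<close>
  have wc: "AE z in lebesgue. z \<in> ?R \<longrightarrow> w i z = c i" if i: "i \<in> ?M" for i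
  proof -
    have di: "(\<lambda>z. w i z - c i) absolutely_integrable_on ?R" by (rule set_integral_diff(1)[OF wi[OF i] cR])
    have "L1_norm ?R (\<lambda>z. w i z - c i) \<le> (\<Sum>i\<in>?M. L1_norm ?R (\<lambda>p. F n i (fst p) - w i p)) + L1_norm ?I (\<lambda>x. F n i x - c i)" for n
    proof -
      have "L1_norm ?R (\<lambda>z. w i z - c i) \<le> L1_norm ?R (\<lambda>z. w i z - F n i (fst z)) + L1_norm ?R (\<lambda>z. F n i (fst z) - c i)"
        by (rule L1_norm_triangle_diff[OF wi[OF i] product_L1_norm_le(1)[OF Fm[OF i] Fi[OF i]] cR])
      also have "L1_norm ?R (\<lambda>z. F n i (fst z) - c i) \<le> L1_norm ?I (\<lambda>x. F n i x - c i)"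
        by (rule product_L1_norm_le(2)[of "\<lambda>x. F n i x - c i"]) (use Fm[OF i] set_integral_diff(1)[OF Fi[OF i] ci] in auto)
      also have "L1_norm ?R (\<lambda>z. w i z - F n i (fst z)) = L1_norm ?R (\<lambda>z. F n i (fst z) - w i z)" by (rule L1_norm_diff_commute)
      also have "\<dots> \<le> (\<Sum>i\<in>?M. L1_norm ?R (\<lambda>p. F n i (fst p) - w i p))"
        by (rule member_le_sum[OF i]) (use fin L1_norm_nonneg in auto)
      finally show ?thesis by simp
    qed
    then have "L1_norm ?R (\<lambda>z. w i z - c i) \<le> 0 + 0"
      by (intro LIMSEQ_le_const[OF tendsto_add[OF wl Flim[OF i]]]) auto
    then have "L1_norm ?R (\<lambda>z. w i z - c i) = 0" using L1_norm_nonneg[of ?R "\<lambda>z. w i z - c i"] by linarith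
    from L1_norm_zero_imp_AE[OF di this] show ?thesis by eventually_elim simp
  qed
  obtain g where g: "\<forall>j\<in>In. g j absolutely_integrable_on ?I \<and>
       (AE t in lebesgue. t \<in> ?I \<longrightarrow> has_trace ?R (w j) (1, t) (g j t))"
    and gw: "\<forall>i\<in>?M. \<forall>\<phi>. C1c ({0..<1} \<times> {0..<1}) \<phi> \<longrightarrow>
       (LINT z:?R|lebesgue. w i z * (frechet_derivative \<phi> (at z) (0, 1) + lam i * frechet_derivative \<phi> (at z) (1, 0)))
         + (LINT x:?I|lebesgue. c i * \<phi> (x, 0))
       = (if i \<in> In then - lam i * ?B i * (LINT t:?I|lebesgue. \<phi> (0, t))
          else - (LINT t:?I|lebesgue. \<phi> (0, t) * (\<Sum>j\<in>In. \<gamma> i j * lam j * g j t)))"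
    using conjunct2[OF w[unfolded transport_solution_def]] by (elim exE conjE) (rule that)
  \<comment> \<open>\<open>w j\<close> is constant almost everywhere, so the uniqueness of traces
    identifies \<open>g j t\<close> with the inflow value.\<close>
  have gB: "AE t in lebesgue. t \<in> ?I \<longrightarrow> g j t = ?B j" if j: "j \<in> In" for j
    using conjunct2[OF bspec[OF g j]]
  proof eventually_elim
    case (elim t)
    show ?case
    proof
      assume t: "t \<in> ?I"
      have jM: "j \<in> ?M" using j by simp
      have o: "open ?R" by (intro open_Times open_greaterThanLessThan)
      have cl: "(1, t) \<in> closure ?R" using t by (simp add: closure_Times)
      have nR: "(1, t) \<notin> ?R" by simp
      have "has_trace ?R (w j) (1, t) (c j)"
        by (rule has_traceI[OF _ nR wc[OF jM] tendsto_const]) (use borel_open[OF o] in simp)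
      from has_trace_unique[OF o cl wi[OF jM] mp[OF elim t] this] show "g j t = ?B j" using j by (simp add: c_def)
    qed
  qed
  have allg: "AE t in lebesgue. \<forall>j\<in>In. t \<in> ?I \<longrightarrow> g j t = ?B j"
    using fin by (intro AE_finite_allI gB) simp_all
  obtain \<phi> :: "real \<times> real \<Rightarrow> real" where \<phi>: "C1c ({0..<1} \<times> {0..<1}) \<phi>" and \<phi>0: "(LINT t:?I|lebesgue. \<phi> (0, t)) \<noteq> 0"
    using test_function_exists by (elim exE conjE) (rule that)
  let ?J = "LINT t:?I|lebesgue. \<phi> (0, t)"
  have iM: "i0 \<in> ?M" and iI: "i0 \<notin> In" using i0 disj by auto
  let ?D = "\<lambda>z. frechet_derivative \<phi> (at z) (0, 1) + lam i0 * frechet_derivative \<phi> (at z) (1, 0)"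
  have "(LINT z:?R|lebesgue. w i0 z * ?D z) = (LINT z:?R|lebesgue. c i0 * ?D z)"
    by (rule set_integral_lebesgue_cong_AE) (use wc[OF iM] in eventually_elim, simp)
  moreover have "(LINT t:?I|lebesgue. \<phi> (0, t) * (\<Sum>j\<in>In. \<gamma> i0 j * lam j * g j t)) = (LINT t:?I|lebesgue. (\<gamma> i0 j0 * lam j0) * \<phi> (0, t))"
  proof (rule set_integral_lebesgue_cong_AE)
    show "AE t in lebesgue. t \<in> ?I \<longrightarrow> \<phi> (0, t) * (\<Sum>j\<in>In. \<gamma> i0 j * lam j * g j t) = (\<gamma> i0 j0 * lam j0) * \<phi> (0, t)"
      using allg
    proof eventually_elim
      case (elim t)
      show ?case
      proof
        assume "t \<in> ?I"
        then have "(\<Sum>j\<in>In. \<gamma> i0 j * lam j * g j t) = (\<Sum>j\<in>In. if j = j0 then \<gamma> i0 j * lam j else 0)"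
          using elim by (intro sum.cong refl) simp
        also have "\<dots> = \<gamma> i0 j0 * lam j0" using fin j0 by simp
        finally show "\<phi> (0, t) * (\<Sum>j\<in>In. \<gamma> i0 j * lam j * g j t) = (\<gamma> i0 j0 * lam j0) * \<phi> (0, t)" by simp
      qed
    qed
  qed
  moreover have "(LINT z:?R|lebesgue. c i0 * ?D z) + (LINT x:?I|lebesgue. c i0 * \<phi> (x, 0)) = - lam i0 * (LINT t:?I|lebesgue. c i0 * \<phi> (0, t))"
    by (rule transport_identity[OF lam[OF iM] zero_less_one zero_less_one _ _ \<phi>, of "\<lambda>_. c i0" "\<bar>c i0\<bar>"]) simp_all
  ultimately have "- lam i0 * (LINT t:?I|lebesgue. c i0 * \<phi> (0, t)) = - (LINT t:?I|lebesgue. (\<gamma> i0 j0 * lam j0) * \<phi> (0, t))"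
    using mp[OF spec[OF bspec[OF gw iM]] \<phi>] iI by simp
  then have "lam i0 * c i0 * ?J = \<gamma> i0 j0 * lam j0 * ?J" by simp
  then have "lam i0 * c i0 = \<gamma> i0 j0 * lam j0" by (simp only: mult_right_cancel[OF \<phi>0])
  moreover have "c i0 = lam j0 * G i0 j0" using iI by (simp add: c_def)
  ultimately have "\<gamma> i0 j0 * lam j0 = (lam i0 * G i0 j0) * lam j0" by (simp only: mult_ac)
  moreover have "lam j0 \<noteq> 0" using lam[of j0] j0 by auto
  ultimately show ?thesis by simp
qed

theorem theorem4p2:
  fixes m :: nat and In Out :: "nat set"
    and lam :: "nat \<Rightarrow> real" and K :: "nat \<Rightarrow> nat \<Rightarrow> real"
  assumes "In \<union> Out = {1..m}" and "In \<inter> Out = {}" and "In \<noteq> {}" and "Out \<noteq> {}"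
    and "\<And>i. i \<in> {1..m} \<Longrightarrow> lam i > 0"
    and "\<And>i j. i \<in> {1..m} \<Longrightarrow> j \<in> {1..m} \<Longrightarrow> K i j \<ge> 0"
    and "\<And>i j. i \<in> {1..m} \<Longrightarrow> j \<in> {1..m} \<Longrightarrow> K i j = K j i"
    and "\<forall>i\<in>In. \<exists>j\<in>Out. K i j > 0"
  shows "\<exists>\<gamma> :: nat \<Rightarrow> nat \<Rightarrow> real.
     (\<forall>i\<in>Out. \<forall>j\<in>In. \<gamma> i j \<ge> 0) \<and>
     (\<forall>j\<in>In. (\<Sum>i\<in>Out. \<gamma> i j) = 1) \<and>
     vanishing_viscosity_limit In Out lam K \<gamma> \<and>
     (\<forall>\<gamma>'. vanishing_viscosity_limit In Out lam K \<gamma>' \<longrightarrow> (\<forall>i\<in>Out. \<forall>j\<in>In. \<gamma>' i j = \<gamma> i j)) \<and>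
     ((\<forall>i\<in>Out. \<exists>j\<in>In. K i j > 0) \<longrightarrow> (\<forall>i\<in>Out. \<exists>j\<in>In. \<gamma> i j > 0))"
proof -
  have fin: "finite (In \<union> Out)" using assms(1) by simp
  have lam: "lam i > 0" if "i \<in> In \<union> Out" for i using assms(1,5) that by simp
  have K: "K i j \<ge> 0" if "i \<in> In \<union> Out" "j \<in> In \<union> Out" for i j using assms(1,6) that by simp
  have Ks: "K i j = K j i" if "i \<in> In \<union> Out" "j \<in> In \<union> Out" for i j using assms(1,7) that by simp
  have lamO: "lam i > 0" if "i \<in> Out" for i using lam that by simp
  obtain G :: "nat \<Rightarrow> nat \<Rightarrow> real" where G0: "\<And>i k. i \<in> In \<union> Out \<Longrightarrow> k \<in> In \<Longrightarrow> G i k \<ge> 0"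
    and G: "\<And>i k. i \<in> In \<union> Out \<Longrightarrow> k \<in> In \<Longrightarrow>
      node_op (In \<union> Out) (\<lambda>i. if i \<in> In then 0 else lam i) K (\<lambda>i. G i k) i = (if i = k then 1 else 0)"
    and G1: "\<And>k. k \<in> In \<Longrightarrow> (\<Sum>i\<in>Out. lam i * G i k) = 1"
    and Gp: "\<And>i k. i \<in> Out \<Longrightarrow> k \<in> In \<Longrightarrow> K i k > 0 \<Longrightarrow> G i k > 0"
  proof (rule network_response[of In Out lam K])
    show "finite (In \<union> Out)" "In \<inter> Out = {}" "\<forall>i\<in>In. \<exists>j\<in>Out. K i j > 0" by (fact fin assms(2,8))+
    show "lam i > 0" if "i \<in> Out" for i by (rule lamO[OF that])
    show "K i j \<ge> 0" if "i \<in> In \<union> Out" "j \<in> In \<union> Out" for i j by (rule K[OF that])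
    show "K i j = K j i" if "i \<in> In \<union> Out" "j \<in> In \<union> Out" for i j by (rule Ks[OF that])
  qed (rule that)
  \<comment> \<open>Velocity times node value: the flux leaving through arc \<open>i\<close> for a
    unit flux arriving through arc \<open>j\<close>.\<close>
  show ?thesis
  proof (intro exI[of _ "\<lambda>i j. lam i * G i j"] conjI)
    show "\<forall>i\<in>Out. \<forall>j\<in>In. 0 \<le> lam i * G i j" using lamO G0 by (simp add: less_imp_le)
    show "\<forall>j\<in>In. (\<Sum>i\<in>Out. lam i * G i j) = 1" using G1 by simp
    show "vanishing_viscosity_limit In Out lam K (\<lambda>i j. lam i * G i j)"
      unfolding vanishing_viscosity_limit_def
    proof (intro allI impI)
      fix L B \<epsilon> :: "nat \<Rightarrow> real" and u0 :: "nat \<Rightarrow> real \<Rightarrow> real" and u0\<epsilon> u\<epsilon> T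
      assume a: "\<forall>i\<in>In \<union> Out. L i > 0" "\<forall>i\<in>In \<union> Out. BV (edge L i) (u0 i)" "\<forall>n. \<epsilon> n > 0" "\<epsilon> \<longlonglongrightarrow> 0"
        "admissible_approximation In Out L lam K B \<epsilon> u0 u0\<epsilon>"
        "\<forall>n. parabolic_solution In Out L lam K B (\<epsilon> n) (u0\<epsilon> n) (u\<epsilon> n)" and T: "(T::real) > 0"
      note v = vanishing_viscosity_convergence[OF fin assms(2) K Ks lam G bspec[OF a(1)] bspec[OF a(2)] spec[OF a(3)] a(4,5) spec[OF a(6)] T]
      show "(\<forall>n. \<forall>i\<in>In \<union> Out. u\<epsilon> n i absolutely_integrable_on edge L i \<times> {0<..<T}) \<and>
        (\<exists>u. transport_solution In Out L lam (\<lambda>i j. lam i * G i j) B u0 T u) \<and>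
        (\<forall>u. transport_solution In Out L lam (\<lambda>i j. lam i * G i j) B u0 T u \<longrightarrow>
          (\<lambda>n. \<Sum>i\<in>In \<union> Out. L1_norm (edge L i \<times> {0<..<T}) (\<lambda>p. u\<epsilon> n i p - u i p)) \<longlonglongrightarrow> 0)"
        by (intro conjI) (rule v, assumption+)+
    qed
    show "\<forall>\<gamma>'. vanishing_viscosity_limit In Out lam K \<gamma>' \<longrightarrow> (\<forall>i\<in>Out. \<forall>j\<in>In. \<gamma>' i j = lam i * G i j)"
    proof (intro allI impI ballI)
      fix \<gamma>' i j assume \<gamma>': "vanishing_viscosity_limit In Out lam K \<gamma>'" and ij: "i \<in> Out" "j \<in> In"
      show "\<gamma>' i j = lam i * G i j"
        by (rule viscosity_coefficients_unique[OF fin assms(2) _ _ assms(8) _ ij(2,1) \<gamma>']) (rule lam K G ij | assumption)+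
    qed
    show "(\<forall>i\<in>Out. \<exists>j\<in>In. K i j > 0) \<longrightarrow> (\<forall>i\<in>Out. \<exists>j\<in>In. lam i * G i j > 0)"
      using Gp lamO by (meson mult_pos_pos)
  qed
qed

end
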